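(* Let $u_{in}\in H^7(\mathbb{T}\times\mathbb{R}\times\mathbb{T})$ be a divergence-free vector field. The solution $u(t)$ to the linearized Navier-Stokes equations $$\partial_t u + y\partial_x u = (-u^2,0,0)^T - \nabla p^L + \nu\Delta u,\qquad \Delta p^L = -2\partial_x u^2,\qquad \nabla\cdot u = 0$$ with initial data $u_{in}$ satisfies, for some $c\in(0,1/3)$, $$\|u^2_{\neq}(t)\|_{L^2} + \|u^2_{\neq}(t,x+ty,y,z)\|_{H^3} \lesssim \langle t\rangle^{-2}e^{-c\nu t^3}\|u^2_{in}\|_{H^7},$$ $$\|u^1_{\neq}(t,x+ty,y,z)\|_{H^1} \lesssim e^{-c\nu t^3}\|u_{in}\|_{H^7},$$ $$\|u^3_{\neq}(t,x+ty,y,z)\|_{H^1} \lesssim e^{-c\nu t^3}\|u_{in}\|_{H^7},$$ and the formulas $$u^1_0(t,y,z) = e^{\nu t\Delta}\left(u^1_{in\,0} - t\,u^2_{in\,0}\right),\qquad u^2_0(t,y,z) = e^{\nu t\Delta}u^2_{in\,0},\qquad u^3_0(t,y,z)=e^{\nu t\Delta}u^3_{in\,0}.$$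
   Context: Domain $(x,y,z)\in\mathbb{T}\times\mathbb{R}\times\mathbb{T}$, $\mathbb{T}=\mathbb{R}/2\pi\mathbb{Z}$; $u=(u^1,u^2,u^3)$, $t\ge 0$, and $\nu>0$ is the inverse Reynolds number. $f_0(y,z)=\frac{1}{2\pi}\int f\,dx$ is the $x$-average, $f_{\neq}=f-f_0$, and $u^i_{in\,0}$ is the $x$-average of $u^i_{in}$; $e^{\nu t\Delta}$ is the heat semigroup (here on $\mathbb{R}\times\mathbb{T}$). $\langle t\rangle=(1+t^2)^{1/2}$. $H^\sigma$ is the $L^2$-based Sobolev space of order $\sigma$. $A\lesssim B$ means $A\le CB$ with $C$ independent of $t$, $\nu$ and $u_{in}$; likewise $c$ does not depend on these. *)

theory Defs
  imports "HOL-Analysis.Analysis"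
begin

section \<open>Functions on the domain \<open>\<bbbT> \<times> \<real> \<times> \<bbbT>\<close>\<close>

text \<open>
  A point is a triple \<open>(x, y, z)\<close>. A function on \<open>\<bbbT> \<times> \<real> \<times> \<bbbT>\<close> is represented by a function on
  \<open>\<real>\<^sup>3\<close> that is \<open>2\<pi>\<close>-periodic in \<open>x\<close> and in \<open>z\<close>; integrals run over one period cell.
\<close>

type_synonym pt = "real \<times> real \<times> real"

definition periodic_xz :: "(pt \<Rightarrow> real) \<Rightarrow> bool" where
  "periodic_xz f \<longleftrightarrow>
     (\<forall>x y z. f (x + 2 * pi, y, z) = f (x, y, z) \<and> f (x, y, z + 2 * pi) = f (x, y, z))"

definition cell :: "pt set" where
  "cell = {0..2 * pi} \<times> UNIV \<times> {0..2 * pi}"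

text \<open>
  Elements of \<open>L\<^sup>2\<close> are represented by Borel functions (every class has a Borel representative).
\<close>

definition L2 :: "(pt \<Rightarrow> real) \<Rightarrow> bool" where
  "L2 f \<longleftrightarrow> f \<in> borel_measurable borel \<and> periodic_xz f \<and>
     set_integrable lborel cell (\<lambda>w. (f w)\<^sup>2)"

definition ip :: "(pt \<Rightarrow> real) \<Rightarrow> (pt \<Rightarrow> real) \<Rightarrow> real" where
  "ip f g = (LINT w:cell|lborel. f w * g w)"

definition L2_norm :: "(pt \<Rightarrow> real) \<Rightarrow> real" where
  "L2_norm f = sqrt (LINT w:cell|lborel. (f w)\<^sup>2)"

section \<open>Test functions, weak derivatives and Sobolev spaces\<close>

definition unit_vec :: "3 \<Rightarrow> pt" where
  "unit_vec i = (if i = 1 then (1, 0, 0) else if i = 2 then (0, 1, 0) else (0, 0, 1))"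

definition pd :: "3 \<Rightarrow> (pt \<Rightarrow> real) \<Rightarrow> pt \<Rightarrow> real" where
  "pd i f w = deriv (\<lambda>s. f (w + s *\<^sub>R unit_vec i)) 0"

definition laplace :: "(pt \<Rightarrow> real) \<Rightarrow> pt \<Rightarrow> real" where
  "laplace f w = (\<Sum>i\<in>UNIV. pd i (pd i f) w)"

primrec C_k :: "nat \<Rightarrow> (pt \<Rightarrow> real) \<Rightarrow> bool" where
  "C_k 0 f \<longleftrightarrow> continuous_on UNIV f"
| "C_k (Suc n) f \<longleftrightarrow>
     (\<forall>i. (\<forall>w. (\<lambda>s. f (w + s *\<^sub>R unit_vec i)) differentiable (at 0)) \<and> C_k n (pd i f))"

text \<open>The space \<open>C\<^sub>c\<^sup>\<infinity>(\<bbbT> \<times> \<real> \<times> \<bbbT>)\<close>: compact support only constrains \<open>y\<close>.\<close>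

definition test_fun :: "(pt \<Rightarrow> real) \<Rightarrow> bool" where
  "test_fun \<phi> \<longleftrightarrow> (\<forall>n. C_k n \<phi>) \<and> periodic_xz \<phi> \<and>
     (\<exists>R. \<forall>x y z. R < \<bar>y\<bar> \<longrightarrow> \<phi> (x, y, z) = 0)"

type_synonym multi_index = "nat \<times> nat \<times> nat"

fun ord_mi :: "multi_index \<Rightarrow> nat" where
  "ord_mi (a, b, c) = a + b + c"

fun pd_mi :: "multi_index \<Rightarrow> (pt \<Rightarrow> real) \<Rightarrow> pt \<Rightarrow> real" where
  "pd_mi (a, b, c) f = (pd 1 ^^ a) ((pd 2 ^^ b) ((pd 3 ^^ c) f))"

definition has_weak_pd :: "multi_index \<Rightarrow> (pt \<Rightarrow> real) \<Rightarrow> (pt \<Rightarrow> real) \<Rightarrow> bool" where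
  "has_weak_pd \<alpha> f g \<longleftrightarrow>
     L2 g \<and> (\<forall>\<phi>. test_fun \<phi> \<longrightarrow> ip f (pd_mi \<alpha> \<phi>) = (- 1) ^ ord_mi \<alpha> * ip g \<phi>)"

definition sobolev :: "nat \<Rightarrow> (pt \<Rightarrow> real) \<Rightarrow> bool" where
  "sobolev m f \<longleftrightarrow> L2 f \<and> (\<forall>\<alpha>. ord_mi \<alpha> \<le> m \<longrightarrow> (\<exists>g. has_weak_pd \<alpha> f g))"

text \<open>
  Weak derivatives are unique almost everywhere, so the choice below does not affect the norm;
  the norm is meaningful only for functions satisfying \<^const>\<open>sobolev\<close>.
\<close>

definition sobolev_norm :: "nat \<Rightarrow> (pt \<Rightarrow> real) \<Rightarrow> real" where
  "sobolev_norm m f =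
     sqrt (\<Sum>\<alpha> | ord_mi \<alpha> \<le> m. (L2_norm (SOME g. has_weak_pd \<alpha> f g))\<^sup>2)"

definition sobolev_vec :: "nat \<Rightarrow> (pt \<Rightarrow> real ^ 3) \<Rightarrow> bool" where
  "sobolev_vec m v \<longleftrightarrow> (\<forall>i. sobolev m (\<lambda>w. v w $ i))"

definition sobolev_vec_norm :: "nat \<Rightarrow> (pt \<Rightarrow> real ^ 3) \<Rightarrow> real" where
  "sobolev_vec_norm m v = sqrt (\<Sum>i\<in>UNIV. (sobolev_norm m (\<lambda>w. v w $ i))\<^sup>2)"

section \<open>The linearized Navier--Stokes equations\<close>

definition div_free :: "(pt \<Rightarrow> real ^ 3) \<Rightarrow> bool" where
  "div_free v \<longleftrightarrow> (\<forall>\<phi>. test_fun \<phi> \<longrightarrow> (\<Sum>i\<in>UNIV. ip (\<lambda>w. v w $ i) (pd i \<phi>)) = 0)"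

definition L2_continuous :: "(real \<Rightarrow> pt \<Rightarrow> real) \<Rightarrow> bool" where
  "L2_continuous f \<longleftrightarrow> (\<forall>t\<ge>0. L2 (f t) \<and>
     ((\<lambda>s. L2_norm (\<lambda>w. f s w - f t w)) \<longlongrightarrow> 0) (at t within {0..}))"

text \<open>
  Solutions are taken in \<open>C([0,\<infinity>); L\<^sup>2)\<close>, and the equations
  \<open>\<partial>\<^sub>t u + y \<partial>\<^sub>x u = (-u\<^sup>2, 0, 0) - \<nabla>p + \<nu> \<Delta>u\<close>, \<open>\<Delta>p = -2 \<partial>\<^sub>x u\<^sup>2\<close>, \<open>\<nabla> \<cdot> u = 0\<close>
  (superscripts are component indices) hold in the sense of distributions: all spatial derivatives
  are moved to the test function. Square integrability of \<open>p\<close> fixes the pressure, which the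
  equations leave undetermined up to harmonic functions; it says \<open>p = -2 \<Delta>\<^sup>-\<^sup>1 \<partial>\<^sub>x u\<^sup>2\<close>.
\<close>

definition lin_NS_solution ::
  "real \<Rightarrow> (pt \<Rightarrow> real ^ 3) \<Rightarrow> (real \<Rightarrow> pt \<Rightarrow> real ^ 3) \<Rightarrow> (real \<Rightarrow> pt \<Rightarrow> real) \<Rightarrow> bool" where
  "lin_NS_solution \<nu> u_in u p \<longleftrightarrow>
     (\<forall>i. L2_continuous (\<lambda>t w. u t w $ i)) \<and> L2_continuous p \<and>
     (AE w in lborel. u 0 w = u_in w) \<and>
     (\<forall>t\<ge>0. div_free (u t)) \<and>
     (\<forall>t\<ge>0. \<forall>\<phi>. test_fun \<phi> \<longrightarrow>
        ip (p t) (laplace \<phi>) = 2 * ip (\<lambda>w. u t w $ 2) (pd 1 \<phi>)) \<and>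
     (\<forall>t\<ge>0. \<forall>i. \<forall>\<phi>. test_fun \<phi> \<longrightarrow>
        ((\<lambda>s. ip (\<lambda>w. u s w $ i) \<phi>) has_real_derivative
           ip (\<lambda>w. u t w $ i) (\<lambda>(x, y, z). y * pd 1 \<phi> (x, y, z))
           - (if i = 1 then ip (\<lambda>w. u t w $ 2) \<phi> else 0)
           + ip (p t) (pd i \<phi>)
           + \<nu> * ip (\<lambda>w. u t w $ i) (laplace \<phi>))
          (at t within {0..}))"

section \<open>Averages in \<open>x\<close>, the moving frame and the heat semigroup\<close>

definition x_avg :: "(pt \<Rightarrow> real) \<Rightarrow> real \<times> real \<Rightarrow> real" where
  "x_avg f = (\<lambda>(y, z). 1 / (2 * pi) * (LINT x:{0..2 * pi}|lborel. f (x, y, z)))"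

definition x_fluct :: "(pt \<Rightarrow> real) \<Rightarrow> pt \<Rightarrow> real" where
  "x_fluct f = (\<lambda>(x, y, z). f (x, y, z) - x_avg f (y, z))"

definition shear :: "real \<Rightarrow> (pt \<Rightarrow> real) \<Rightarrow> pt \<Rightarrow> real" where
  "shear t f = (\<lambda>(x, y, z). f (x + t * y, y, z))"

text \<open>
  \<open>heat s g\<close> is \<open>e\<^bsup>s\<Delta>\<^esup> g\<close> on \<open>\<real> \<times> \<bbbT>\<close>: since \<open>g\<close> is periodic in its second argument, integrating it
  against the Gaussian over \<open>\<real>\<^sup>2\<close> is integrating it over one period against the periodized Gaussian,
  which is the heat kernel of \<open>\<real> \<times> \<bbbT>\<close>.
\<close>

definition heat :: "real \<Rightarrow> (real \<times> real \<Rightarrow> real) \<Rightarrow> real \<times> real \<Rightarrow> real" where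
  "heat s g = (\<lambda>(y, z). if s = 0 then g (y, z) else
     (LINT (y', z')|lborel.
        1 / (4 * pi * s) * exp (- ((y - y')\<^sup>2 + (z - z')\<^sup>2) / (4 * s)) * g (y', z')))"

definition jap :: "real \<Rightarrow> real" where
  "jap t = sqrt (1 + t\<^sup>2)"

end

theory Submission
  imports Defs "HOL-Probability.Probability"
begin

text \<open>
  In the frame moving with the shear, a Fourier mode \<open>(k, \<eta>, l)\<close> sits at the frequency
  \<open>\<xi>\<^sub>t = (k, \<eta> - kt, l)\<close> and the equations become ordinary differential equations:
  \<open>exp (\<nu> \<integral>\<^sub>0\<^sup>t |\<xi>\<^sub>s|\<^sup>2 ds) |\<xi>\<^sub>t|\<^sup>2 u\<^sup>2\<close> is constant in time, and \<open>u\<^sup>1\<close>, \<open>u\<^sup>3\<close> follow by one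
  integration. For \<open>k \<noteq> 0\<close> the exponent is at least \<open>\<nu> t\<^sup>3 / 12\<close> and \<open>|\<xi>\<^sub>t|\<^sup>-\<^sup>2\<close> is bounded by
  \<open>3 \<langle>t\<rangle>\<^sup>-\<^sup>2 \<langle>\<xi>\<rangle>\<^sup>2\<close>; for \<open>k = 0\<close> the frequency is stationary and the formulas of the heat
  semigroup remain. Since the multiplication by \<open>y\<close> is unbounded, the weak equations are tested with
  characters cut off at \<open>|y| \<le> R\<close>; the cutoff errors vanish along \<open>R \<rightarrow> \<infinity>\<close> for almost every mode.
\<close>

section \<open>Square integrable functions\<close>

text \<open>The solution is given, not constructed, so everything is extracted from weak identities.
  A mode of an L2 function is defined only almost everywhere in frequency, while an ordinary
  differential equation needs a fixed mode; the cutoff makes each mode a genuine number, continuous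
  in time. The pressure is eliminated mode by mode, dividing by |\<xi>_t|^2, and this never vanishes
  along a characteristic once \<eta> \<noteq> 0, at the cost of a null set.

  The order 7 serves two purposes. The rate of damping costs four derivatives, and 3 + 4 = 7.
  Turning decay of a transform back into weak derivatives uses an absolutely convergent inversion
  integral, hence integrability of the transform with the weight of order 3; for data in H^7 this
  holds since the weight of order -4 is square integrable in three dimensions. Therefore each mode
  is bounded twice: with decay but a loss of four derivatives for the norms, and without loss but
  growing in t for integrability at a fixed time.\<close>

definition sqi :: "'a measure \<Rightarrow> ('a \<Rightarrow> complex) \<Rightarrow> bool" where
  "sqi M f \<longleftrightarrow> f \<in> borel_measurable M \<and> integrable M (\<lambda>x. (cmod (f x))\<^sup>2)"

definition norm2 :: "'a measure \<Rightarrow> ('a \<Rightarrow> complex) \<Rightarrow> real" where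
  "norm2 M f = sqrt (LINT x|M. (cmod (f x))\<^sup>2)"

lemma sqi_measurable [measurable_dest]: "sqi M f \<Longrightarrow> f \<in> borel_measurable M"
  by (simp add: sqi_def)

lemma sqi_integrable: "sqi M f \<Longrightarrow> integrable M (\<lambda>x. (cmod (f x))\<^sup>2)"
  by (simp add: sqi_def)

lemma norm2_nonneg [simp]: "0 \<le> norm2 M f"
  by (simp add: norm2_def)

lemma norm2_sq: "(norm2 M f)\<^sup>2 = (LINT x|M. (cmod (f x))\<^sup>2)"
  by (simp add: norm2_def)

lemma nn_norm2:
  assumes "sqi M f"
  shows "(\<integral>\<^sup>+x. ennreal ((cmod (f x))\<^sup>2) \<partial>M) = ennreal ((norm2 M f)\<^sup>2)"
  by (simp add: norm2_sq nn_integral_eq_integral sqi_integrable[OF assms])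

lemma sqi_nnI:
  assumes "f \<in> borel_measurable M" "(\<integral>\<^sup>+x. ennreal ((cmod (f x))\<^sup>2) \<partial>M) < \<infinity>"
  shows "sqi M f"
  using assms by (auto simp: sqi_def intro!: integrableI_bounded)

lemma sqi_iff_nn:
  "sqi M f \<longleftrightarrow> f \<in> borel_measurable M \<and> (\<integral>\<^sup>+x. ennreal ((cmod (f x))\<^sup>2) \<partial>M) < \<infinity>"
proof
  assume "sqi M f"
  then show "f \<in> borel_measurable M \<and> (\<integral>\<^sup>+x. ennreal ((cmod (f x))\<^sup>2) \<partial>M) < \<infinity>"
    by (subst nn_norm2) (auto dest: sqi_measurable)
qed (blast intro: sqi_nnI)

lemma sqi_dominated:
  assumes "sqi M g" "f \<in> borel_measurable M" "AE x in M. cmod (f x) \<le> C * cmod (g x)"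
  shows "sqi M f"
proof -
  have "AE x in M. norm ((cmod (f x))\<^sup>2) \<le> norm (C\<^sup>2 * (cmod (g x))\<^sup>2)"
    using assms(3)
  proof eventually_elim
    case (elim x)
    then have "(cmod (f x))\<^sup>2 \<le> (C * cmod (g x))\<^sup>2" by (intro power_mono) auto
    then show ?case by (simp add: power_mult_distrib)
  qed
  then have "integrable M (\<lambda>x. (cmod (f x))\<^sup>2)"
    using assms by (intro Bochner_Integration.integrable_bound[OF integrable_mult_right[OF sqi_integrable[OF assms(1)], of "C\<^sup>2"]]) auto
  then show ?thesis using assms by (simp add: sqi_def)
qed

lemma norm2_dominated:
  assumes "sqi M g" "f \<in> borel_measurable M" "AE x in M. cmod (f x) \<le> C * cmod (g x)" "C \<ge> 0"
  shows "norm2 M f \<le> C * norm2 M g"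
proof -
  have "(LINT x|M. (cmod (f x))\<^sup>2) \<le> (LINT x|M. C\<^sup>2 * (cmod (g x))\<^sup>2)"
  proof (rule integral_mono_AE)
    show "integrable M (\<lambda>x. (cmod (f x))\<^sup>2)" using sqi_dominated[OF assms(1-3)] by (rule sqi_integrable)
    show "integrable M (\<lambda>x. C\<^sup>2 * (cmod (g x))\<^sup>2)" using assms(1) by (intro integrable_mult_right sqi_integrable)
    show "AE x in M. (cmod (f x))\<^sup>2 \<le> C\<^sup>2 * (cmod (g x))\<^sup>2"
      using assms(3)
    proof eventually_elim
      case (elim x)
      then have "(cmod (f x))\<^sup>2 \<le> (C * cmod (g x))\<^sup>2" by (intro power_mono) auto
      then show ?case by (simp add: power_mult_distrib)
    qed
  qed
  then have "(norm2 M f)\<^sup>2 \<le> (C * norm2 M g)\<^sup>2"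
    by (simp add: norm2_sq power_mult_distrib)
  then show ?thesis by (rule power2_le_imp_le) (simp add: assms(4))
qed

lemma sqi_cmult: "sqi M f \<Longrightarrow> sqi M (\<lambda>x. c * f x)"
  by (rule sqi_dominated[of M f _ "cmod c"]) (auto simp: norm_mult)

lemma sqi_0 [simp]: "sqi M (\<lambda>x. 0)"
  by (simp add: sqi_def)

lemma norm2_0 [simp]: "norm2 M (\<lambda>x. 0) = 0"
  by (simp add: norm2_def)

lemma norm2_cmult: "norm2 M (\<lambda>x. c * f x) = cmod c * norm2 M f"
  by (simp add: norm2_def norm_mult power_mult_distrib real_sqrt_mult)

lemma norm2_minus_commute: "norm2 M (\<lambda>x. f x - g x) = norm2 M (\<lambda>x. g x - f x)"
  by (simp add: norm2_def norm_minus_commute)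

lemma sqi_add:
  assumes [measurable]: "sqi M f" "sqi M g"
  shows "sqi M (\<lambda>x. f x + g x)"
  unfolding sqi_def
proof
  show "(\<lambda>x. f x + g x) \<in> borel_measurable M" by measurable
  have "(cmod (f x + g x))\<^sup>2 \<le> 2 * (cmod (f x))\<^sup>2 + 2 * (cmod (g x))\<^sup>2" for x
  proof -
    have "(cmod (f x + g x))\<^sup>2 \<le> (cmod (f x) + cmod (g x))\<^sup>2"
      by (intro power_mono norm_triangle_ineq) auto
    also have "\<dots> \<le> 2 * (cmod (f x))\<^sup>2 + 2 * (cmod (g x))\<^sup>2"
      using sum_squares_bound[of "cmod (f x)" "cmod (g x)"] by (simp add: power2_sum)
    finally show ?thesis .
  qed
  note bd = this
  have "integrable M (\<lambda>x. 2 * (cmod (f x))\<^sup>2 + 2 * (cmod (g x))\<^sup>2)"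
    using sqi_integrable[OF assms(1)] sqi_integrable[OF assms(2)] by simp
  then show "integrable M (\<lambda>x. (cmod (f x + g x))\<^sup>2)"
  proof (rule Bochner_Integration.integrable_bound)
    show "AE x in M. norm ((cmod (f x + g x))\<^sup>2) \<le> norm (2 * (cmod (f x))\<^sup>2 + 2 * (cmod (g x))\<^sup>2)"
      by (rule AE_I2) (use bd in simp)
  qed measurable
qed

lemma sqi_diff: "sqi M f \<Longrightarrow> sqi M g \<Longrightarrow> sqi M (\<lambda>x. f x - g x)"
  using sqi_add[of M f "\<lambda>x. (-1) * g x"] sqi_cmult[of M g "-1"] by simp

lemma borel_measurable_cnj [measurable (raw)]:
  "f \<in> borel_measurable M \<Longrightarrow> (\<lambda>x. cnj (f x)) \<in> borel_measurable M"
  by (rule measurable_compose[of f M borel]) (auto intro!: borel_measurable_continuous_onI continuous_intros)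

lemma sqi_cnj: "sqi M f \<Longrightarrow> sqi M (\<lambda>x. cnj (f x))"
  by (rule sqi_dominated[of M f _ 1]) auto

lemma sqi_integrable_mult:
  assumes [measurable]: "sqi M f" "sqi M g"
  shows "integrable M (\<lambda>x. f x * g x)"
proof (rule Bochner_Integration.integrable_bound)
  show "integrable M (\<lambda>x. (cmod (f x))\<^sup>2 + (cmod (g x))\<^sup>2)"
    using assms by (auto intro: sqi_integrable)
  have "cmod (f x) * cmod (g x) \<le> (cmod (f x))\<^sup>2 + (cmod (g x))\<^sup>2" for x
    using sum_squares_bound[of "cmod (f x)" "cmod (g x)"]
      mult_nonneg_nonneg[OF norm_ge_zero[of "f x"] norm_ge_zero[of "g x"]] by linarith
  then show "AE x in M. norm (f x * g x) \<le> norm ((cmod (f x))\<^sup>2 + (cmod (g x))\<^sup>2)"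
    by (auto simp: norm_mult)
qed measurable

lemma norm2_Cauchy_Schwarz:
  assumes [measurable]: "sqi M f" "sqi M g"
  shows "(LINT x|M. cmod (f x) * cmod (g x)) \<le> norm2 M f * norm2 M g"
proof -
  have i: "integrable M (\<lambda>x. cmod (f x) * cmod (g x))"
    using integrable_norm[OF sqi_integrable_mult[OF assms]] by (simp add: norm_mult)
  have "(\<integral>\<^sup>+x. ennreal (cmod (f x)) * ennreal (cmod (g x)) \<partial>M)\<^sup>2 \<le>
     (\<integral>\<^sup>+x. (ennreal (cmod (f x)))\<^sup>2 \<partial>M) * (\<integral>\<^sup>+x. (ennreal (cmod (g x)))\<^sup>2 \<partial>M)"
    by (rule Cauchy_Schwarz_nn_integral) measurable
  then have "(ennreal (LINT x|M. cmod (f x) * cmod (g x)))\<^sup>2 \<le> ennreal ((norm2 M f)\<^sup>2) * ennreal ((norm2 M g)\<^sup>2)"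
    by (simp add: ennreal_mult'[symmetric] ennreal_power nn_norm2[OF assms(1)] nn_norm2[OF assms(2)]
        nn_integral_eq_integral[OF i])
  then have "(LINT x|M. cmod (f x) * cmod (g x))\<^sup>2 \<le> (norm2 M f * norm2 M g)\<^sup>2"
    by (subst (asm) ennreal_power) (auto simp: ennreal_mult'[symmetric] power_mult_distrib)
  then show ?thesis by (rule power2_le_imp_le) simp
qed

lemma norm2_inner_bound:
  assumes "sqi M f" "sqi M g"
  shows "cmod (LINT x|M. f x * g x) \<le> norm2 M f * norm2 M g"
proof -
  have "cmod (LINT x|M. f x * g x) \<le> (LINT x|M. cmod (f x) * cmod (g x))"
    using integral_norm_bound[of M "\<lambda>x. f x * g x"] by (simp add: norm_mult)
  then show ?thesis using norm2_Cauchy_Schwarz[OF assms] by simp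
qed

lemma norm2_triangle:
  assumes "sqi M f" "sqi M g"
  shows "norm2 M (\<lambda>x. f x + g x) \<le> norm2 M f + norm2 M g"
proof -
  have i: "integrable M (\<lambda>x. cmod (f x) * cmod (g x))"
    using integrable_norm[OF sqi_integrable_mult[OF assms]] by (simp add: norm_mult)
  have "(norm2 M (\<lambda>x. f x + g x))\<^sup>2 \<le> (LINT x|M. (cmod (f x))\<^sup>2 + 2 * (cmod (f x) * cmod (g x)) + (cmod (g x))\<^sup>2)"
    unfolding norm2_sq
  proof (rule integral_mono)
    fix x
    have "(cmod (f x + g x))\<^sup>2 \<le> (cmod (f x) + cmod (g x))\<^sup>2"
      by (intro power_mono norm_triangle_ineq) auto
    then show "(cmod (f x + g x))\<^sup>2 \<le> (cmod (f x))\<^sup>2 + 2 * (cmod (f x) * cmod (g x)) + (cmod (g x))\<^sup>2"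
      by (simp add: power2_sum)
  qed (intro Bochner_Integration.integrable_add integrable_mult_right i sqi_integrable sqi_add assms)+
  also have "\<dots> = (norm2 M f)\<^sup>2 + 2 * (LINT x|M. cmod (f x) * cmod (g x)) + (norm2 M g)\<^sup>2"
    using i sqi_integrable[OF assms(1)] sqi_integrable[OF assms(2)] by (simp add: norm2_sq)
  also have "\<dots> \<le> (norm2 M f + norm2 M g)\<^sup>2"
    using norm2_Cauchy_Schwarz[OF assms] by (simp add: power2_sum)
  finally show ?thesis by (rule power2_le_imp_le) simp
qed

lemma norm2_triangle_diff:
  assumes "sqi M f" "sqi M g" "sqi M h"
  shows "norm2 M (\<lambda>x. f x - h x) \<le> norm2 M (\<lambda>x. f x - g x) + norm2 M (\<lambda>x. g x - h x)"
  using norm2_triangle[OF sqi_diff[OF assms(1,2)] sqi_diff[OF assms(2,3)]] by simp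

lemma norm2_diff_abs:
  assumes "sqi M f" "sqi M g"
  shows "\<bar>norm2 M f - norm2 M g\<bar> \<le> norm2 M (\<lambda>x. f x - g x)"
  using norm2_triangle_diff[OF assms sqi_0] norm2_triangle_diff[OF assms(2,1) sqi_0]
  by (simp add: norm2_minus_commute[of M g f])

lemma norm2_eq_0_AE:
  assumes "sqi M f" "norm2 M f = 0"
  shows "AE x in M. f x = 0"
proof -
  have "(LINT x|M. (cmod (f x))\<^sup>2) = 0"
    using assms(2) by (simp add: norm2_def)
  then show ?thesis
    using integral_nonneg_eq_0_iff_AE[OF sqi_integrable[OF assms(1)]] by simp
qed

lemma norm2_cong_AE:
  assumes "f \<in> borel_measurable M" "g \<in> borel_measurable M" "AE x in M. cmod (f x) = cmod (g x)"
  shows "norm2 M f = norm2 M g"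
  unfolding norm2_def using assms by (intro arg_cong[where f=sqrt] integral_cong_AE) auto

lemma norm2_tendsto_0_dominated:
  assumes [measurable]: "sqi M g" "\<And>n. f n \<in> borel_measurable M"
    and "\<And>n. AE x in M. cmod (f n x) \<le> cmod (g x)" "AE x in M. (\<lambda>n. f n x) \<longlonglongrightarrow> 0"
  shows "(\<lambda>n. norm2 M (f n)) \<longlonglongrightarrow> 0"
proof -
  have "(\<lambda>n. LINT x|M. (cmod (f n x))\<^sup>2) \<longlonglongrightarrow> (LINT x|M. 0)"
  proof (rule integral_dominated_convergence[where w = "\<lambda>x. (cmod (g x))\<^sup>2"])
    show "AE x in M. (\<lambda>n. (cmod (f n x))\<^sup>2) \<longlonglongrightarrow> 0"
      using assms(4) by eventually_elim (auto intro!: tendsto_eq_intros)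
    show "AE x in M. norm ((cmod (f n x))\<^sup>2) \<le> (cmod (g x))\<^sup>2" for n
      using assms(3)[of n] by eventually_elim (auto intro!: power_mono)
  qed (use assms sqi_integrable in auto)
  then have "(\<lambda>n. sqrt (LINT x|M. (cmod (f n x))\<^sup>2)) \<longlonglongrightarrow> sqrt 0"
    by (intro tendsto_real_sqrt) simp
  then show ?thesis by (simp add: norm2_def)
qed

lemma norm2_limit_unique:
  assumes "sqi M F" "sqi M G" "\<And>n. sqi M (X n)"
    and "(\<lambda>n. norm2 M (\<lambda>x. X n x - F x)) \<longlonglongrightarrow> 0" "(\<lambda>n. norm2 M (\<lambda>x. X n x - G x)) \<longlonglongrightarrow> 0"
  shows "AE x in M. F x = G x"
proof -
  have "norm2 M (\<lambda>x. F x - G x) \<le> norm2 M (\<lambda>x. X n x - F x) + norm2 M (\<lambda>x. X n x - G x)" for n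
    using norm2_triangle_diff[OF assms(1) assms(3)[of n] assms(2)] by (simp add: norm2_minus_commute[of M F])
  then have "norm2 M (\<lambda>x. F x - G x) \<le> 0 + 0"
    by (intro LIMSEQ_le_const[OF tendsto_add[OF assms(4,5)]]) auto
  then have "norm2 M (\<lambda>x. F x - G x) = 0"
    by (simp add: antisym)
  from norm2_eq_0_AE[OF sqi_diff[OF assms(1,2)] this] show ?thesis by simp
qed

text \<open>From 2ab <= a^2 + b^2 follows 2 d k <= 2^k (d k)^2 + 2^-k. This turns summability of
  weighted squares, which can be checked under an integral, into summability of the increments
  themselves.\<close>

lemma summable_of_weighted_squares:
  fixes d :: "nat \<Rightarrow> real"
  assumes "\<And>k. d k \<ge> 0" "summable (\<lambda>k. 2 ^ k * (d k)\<^sup>2)"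
  shows "summable d"
proof (rule summable_comparison_test')
  show "summable (\<lambda>k. 2 ^ k * (d k)\<^sup>2 + (1/2) ^ k)"
    by (intro summable_add assms summable_geometric) simp
  fix k
  define a where "a = (2::real) ^ k"
  have a: "a > 0" "(1/2) ^ k = 1 / a" by (simp_all add: a_def power_one_over)
  have "0 \<le> (a * d k - 1)\<^sup>2" by simp
  then have "2 * a * d k \<le> a\<^sup>2 * (d k)\<^sup>2 + 1" by (simp add: power2_diff power_mult_distrib)
  then have "2 * d k \<le> a * (d k)\<^sup>2 + 1 / a" using a by (simp add: field_simps power2_eq_square)
  then show "norm (d k) \<le> 2 ^ k * (d k)\<^sup>2 + (1/2) ^ k"
    using assms(1)[of k] a by (simp add: a_def)
qed

text \<open>Riesz-Fischer. Along a subsequence with gaps below 2^-k, the squared gaps weighted by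
  2^k have total integral at most the sum of 2^-k, so the increments are absolutely summable at
  almost every point. Fatou's lemma identifies the pointwise limit as the limit in norm.\<close>

lemma norm2_complete:
  assumes X: "\<And>n. sqi M (X n)"
    and C: "\<And>e. e > 0 \<Longrightarrow> \<exists>N. \<forall>m\<ge>N. \<forall>n\<ge>N. norm2 M (\<lambda>x. X m x - X n x) < e"
  obtains F where "sqi M F" "(\<lambda>n. norm2 M (\<lambda>x. X n x - F x)) \<longlonglongrightarrow> 0"
proof -
  have [measurable]: "X n \<in> borel_measurable M" for n using X by (rule sqi_measurable)
  have "\<forall>k. \<exists>N. \<forall>m\<ge>N. \<forall>n\<ge>N. norm2 M (\<lambda>x. X m x - X n x) < (1/2) ^ k"
    using C by simp
  then obtain N where N: "\<And>k m n. m \<ge> N k \<Longrightarrow> n \<ge> N k \<Longrightarrow> norm2 M (\<lambda>x. X m x - X n x) < (1/2) ^ k"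
    by metis
  \<comment> \<open>Partial sums of \<open>N\<close> make the indices monotone while keeping them
    above each \<open>N k\<close>.\<close>
  define r where "r k = (\<Sum>j\<le>k. N j) + k" for k
  have rN: "r k \<ge> N k" for k
    unfolding r_def by (simp add: member_le_sum trans_le_add1)
  have rS: "r k \<le> r (Suc k)" for k unfolding r_def by simp
  define Y where "Y k = X (r k)" for k
  have [measurable]: "Y k \<in> borel_measurable M" for k by (simp add: Y_def)
  define d where "d k x = cmod (Y (Suc k) x - Y k x)" for k x
  have dn: "(\<integral>\<^sup>+x. ennreal (2 ^ k * (d k x)\<^sup>2) \<partial>M) \<le> ennreal ((1/2) ^ k)" for k
  proof -
    have "norm2 M (\<lambda>x. Y (Suc k) x - Y k x) \<le> (1/2) ^ k"
      unfolding Y_def using N[of k "r (Suc k)" "r k"] rN[of k] rS[of k] by simp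
    then have "(norm2 M (\<lambda>x. Y (Suc k) x - Y k x))\<^sup>2 \<le> ((1/2) ^ k)\<^sup>2"
      by (intro power_mono) auto
    then have "2 ^ k * (norm2 M (\<lambda>x. Y (Suc k) x - Y k x))\<^sup>2 \<le> 2 ^ k * ((1/2) ^ k)\<^sup>2"
      by simp
    also have "\<dots> = (1/2) ^ k" by (simp add: power2_eq_square power_one_over)
    finally have *: "2 ^ k * (norm2 M (\<lambda>x. Y (Suc k) x - Y k x))\<^sup>2 \<le> (1/2) ^ k" .
    have "(\<integral>\<^sup>+x. ennreal (2 ^ k * (d k x)\<^sup>2) \<partial>M) = ennreal (2 ^ k) * (\<integral>\<^sup>+x. ennreal ((d k x)\<^sup>2) \<partial>M)"
      by (subst nn_integral_cmult[symmetric]) (auto simp: d_def ennreal_mult')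
    also have "\<dots> = ennreal (2 ^ k * (norm2 M (\<lambda>x. Y (Suc k) x - Y k x))\<^sup>2)"
      unfolding d_def by (subst nn_norm2) (auto simp: Y_def ennreal_mult' intro!: sqi_diff X)
    finally show ?thesis using * by (simp add: ennreal_leI)
  qed
  have "(\<integral>\<^sup>+x. (\<Sum>k. ennreal (2 ^ k * (d k x)\<^sup>2)) \<partial>M) = (\<Sum>k. \<integral>\<^sup>+x. ennreal (2 ^ k * (d k x)\<^sup>2) \<partial>M)"
    by (rule nn_integral_suminf) (auto simp: d_def)
  also have "\<dots> \<le> (\<Sum>k. ennreal ((1/2) ^ k))"
    by (intro suminf_le dn) auto
  also have "\<dots> = ennreal (\<Sum>k. (1/2) ^ k)"
    by (rule suminf_ennreal2) auto
  also have "\<dots> < \<infinity>" by simp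
  finally have "AE x in M. (\<Sum>k. ennreal (2 ^ k * (d k x)\<^sup>2)) \<noteq> \<infinity>"
    by (intro nn_integral_noteq_infinite) (auto simp: d_def)
  then have conv: "AE x in M. (\<lambda>k. Y k x) \<longlonglongrightarrow> lim (\<lambda>k. Y k x)"
  proof eventually_elim
    case (elim x)
    have "summable (\<lambda>k. 2 ^ k * (d k x)\<^sup>2)"
      using elim by (intro summable_suminf_not_top) auto
    then have "summable (\<lambda>k. d k x)"
      by (rule summable_of_weighted_squares[rotated]) (simp add: d_def)
    then have "summable (\<lambda>k. Y (Suc k) x - Y k x)"
      unfolding d_def by (rule summable_norm_cancel)
    then have "convergent (\<lambda>k. \<Sum>i<k. Y (Suc i) x - Y i x)"
      by (simp add: summable_iff_convergent)
    then have "convergent (\<lambda>k. Y k x - Y 0 x)"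
      by (simp only: sum_lessThan_telescope[of "\<lambda>k. Y k x"])
    then have "convergent (\<lambda>k. Y k x - Y 0 x + Y 0 x)"
      by (intro convergent_add convergent_const)
    then show ?case by (simp add: convergent_LIMSEQ_iff)
  qed
  define F where "F x = lim (\<lambda>k. Y k x)" for x
  have [measurable]: "F \<in> borel_measurable M" unfolding F_def by (rule borel_measurable_lim_metric) simp
  \<comment> \<open>Fatou's lemma along the subsequence preserves the Cauchy bound in the limit;
    square integrability of \<open>F\<close> also comes from here.\<close>
  have est: "(\<integral>\<^sup>+x. ennreal ((cmod (X n x - F x))\<^sup>2) \<partial>M) \<le> ennreal (((1/2) ^ k)\<^sup>2)" if "n \<ge> N k" for n k
  proof -
    have "(\<integral>\<^sup>+x. ennreal ((cmod (X n x - F x))\<^sup>2) \<partial>M) =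
        (\<integral>\<^sup>+x. liminf (\<lambda>j. ennreal ((cmod (X n x - Y j x))\<^sup>2)) \<partial>M)"
    proof (rule nn_integral_cong_AE)
      show "AE x in M. ennreal ((cmod (X n x - F x))\<^sup>2) = liminf (\<lambda>j. ennreal ((cmod (X n x - Y j x))\<^sup>2))"
        using conv
      proof eventually_elim
        case (elim x)
        have "(\<lambda>j. ennreal ((cmod (X n x - Y j x))\<^sup>2)) \<longlonglongrightarrow> ennreal ((cmod (X n x - F x))\<^sup>2)"
          unfolding F_def by (intro tendsto_ennrealI tendsto_intros elim)
        then show ?case by (intro lim_imp_Liminf[symmetric]) auto
      qed
    qed
    also have "\<dots> \<le> liminf (\<lambda>j. \<integral>\<^sup>+x. ennreal ((cmod (X n x - Y j x))\<^sup>2) \<partial>M)"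
      by (rule nn_integral_liminf) measurable
    also have "\<dots> \<le> ennreal (((1/2) ^ k)\<^sup>2)"
    proof (rule Liminf_le)
      show "\<forall>\<^sub>F j in sequentially. (\<integral>\<^sup>+x. ennreal ((cmod (X n x - Y j x))\<^sup>2) \<partial>M) \<le> ennreal (((1/2) ^ k)\<^sup>2)"
        using eventually_ge_at_top[of k]
      proof eventually_elim
        case (elim j)
        have "r k \<le> r j" using elim rS by (simp add: lift_Suc_mono_le)
        then have "norm2 M (\<lambda>x. X n x - Y j x) \<le> (1/2) ^ k"
          unfolding Y_def using N[of k n "r j"] rN[of k] that by simp
        then have "(norm2 M (\<lambda>x. X n x - Y j x))\<^sup>2 \<le> ((1/2) ^ k)\<^sup>2"
          by (intro power_mono) auto
        then show ?case
          by (subst nn_norm2) (auto simp: Y_def intro!: sqi_diff X ennreal_leI)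
      qed
    qed auto
    finally show ?thesis .
  qed
  have dF: "sqi M (\<lambda>x. X n x - F x)" if "n \<ge> N k" for n k
    using le_less_trans[OF est[OF that]] by (intro sqi_nnI) auto
  have "sqi M (\<lambda>x. X (N 0) x - (X (N 0) x - F x))"
    by (intro sqi_diff X dF[of 0]) auto
  then have F: "sqi M F" by simp
  have "(\<lambda>n. norm2 M (\<lambda>x. X n x - F x)) \<longlonglongrightarrow> 0"
  proof (rule LIMSEQ_I)
    fix e :: real assume "e > 0"
    then obtain k where k: "(1/2) ^ k < e" using real_arch_pow_inv[of e "1/2"] by auto
    have "norm2 M (\<lambda>x. X n x - F x) \<le> (1/2) ^ k" if "n \<ge> N k" for n
    proof -
      have "(norm2 M (\<lambda>x. X n x - F x))\<^sup>2 \<le> ((1/2) ^ k)\<^sup>2"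
        using est[OF that] by (subst (asm) nn_norm2[OF dF[OF that]]) simp
      then show ?thesis by (rule power2_le_imp_le) simp
    qed
    with k show "\<exists>no. \<forall>n\<ge>no. norm (norm2 M (\<lambda>x. X n x - F x) - 0) < e"
      by (intro exI[of _ "N k"]) (auto intro: le_less_trans)
  qed
  with F show ?thesis by (rule that)
qed

section \<open>Plancherel's theorem from an approximate identity\<close>

text \<open>The kernel stays abstract so that line, circle and product cell share one theory;
  \<open>e x y\<close> will be a normalized character, of modulus at most 1.\<close>

definition transform :: "'a measure \<Rightarrow> ('a \<Rightarrow> 'b \<Rightarrow> complex) \<Rightarrow> ('a \<Rightarrow> complex) \<Rightarrow> 'b \<Rightarrow> complex" where
  "transform M e f y = (LINT x|M. f x * e x y)"

lemma (in pair_sigma_finite) integrable_pair_mult: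
  fixes f :: "_ \<Rightarrow> 'c::{real_normed_field, banach, second_countable_topology}"
  assumes f: "integrable M1 f" and g: "integrable M2 g"
  shows "integrable (M1 \<Otimes>\<^sub>M M2) (\<lambda>p. f (fst p) * g (snd p))"
proof (rule Fubini_integrable)
  have [measurable]: "f \<in> borel_measurable M1" "g \<in> borel_measurable M2" using f g by auto
  show "(\<lambda>p. f (fst p) * g (snd p)) \<in> borel_measurable (M1 \<Otimes>\<^sub>M M2)" by measurable
  show "integrable M1 (\<lambda>x. LINT y|M2. norm (f (fst (x, y)) * g (snd (x, y))))"
    using f by (simp add: norm_mult)
  show "AE x in M1. integrable M2 (\<lambda>y. f (fst (x, y)) * g (snd (x, y)))"
    using g by simp
qed

lemma kernel_measurable:
  assumes e: "(\<lambda>(x, y). e x y) \<in> borel_measurable (M \<Otimes>\<^sub>M N)"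
    and [measurable]: "F \<in> measurable L M" "G \<in> measurable L N"
  shows "(\<lambda>z. e (F z) (G z)) \<in> borel_measurable L"
proof -
  have "(\<lambda>z. (F z, G z)) \<in> measurable L (M \<Otimes>\<^sub>M N)" by measurable
  from measurable_compose[OF this e] show ?thesis by simp
qed

locale bounded_kernel = M: sigma_finite_measure M + N: sigma_finite_measure N
  for M :: "'a measure" and N :: "'b measure" +
  fixes e :: "'a \<Rightarrow> 'b \<Rightarrow> complex"
  assumes e_meas: "(\<lambda>(x, y). e x y) \<in> borel_measurable (M \<Otimes>\<^sub>M N)"
    and e_bound: "cmod (e x y) \<le> 1"
begin

lemma e_measurable [measurable (raw)]:
  "F \<in> measurable L M \<Longrightarrow> G \<in> measurable L N \<Longrightarrow> (\<lambda>z. e (F z) (G z)) \<in> borel_measurable L"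
  by (rule kernel_measurable[OF e_meas])

lemma transform_measurable [measurable (raw)]:
  assumes [measurable]: "f \<in> borel_measurable M"
  shows "transform M e f \<in> borel_measurable N"
  unfolding transform_def by measurable

lemma integrable_transform:
  assumes "integrable M f" "y \<in> space N"
  shows "integrable M (\<lambda>x. f x * e x y)"
proof (rule Bochner_Integration.integrable_bound[OF assms(1)])
  have [measurable]: "f \<in> borel_measurable M" "y \<in> space N" using assms by auto
  show "(\<lambda>x. f x * e x y) \<in> borel_measurable M" by measurable
  show "AE x in M. cmod (f x * e x y) \<le> cmod (f x)"
    using e_bound by (auto simp: norm_mult mult_left_le)
qed

lemma transform_bound:
  assumes "integrable M f" "y \<in> space N"
  shows "cmod (transform M e f y) \<le> (LINT x|M. cmod (f x))"
proof -
  have "cmod (transform M e f y) \<le> (LINT x|M. cmod (f x * e x y))"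
    unfolding transform_def by (rule integral_norm_bound)
  also have "\<dots> \<le> (LINT x|M. cmod (f x))"
  proof (rule integral_mono)
    show "integrable M (\<lambda>x. cmod (f x * e x y))"
      by (intro integrable_norm integrable_transform assms)
  qed (use assms e_bound in \<open>auto simp: norm_mult mult_left_le\<close>)
  finally show ?thesis .
qed

lemma transform_add:
  assumes "integrable M f" "integrable M g" "y \<in> space N"
  shows "transform M e (\<lambda>x. f x + g x) y = transform M e f y + transform M e g y"
  unfolding transform_def using integrable_transform[OF assms(1,3)] integrable_transform[OF assms(2,3)]
  by (simp add: distrib_right)

lemma transform_cmult: "transform M e (\<lambda>x. c * f x) y = c * transform M e f y"
  unfolding transform_def by (simp add: mult.assoc)

lemma transform_diff:
  assumes "integrable M f" "integrable M g" "y \<in> space N"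
  shows "transform M e (\<lambda>x. f x - g x) y = transform M e f y - transform M e g y"
  using transform_add[OF assms(1) integrable_mult_right[OF assms(2), of "-1"] assms(3)] transform_cmult[of "-1" g y]
  by simp

end

text \<open>Phrased with nonnegative integrals, the identity also contains the finiteness of the
  left-hand side, and Tonelli carries it over to product kernels.\<close>

locale plancherel_kernel = bounded_kernel M N e
  for M :: "'a measure" and N :: "'b measure" and e +
  assumes plancherel: "integrable M f \<Longrightarrow> sqi M f \<Longrightarrow>
    (\<integral>\<^sup>+y. ennreal ((cmod (transform M e f y))\<^sup>2) \<partial>N) = (\<integral>\<^sup>+x. ennreal ((cmod (f x))\<^sup>2) \<partial>M)"

text \<open>\<open>W n\<close> is a convergence factor in frequency and \<open>K n\<close> the
  summability kernel it produces: Gaussian on the line, Fejer on the circle. Concentration is asked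
  only almost everywhere, since on an interval modelling the circle it fails at the two end points,
  where half of the mass sits near the opposite end.\<close>

locale approx_identity = bounded_kernel M N e
  for M :: "real measure" and N :: "'b measure" and e +
  fixes W :: "nat \<Rightarrow> 'b \<Rightarrow> real" and K :: "nat \<Rightarrow> real \<Rightarrow> real \<Rightarrow> real"
  assumes sets_M [measurable_cong]: "sets M = sets borel"
    and M_fin: "emeasure M {a..b} < \<infinity>"
    and M_atomless: "emeasure M {a} = 0"
    and W_int: "integrable N (W n)" and W_nonneg: "0 \<le> W n y" and W_le_1: "W n y \<le> 1"
    and W_lim: "(\<lambda>n. W n y) \<longlonglongrightarrow> 1"
    and K_eq: "(LINT y|N. of_real (W n y) * (e x y * cnj (e x' y))) = of_real (K n x x')"
    and K_meas: "(\<lambda>p. K n (fst p) (snd p)) \<in> borel_measurable (borel \<Otimes>\<^sub>M borel)"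
    and K_nonneg: "0 \<le> K n x x'"
    and K_sym: "K n x x' = K n x' x"
    and K_int: "integrable M (K n x)" and K_mass: "(LINT x'|M. K n x x') = 1"
    and K_conc: "AE x in M. \<forall>\<delta>>0. (\<lambda>n. LINT x'|M. indicator {x'. \<delta> \<le> \<bar>x' - x\<bar>} x' * K n x x') \<longlonglongrightarrow> 0"
begin

sublocale MM: pair_sigma_finite M M ..

lemma space_M [simp]: "space M = UNIV"
  using sets_eq_imp_space_eq[OF sets_M] by simp

lemma K_measurable [measurable (raw)]:
  assumes [measurable]: "F \<in> borel_measurable L" "G \<in> borel_measurable L"
  shows "(\<lambda>z. K n (F z) (G z)) \<in> borel_measurable L"
proof -
  have "(\<lambda>z. (F z, G z)) \<in> measurable L (borel \<Otimes>\<^sub>M borel)" by measurable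
  from measurable_compose[OF this K_meas] show ?thesis by simp
qed

lemma W_measurable [measurable]: "W n \<in> borel_measurable N"
  using W_int by auto

text \<open>Without \<open>W n\<close> the integral over two copies of \<open>M\<close> and over
  \<open>N\<close> need not converge absolutely. The integrable factor permits Fubini, and the
  frequency integral collapses to \<open>K n\<close>.\<close>

lemma weighted_inner:
  assumes f: "integrable M f" and g: "integrable M g"
  shows "integrable (M \<Otimes>\<^sub>M M) (\<lambda>p. f (fst p) * cnj (g (snd p)) * of_real (K n (fst p) (snd p)))" (is ?I)
    and "(LINT y|N. of_real (W n y) * (transform M e f y * cnj (transform M e g y))) =
      (LINT p|(M \<Otimes>\<^sub>M M). f (fst p) * cnj (g (snd p)) * of_real (K n (fst p) (snd p)))" (is ?E)
proof -
  have [measurable]: "f \<in> borel_measurable M" "g \<in> borel_measurable M" using f g by auto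
  interpret PM: sigma_finite_measure "M \<Otimes>\<^sub>M M"
    by (rule sigma_finite_pair_measure) unfold_locales
  interpret PN: pair_sigma_finite "M \<Otimes>\<^sub>M M" N ..
  let ?h = "\<lambda>p. f (fst p) * cnj (g (snd p))"
  let ?Q = "\<lambda>p y. ?h p * (of_real (W n y) * (e (fst p) y * cnj (e (snd p) y)))"
  have h: "integrable (M \<Otimes>\<^sub>M M) ?h"
    using g by (intro MM.integrable_pair_mult[OF f, of "\<lambda>x. cnj (g x)"]) simp
  have Q: "integrable ((M \<Otimes>\<^sub>M M) \<Otimes>\<^sub>M N) (\<lambda>(p, y). ?Q p y)"
  proof (rule Bochner_Integration.integrable_bound)
    show "integrable ((M \<Otimes>\<^sub>M M) \<Otimes>\<^sub>M N) (\<lambda>q. ?h (fst q) * complex_of_real (W n (snd q)))"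
      by (rule PN.integrable_pair_mult[OF h]) (simp add: W_int)
    show "AE q in (M \<Otimes>\<^sub>M M) \<Otimes>\<^sub>M N. norm (case q of (p, y) \<Rightarrow> ?Q p y) \<le> norm (?h (fst q) * complex_of_real (W n (snd q)))"
    proof (intro AE_I2, clarsimp simp: norm_mult)
      fix a b y
      have "cmod (e a y) * cmod (e b y) \<le> 1" using mult_mono[OF e_bound[of a y] e_bound[of b y]] by simp
      then show "cmod (f a) * cmod (g b) * (\<bar>W n y\<bar> * (cmod (e a y) * cmod (e b y))) \<le> cmod (f a) * cmod (g b) * \<bar>W n y\<bar>"
        by (intro mult_left_mono) (auto intro: mult_left_le)
    qed
  qed measurable
  have "integrable (M \<Otimes>\<^sub>M M) (\<lambda>p. LINT y|N. ?Q p y)"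
    using PN.integrable_fst[OF Q] by simp
  moreover have inner: "(LINT y|N. ?Q p y) = ?h p * of_real (K n (fst p) (snd p))" for p
    by (simp add: K_eq)
  ultimately show ?I by (simp only: inner)
  have "(LINT y|N. (LINT p|(M \<Otimes>\<^sub>M M). ?Q p y)) = (LINT p|(M \<Otimes>\<^sub>M M). ?h p * of_real (K n (fst p) (snd p)))"
    using PN.Fubini_integral[OF Q] by (simp only: inner)
  moreover have "(LINT p|(M \<Otimes>\<^sub>M M). ?Q p y) = of_real (W n y) * (transform M e f y * cnj (transform M e g y))"
    if y: "y \<in> space N" for y
  proof -
    note I1 = integrable_transform[OF f y] and I2 = integrable_transform[OF g y]
    have I3: "integrable (M \<Otimes>\<^sub>M M) (\<lambda>p. (f (fst p) * e (fst p) y) * cnj (g (snd p) * e (snd p) y))"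
      by (intro MM.integrable_pair_mult[OF I1, of "\<lambda>x. cnj (g x * e x y)"] integrable_cnj I2)
    have "(LINT p|(M \<Otimes>\<^sub>M M). (f (fst p) * e (fst p) y) * cnj (g (snd p) * e (snd p) y)) =
        (LINT x|M. LINT x'|M. (f x * e x y) * cnj (g x' * e x' y))"
      using MM.integral_fst'[OF I3] by simp
    also have "\<dots> = (LINT x|M. (f x * e x y) * cnj (LINT x'|M. g x' * e x' y))"
      using Bochner_Integration.integral_cnj[of M "\<lambda>x'. g x' * e x' y"] by (simp only: integral_mult_right_zero)
    also have "\<dots> = (LINT x|M. f x * e x y) * cnj (LINT x'|M. g x' * e x' y)"
      by (rule integral_mult_left_zero)
    finally have "(LINT p|(M \<Otimes>\<^sub>M M). (f (fst p) * e (fst p) y) * cnj (g (snd p) * e (snd p) y)) =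
       transform M e f y * cnj (transform M e g y)" by (simp only: transform_def)
    moreover have "(LINT p|(M \<Otimes>\<^sub>M M). ?Q p y) = (LINT p|(M \<Otimes>\<^sub>M M). of_real (W n y) * ((f (fst p) * e (fst p) y) * cnj (g (snd p) * e (snd p) y)))"
      by (rule Bochner_Integration.integral_cong) (auto simp: mult_ac)
    ultimately show ?thesis by simp
  qed
  ultimately show ?E
    using Bochner_Integration.integral_cong[OF refl, of N "\<lambda>y. LINT p|(M \<Otimes>\<^sub>M M). ?Q p y"
        "\<lambda>y. of_real (W n y) * (transform M e f y * cnj (transform M e g y))"] by simp
qed

lemma K_nn_mass: "(\<integral>\<^sup>+x'. ennreal (K n x x') \<partial>M) = 1"
  using nn_integral_eq_integral[OF K_int, of n x] K_nonneg K_mass by simp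

text \<open>Schur's test: |f(x) f(x')| is at most half of |f(x)|^2 + |f(x')|^2, and
  \<open>K n\<close> is symmetric with mass one in either variable.\<close>

lemma transform_weighted_bound:
  assumes f: "integrable M f" "sqi M f"
  shows "(\<integral>\<^sup>+y. ennreal (W n y * (cmod (transform M e f y))\<^sup>2) \<partial>N) \<le> (\<integral>\<^sup>+x. ennreal ((cmod (f x))\<^sup>2) \<partial>M)"
proof -
  have [measurable]: "f \<in> borel_measurable M" using f by auto
  define C where "C = (LINT x|M. cmod (f x))"
  have i: "integrable N (\<lambda>y. W n y * (cmod (transform M e f y))\<^sup>2)"
  proof (rule Bochner_Integration.integrable_bound)
    show "integrable N (\<lambda>y. W n y * C\<^sup>2)" using W_int by simp
    show "AE y in N. norm (W n y * (cmod (transform M e f y))\<^sup>2) \<le> norm (W n y * C\<^sup>2)"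
      using transform_bound[OF f(1)]
      by (auto simp: abs_mult C_def intro!: mult_left_mono power_mono)
  qed measurable
  let ?k = "\<lambda>p. f (fst p) * cnj (f (snd p)) * of_real (K n (fst p) (snd p))"
  have "complex_of_real (LINT y|N. W n y * (cmod (transform M e f y))\<^sup>2) =
     (LINT y|N. of_real (W n y) * (transform M e f y * cnj (transform M e f y)))"
    by (subst integral_complex_of_real[symmetric]) (simp only: of_real_mult complex_norm_square)
  also have "\<dots> = (LINT p|(M \<Otimes>\<^sub>M M). ?k p)"
    by (rule weighted_inner(2)[OF f(1) f(1)])
  finally have eq: "complex_of_real (LINT y|N. W n y * (cmod (transform M e f y))\<^sup>2) = (LINT p|(M \<Otimes>\<^sub>M M). ?k p)" .
  have "(LINT y|N. W n y * (cmod (transform M e f y))\<^sup>2) \<le> cmod (LINT p|(M \<Otimes>\<^sub>M M). ?k p)"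
    unfolding eq[symmetric] by simp
  also have "\<dots> \<le> (LINT p|(M \<Otimes>\<^sub>M M). cmod (?k p))"
    by (rule integral_norm_bound)
  finally have "(\<integral>\<^sup>+y. ennreal (W n y * (cmod (transform M e f y))\<^sup>2) \<partial>N) \<le> ennreal (LINT p|(M \<Otimes>\<^sub>M M). cmod (?k p))"
    using W_nonneg by (subst nn_integral_eq_integral[OF i]) (auto simp: ennreal_leI)
  also have "\<dots> = (\<integral>\<^sup>+p. ennreal (cmod (?k p)) \<partial>(M \<Otimes>\<^sub>M M))"
    using weighted_inner(1)[OF f(1) f(1)] by (subst nn_integral_eq_integral) auto
  also have "\<dots> \<le> (\<integral>\<^sup>+p. (ennreal ((cmod (f (fst p)))\<^sup>2 / 2) * ennreal (K n (fst p) (snd p)) +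
        ennreal ((cmod (f (snd p)))\<^sup>2 / 2) * ennreal (K n (fst p) (snd p))) \<partial>(M \<Otimes>\<^sub>M M))"
  proof (rule nn_integral_mono)
    fix p :: "real \<times> real"
    have "cmod (f (fst p)) * cmod (f (snd p)) \<le> (cmod (f (fst p)))\<^sup>2 / 2 + (cmod (f (snd p)))\<^sup>2 / 2"
      using sum_squares_bound[of "cmod (f (fst p))" "cmod (f (snd p))"] by simp
    then have "cmod (?k p) \<le> ((cmod (f (fst p)))\<^sup>2 / 2 + (cmod (f (snd p)))\<^sup>2 / 2) * K n (fst p) (snd p)"
      using K_nonneg by (auto simp: norm_mult intro!: mult_right_mono)
    then show "ennreal (cmod (?k p)) \<le> ennreal ((cmod (f (fst p)))\<^sup>2 / 2) * ennreal (K n (fst p) (snd p)) +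
        ennreal ((cmod (f (snd p)))\<^sup>2 / 2) * ennreal (K n (fst p) (snd p))"
      using K_nonneg by (simp add: ennreal_mult'[symmetric] ennreal_plus[symmetric] distrib_right ennreal_leI del: ennreal_plus)
  qed
  also have "\<dots> = (\<integral>\<^sup>+p. ennreal ((cmod (f (fst p)))\<^sup>2 / 2) * ennreal (K n (fst p) (snd p)) \<partial>(M \<Otimes>\<^sub>M M)) +
       (\<integral>\<^sup>+p. ennreal ((cmod (f (snd p)))\<^sup>2 / 2) * ennreal (K n (fst p) (snd p)) \<partial>(M \<Otimes>\<^sub>M M))"
    by (rule nn_integral_add) measurable
  also have "(\<integral>\<^sup>+p. ennreal ((cmod (f (fst p)))\<^sup>2 / 2) * ennreal (K n (fst p) (snd p)) \<partial>(M \<Otimes>\<^sub>M M)) =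
     (\<integral>\<^sup>+x. \<integral>\<^sup>+x'. ennreal ((cmod (f x))\<^sup>2 / 2) * ennreal (K n x x') \<partial>M \<partial>M)"
    by (subst M.nn_integral_fst[symmetric]) auto
  also have "\<dots> = (\<integral>\<^sup>+x. ennreal ((cmod (f x))\<^sup>2 / 2) \<partial>M)"
    by (subst nn_integral_cmult) (auto simp: K_nn_mass)
  also have "(\<integral>\<^sup>+p. ennreal ((cmod (f (snd p)))\<^sup>2 / 2) * ennreal (K n (fst p) (snd p)) \<partial>(M \<Otimes>\<^sub>M M)) =
     (\<integral>\<^sup>+x'. \<integral>\<^sup>+x. ennreal ((cmod (f x'))\<^sup>2 / 2) * ennreal (K n x' x) \<partial>M \<partial>M)"
    by (subst MM.nn_integral_snd[symmetric]) (auto simp: K_sym)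
  also have "\<dots> = (\<integral>\<^sup>+x. ennreal ((cmod (f x))\<^sup>2 / 2) \<partial>M)"
    by (subst nn_integral_cmult) (auto simp: K_nn_mass)
  also have "(\<integral>\<^sup>+x. ennreal ((cmod (f x))\<^sup>2 / 2) \<partial>M) + (\<integral>\<^sup>+x. ennreal ((cmod (f x))\<^sup>2 / 2) \<partial>M) =
     (\<integral>\<^sup>+x. ennreal ((cmod (f x))\<^sup>2) \<partial>M)"
    by (subst nn_integral_add[symmetric]) (auto simp: ennreal_plus[symmetric] simp del: ennreal_plus)
  finally show ?thesis .
qed

text \<open>The factors \<open>W n\<close> tend to 1, so Fatou's lemma removes them. This yields an
  inequality only; equality comes from approximating the second argument of the inner
  product.\<close>

lemma bessel_nn:
  assumes f: "integrable M f" "sqi M f"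
  shows "(\<integral>\<^sup>+y. ennreal ((cmod (transform M e f y))\<^sup>2) \<partial>N) \<le> (\<integral>\<^sup>+x. ennreal ((cmod (f x))\<^sup>2) \<partial>M)"
proof -
  have [measurable]: "f \<in> borel_measurable M" using f by auto
  have "(\<integral>\<^sup>+y. ennreal ((cmod (transform M e f y))\<^sup>2) \<partial>N) =
      (\<integral>\<^sup>+y. liminf (\<lambda>n. ennreal (W n y * (cmod (transform M e f y))\<^sup>2)) \<partial>N)"
  proof (rule nn_integral_cong)
    fix y
    have "(\<lambda>n. ennreal (W n y * (cmod (transform M e f y))\<^sup>2)) \<longlonglongrightarrow> ennreal (1 * (cmod (transform M e f y))\<^sup>2)"
      by (intro tendsto_ennrealI tendsto_intros W_lim)
    then show "ennreal ((cmod (transform M e f y))\<^sup>2) = liminf (\<lambda>n. ennreal (W n y * (cmod (transform M e f y))\<^sup>2))"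
      by (intro lim_imp_Liminf[symmetric]) auto
  qed
  also have "\<dots> \<le> liminf (\<lambda>n. \<integral>\<^sup>+y. ennreal (W n y * (cmod (transform M e f y))\<^sup>2) \<partial>N)"
    by (rule nn_integral_liminf) measurable
  also have "\<dots> \<le> (\<integral>\<^sup>+x. ennreal ((cmod (f x))\<^sup>2) \<partial>M)"
    by (rule Liminf_le) (auto simp: transform_weighted_bound[OF f])
  finally show ?thesis .
qed

lemma bessel:
  assumes f: "integrable M f" "sqi M f"
  shows "sqi N (transform M e f)" "norm2 N (transform M e f) \<le> norm2 M f"
proof -
  have [measurable]: "f \<in> borel_measurable M" using f by auto
  have le: "(\<integral>\<^sup>+y. ennreal ((cmod (transform M e f y))\<^sup>2) \<partial>N) \<le> ennreal ((norm2 M f)\<^sup>2)"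
    using bessel_nn[OF f] nn_norm2[OF f(2)] by simp
  then show *: "sqi N (transform M e f)"
    by (intro sqi_nnI) (auto intro: le_less_trans)
  from le have "(norm2 N (transform M e f))\<^sup>2 \<le> (norm2 M f)\<^sup>2"
    by (simp add: nn_norm2[OF *])
  then show "norm2 N (transform M e f) \<le> norm2 M f" by (rule power2_le_imp_le) simp
qed

text \<open>Integrability of \<open>g\<close> is part of the predicate so that, for a fixed
  \<open>f\<close>, the admissible \<open>g\<close> are closed under linear combinations and under
  those limits in norm that are again integrable.\<close>

definition parseval :: "(real \<Rightarrow> complex) \<Rightarrow> (real \<Rightarrow> complex) \<Rightarrow> bool" where
  "parseval f g \<longleftrightarrow> integrable M g \<and> sqi M g \<and>
     (LINT y|N. transform M e f y * cnj (transform M e g y)) = (LINT x|M. f x * cnj (g x))"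

lemma parseval_add:
  assumes f: "integrable M f" "sqi M f" and "parseval f g" "parseval f h"
  shows "parseval f (\<lambda>x. g x + h x)"
proof -
  have g: "integrable M g" "sqi M g" and h: "integrable M h" "sqi M h" using assms by (auto simp: parseval_def)
  have "(LINT y|N. transform M e f y * cnj (transform M e (\<lambda>x. g x + h x) y)) =
     (LINT y|N. transform M e f y * cnj (transform M e g y) + transform M e f y * cnj (transform M e h y))"
    by (rule Bochner_Integration.integral_cong) (auto simp: transform_add[OF g(1) h(1)] distrib_left)
  also have "\<dots> = (LINT x|M. f x * cnj (g x)) + (LINT x|M. f x * cnj (h x))"
    using assms by (subst Bochner_Integration.integral_add)
      (auto intro!: sqi_integrable_mult sqi_cnj bessel g h simp: parseval_def)
  also have "\<dots> = (LINT x|M. f x * cnj (g x + h x))"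
    by (subst Bochner_Integration.integral_add[symmetric])
      (auto intro!: sqi_integrable_mult sqi_cnj f g h simp: distrib_left)
  finally show ?thesis using g h by (auto simp: parseval_def intro: sqi_add)
qed

lemma parseval_cmult:
  assumes "parseval f g"
  shows "parseval f (\<lambda>x. c * g x)"
  using assms by (auto simp: parseval_def transform_cmult sqi_cmult mult.left_commute[of _ "cnj c"])

lemma parseval_0: "parseval f (\<lambda>x. 0)"
  by (simp add: parseval_def transform_def)

lemma parseval_sum:
  assumes f: "integrable M f" "sqi M f" and "finite I" "\<And>i. i \<in> I \<Longrightarrow> parseval f (g i)"
  shows "parseval f (\<lambda>x. \<Sum>i\<in>I. g i x)"
  using assms(3,4) by (induction I rule: finite_induct) (auto intro: parseval_add f parseval_0)

text \<open>Bessel's inequality makes both sides of the identity continuous in the second argument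
  with respect to the norm.\<close>

lemma parseval_lim:
  assumes f: "integrable M f" "sqi M f" and g: "\<And>n. parseval f (g n)"
    and h: "integrable M h" "sqi M h" and lim: "(\<lambda>n. norm2 M (\<lambda>x. g n x - h x)) \<longlonglongrightarrow> 0"
  shows "parseval f h"
proof -
  have g': "integrable M (g n)" "sqi M (g n)" for n using g by (auto simp: parseval_def)
  have d: "integrable M (\<lambda>x. g n x - h x)" "sqi M (\<lambda>x. g n x - h x)" for n
    using g'[of n] h by (auto intro: sqi_diff)
  have l0: "(\<lambda>n. norm2 M f * norm2 M (\<lambda>x. g n x - h x)) \<longlonglongrightarrow> 0"
    using tendsto_mult_right_zero[OF lim] by (simp add: mult.commute)
  have "(\<lambda>n. (LINT y|N. transform M e f y * cnj (transform M e (g n) y)) - (LINT y|N. transform M e f y * cnj (transform M e h y))) \<longlonglongrightarrow> 0"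
  proof (rule Lim_null_comparison[OF always_eventually[OF allI] l0])
    fix n
    have "(LINT y|N. transform M e f y * cnj (transform M e (g n) y)) - (LINT y|N. transform M e f y * cnj (transform M e h y))
      = (LINT y|N. transform M e f y * cnj (transform M e (g n) y) - transform M e f y * cnj (transform M e h y))"
      by (subst Bochner_Integration.integral_diff) (auto intro!: sqi_integrable_mult sqi_cnj bessel f g' h)
    also have "\<dots> = (LINT y|N. transform M e f y * cnj (transform M e (\<lambda>x. g n x - h x) y))"
      by (rule Bochner_Integration.integral_cong) (auto simp: transform_diff[OF g'(1) h(1)] right_diff_distrib)
    also have "cmod \<dots> \<le> norm2 N (transform M e f) * norm2 N (\<lambda>y. cnj (transform M e (\<lambda>x. g n x - h x) y))"
      by (intro norm2_inner_bound sqi_cnj bessel f d)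
    also have "norm2 N (\<lambda>y. cnj (transform M e (\<lambda>x. g n x - h x) y)) = norm2 N (transform M e (\<lambda>x. g n x - h x))"
      by (simp add: norm2_def)
    also have "norm2 N (transform M e f) * \<dots> \<le> norm2 M f * norm2 M (\<lambda>x. g n x - h x)"
      by (intro mult_mono bessel f d) auto
    finally show "norm ((LINT y|N. transform M e f y * cnj (transform M e (g n) y)) - (LINT y|N. transform M e f y * cnj (transform M e h y)))
       \<le> norm2 M f * norm2 M (\<lambda>x. g n x - h x)" .
  qed
  then have 1: "(\<lambda>n. (LINT y|N. transform M e f y * cnj (transform M e (g n) y))) \<longlonglongrightarrow> (LINT y|N. transform M e f y * cnj (transform M e h y))"
    by (simp add: LIM_zero_iff)
  have "(\<lambda>n. (LINT x|M. f x * cnj (g n x)) - (LINT x|M. f x * cnj (h x))) \<longlonglongrightarrow> 0"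
  proof (rule Lim_null_comparison[OF always_eventually[OF allI] l0])
    fix n
    have "(LINT x|M. f x * cnj (g n x)) - (LINT x|M. f x * cnj (h x)) = (LINT x|M. f x * cnj (g n x - h x))"
      by (subst Bochner_Integration.integral_diff[symmetric])
        (auto intro!: sqi_integrable_mult sqi_cnj f g' h simp: right_diff_distrib)
    also have "cmod \<dots> \<le> norm2 M f * norm2 M (\<lambda>x. cnj (g n x - h x))"
      by (intro norm2_inner_bound f sqi_cnj d)
    also have "norm2 M (\<lambda>x. cnj (g n x - h x)) = norm2 M (\<lambda>x. g n x - h x)"
      unfolding norm2_def by (simp only: complex_mod_cnj)
    finally show "norm ((LINT x|M. f x * cnj (g n x)) - (LINT x|M. f x * cnj (h x))) \<le> norm2 M f * norm2 M (\<lambda>x. g n x - h x)" .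
  qed
  then have 2: "(\<lambda>n. LINT x|M. f x * cnj (g n x)) \<longlonglongrightarrow> (LINT x|M. f x * cnj (h x))"
    by (simp add: LIM_zero_iff)
  show ?thesis
    using LIMSEQ_unique[OF 1] 2 g h unfolding parseval_def by simp
qed

lemma bounded_support_indicator:
  assumes "A \<in> sets borel" "A \<subseteq> {a..b}"
  shows "integrable M (indicator A :: real \<Rightarrow> complex)" "sqi M (indicator A)"
proof -
  have "emeasure M A \<le> emeasure M {a..b}"
    using assms by (intro emeasure_mono) (auto simp: sets_M)
  then have fin: "emeasure M A < \<infinity>" using M_fin[of a b] by (auto intro: le_less_trans)
  have r: "integrable M (indicator A :: real \<Rightarrow> real)"
    using assms fin by (intro integrable_real_indicator) (auto simp: sets_M)
  have "(indicator A :: real \<Rightarrow> complex) = (\<lambda>x. of_real (indicator A x))"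
    by (simp add: fun_eq_iff indicator_def)
  then show "integrable M (indicator A :: real \<Rightarrow> complex)" using r by simp
  note r
  moreover have "(cmod (indicator A x))\<^sup>2 = indicator A x" for x by (simp split: split_indicator)
  ultimately show "sqi M (indicator A)"
    using assms by (simp add: sqi_def sets_M)
qed

text \<open>Off the two end points, \<open>x\<close> has positive distance either to the interval or
  to its complement, so the kernel mass on the wrong side is far from \<open>x\<close> and vanishes.
  Atomlessness discards the end points.\<close>

lemma kernel_indicator_limit:
  "AE x in M. (\<lambda>n. LINT x'|M. indicator {a..b} x' * K n x x') \<longlonglongrightarrow> indicator {a..b} x"
proof -
  have "AE x in M. x \<noteq> a" "AE x in M. x \<noteq> b"
    by (rule AE_I[where N = "{a}"], use M_atomless in \<open>auto simp: sets_M\<close>)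
      (rule AE_I[where N = "{b}"], use M_atomless in \<open>auto simp: sets_M\<close>)
  with K_conc show ?thesis
  proof eventually_elim
    case (elim x)
    define far where "far \<delta> = {x'. \<delta> \<le> \<bar>x' - x\<bar>}" for \<delta>
    have far: "far \<delta> \<in> sets borel" for \<delta> unfolding far_def by measurable
    note [measurable] = far
    have I: "integrable M (\<lambda>x'. indicator A x' * K n x x')" if "A \<in> sets borel" for A n
      using integrable_real_mult_indicator[of A M "K n x"] that K_int by (simp add: sets_M mult.commute)
    have lim: "(\<lambda>n. LINT x'|M. indicator (far \<delta>) x' * K n x x') \<longlonglongrightarrow> 0" if "\<delta> > 0" for \<delta>
      using elim that by (simp add: far_def)
    have small: "(\<lambda>n. LINT x'|M. indicator A x' * K n x x') \<longlonglongrightarrow> 0"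
      if "\<delta> > 0" "A \<in> sets borel" "A \<subseteq> far \<delta>" for A \<delta>
    proof (rule real_tendsto_sandwich[OF _ _ tendsto_const lim[OF that(1)]])
      show "\<forall>\<^sub>F n in sequentially. 0 \<le> (LINT x'|M. indicator A x' * K n x x')"
        using K_nonneg by (intro always_eventually allI integral_nonneg_AE) auto
      show "\<forall>\<^sub>F n in sequentially. (LINT x'|M. indicator A x' * K n x x') \<le> (LINT x'|M. indicator (far \<delta>) x' * K n x x')"
        using K_nonneg that by (intro always_eventually allI integral_mono I) (auto split: split_indicator)
    qed
    show ?case
    proof (cases "a < x \<and> x < b")
      case True
      have "(\<lambda>n. LINT x'|M. indicator (- {a..b}) x' * K n x x') \<longlonglongrightarrow> 0"
        using True by (intro small[of "min (x - a) (b - x)"]) (auto simp: far_def)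
      then have "(\<lambda>n. 1 - (LINT x'|M. indicator (- {a..b}) x' * K n x x')) \<longlonglongrightarrow> 1 - 0"
        by (intro tendsto_intros)
      moreover have "1 - (LINT x'|M. indicator (- {a..b}) x' * K n x x') = (LINT x'|M. indicator {a..b} x' * K n x x')" for n
      proof -
        have "(LINT x'|M. K n x x') = (LINT x'|M. indicator {a..b} x' * K n x x' + indicator (- {a..b}) x' * K n x x')"
          by (rule Bochner_Integration.integral_cong) (auto split: split_indicator)
        also have "\<dots> = (LINT x'|M. indicator {a..b} x' * K n x x') + (LINT x'|M. indicator (- {a..b}) x' * K n x x')"
          by (intro Bochner_Integration.integral_add I) auto
        finally show ?thesis by (simp add: K_mass)
      qed
      ultimately show ?thesis using True by simp
    next
      case False
      then have "x < a \<or> b < x" using elim by auto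
      then have "(\<lambda>n. LINT x'|M. indicator {a..b} x' * K n x x') \<longlonglongrightarrow> 0"
      proof
        assume "x < a" then show ?thesis by (intro small[of "a - x"]) (auto simp: far_def)
      next
        assume "b < x" then show ?thesis by (intro small[of "x - b"]) (auto simp: far_def)
      qed
      then show ?thesis using False elim by (auto simp: indicator_def)
    qed
  qed
qed

text \<open>The average by \<open>K n\<close> is put on the indicator rather than on
  \<open>f\<close>: it is bounded by 1, so |f| dominates, and pointwise convergence is required for
  intervals only.\<close>

lemma parseval_interval:
  assumes f: "integrable M f" "sqi M f"
  shows "parseval f (indicator {a..b})"
proof -
  have [measurable]: "f \<in> borel_measurable M" using f by auto
  let ?g = "indicator {a..b} :: real \<Rightarrow> complex"
  have g: "integrable M ?g" "sqi M ?g" using bounded_support_indicator[of "{a..b}" a b] by auto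
  have "(\<lambda>n. LINT y|N. of_real (W n y) * (transform M e f y * cnj (transform M e ?g y))) \<longlonglongrightarrow>
     (LINT y|N. transform M e f y * cnj (transform M e ?g y))"
  proof (rule integral_dominated_convergence[where w = "\<lambda>y. cmod (transform M e f y * cnj (transform M e ?g y))"])
    have "(\<lambda>n. of_real (W n y) * (transform M e f y * cnj (transform M e ?g y))) \<longlonglongrightarrow>
       of_real 1 * (transform M e f y * cnj (transform M e ?g y))" for y
      by (intro tendsto_intros W_lim)
    then show "AE y in N. (\<lambda>n. of_real (W n y) * (transform M e f y * cnj (transform M e ?g y))) \<longlonglongrightarrow>
       transform M e f y * cnj (transform M e ?g y)" by simp
    show "integrable N (\<lambda>y. cmod (transform M e f y * cnj (transform M e ?g y)))"
      by (intro integrable_norm sqi_integrable_mult sqi_cnj bessel f g)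
    show "AE y in N. cmod (of_real (W n y) * (transform M e f y * cnj (transform M e ?g y))) \<le> cmod (transform M e f y * cnj (transform M e ?g y))" for n
      using W_nonneg[of n] W_le_1[of n] by (auto simp: norm_mult intro!: mult_left_le_one_le)
  qed (use f g in measurable)
  moreover have "(LINT y|N. of_real (W n y) * (transform M e f y * cnj (transform M e ?g y))) =
     (LINT x|M. f x * of_real (LINT x'|M. indicator {a..b} x' * K n x x'))" for n
  proof -
    have "(LINT y|N. of_real (W n y) * (transform M e f y * cnj (transform M e ?g y))) =
       (LINT x|M. LINT x'|M. f x * cnj (?g x') * of_real (K n x x'))"
      using weighted_inner(2)[OF f(1) g(1), of n] MM.integral_fst'[OF weighted_inner(1)[OF f(1) g(1), of n]] by simp
    also have "\<dots> = (LINT x|M. LINT x'|M. f x * of_real (indicator {a..b} x' * K n x x'))"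
      by (intro Bochner_Integration.integral_cong) (auto split: split_indicator)
    also have "\<dots> = (LINT x|M. f x * of_real (LINT x'|M. indicator {a..b} x' * K n x x'))"
      by (subst integral_mult_right_zero, subst integral_complex_of_real) simp
    finally show ?thesis .
  qed
  moreover have "(\<lambda>n. LINT x|M. f x * of_real (LINT x'|M. indicator {a..b} x' * K n x x')) \<longlonglongrightarrow> (LINT x|M. f x * cnj (?g x))"
  proof (rule integral_dominated_convergence[where w = "\<lambda>x. cmod (f x)"])
    show "AE x in M. (\<lambda>n. f x * of_real (LINT x'|M. indicator {a..b} x' * K n x x')) \<longlonglongrightarrow> f x * cnj (?g x)"
      using kernel_indicator_limit[of a b]
    proof eventually_elim
      case (elim x)
      have "(\<lambda>n. f x * of_real (LINT x'|M. indicator {a..b} x' * K n x x')) \<longlonglongrightarrow> f x * of_real (indicator {a..b} x)"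
        by (intro tendsto_intros elim)
      moreover have "complex_of_real (indicator {a..b} x) = cnj (?g x)" by (simp split: split_indicator)
      ultimately show ?case by (simp only:)
    qed
    show "AE x in M. cmod (f x * of_real (LINT x'|M. indicator {a..b} x' * K n x x')) \<le> cmod (f x)" for n
    proof (rule AE_I2)
      fix x
      have "0 \<le> (LINT x'|M. indicator {a..b} x' * K n x x')"
        using K_nonneg by (intro integral_nonneg_AE) auto
      moreover have "(LINT x'|M. indicator {a..b} x' * K n x x') \<le> (LINT x'|M. K n x x')"
        using integrable_real_mult_indicator[of "{a..b}" M "K n x"] K_int K_nonneg
        by (intro integral_mono) (auto simp: sets_M mult.commute split: split_indicator)
      ultimately show "cmod (f x * of_real (LINT x'|M. indicator {a..b} x' * K n x x')) \<le> cmod (f x)"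
        by (simp add: norm_mult K_mass mult_left_le)
    qed
    show "integrable M (\<lambda>x. cmod (f x))" using f(1) by (rule integrable_norm)
  qed measurable
  ultimately show ?thesis using g LIMSEQ_unique unfolding parseval_def by auto
qed

text \<open>Dynkin's argument over the intersection-stable family of closed intervals. Intersecting
  with {-a..a} keeps the indicators of complements integrable.\<close>

lemma parseval_borel:
  assumes f: "integrable M f" "sqi M f" and A: "A \<in> sets borel"
  shows "parseval f (indicator (A \<inter> {- a..a}))"
proof -
  define G where "G = range (\<lambda>(l, u). {l..u :: real})"
  have borel: "sets borel = sigma_sets UNIV G"
    unfolding G_def by (subst borel_eq_atLeastAtMost) (auto intro!: sets_measure_of)
  have "Int_stable G" unfolding G_def Int_stable_def by (auto simp: image_iff)
  moreover have "G \<subseteq> Pow UNIV" by simp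
  moreover have "A \<in> sigma_sets UNIV G" using A borel by simp
  ultimately show ?thesis
  proof (induction rule: sigma_sets_induct_disjoint)
    case (basic A)
    then obtain l u where "A = {l..u}" by (auto simp: G_def)
    then have "A \<inter> {-a..a} = {max l (-a)..min u a}" by auto
    then show ?case using parseval_interval[OF f] by simp
  next
    case empty
    show ?case using parseval_0[of f] by (simp add: indicator_def)
  next
    case (compl A)
    have "parseval f (\<lambda>x. indicator {-a..a} x + (-1) * indicator (A \<inter> {-a..a}) x)"
      by (intro parseval_add f parseval_interval parseval_cmult compl)
    moreover have "(\<lambda>x. indicator {-a..a} x + (-1) * indicator (A \<inter> {-a..a}) x) = (indicator ((UNIV - A) \<inter> {-a..a}) :: real \<Rightarrow> complex)"
      by (auto simp: fun_eq_iff split: split_indicator)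
    ultimately show ?case by simp
  next
    case (union A)
    have A: "A i \<in> sets borel" for i using union(2) borel by auto
    have *: "(\<lambda>x. \<Sum>i<n. indicator (A i \<inter> {-a..a}) x) = (indicator ((\<Union>i<n. A i) \<inter> {-a..a}) :: real \<Rightarrow> complex)" for n
    proof (induction n)
      case (Suc n)
      have "x \<in> A n \<Longrightarrow> x \<notin> (\<Union>i<n. A i)" for x
      proof
        assume x: "x \<in> A n" "x \<in> (\<Union>i<n. A i)"
        then obtain i where "i < n" "x \<in> A i" by auto
        moreover from this have "A i \<inter> A n = {}" using union(1) by (auto simp: disjoint_family_on_def)
        ultimately show False using x by blast
      qed
      then have "indicator ((\<Union>i<n. A i) \<inter> {-a..a}) x + indicator (A n \<inter> {-a..a}) x =
          (indicator ((\<Union>i<Suc n. A i) \<inter> {-a..a}) x :: complex)" for x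
        by (auto simp: indicator_def less_Suc_eq)
      then show ?case by (simp only: sum.lessThan_Suc fun_cong[OF Suc.IH])
    qed (simp add: indicator_def)
    have n: "parseval f (indicator ((\<Union>i<n. A i) \<inter> {-a..a}))" for n
      unfolding *[symmetric] by (intro parseval_sum f union) auto
    show ?case
    proof (rule parseval_lim[OF f n])
      show "integrable M (indicator (\<Union> (range A) \<inter> {-a..a}) :: real \<Rightarrow> complex)" "sqi M (indicator (\<Union> (range A) \<inter> {-a..a}))"
        using A by (intro bounded_support_indicator[of _ "-a" a]; auto)+
      show "(\<lambda>n. norm2 M (\<lambda>x. indicator ((\<Union>i<n. A i) \<inter> {-a..a}) x - indicator (\<Union> (range A) \<inter> {-a..a}) x)) \<longlonglongrightarrow> 0"
      proof (rule norm2_tendsto_0_dominated)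
        show "sqi M (indicator {-a..a})" using bounded_support_indicator[of "{-a..a}" "-a" a] by auto
        show "AE x in M. (\<lambda>n. indicator ((\<Union>i<n. A i) \<inter> {-a..a}) x - indicator (\<Union> (range A) \<inter> {-a..a}) x :: complex) \<longlonglongrightarrow> 0"
        proof (rule AE_I2)
          fix x
          have "\<forall>\<^sub>F n in sequentially. indicator ((\<Union>i<n. A i) \<inter> {-a..a}) x - indicator (\<Union> (range A) \<inter> {-a..a}) x = (0::complex)"
          proof (cases "x \<in> \<Union> (range A)")
            case True
            then obtain k where "x \<in> A k" by auto
            then have "\<forall>n\<ge>Suc k. x \<in> (\<Union>i<n. A i)" by (auto intro!: bexI[of _ k])
            then show ?thesis using True by (intro eventually_sequentiallyI[of "Suc k"]) (auto simp: indicator_def)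
          qed (auto simp: indicator_def)
          then show "(\<lambda>n. indicator ((\<Union>i<n. A i) \<inter> {-a..a}) x - indicator (\<Union> (range A) \<inter> {-a..a}) x :: complex) \<longlonglongrightarrow> 0"
            by (rule tendsto_eventually)
        qed
      qed (use A in \<open>auto simp: sets_M split: split_indicator intro!: measurable_compose[OF _ borel_measurable_cnj]\<close>)
    qed
  qed
qed

text \<open>Simple functions cut to bounded intervals are finite combinations of the indicators of
  \<open>parseval_borel\<close>. They are bounded by 2|g|, so 3|g| dominates the error of
  approximation.\<close>

theorem plancherel_parseval:
  assumes f: "integrable M f" "sqi M f" and g: "integrable M g" "sqi M g"
  shows "parseval f g"
proof -
  have [measurable]: "g \<in> borel_measurable M" using g by auto
  obtain F where F: "\<And>i. simple_function M (F i)" "\<And>x. x \<in> space M \<Longrightarrow> (\<lambda>i. F i x) \<longlonglongrightarrow> g x"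
      "\<And>i x. x \<in> space M \<Longrightarrow> dist (F i x) 0 \<le> 2 * dist (g x) 0"
    using borel_measurable_implies_sequence_metric[of g M 0] by auto
  have [measurable]: "F i \<in> borel_measurable M" for i using F(1) by (rule borel_measurable_simple_function)
  define h where "h i x = F i x * indicator {- real i..real i} x" for i x
  have h: "parseval f (h i)" for i
  proof -
    have fin: "finite (range (F i))" using simple_functionD(1)[OF F(1)[of i]] by simp
    have s: "F i -` {c} \<in> sets borel" for c
      using simple_functionD(2)[OF F(1)[of i], of "{c}"] by (simp add: sets_M)
    have "parseval f (\<lambda>x. \<Sum>c\<in>range (F i). c * indicator (F i -` {c} \<inter> {- real i..real i}) x)"
      by (intro parseval_sum f fin parseval_cmult parseval_borel s)
    moreover have "(\<Sum>c\<in>range (F i). c * indicator (F i -` {c} \<inter> {- real i..real i}) x) = h i x" for x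
    proof -
      have "(\<Sum>c\<in>range (F i). c * indicator (F i -` {c} \<inter> {- real i..real i}) x) =
         (\<Sum>c\<in>range (F i). if c = F i x then h i x else 0)"
        by (intro sum.cong) (auto simp: h_def indicator_def)
      also have "\<dots> = h i x" using fin by simp
      finally show ?thesis .
    qed
    ultimately show ?thesis by simp
  qed
  show ?thesis
  proof (rule parseval_lim[OF f h g], rule norm2_tendsto_0_dominated)
    show "sqi M (\<lambda>x. 3 * g x)" using g by (intro sqi_cmult)
    show "AE x in M. cmod (h i x - g x) \<le> cmod (3 * g x)" for i
    proof (rule AE_I2)
      fix x
      have "cmod (h i x) \<le> 2 * cmod (g x)" using F(3)[of x i] by (auto simp: h_def norm_mult split: split_indicator)
      then show "cmod (h i x - g x) \<le> cmod (3 * g x)"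
        using norm_triangle_ineq4[of "h i x" "g x"] by (simp add: norm_mult)
    qed
    show "AE x in M. (\<lambda>i. h i x - g x) \<longlonglongrightarrow> 0"
    proof (rule AE_I2)
      fix x
      have "(\<lambda>i. indicator {- real i..real i} x :: complex) \<longlonglongrightarrow> 1"
      proof (rule tendsto_eventually)
        obtain k :: nat where "\<bar>x\<bar> \<le> real k" using real_arch_simple by blast
        then show "\<forall>\<^sub>F i in sequentially. indicator {- real i..real i} x = (1::complex)"
          by (intro eventually_sequentiallyI[of k]) (auto simp: indicator_def)
      qed
      then have "(\<lambda>i. h i x - g x) \<longlonglongrightarrow> g x * 1 - g x"
        unfolding h_def using F(2)[of x] by (intro tendsto_intros) auto
      then show "(\<lambda>i. h i x - g x) \<longlonglongrightarrow> 0" by simp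
    qed
  qed (simp add: h_def)
qed

theorem plancherel_nn:
  assumes "integrable M f" "sqi M f"
  shows "(\<integral>\<^sup>+y. ennreal ((cmod (transform M e f y))\<^sup>2) \<partial>N) = (\<integral>\<^sup>+x. ennreal ((cmod (f x))\<^sup>2) \<partial>M)"
proof -
  have "complex_of_real ((norm2 N (transform M e f))\<^sup>2) = complex_of_real ((norm2 M f)\<^sup>2)"
    using plancherel_parseval[OF assms assms] unfolding parseval_def norm2_sq
    by (simp flip: complex_norm_square integral_complex_of_real)
  then have "(norm2 N (transform M e f))\<^sup>2 = (norm2 M f)\<^sup>2" by (simp only: of_real_eq_iff)
  then show ?thesis using nn_norm2[OF assms(2)] nn_norm2[OF bessel(1)[OF assms]] by simp
qed

end

sublocale approx_identity \<subseteq> plancherel_kernel M N e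
  by unfold_locales (rule plancherel_nn)

text \<open>One variable is transformed at a time. The half-transformed \<open>g y\<close> must
  again be in L1 and L2 for almost every \<open>y\<close>: L2 follows from the first Plancherel
  identity and Tonelli, L1 from bounding a transform by the L1 norm.\<close>

lemma plancherel_kernel_pair:
  assumes "plancherel_kernel M N e" "plancherel_kernel M' N' e'"
  shows "plancherel_kernel (M \<Otimes>\<^sub>M M') (N \<Otimes>\<^sub>M N') (\<lambda>p q. e (fst p) (fst q) * e' (snd p) (snd q))"
proof -
  interpret A: plancherel_kernel M N e by fact
  interpret B: plancherel_kernel M' N' e' by fact
  interpret MM: pair_sigma_finite M M' ..
  interpret NN: pair_sigma_finite N N' ..
  interpret NM: pair_sigma_finite N M' ..
  interpret P: sigma_finite_measure "M \<Otimes>\<^sub>M M'" by (rule sigma_finite_pair_measure) unfold_locales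
  interpret Q: sigma_finite_measure "N \<Otimes>\<^sub>M N'" by (rule sigma_finite_pair_measure) unfold_locales
  let ?E = "\<lambda>p q. e (fst p) (fst q) * e' (snd p) (snd q)"
  interpret E: bounded_kernel "M \<Otimes>\<^sub>M M'" "N \<Otimes>\<^sub>M N'" ?E
  proof unfold_locales
    show "(\<lambda>(x, y). ?E x y) \<in> borel_measurable ((M \<Otimes>\<^sub>M M') \<Otimes>\<^sub>M (N \<Otimes>\<^sub>M N'))"
      by measurable
    show "cmod (?E p q) \<le> 1" for p q
      using mult_mono[OF A.e_bound[of "fst p" "fst q"] B.e_bound[of "snd p" "snd q"]] by (simp add: norm_mult)
  qed
  show ?thesis
  proof unfold_locales
    fix f assume f: "integrable (M \<Otimes>\<^sub>M M') f" "sqi (M \<Otimes>\<^sub>M M') f"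
    have [measurable]: "f \<in> borel_measurable (M \<Otimes>\<^sub>M M')" using f by auto
    define g where "g y x' = (LINT x|M. f (x, x') * e x y)" for y x'
    have [measurable]: "(\<lambda>q. g (fst q) (snd q)) \<in> borel_measurable (N \<Otimes>\<^sub>M M')"
      unfolding g_def by measurable
    have T: "transform (M \<Otimes>\<^sub>M M') ?E f q = transform M' e' (g (fst q)) (snd q)" if q: "q \<in> space (N \<Otimes>\<^sub>M N')" for q
    proof -
      have "integrable (M \<Otimes>\<^sub>M M') (\<lambda>p. f p * ?E p q)" by (rule E.integrable_transform[OF f(1) q])
      then have "integrable (M \<Otimes>\<^sub>M M') (\<lambda>(x, x'). f (x, x') * (e x (fst q) * e' x' (snd q)))"
        by (simp add: case_prod_beta')
      from MM.integral_snd[OF this]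
      have "transform (M \<Otimes>\<^sub>M M') ?E f q = (LINT x'|M'. LINT x|M. f (x, x') * (e x (fst q) * e' x' (snd q)))"
        by (simp add: transform_def case_prod_beta')
      also have "\<dots> = (LINT x'|M'. LINT x|M. (f (x, x') * e x (fst q)) * e' x' (snd q))"
        by (simp add: mult.assoc)
      also have "\<dots> = transform M' e' (g (fst q)) (snd q)"
        unfolding transform_def g_def by (simp only: integral_mult_left_zero)
      finally show ?thesis .
    qed
    have "AE x' in M'. integrable M (\<lambda>x. f (x, x')) \<and> sqi M (\<lambda>x. f (x, x'))"
    proof -
      have "AE x' in M'. integrable M (\<lambda>x. f (x, x'))"
        using f(1) by (intro MM.AE_integrable_snd) simp
      moreover have "AE x' in M'. integrable M (\<lambda>x. (cmod (f (x, x')))\<^sup>2)"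
        using sqi_integrable[OF f(2)] by (intro MM.AE_integrable_snd) (simp add: case_prod_beta')
      ultimately show ?thesis by eventually_elim (auto simp: sqi_def)
    qed
    then have g_pl: "AE x' in M'. (\<integral>\<^sup>+y. ennreal ((cmod (g y x'))\<^sup>2) \<partial>N) = (\<integral>\<^sup>+x. ennreal ((cmod (f (x, x')))\<^sup>2) \<partial>M)"
    proof eventually_elim
      case (elim x')
      then show ?case using A.plancherel[of "\<lambda>x. f (x, x')"] by (simp add: g_def transform_def)
    qed
    have g_total: "(\<integral>\<^sup>+y. \<integral>\<^sup>+x'. ennreal ((cmod (g y x'))\<^sup>2) \<partial>M' \<partial>N) = (\<integral>\<^sup>+p. ennreal ((cmod (f p))\<^sup>2) \<partial>(M \<Otimes>\<^sub>M M'))"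
    proof -
      have "(\<integral>\<^sup>+y. \<integral>\<^sup>+x'. ennreal ((cmod (g y x'))\<^sup>2) \<partial>M' \<partial>N) = (\<integral>\<^sup>+x'. \<integral>\<^sup>+y. ennreal ((cmod (g y x'))\<^sup>2) \<partial>N \<partial>M')"
        by (rule NM.Fubini'[symmetric]) (simp add: case_prod_beta')
      also have "\<dots> = (\<integral>\<^sup>+x'. \<integral>\<^sup>+x. ennreal ((cmod (f (x, x')))\<^sup>2) \<partial>M \<partial>M')"
        using g_pl by (intro nn_integral_cong_AE) auto
      also have "\<dots> = (\<integral>\<^sup>+p. ennreal ((cmod (f p))\<^sup>2) \<partial>(M \<Otimes>\<^sub>M M'))"
        by (subst MM.nn_integral_snd) auto
      finally show ?thesis .
    qed
    have "(\<integral>\<^sup>+y. \<integral>\<^sup>+x'. ennreal ((cmod (g y x'))\<^sup>2) \<partial>M' \<partial>N) < \<infinity>"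
      using f(2) unfolding g_total sqi_iff_nn by simp
    then have "AE y in N. (\<integral>\<^sup>+x'. ennreal ((cmod (g y x'))\<^sup>2) \<partial>M') \<noteq> \<infinity>"
      by (intro nn_integral_noteq_infinite) auto
    then have g_ok: "AE y in N. (\<integral>\<^sup>+y'. ennreal ((cmod (transform M' e' (g y) y'))\<^sup>2) \<partial>N') = (\<integral>\<^sup>+x'. ennreal ((cmod (g y x'))\<^sup>2) \<partial>M')"
      using AE_space
    proof eventually_elim
      case (elim y)
      have [measurable]: "g y \<in> borel_measurable M'"
        using elim(2) unfolding g_def by measurable
      have "sqi M' (g y)" using elim by (intro sqi_nnI) (auto simp: less_top)
      moreover have "integrable M' (g y)"
      proof (rule Bochner_Integration.integrable_bound)
        show "integrable M' (\<lambda>x'. LINT x|M. cmod (f (x, x')))"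
          using f(1) by (intro MM.integrable_snd) (simp add: case_prod_beta')
        show "AE x' in M'. norm (g y x') \<le> norm (LINT x|M. cmod (f (x, x')))"
        proof -
        have "AE x' in M'. integrable M (\<lambda>x. f (x, x'))"
          using f(1) by (intro MM.AE_integrable_snd) simp
        then show ?thesis
        proof eventually_elim
          case (elim x')
          then show ?case
            using A.transform_bound[of "\<lambda>x. f (x, x')" y] \<open>y \<in> space N\<close>
            by (auto simp: g_def transform_def intro: order_trans)
        qed
        qed
      qed measurable
      ultimately show ?case by (intro B.plancherel)
    qed
    have [measurable]: "(\<lambda>q. transform M' e' (g (fst q)) (snd q)) \<in> borel_measurable (N \<Otimes>\<^sub>M N')"
      unfolding transform_def g_def by measurable
    have "(\<integral>\<^sup>+q. ennreal ((cmod (transform (M \<Otimes>\<^sub>M M') ?E f q))\<^sup>2) \<partial>(N \<Otimes>\<^sub>M N')) =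
        (\<integral>\<^sup>+q. ennreal ((cmod (transform M' e' (g (fst q)) (snd q)))\<^sup>2) \<partial>(N \<Otimes>\<^sub>M N'))"
      by (rule nn_integral_cong) (simp add: T)
    also have "\<dots> = (\<integral>\<^sup>+y. \<integral>\<^sup>+y'. ennreal ((cmod (transform M' e' (g y) y'))\<^sup>2) \<partial>N' \<partial>N)"
      by (subst B.N.nn_integral_fst[symmetric]) auto
    also have "\<dots> = (\<integral>\<^sup>+y. \<integral>\<^sup>+x'. ennreal ((cmod (g y x'))\<^sup>2) \<partial>M' \<partial>N)"
      using g_ok by (rule nn_integral_cong_AE)
    finally show "(\<integral>\<^sup>+q. ennreal ((cmod (transform (M \<Otimes>\<^sub>M M') ?E f q))\<^sup>2) \<partial>(N \<Otimes>\<^sub>M N')) =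
       (\<integral>\<^sup>+p. ennreal ((cmod (f p))\<^sup>2) \<partial>(M \<Otimes>\<^sub>M M'))" using g_total by simp
  qed
qed

section \<open>The Fourier transform on the line by Gaussian summability\<close>

lemma gaussian_fourier:
  assumes "\<sigma> > 0"
  shows "(LINT y|lborel. of_real (exp (- y\<^sup>2 / (2 * \<sigma>\<^sup>2))) * cis (s * y)) = of_real (sqrt (2 * pi) * \<sigma> * exp (- (\<sigma> * s)\<^sup>2 / 2))"
proof -
  have "char std_normal_distribution (\<sigma> * s) = (LINT y|lborel. std_normal_density y *\<^sub>R cis ((\<sigma> * s) * y))"
    unfolding char_def by (subst integral_density) (auto simp: normal_density_nonneg cis_conv_exp mult_ac)
  then have "(LINT y|lborel. std_normal_density y *\<^sub>R cis ((\<sigma> * s) * y)) = of_real (exp (- (\<sigma> * s)\<^sup>2 / 2))"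
    by (simp add: char_std_normal_distribution)
  moreover have "(LINT y|lborel. of_real (exp (- y\<^sup>2 / (2 * \<sigma>\<^sup>2))) * cis (s * y)) =
    \<bar>\<sigma>\<bar> *\<^sub>R (LINT y|lborel. of_real (exp (- (0 + \<sigma> * y)\<^sup>2 / (2 * \<sigma>\<^sup>2))) * cis (s * (0 + \<sigma> * y)))"
    using assms by (intro lborel_integral_real_affine) simp
  moreover have "of_real (exp (- (0 + \<sigma> * y)\<^sup>2 / (2 * \<sigma>\<^sup>2))) * cis (s * (0 + \<sigma> * y)) =
     of_real (sqrt (2 * pi)) * (std_normal_density y *\<^sub>R cis ((\<sigma> * s) * y))" for y
    using assms by (simp add: std_normal_density_def scaleR_conv_of_real power_mult_distrib mult_ac)
  ultimately show ?thesis using assms by (simp add: scaleR_conv_of_real)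
qed

lemma integrable_gaussian:
  assumes "\<sigma> > 0"
  shows "integrable lborel (\<lambda>y::real. exp (- y\<^sup>2 / (2 * \<sigma>\<^sup>2)))"
proof -
  have "integrable lborel (\<lambda>y. sqrt (2 * pi * \<sigma>\<^sup>2) * normal_density 0 \<sigma> y)"
    using assms by (intro integrable_mult_right integrable_normal_density)
  then show ?thesis using assms by (simp add: normal_density_def)
qed

definition e_line :: "real \<Rightarrow> real \<Rightarrow> complex" where
  "e_line y \<eta> = cis (- (\<eta> * y)) / sqrt (2 * pi)"

lemma sqrt_2pi_ge_1: "1 \<le> sqrt (2 * pi)"
  using pi_ge_two by simp

text \<open>A Gaussian factor of width n + 1 in frequency corresponds to a normal density of
  standard deviation 1/(n + 1) around the base point; Chebyshev's inequality controls its
  tails.\<close>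

lemma plancherel_line: "plancherel_kernel lborel lborel e_line"
proof -
  interpret approx_identity lborel lborel e_line
    "\<lambda>n \<eta>. exp (- \<eta>\<^sup>2 / (2 * (real (Suc n))\<^sup>2))" "\<lambda>n y y'. normal_density y (1 / real (Suc n)) y'"
  proof
    show "(\<lambda>(x, y). e_line x y) \<in> borel_measurable (lborel \<Otimes>\<^sub>M lborel)"
      unfolding e_line_def by (auto simp: lborel_prod intro!: borel_measurable_continuous_onI continuous_intros simp: case_prod_beta')
    show "cmod (e_line x y) \<le> 1" for x y
      using sqrt_2pi_ge_1 by (simp add: e_line_def norm_divide)
    show "emeasure lborel {a..b::real} < \<infinity>" for a b by (simp add: emeasure_lborel_Icc_eq)
    show "integrable lborel (\<lambda>\<eta>. exp (- \<eta>\<^sup>2 / (2 * (real (Suc n))\<^sup>2)))" for n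
      by (rule integrable_gaussian) simp
    show "(\<lambda>n. exp (- y\<^sup>2 / (2 * (real (Suc n))\<^sup>2))) \<longlonglongrightarrow> 1" for y
      by real_asymp
    show "(LINT y|lborel. of_real (exp (- y\<^sup>2 / (2 * (real (Suc n))\<^sup>2))) * (e_line x y * cnj (e_line x' y))) =
        of_real (normal_density x (1 / real (Suc n)) x')" for n x x'
    proof -
      define a where "a = real (Suc n)"
      have a: "a > 0" by (simp add: a_def)
      have pi2: "complex_of_real (sqrt (2 * pi)) * complex_of_real (sqrt (2 * pi)) = complex_of_real (2 * pi)"
        unfolding of_real_mult[symmetric] by simp
      have "e_line x y * cnj (e_line x' y) = cis ((x' - x) * y) / (2 * pi)" for y
        using pi2 by (simp add: e_line_def cis_cnj cis_mult algebra_simps)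
      then have "(LINT y|lborel. of_real (exp (- y\<^sup>2 / (2 * a\<^sup>2))) * (e_line x y * cnj (e_line x' y))) =
        (LINT y|lborel. of_real (exp (- y\<^sup>2 / (2 * a\<^sup>2))) * cis ((x' - x) * y)) / (2 * pi)"
        by simp
      also have "\<dots> = of_real (sqrt (2 * pi) * a * exp (- (a * (x' - x))\<^sup>2 / 2) / (2 * pi))"
        by (subst gaussian_fourier[OF a]) simp
      also have "sqrt (2 * pi) * a * exp (- (a * (x' - x))\<^sup>2 / 2) / (2 * pi) = normal_density x (1 / a) x'"
      proof -
        define r where "r = sqrt (2 * pi)"
        have r: "r > 0" "2 * pi = r * r" by (simp_all add: r_def)
        have 1: "sqrt (2 * pi * (1 / a)\<^sup>2) = r / a"
          using a by (simp add: r_def real_sqrt_mult real_sqrt_divide power_one_over)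
        have 2: "- (x' - x)\<^sup>2 / (2 * (1 / a)\<^sup>2) = - (a * (x' - x))\<^sup>2 / 2"
          using a by (simp only: power_mult_distrib) (simp add: power_one_over)
        have 3: "sqrt (2 * pi) * a * E / (2 * pi) = 1 / (r / a) * E" for E
          unfolding r_def[symmetric] r(2) using r(1) by simp
        show ?thesis unfolding normal_density_def 1 2 by (rule 3)
      qed
      finally show ?thesis by (simp only: a_def)
    qed
    show "(\<lambda>p. normal_density (fst p) (1 / real (Suc n)) (snd p)) \<in> borel_measurable (borel \<Otimes>\<^sub>M borel)" for n
      unfolding normal_density_def by measurable
    show "normal_density x (1 / real (Suc n)) x' = normal_density x' (1 / real (Suc n)) x" for n x x'
      unfolding normal_density_def by (simp add: power2_commute)
    show "AE x in lborel. \<forall>\<delta>>0. (\<lambda>n. LINT x'|lborel. indicator {x'. \<delta> \<le> \<bar>x' - x\<bar>} x' * normal_density x (1 / real (Suc n)) x') \<longlonglongrightarrow> 0"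
    proof (intro AE_I2 allI impI)
      fix x \<delta> :: real assume d: "\<delta> > 0"
      show "(\<lambda>n. LINT x'|lborel. indicator {x'. \<delta> \<le> \<bar>x' - x\<bar>} x' * normal_density x (1 / real (Suc n)) x') \<longlonglongrightarrow> 0"
      proof (rule real_tendsto_sandwich[OF _ _ tendsto_const])
        show "(\<lambda>n. (1 / real (Suc n))\<^sup>2 / \<delta>\<^sup>2) \<longlonglongrightarrow> 0" using d by real_asymp
        show "\<forall>\<^sub>F n in sequentially. 0 \<le> (LINT x'|lborel. indicator {x'. \<delta> \<le> \<bar>x' - x\<bar>} x' * normal_density x (1 / real (Suc n)) x')"
          by (intro always_eventually allI integral_nonneg_AE) auto
        show "\<forall>\<^sub>F n in sequentially. (LINT x'|lborel. indicator {x'. \<delta> \<le> \<bar>x' - x\<bar>} x' * normal_density x (1 / real (Suc n)) x') \<le> (1 / real (Suc n))\<^sup>2 / \<delta>\<^sup>2"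
        proof (intro always_eventually allI)
          fix n
          let ?s = "1 / real (Suc n)"
          have m: "integrable lborel (\<lambda>x'. normal_density x ?s x' * (x' - x)\<^sup>2)" "(LINT x'|lborel. normal_density x ?s x' * (x' - x)\<^sup>2) = ?s\<^sup>2"
            using integrable_normal_moment[of ?s x 2] integral_normal_moment_even[of ?s x 1] by (simp_all add: fact_numeral)
          have "(LINT x'|lborel. indicator {x'. \<delta> \<le> \<bar>x' - x\<bar>} x' * normal_density x ?s x') \<le>
             (LINT x'|lborel. (1 / \<delta>\<^sup>2) * (normal_density x ?s x' * (x' - x)\<^sup>2))"
          proof (rule integral_mono)
            show "integrable lborel (\<lambda>x'. indicator {x'. \<delta> \<le> \<bar>x' - x\<bar>} x' * normal_density x ?s x')"
              using integrable_real_mult_indicator[of "{x'. \<delta> \<le> \<bar>x' - x\<bar>}" lborel "normal_density x ?s"]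
              by (simp add: mult.commute)
            show "integrable lborel (\<lambda>x'. (1 / \<delta>\<^sup>2) * (normal_density x ?s x' * (x' - x)\<^sup>2))"
              using m(1) by (rule integrable_mult_right)
            fix x'
            show "indicator {x'. \<delta> \<le> \<bar>x' - x\<bar>} x' * normal_density x ?s x' \<le> (1 / \<delta>\<^sup>2) * (normal_density x ?s x' * (x' - x)\<^sup>2)"
            proof (cases "\<delta> \<le> \<bar>x' - x\<bar>")
              case True
              then have "\<delta>\<^sup>2 \<le> (x' - x)\<^sup>2" using d by (metis power_mono less_imp_le power2_abs)
              then have "1 * normal_density x ?s x' \<le> ((x' - x)\<^sup>2 / \<delta>\<^sup>2) * normal_density x ?s x'"
                using d by (intro mult_right_mono) (auto simp: field_simps)
              then show ?thesis using True by (simp add: mult_ac)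
            qed simp
          qed
          also have "\<dots> = ?s\<^sup>2 / \<delta>\<^sup>2" using m(2) by simp
          finally show "(LINT x'|lborel. indicator {x'. \<delta> \<le> \<bar>x' - x\<bar>} x' * normal_density x ?s x') \<le> ?s\<^sup>2 / \<delta>\<^sup>2" .
        qed
      qed
    qed
  qed (simp_all add: integrable_normal_density)
  show ?thesis by unfold_locales
qed

section \<open>Fourier series by Fejer summability\<close>

definition circle :: "real measure" where
  "circle = density lborel (indicator {0..2 * pi})"

definition e_circle :: "real \<Rightarrow> int \<Rightarrow> complex" where
  "e_circle x k = cis (- (of_int k * x)) / sqrt (2 * pi)"

lemma sets_circle [measurable_cong, simp]: "sets circle = sets borel"
  by (simp add: circle_def)

lemma space_circle [simp]: "space circle = UNIV"
  by (simp add: circle_def)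

lemma borel_measurable_circle [simp]: "borel_measurable circle = borel_measurable borel"
  by (rule measurable_cong_sets) auto

lemma integral_circle:
  fixes f :: "real \<Rightarrow> 'b::{banach, second_countable_topology}"
  assumes "f \<in> borel_measurable borel"
  shows "(LINT x|circle. f x) = (LINT x|lborel. indicator {0..2 * pi} x *\<^sub>R f x)"
proof -
  have "circle = density lborel (\<lambda>x. ennreal (indicator {0..2*pi} x))"
    unfolding circle_def by (intro density_cong) (auto split: split_indicator)
  then show ?thesis using integral_density[of f lborel "indicator {0..2 * pi}"] assms by simp
qed

lemma integrable_circle:
  fixes f :: "real \<Rightarrow> 'b::{banach, second_countable_topology}"
  assumes "f \<in> borel_measurable borel"
  shows "integrable circle f \<longleftrightarrow> integrable lborel (\<lambda>x. indicator {0..2 * pi} x *\<^sub>R f x)"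
proof -
  have "circle = density lborel (\<lambda>x. ennreal (indicator {0..2*pi} x))"
    unfolding circle_def by (intro density_cong) (auto split: split_indicator)
  then show ?thesis using integrable_density[of f lborel "indicator {0..2 * pi}"] assms by simp
qed

lemma emeasure_circle: "A \<in> sets borel \<Longrightarrow> emeasure circle A = emeasure lborel ({0..2*pi} \<inter> A)"
  unfolding circle_def by (subst emeasure_density) (auto simp: nn_integral_indicator indicator_inter_arith[symmetric] simp flip: nn_integral_indicator)

lemma finite_measure_circle: "finite_measure circle"
  by (rule finite_measureI) (simp add: emeasure_circle)

interpretation circle: finite_measure circle
  by (rule finite_measure_circle)

lemma integral_cis_circle: "(LINT x|circle. cis (of_int k * x)) = (if k = 0 then 2 * pi else 0)"
proof (cases "k = 0")
  case True
  then show ?thesis by (simp add: emeasure_circle measure_def scaleR_conv_of_real)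
next
  case False
  have "(LINT x|circle. cis (of_int k * x)) = (LINT x|lborel. indicator {0..2 * pi} x *\<^sub>R cis (of_int k * x))"
    by (rule integral_circle) (auto intro!: borel_measurable_continuous_onI continuous_intros)
  also have "\<dots> = cis (of_int k * (2 * pi)) / (\<i> * of_int k) - cis (of_int k * 0) / (\<i> * of_int k)"
  proof (rule integral_FTC_Icc)
    show "((\<lambda>x. cis (of_int k * x) / (\<i> * of_int k)) has_vector_derivative cis (of_int k * x)) (at x within {0..2*pi})" for x
      unfolding cis_conv_exp using False
      by (auto intro!: derivative_eq_intros has_vector_derivative_real_field simp: field_simps)
  qed (auto intro!: continuous_intros)
  also have "cis (of_int k * (2 * pi)) = 1"
    using cis_multiple_2pi[of "of_int k"] by (simp add: mult_ac)
  finally show ?thesis using False by simp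
qed


lemma count_space_single:
  fixes F :: "'b \<Rightarrow> 'c::{banach, second_countable_topology, real_normed_algebra_1}"
  shows "integrable (count_space UNIV) (\<lambda>k. of_bool (a = k) * F k)"
    and "(LINT k|count_space UNIV. of_bool (a = k) * F k) = F a"
proof -
  have *: "(\<lambda>k. of_bool (a = k) * F k) = (\<lambda>k. indicator {a} k *\<^sub>R F a)"
    by (auto simp: fun_eq_iff indicator_def)
  show "integrable (count_space UNIV) (\<lambda>k. of_bool (a = k) * F k)" "(LINT k|count_space UNIV. of_bool (a = k) * F k) = F a"
    unfolding * by (simp_all add: measure_def)
qed

lemma integral_periodic_cis:
  "(LINT x|circle. cis (of_int k * (x - c))) = (if k = 0 then 2 * pi else 0)"
proof -
  have "(LINT x|circle. cis (of_int k * (x - c))) = cis (- (of_int k * c)) * (LINT x|circle. cis (of_int k * x))"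
    by (subst integral_mult_right_zero[symmetric]) (simp add: cis_mult right_diff_distrib)
  then show ?thesis by (simp add: integral_cis_circle)
qed

lemma integrable_circle_continuous:
  fixes f :: "real \<Rightarrow> 'b::{banach, second_countable_topology, euclidean_space}"
  assumes "continuous_on UNIV f"
  shows "integrable circle f"
  using borel_integrable_compact[of "{0..2*pi}" f] assms
  by (subst integrable_circle) (auto intro: continuous_on_subset borel_measurable_continuous_onI)

text \<open>The Fejer kernel divided by 2\<pi>, so that its mass is one. As a squared modulus it is
  visibly nonnegative; expanding the square yields triangular weights on the frequencies.\<close>

definition fejer :: "nat \<Rightarrow> real \<Rightarrow> real" where
  "fejer n s = (cmod (\<Sum>j\<le>n. cis (of_int (int j) * s)))\<^sup>2 / (2 * pi * real (Suc n))"

lemma fejer_eq: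
  "complex_of_real (fejer n s) = (\<Sum>j\<le>n. \<Sum>j'\<le>n. cis (of_int (int j - int j') * s)) / (2 * pi * real (Suc n))"
proof -
  have "complex_of_real ((cmod (\<Sum>j\<le>n. cis (of_int (int j) * s)))\<^sup>2) =
     (\<Sum>j\<le>n. cis (of_int (int j) * s)) * cnj (\<Sum>j\<le>n. cis (of_int (int j) * s))"
    by (rule complex_norm_square)
  also have "\<dots> = (\<Sum>j\<le>n. \<Sum>j'\<le>n. cis (of_int (int j - int j') * s))"
    by (simp add: sum_product cis_cnj cis_mult left_diff_distrib)
  finally show ?thesis by (simp add: fejer_def)
qed

lemma fejer_minus: "fejer n (- s) = fejer n s"
proof -
  have "cmod (\<Sum>j\<le>n. cis (of_int (int j) * (- s))) = cmod (cnj (\<Sum>j\<le>n. cis (of_int (int j) * s)))"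
    by (simp add: cis_cnj)
  then show ?thesis by (simp only: fejer_def complex_mod_cnj)
qed

text \<open>The geometric sum is at most 2/|cis s - 1| in modulus for every \<open>n\<close>, so the
  division by n + 1 makes the kernel small away from the multiples of 2\<pi>.\<close>

lemma fejer_bound:
  assumes "cis s \<noteq> 1"
  shows "fejer n s \<le> 4 / (cmod (cis s - 1))\<^sup>2 / (2 * pi * real (Suc n))"
proof -
  have "(\<Sum>j\<le>n. cis (of_int (int j) * s)) = (\<Sum>j\<le>n. cis s ^ j)"
    by (rule sum.cong) (simp_all add: Complex.DeMoivre)
  also have "\<dots> = (1 - cis s ^ Suc n) / (1 - cis s)"
    using assms by (simp add: sum_gp0)
  finally have "cmod (\<Sum>j\<le>n. cis (of_int (int j) * s)) = cmod (1 - cis s ^ Suc n) / cmod (cis s - 1)"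
    by (simp add: norm_divide norm_minus_commute)
  also have "\<dots> \<le> 2 / cmod (cis s - 1)"
    using norm_triangle_ineq4[of 1 "cis s ^ Suc n"] by (intro divide_right_mono) (auto simp: norm_power norm_mult)
  finally have "(cmod (\<Sum>j\<le>n. cis (of_int (int j) * s)))\<^sup>2 \<le> (2 / cmod (cis s - 1))\<^sup>2"
    by (intro power_mono) auto
  then show ?thesis unfolding fejer_def by (intro divide_right_mono) (auto simp: power_divide)
qed

lemma cis_eq_1_near:
  assumes "cis s = 1" "\<bar>s\<bar> < 2 * pi"
  shows "s = 0"
proof -
  have "cos s = 1" using assms(1) by (simp add: complex_eq_iff)
  then obtain n :: int where n: "s = of_int n * 2 * pi" using cos_one_2pi_int by auto
  have "n = 0"
  proof (rule ccontr)
    assume "n \<noteq> 0"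
    then have "1 \<le> \<bar>of_int n :: real\<bar>" by linarith
    then have "2 * pi \<le> \<bar>of_int n :: real\<bar> * (2 * pi)" by simp
    then show False using assms(2) n by (simp add: abs_mult mult.assoc)
  qed
  then show ?thesis using n by simp
qed

lemma plancherel_circle: "plancherel_kernel circle (count_space UNIV) e_circle"
proof -
  have count: "sigma_finite_measure (count_space (UNIV :: int set))"
    by (rule sigma_finite_measure_count_space_countable) simp
  interpret C: sigma_finite_measure "count_space (UNIV :: int set)" by (rule count)
  \<comment> \<open>Counting the pairs with difference \<open>k\<close> gives max 0 (n + 1 - |k|),
    so \<open>W\<close> is the triangular Fejer weight; the double sum matches the expansion
    \<open>fejer_eq\<close> term by term.\<close>
  define W :: "nat \<Rightarrow> int \<Rightarrow> real" where
    "W n k = (\<Sum>j\<le>n. \<Sum>j'\<le>n. of_bool (int j - int j' = k)) / real (Suc n)" for n k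
  have cont_fejer: "continuous_on UNIV (fejer n)" for n
    unfolding fejer_def by (intro continuous_intros) auto
  interpret approx_identity circle "count_space (UNIV :: int set)" e_circle W "\<lambda>n x x'. fejer n (x' - x)"
  proof
    show "(\<lambda>(x, y). e_circle x y) \<in> borel_measurable (circle \<Otimes>\<^sub>M count_space UNIV)"
    proof -
      have "(\<lambda>(y, x). e_circle x y) \<in> borel_measurable (count_space UNIV \<Otimes>\<^sub>M circle)"
        unfolding e_circle_def
        by (rule measurable_pair_measure_countable1) (auto intro!: borel_measurable_continuous_onI continuous_intros)
      from measurable_pair_swap[OF this] show ?thesis by (simp add: case_prod_beta')
    qed
    show "cmod (e_circle x y) \<le> 1" for x y
      using sqrt_2pi_ge_1 by (simp add: e_circle_def norm_divide)
    show "emeasure circle {a..b} < \<infinity>" for a b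
      by (simp add: circle.emeasure_finite less_top[symmetric])
    show "emeasure circle {a} = 0" for a
    proof -
      have "emeasure lborel ({0..2 * pi} \<inter> {a}) \<le> emeasure lborel {a}" by (intro emeasure_mono) auto
      then show ?thesis by (simp add: emeasure_circle)
    qed
    show "integrable (count_space UNIV) (W n)" for n
      unfolding W_def using count_space_single(1)[where F="\<lambda>_. 1::real"]
      by (intro integrable_divide Bochner_Integration.integrable_sum) simp
    show "0 \<le> W n y" for n y unfolding W_def by (intro divide_nonneg_nonneg sum_nonneg) auto
    have inner: "(\<Sum>j'\<le>n. of_bool (int j - int j' = k)) = (of_bool (0 \<le> int j - k \<and> int j - k \<le> int n) :: real)" for n j k
    proof (cases "0 \<le> int j - k \<and> int j - k \<le> int n")
      case True
      then have "(\<Sum>j'\<le>n. of_bool (int j - int j' = k)) = (\<Sum>j'\<le>n. if j' = nat (int j - k) then 1 else (0::real))"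
        by (intro sum.cong) auto
      also have "\<dots> = 1" using True by (simp add: nat_le_iff)
      finally show ?thesis using True by simp
    next
      case False
      then have "(\<Sum>j'\<le>n. of_bool (int j - int j' = k)) = (\<Sum>j'\<le>n. (0::real))"
        by (intro sum.cong) auto
      then show ?thesis using False by simp
    qed
    have W2: "W n k = (\<Sum>j\<le>n. of_bool (0 \<le> int j - k \<and> int j - k \<le> int n)) / real (Suc n)" for n k
      unfolding W_def inner ..
    have "(\<Sum>j\<le>n. of_bool (0 \<le> int j - k \<and> int j - k \<le> int n)) \<le> (\<Sum>j\<le>n. (1::real))" for n k
      by (intro sum_mono) auto
    then show W1: "W n k \<le> 1" for n k unfolding W2 by simp
    show "(\<lambda>n. W n k) \<longlonglongrightarrow> 1" for k
    proof (rule real_tendsto_sandwich[OF _ _ _ tendsto_const])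
      show "(\<lambda>n. 1 - real_of_int \<bar>k\<bar> / real (Suc n)) \<longlonglongrightarrow> 1" by real_asymp
      show "\<forall>\<^sub>F n in sequentially. 1 - real_of_int \<bar>k\<bar> / real (Suc n) \<le> W n k"
      proof (intro always_eventually allI)
        fix n
        \<comment> \<open>Indices \<open>j\<close> whose partner j - k leaves the range 0..n. There
          are at most |k| of them, whence 1 - |k|/(n + 1) <= W n k.\<close>
        define B where "B = {j. j \<le> n \<and> \<not> (0 \<le> int j - k \<and> int j - k \<le> int n)}"
        have "B \<subseteq> (if k \<ge> 0 then {..<nat k} else {nat (int n + k + 1)..n})"
          unfolding B_def by auto
        then have "card B \<le> card (if k \<ge> 0 then {..<nat k} else {nat (int n + k + 1)..n})"
          by (rule card_mono[rotated]) auto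
        also have "\<dots> \<le> nat \<bar>k\<bar>" by auto
        finally have B: "card B \<le> nat \<bar>k\<bar>" .
        have "real (Suc n) = (\<Sum>j\<le>n. of_bool (0 \<le> int j - k \<and> int j - k \<le> int n)) + (\<Sum>j\<le>n. of_bool (\<not> (0 \<le> int j - k \<and> int j - k \<le> int n)))"
        proof -
          have "real (Suc n) = (\<Sum>j\<le>n. (of_bool (0 \<le> int j - k \<and> int j - k \<le> int n) + of_bool (\<not> (0 \<le> int j - k \<and> int j - k \<le> int n)) :: real))"
            by (subst sum.cong[OF refl, of _ _ "\<lambda>_. 1"]) auto
          then show ?thesis by (simp only: sum.distrib)
        qed
        also have "(\<Sum>j\<le>n. of_bool (\<not> (0 \<le> int j - k \<and> int j - k \<le> int n))) = real (card B)"
          unfolding B_def by (subst sum_of_bool_eq) (auto intro!: arg_cong[where f = card])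
        also have "real (card B) \<le> real_of_int \<bar>k\<bar>" using B by simp
        finally have "real (Suc n) - real_of_int \<bar>k\<bar> \<le> (\<Sum>j\<le>n. of_bool (0 \<le> int j - k \<and> int j - k \<le> int n))" by simp
        then have "(real (Suc n) - real_of_int \<bar>k\<bar>) / real (Suc n) \<le> W n k"
          unfolding W2 by (intro divide_right_mono) auto
        then show "1 - real_of_int \<bar>k\<bar> / real (Suc n) \<le> W n k" by (simp add: diff_divide_distrib)
      qed
      show "\<forall>\<^sub>F n in sequentially. W n k \<le> 1" using W1 by simp
    qed
    show "(LINT k|count_space UNIV. of_real (W n k) * (e_circle x k * cnj (e_circle x' k))) = of_real (fejer n (x' - x))" for n x x'
    proof -
      have pi2: "complex_of_real (sqrt (2 * pi)) * complex_of_real (sqrt (2 * pi)) = complex_of_real (2 * pi)"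
        unfolding of_real_mult[symmetric] by simp
      have ee: "e_circle x k * cnj (e_circle x' k) = cis (of_int k * (x' - x)) / (2 * pi)" for k
        using pi2 by (simp add: e_circle_def cis_cnj cis_mult algebra_simps)
      let ?F = "\<lambda>k. cis (of_int k * (x' - x))"
      have "of_real (W n k) * (e_circle x k * cnj (e_circle x' k)) =
         (\<Sum>j\<le>n. \<Sum>j'\<le>n. of_bool (int j - int j' = k) * ?F k) / (2 * pi * real (Suc n))" for k
      proof -
        have "complex_of_real (\<Sum>j\<le>n. \<Sum>j'\<le>n. of_bool (int j - int j' = k)) * ?F k = (\<Sum>j\<le>n. \<Sum>j'\<le>n. of_bool (int j - int j' = k) * ?F k)"
          unfolding of_real_sum sum_distrib_right by (intro sum.cong refl) simp
        then show ?thesis unfolding ee W_def of_real_divide by (simp only: times_divide_times_eq) (simp add: mult_ac)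
      qed
      then have "(LINT k|count_space UNIV. of_real (W n k) * (e_circle x k * cnj (e_circle x' k))) =
        (LINT k|count_space UNIV. (\<Sum>j\<le>n. \<Sum>j'\<le>n. of_bool (int j - int j' = k) * ?F k)) / (2 * pi * real (Suc n))"
        by simp
      also have "(LINT k|count_space UNIV. (\<Sum>j\<le>n. \<Sum>j'\<le>n. of_bool (int j - int j' = k) * ?F k)) =
         (\<Sum>j\<le>n. \<Sum>j'\<le>n. (LINT k|count_space UNIV. of_bool (int j - int j' = k) * ?F k))"
        by (simp only: Bochner_Integration.integral_sum Bochner_Integration.integrable_sum count_space_single)
      also have "\<dots> = (\<Sum>j\<le>n. \<Sum>j'\<le>n. ?F (int j - int j'))"
        by (simp only: count_space_single)
      finally show ?thesis unfolding fejer_eq .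
    qed
    show "(\<lambda>p. fejer n (snd p - fst p)) \<in> borel_measurable (borel \<Otimes>\<^sub>M borel)" for n
      using borel_measurable_continuous_onI[OF cont_fejer] by (rule measurable_compose[rotated]) measurable
    show "0 \<le> fejer n (x' - x)" for n x x' unfolding fejer_def by simp
    show "fejer n (x' - x) = fejer n (x - x')" for n x x'
      using fejer_minus[of n "x - x'"] by simp
    show int: "integrable circle (\<lambda>x'. fejer n (x' - x))" for n x
      by (intro integrable_circle_continuous continuous_on_compose2[OF cont_fejer] continuous_intros) auto
    show "(LINT x'|circle. fejer n (x' - x)) = 1" for n x
    proof -
      have "complex_of_real (LINT x'|circle. fejer n (x' - x)) = (LINT x'|circle. (\<Sum>j\<le>n. \<Sum>j'\<le>n. cis (of_int (int j - int j') * (x' - x)))) / (2 * pi * real (Suc n))"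
        by (subst integral_complex_of_real[symmetric]) (simp add: fejer_eq)
      also have "(LINT x'|circle. (\<Sum>j\<le>n. \<Sum>j'\<le>n. cis (of_int (int j - int j') * (x' - x)))) =
        (\<Sum>j\<le>n. \<Sum>j'\<le>n. LINT x'|circle. cis (of_int (int j - int j') * (x' - x)))"
        by (subst Bochner_Integration.integral_sum, intro Bochner_Integration.integrable_sum integrable_circle_continuous continuous_intros)
          (intro sum.cong refl Bochner_Integration.integral_sum integrable_circle_continuous continuous_intros)
      also have "\<dots> = (\<Sum>j\<le>n. \<Sum>j'\<le>n. if j' = j then complex_of_real (2 * pi) else 0)"
      proof (intro sum.cong refl)
        fix j j'
        show "(LINT x'|circle. cis (of_int (int j - int j') * (x' - x))) = (if j' = j then complex_of_real (2 * pi) else 0)"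
          by (rule trans[OF integral_periodic_cis]) simp
      qed
      also have "\<dots> = real (Suc n) * (2 * pi)" by simp
      finally have "complex_of_real (LINT x'|circle. fejer n (x' - x)) = complex_of_real 1" by (simp del: of_nat_Suc)
      then show ?thesis by (simp only: of_real_eq_iff)
    qed
    show "AE x in circle. \<forall>\<delta>>0. (\<lambda>n. LINT x'|circle. indicator {x'. \<delta> \<le> \<bar>x' - x\<bar>} x' * fejer n (x' - x)) \<longlonglongrightarrow> 0"
    proof -
      \<comment> \<open>For \<open>x\<close> in the open interval, every \<open>x'\<close> in the
        closed one satisfies |x' - x| < 2\<pi>, so cis (x' - x) = 1 only for x' = x. At an end point
        this fails.\<close>
      have "AE x in circle. x \<in> {0<..<2 * pi}"
        unfolding circle_def
        by (subst AE_density) (auto intro!: AE_I[where N = "{0, 2 * pi}"] emeasure_lborel_countable simp: indicator_def)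
      then show ?thesis
      proof (eventually_elim, intro allI impI)
        fix x \<delta> :: real assume x: "x \<in> {0<..<2 * pi}" and d: "\<delta> > 0"
        let ?A = "{x'. \<delta> \<le> \<bar>x' - x\<bar>}"
        \<comment> \<open>Compactness turns cis (x' - x) \<noteq> 1 on the far set into the uniform
          lower bound \<open>m\<close> that \<open>fejer_bound\<close> asks for.\<close>
        have "compact ({0..2*pi} \<inter> ?A)"
          by (intro closed_Int_compact[OF _ compact_Icc, of ?A, simplified Int_commute] closed_Collect_le continuous_intros)
        moreover have "continuous_on ({0..2*pi} \<inter> ?A) (\<lambda>x'. cmod (cis (x' - x) - 1))" by (intro continuous_intros)
        ultimately obtain m where m: "m > 0" "\<And>x'. x' \<in> {0..2*pi} \<inter> ?A \<Longrightarrow> m \<le> cmod (cis (x' - x) - 1)"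
        proof (cases "{0..2*pi} \<inter> ?A = {}")
          case True
          show ?thesis by (rule that[of 1]) (use True in auto)
        next
          case False
          assume "compact ({0..2*pi} \<inter> ?A)" "continuous_on ({0..2*pi} \<inter> ?A) (\<lambda>x'. cmod (cis (x' - x) - 1))"
          then obtain z where z: "z \<in> {0..2*pi} \<inter> ?A" "\<And>x'. x' \<in> {0..2*pi} \<inter> ?A \<Longrightarrow> cmod (cis (z - x) - 1) \<le> cmod (cis (x' - x) - 1)"
            using continuous_attains_inf[OF _ False] by blast
          have "cis (z - x) \<noteq> 1"
            using cis_eq_1_near[of "z - x"] z x d by (auto simp: abs_less_iff)
          then show ?thesis by (intro that[of "cmod (cis (z - x) - 1)"] z) auto
        qed
        show "(\<lambda>n. LINT x'|circle. indicator ?A x' * fejer n (x' - x)) \<longlonglongrightarrow> 0"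
        proof (rule real_tendsto_sandwich[OF _ _ tendsto_const])
          show "(\<lambda>n. 4 / m\<^sup>2 / (2 * pi * real (Suc n)) * (2 * pi)) \<longlonglongrightarrow> 0" using m(1) by real_asymp
          show "\<forall>\<^sub>F n in sequentially. 0 \<le> (LINT x'|circle. indicator ?A x' * fejer n (x' - x))"
            by (intro always_eventually allI integral_nonneg_AE) (auto simp: fejer_def)
          show "\<forall>\<^sub>F n in sequentially. (LINT x'|circle. indicator ?A x' * fejer n (x' - x)) \<le> 4 / m\<^sup>2 / (2 * pi * real (Suc n)) * (2 * pi)"
          proof (intro always_eventually allI)
            fix n
            let ?b = "4 / m\<^sup>2 / (2 * pi * real (Suc n))"
            have A: "?A \<in> sets borel" by measurable
            have "(LINT x'|circle. indicator ?A x' * fejer n (x' - x)) \<le> (LINT x'|circle. ?b)"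
            proof (rule integral_mono_AE)
              show "integrable circle (\<lambda>x'. indicator ?A x' * fejer n (x' - x))"
                using integrable_real_mult_indicator[of ?A circle, OF _ int[of n x]] A by (simp add: mult.commute)
              have "AE x' in circle. x' \<in> {0..2 * pi}"
                unfolding circle_def by (subst AE_density) (auto simp: indicator_def)
              then show "AE x' in circle. indicator ?A x' * fejer n (x' - x) \<le> ?b"
              proof eventually_elim
                case (elim x')
                show ?case
                proof (cases "x' \<in> ?A")
                  case True
                  then have mm: "m \<le> cmod (cis (x' - x) - 1)" using elim m(2) by auto
                  then have "cis (x' - x) \<noteq> 1" using m(1) by auto
                  from fejer_bound[OF this, of n]
                  have "fejer n (x' - x) \<le> 4 / (cmod (cis (x' - x) - 1))\<^sup>2 / (2 * pi * real (Suc n))" .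
                  also have "\<dots> \<le> ?b"
                    using mm m(1) by (intro divide_right_mono divide_left_mono power_mono mult_pos_pos zero_less_power) auto
                  finally show ?thesis using True by simp
                qed simp
              qed
            qed simp
            also have "\<dots> = ?b * (2 * pi)" by (simp add: measure_def emeasure_circle)
            finally show "(LINT x'|circle. indicator ?A x' * fejer n (x' - x)) \<le> ?b * (2 * pi)" .
          qed
        qed
      qed
    qed
  qed simp_all
  show ?thesis by unfold_locales
qed

section \<open>The Fourier transform of square integrable functions\<close>

context plancherel_kernel
begin

definition L12 :: "('a \<Rightarrow> complex) \<Rightarrow> bool" where
  "L12 f \<longleftrightarrow> integrable M f \<and> sqi M f"

lemma L12_sqi: "L12 f \<Longrightarrow> sqi M f" and L12_integrable: "L12 f \<Longrightarrow> integrable M f"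
  by (simp_all add: L12_def)

lemma L12_add: "L12 f \<Longrightarrow> L12 g \<Longrightarrow> L12 (\<lambda>x. f x + g x)"
  by (auto simp: L12_def intro: sqi_add)

lemma L12_diff: "L12 f \<Longrightarrow> L12 g \<Longrightarrow> L12 (\<lambda>x. f x - g x)"
  by (auto simp: L12_def intro: sqi_diff)

lemma L12_cmult: "L12 f \<Longrightarrow> L12 (\<lambda>x. c * f x)"
  by (auto simp: L12_def intro: sqi_cmult)

lemma sqi_transform: "L12 f \<Longrightarrow> sqi N (transform M e f)"
  using plancherel[of f] by (auto simp: L12_def sqi_iff_nn)

lemma norm2_transform:
  assumes "L12 f"
  shows "norm2 N (transform M e f) = norm2 M f"
proof -
  have "(norm2 N (transform M e f))\<^sup>2 = (norm2 M f)\<^sup>2"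
    using plancherel[of f] assms nn_norm2[OF sqi_transform[OF assms]] nn_norm2[of M f]
    by (simp add: L12_def)
  then show ?thesis by (simp add: power2_eq_iff_nonneg)
qed

lemma norm2_transform_diff:
  assumes "L12 f" "L12 g"
  shows "norm2 N (\<lambda>y. transform M e f y - transform M e g y) = norm2 M (\<lambda>x. f x - g x)"
proof -
  have "norm2 N (\<lambda>y. transform M e f y - transform M e g y) = norm2 N (transform M e (\<lambda>x. f x - g x))"
    using assms sqi_transform[OF assms(1)] sqi_transform[OF assms(2)] sqi_transform[OF L12_diff[OF assms]]
    by (intro norm2_cong_AE) (auto simp: transform_diff L12_def)
  then show ?thesis using norm2_transform[OF L12_diff[OF assms]] by simp
qed

text \<open>A relation, since \<open>F\<close> is determined only up to null sets. The isometry
  towards all transforms of functions in L1 and L2 says that \<open>F\<close> is the limit of such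
  transforms whenever they approximate \<open>f\<close>, without fixing a sequence.\<close>

definition L2_transform :: "('a \<Rightarrow> complex) \<Rightarrow> ('b \<Rightarrow> complex) \<Rightarrow> bool" where
  "L2_transform f F \<longleftrightarrow> sqi M f \<and> sqi N F \<and>
     (\<forall>g. L12 g \<longrightarrow> norm2 N (\<lambda>y. transform M e g y - F y) = norm2 M (\<lambda>x. g x - f x))"

lemma L2_transform_sqi: "L2_transform f F \<Longrightarrow> sqi M f" "L2_transform f F \<Longrightarrow> sqi N F"
  by (simp_all add: L2_transform_def)

lemma L2_transform_dist:
  "L2_transform f F \<Longrightarrow> L12 g \<Longrightarrow> norm2 N (\<lambda>y. transform M e g y - F y) = norm2 M (\<lambda>x. g x - f x)"
  by (simp add: L2_transform_def)

lemma L2_transform_L12: "L12 f \<Longrightarrow> L2_transform f (transform M e f)"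
  by (auto simp: L2_transform_def L12_sqi sqi_transform norm2_transform_diff)

text \<open>One approximating sequence suffices: both distances in the definition are limits of the
  distances between \<open>g\<close> and \<open>h n\<close>, for which the isometry is
  known.\<close>

lemma L2_transformI:
  assumes f: "sqi M f" and F: "sqi N F" and h: "\<And>n. L12 (h n)"
    and 1: "(\<lambda>n. norm2 M (\<lambda>x. h n x - f x)) \<longlonglongrightarrow> 0"
    and 2: "(\<lambda>n. norm2 N (\<lambda>y. transform M e (h n) y - F y)) \<longlonglongrightarrow> 0"
  shows "L2_transform f F"
  unfolding L2_transform_def
proof (intro conjI f F allI impI)
  fix g assume g: "L12 g"
  have "(\<lambda>n. norm2 N (\<lambda>y. transform M e g y - transform M e (h n) y)) \<longlonglongrightarrow> norm2 N (\<lambda>y. transform M e g y - F y)"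
  proof (rule LIM_zero_cancel, rule Lim_null_comparison[OF always_eventually[OF allI] 2])
    fix n
    have "\<bar>norm2 N (\<lambda>y. transform M e g y - transform M e (h n) y) - norm2 N (\<lambda>y. transform M e g y - F y)\<bar>
      \<le> norm2 N (\<lambda>y. (transform M e g y - transform M e (h n) y) - (transform M e g y - F y))"
      by (intro norm2_diff_abs sqi_diff sqi_transform g h F)
    also have "\<dots> = norm2 N (\<lambda>y. transform M e (h n) y - F y)"
      by (simp add: norm2_def norm_minus_commute)
    finally show "norm (norm2 N (\<lambda>y. transform M e g y - transform M e (h n) y) - norm2 N (\<lambda>y. transform M e g y - F y)) \<le> norm2 N (\<lambda>y. transform M e (h n) y - F y)"
      by simp
  qed
  moreover have "(\<lambda>n. norm2 M (\<lambda>x. g x - h n x)) \<longlonglongrightarrow> norm2 M (\<lambda>x. g x - f x)"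
  proof (rule LIM_zero_cancel, rule Lim_null_comparison[OF always_eventually[OF allI] 1])
    fix n
    have "\<bar>norm2 M (\<lambda>x. g x - h n x) - norm2 M (\<lambda>x. g x - f x)\<bar>
      \<le> norm2 M (\<lambda>x. (g x - h n x) - (g x - f x))"
      using g h f by (intro norm2_diff_abs sqi_diff) (auto simp: L12_def)
    also have "\<dots> = norm2 M (\<lambda>x. h n x - f x)"
      by (simp add: norm2_def norm_minus_commute)
    finally show "norm (norm2 M (\<lambda>x. g x - h n x) - norm2 M (\<lambda>x. g x - f x)) \<le> norm2 M (\<lambda>x. h n x - f x)"
      by simp
  qed
  ultimately show "norm2 N (\<lambda>y. transform M e g y - F y) = norm2 M (\<lambda>x. g x - f x)"
    using LIMSEQ_unique by (simp add: norm2_transform_diff[OF g h])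
qed

text \<open>Truncation to sets of finite measure. The product of \<open>f\<close> with such an
  indicator is integrable as a product of two square integrable functions.\<close>

lemma L12_approximation:
  assumes f: "sqi M f"
  obtains h where "\<And>n. L12 (h n)" "(\<lambda>n. norm2 M (\<lambda>x. h n x - f x)) \<longlonglongrightarrow> 0"
proof -
  obtain A :: "nat \<Rightarrow> 'a set" where A: "range A \<subseteq> sets M" "(\<Union>i. A i) = space M"
      "\<And>i. emeasure M (A i) \<noteq> \<infinity>" "incseq A"
    using M.sigma_finite_incseq by metis
  have [measurable]: "A n \<in> sets M" for n using A(1) by auto
  have [measurable]: "f \<in> borel_measurable M" using f by (rule sqi_measurable)
  define h where "h n x = f x * indicator (A n) x" for n x
  have ind: "sqi M (indicator (A n))" for n
  proof -
    have "integrable M (indicator (A n) :: 'a \<Rightarrow> real)"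
      using A(3) by (intro integrable_real_indicator) (auto simp: less_top)
    moreover have "(cmod (indicator (A n) x))\<^sup>2 = indicator (A n) x" for x by (simp split: split_indicator)
    ultimately show ?thesis by (simp add: sqi_def)
  qed
  have "L12 (h n)" for n
    unfolding L12_def
  proof
    show "integrable M (h n)" unfolding h_def by (rule sqi_integrable_mult[OF f ind])
    show "sqi M (h n)"
      unfolding h_def by (rule sqi_dominated[OF f, of _ 1]) (measurable, auto split: split_indicator)
  qed
  moreover have "(\<lambda>n. norm2 M (\<lambda>x. h n x - f x)) \<longlonglongrightarrow> 0"
  proof (rule norm2_tendsto_0_dominated[OF f])
    show "(\<lambda>x. h n x - f x) \<in> borel_measurable M" for n unfolding h_def by measurable
    show "AE x in M. cmod (h n x - f x) \<le> cmod (f x)" for n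
      by (auto simp: h_def split: split_indicator)
    show "AE x in M. (\<lambda>n. h n x - f x) \<longlonglongrightarrow> 0"
    proof (rule AE_I2)
      fix x assume "x \<in> space M"
      then obtain k where k: "x \<in> A k" using A(2) by auto
      have "h n x - f x = 0" if "n \<ge> k" for n
        using k incseqD[OF A(4) that] by (auto simp: h_def)
      then show "(\<lambda>n. h n x - f x) \<longlonglongrightarrow> 0"
        by (intro tendsto_eventually eventually_sequentiallyI[of k])
    qed
  qed
  ultimately show ?thesis by (rule that)
qed

lemma L2_transform_exists:
  assumes f: "sqi M f"
  obtains F where "L2_transform f F"
proof -
  obtain h where h: "\<And>n. L12 (h n)" "(\<lambda>n. norm2 M (\<lambda>x. h n x - f x)) \<longlonglongrightarrow> 0"
    using L12_approximation[OF f] by blast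
  have tri: "norm2 M (\<lambda>x. h m x - h n x) \<le> norm2 M (\<lambda>x. h m x - f x) + norm2 M (\<lambda>x. h n x - f x)" for m n
    using norm2_triangle_diff[OF L12_sqi[OF h(1)[of m]] f L12_sqi[OF h(1)[of n]]]
    by (simp add: norm2_minus_commute[of M f])
  obtain F where F: "sqi N F" "(\<lambda>n. norm2 N (\<lambda>y. transform M e (h n) y - F y)) \<longlonglongrightarrow> 0"
  proof (rule norm2_complete[of N "\<lambda>n. transform M e (h n)"])
    show "sqi N (transform M e (h n))" for n by (intro sqi_transform h)
    fix r :: real assume "r > 0"
    then obtain K where "\<forall>n\<ge>K. norm2 M (\<lambda>x. h n x - f x) < r / 2"
      using LIMSEQ_D[OF h(2), of "r / 2"] by auto
    then show "\<exists>K. \<forall>m\<ge>K. \<forall>n\<ge>K. norm2 N (\<lambda>y. transform M e (h m) y - transform M e (h n) y) < r"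
      unfolding norm2_transform_diff[OF h(1) h(1)]
      by (intro exI[of _ K] allI impI le_less_trans[OF tri]) (metis add_strict_mono field_sum_of_halves)
  qed
  show ?thesis by (rule that, rule L2_transformI[OF f F(1) h F(2)])
qed

lemma L2_transform_lim:
  assumes "L2_transform f F" "\<And>n. L12 (h n)" "(\<lambda>n. norm2 M (\<lambda>x. h n x - f x)) \<longlonglongrightarrow> 0"
  shows "(\<lambda>n. norm2 N (\<lambda>y. transform M e (h n) y - F y)) \<longlonglongrightarrow> 0"
  using assms by (simp add: L2_transform_dist)

lemma L2_transform_norm: "L2_transform f F \<Longrightarrow> norm2 N F = norm2 M f"
  using L2_transform_dist[of f F "\<lambda>x. 0"] by (simp add: L12_def transform_def norm2_def)

lemma L2_transform_add:
  assumes "L2_transform f F" "L2_transform g G"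
  shows "L2_transform (\<lambda>x. f x + g x) (\<lambda>y. F y + G y)"
proof -
  note sq = L2_transform_sqi[OF assms(1)] L2_transform_sqi[OF assms(2)]
  obtain h where h: "\<And>n. L12 (h n)" "(\<lambda>n. norm2 M (\<lambda>x. h n x - f x)) \<longlonglongrightarrow> 0"
    using L12_approximation[OF sq(1)] by blast
  obtain k where k: "\<And>n. L12 (k n)" "(\<lambda>n. norm2 M (\<lambda>x. k n x - g x)) \<longlonglongrightarrow> 0"
    using L12_approximation[OF sq(3)] by blast
  show ?thesis
  proof (rule L2_transformI)
    show "L12 (\<lambda>x. h n x + k n x)" for n by (intro L12_add h k)
    show "(\<lambda>n. norm2 M (\<lambda>x. h n x + k n x - (f x + g x))) \<longlonglongrightarrow> 0"
    proof (rule Lim_null_comparison[OF always_eventually[OF allI] tendsto_add_zero[OF h(2) k(2)]])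
      show "norm (norm2 M (\<lambda>x. h n x + k n x - (f x + g x))) \<le> norm2 M (\<lambda>x. h n x - f x) + norm2 M (\<lambda>x. k n x - g x)" for n
        using norm2_triangle[OF sqi_diff[OF L12_sqi[OF h(1)] sq(1)] sqi_diff[OF L12_sqi[OF k(1)] sq(3)], of n n]
        by (simp add: add_diff_add)
    qed
    show "(\<lambda>n. norm2 N (\<lambda>y. transform M e (\<lambda>x. h n x + k n x) y - (F y + G y))) \<longlonglongrightarrow> 0"
    proof (rule Lim_null_comparison[OF always_eventually[OF allI]
          tendsto_add_zero[OF L2_transform_lim[OF assms(1) h] L2_transform_lim[OF assms(2) k]]])
      fix n
      have "norm2 N (\<lambda>y. transform M e (\<lambda>x. h n x + k n x) y - (F y + G y)) =
         norm2 N (\<lambda>y. (transform M e (h n) y - F y) + (transform M e (k n) y - G y))"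
        using h(1)[of n] k(1)[of n] sqi_transform[OF L12_add[OF h(1)[of n] k(1)[of n]]] sq
          sqi_transform[OF h(1)[of n]] sqi_transform[OF k(1)[of n]]
        by (intro norm2_cong_AE AE_I2) (auto simp: transform_add L12_def add_diff_add)
      also have "\<dots> \<le> norm2 N (\<lambda>y. transform M e (h n) y - F y) + norm2 N (\<lambda>y. transform M e (k n) y - G y)"
        by (intro norm2_triangle sqi_diff sqi_transform h k sq)
      finally show "norm (norm2 N (\<lambda>y. transform M e (\<lambda>x. h n x + k n x) y - (F y + G y))) \<le>
        norm2 N (\<lambda>y. transform M e (h n) y - F y) + norm2 N (\<lambda>y. transform M e (k n) y - G y)" by simp
    qed
  qed (intro sqi_add sq)+
qed

lemma L2_transform_cmult:
  assumes "L2_transform f F"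
  shows "L2_transform (\<lambda>x. c * f x) (\<lambda>y. c * F y)"
proof -
  note sq = L2_transform_sqi[OF assms(1)]
  obtain h where h: "\<And>n. L12 (h n)" "(\<lambda>n. norm2 M (\<lambda>x. h n x - f x)) \<longlonglongrightarrow> 0"
    using L12_approximation[OF sq(1)] by blast
  show ?thesis
  proof (rule L2_transformI)
    show "L12 (\<lambda>x. c * h n x)" for n by (intro L12_cmult h)
    show "(\<lambda>n. norm2 M (\<lambda>x. c * h n x - c * f x)) \<longlonglongrightarrow> 0"
      unfolding right_diff_distrib[symmetric] norm2_cmult using h(2) by (rule tendsto_mult_right_zero)
    show "(\<lambda>n. norm2 N (\<lambda>y. transform M e (\<lambda>x. c * h n x) y - c * F y)) \<longlonglongrightarrow> 0"
      unfolding transform_cmult right_diff_distrib[symmetric] norm2_cmult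
      using L2_transform_lim[OF assms h] by (rule tendsto_mult_right_zero)
  qed (intro sqi_cmult sq)+
qed

lemma L2_transform_diff:
  "L2_transform f F \<Longrightarrow> L2_transform g G \<Longrightarrow> L2_transform (\<lambda>x. f x - g x) (\<lambda>y. F y - G y)"
  using L2_transform_add[of f F "\<lambda>x. (-1) * g x" "\<lambda>y. (-1) * G y"] L2_transform_cmult[of g G "-1"] by simp

lemma L2_transform_unique:
  assumes "L2_transform f F" "L2_transform g G" "AE x in M. f x = g x"
  shows "AE y in N. F y = G y"
proof -
  note D = L2_transform_diff[OF assms(1,2)]
  have "norm2 M (\<lambda>x. f x - g x) = norm2 M (\<lambda>x. 0)"
    using assms L2_transform_sqi[OF D] by (intro norm2_cong_AE) auto
  then have "norm2 N (\<lambda>y. F y - G y) = 0" using L2_transform_norm[OF D] by simp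
  from norm2_eq_0_AE[OF L2_transform_sqi(2)[OF D] this] show ?thesis by simp
qed

lemma L2_transform_inj:
  assumes "L2_transform f F" "L2_transform g G" "AE y in N. F y = G y"
  shows "AE x in M. f x = g x"
proof -
  note D = L2_transform_diff[OF assms(1,2)]
  have "norm2 N (\<lambda>y. F y - G y) = norm2 N (\<lambda>x. 0)"
    using assms L2_transform_sqi[OF D] by (intro norm2_cong_AE) auto
  then have "norm2 M (\<lambda>x. f x - g x) = 0" using L2_transform_norm[OF D] by simp
  from norm2_eq_0_AE[OF L2_transform_sqi(1)[OF D] this] show ?thesis by simp
qed

lemma Re_inner_polar:
  assumes "sqi L f" "sqi L g"
  shows "2 * Re (LINT x|L. f x * cnj (g x)) = (norm2 L (\<lambda>x. f x + g x))\<^sup>2 - (norm2 L f)\<^sup>2 - (norm2 L g)\<^sup>2"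
proof -
  have i: "integrable L (\<lambda>x. f x * cnj (g x))" by (intro sqi_integrable_mult sqi_cnj assms)
  define r where "r x = Re (f x * cnj (g x))" for x
  have r: "integrable L r" "(LINT x|L. r x) = Re (LINT x|L. f x * cnj (g x))"
    unfolding r_def using integrable_Re[OF i] integral_Re[OF i] by auto
  have "(cmod (f x + g x))\<^sup>2 = (cmod (f x))\<^sup>2 + (cmod (g x))\<^sup>2 + 2 * r x" for x
    by (simp add: cmod_power2 power2_sum r_def)
  then show ?thesis
    unfolding norm2_sq r(2)[symmetric] using sqi_integrable[OF assms(1)] sqi_integrable[OF assms(2)] r(1)
    by simp
qed

text \<open>Polarization gives equality of real parts from equality of norms; replacing
  \<open>f\<close> by \<i> f gives the imaginary parts.\<close>

lemma L2_transform_parseval: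
  assumes "L2_transform f F" "L2_transform g G"
  shows "(LINT x|M. f x * cnj (g x)) = (LINT y|N. F y * cnj (G y))"
proof -
  have re: "Re (LINT x|M. f x * cnj (g x)) = Re (LINT y|N. F y * cnj (G y))"
    if "L2_transform f F" "L2_transform g G" for f F g G
  proof -
    have "2 * Re (LINT x|M. f x * cnj (g x)) = 2 * Re (LINT y|N. F y * cnj (G y))"
      using that L2_transform_add[OF that, THEN L2_transform_norm]
      by (simp only: Re_inner_polar L2_transform_sqi L2_transform_norm)
    then show ?thesis by simp
  qed
  have "Re (\<i> * (LINT x|M. f x * cnj (g x))) = Re (\<i> * (LINT y|N. F y * cnj (G y)))"
    using re[OF L2_transform_cmult[OF assms(1), of \<i>] assms(2)] by (simp only: mult.assoc integral_mult_right_zero)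
  with re[OF assms] show ?thesis by (simp add: complex_eq_iff)
qed

text \<open>The adjoint integral, meaningful pointwise when \<open>H\<close> is integrable. Being an
  explicit integral of characters it inherits their periodicity, which an abstract limit in L2 would
  not.\<close>

definition inverse_transform :: "('b \<Rightarrow> complex) \<Rightarrow> 'a \<Rightarrow> complex" where
  "inverse_transform H x = (LINT y|N. H y * cnj (e x y))"

lemma inverse_transform_measurable [measurable]:
  assumes [measurable]: "H \<in> borel_measurable N"
  shows "inverse_transform H \<in> borel_measurable M"
  unfolding inverse_transform_def by measurable

lemma inverse_transform_inner:
  assumes H: "integrable N H" and g: "integrable M g"
  shows "(LINT x|M. inverse_transform H x * cnj (g x)) = (LINT y|N. H y * cnj (transform M e g y))"
proof -
  interpret P: pair_sigma_finite M N ..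
  have [measurable]: "H \<in> borel_measurable N" "g \<in> borel_measurable M" using assms by auto
  let ?Q = "\<lambda>x y. (H y * cnj (e x y)) * cnj (g x)"
  have Q: "integrable (M \<Otimes>\<^sub>M N) (\<lambda>(x, y). ?Q x y)"
  proof (rule Bochner_Integration.integrable_bound)
    show "integrable (M \<Otimes>\<^sub>M N) (\<lambda>p. g (fst p) * H (snd p))" by (rule P.integrable_pair_mult[OF g H])
    show "AE p in M \<Otimes>\<^sub>M N. norm (case p of (x, y) \<Rightarrow> ?Q x y) \<le> norm (g (fst p) * H (snd p))"
    proof (intro AE_I2, clarsimp simp: norm_mult)
      fix a b
      show "cmod (H b) * cmod (e a b) * cmod (g a) \<le> cmod (g a) * cmod (H b)"
        using mult_left_le[OF e_bound[of a b], of "cmod (g a) * cmod (H b)"] by (simp add: mult_ac)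
    qed
  qed measurable
  have "(LINT x|M. inverse_transform H x * cnj (g x)) = (LINT x|M. LINT y|N. ?Q x y)"
    unfolding inverse_transform_def by (simp only: integral_mult_left_zero)
  also have "\<dots> = (LINT y|N. LINT x|M. ?Q x y)"
    by (rule P.Fubini_integral[OF Q, symmetric])
  also have "\<dots> = (LINT y|N. H y * cnj (transform M e g y))"
  proof (rule Bochner_Integration.integral_cong[OF refl])
    fix y
    have "(LINT x|M. ?Q x y) = (LINT x|M. H y * cnj (g x * e x y))" by (simp add: mult_ac)
    also have "\<dots> = H y * cnj (transform M e g y)"
      unfolding transform_def by (subst integral_mult_right_zero) (simp only: Bochner_Integration.integral_cnj)
    finally show "(LINT x|M. ?Q x y) = H y * cnj (transform M e g y)" .
  qed
  finally show ?thesis .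
qed

text \<open>Duality: pairing the inverse transform with its own truncation \<open>h n\<close> and
  using Cauchy-Schwarz bounds the squared norm of \<open>h n\<close> by its norm times that of
  \<open>H\<close>. Truncation makes \<open>h n\<close> admissible before square integrability is
  known; Fatou's lemma removes it.\<close>

lemma
  assumes H: "integrable N H" "sqi N H"
  shows sqi_inverse_transform: "sqi M (inverse_transform H)"
    and norm2_inverse_transform: "norm2 M (inverse_transform H) \<le> norm2 N H"
proof -
  let ?g = "inverse_transform H"
  have [measurable]: "H \<in> borel_measurable N" using H by auto
  have bd: "cmod (?g x) \<le> (LINT y|N. cmod (H y))" if "x \<in> space M" for x
  proof -
    have [measurable]: "x \<in> space M" using that .
    have "cmod (?g x) \<le> (LINT y|N. cmod (H y * cnj (e x y)))"
      unfolding inverse_transform_def by (rule integral_norm_bound)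
    also have "\<dots> \<le> (LINT y|N. cmod (H y))"
    proof (rule integral_mono)
      show "integrable N (\<lambda>y. cmod (H y * cnj (e x y)))"
        by (rule integrable_norm, rule Bochner_Integration.integrable_bound[OF H(1)])
          (use e_bound in \<open>auto simp: norm_mult mult_left_le\<close>)
    qed (use H e_bound in \<open>auto simp: norm_mult mult_left_le\<close>)
    finally show ?thesis .
  qed
  obtain A :: "nat \<Rightarrow> 'a set" where A: "range A \<subseteq> sets M" "(\<Union>i. A i) = space M"
      "\<And>i. emeasure M (A i) \<noteq> \<infinity>" "incseq A"
    using M.sigma_finite_incseq by metis
  have [measurable]: "A n \<in> sets M" for n using A(1) by auto
  define h where "h n x = ?g x * indicator (A n) x" for n x
  define C where "C = (LINT y|N. cmod (H y))"
  have ind: "integrable M (indicator (A n) :: 'a \<Rightarrow> real)" for n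
    using A(3) by (intro integrable_real_indicator) (auto simp: less_top)
  have h_meas [measurable]: "h n \<in> borel_measurable M" for n unfolding h_def by measurable
  have h: "L12 (h n)" for n
    unfolding L12_def sqi_def
  proof (intro conjI)
    show "integrable M (h n)"
      by (rule Bochner_Integration.integrable_bound[OF integrable_mult_right[OF ind[of n], of C]])
        (use bd in \<open>auto simp: h_def C_def split: split_indicator intro!: AE_I2\<close>)
    have "C \<ge> 0" unfolding C_def by (rule integral_nonneg_AE) simp
    then show "integrable M (\<lambda>x. (cmod (h n x))\<^sup>2)"
      by (intro Bochner_Integration.integrable_bound[OF integrable_mult_right[OF ind[of n], of "C\<^sup>2"]])
        (use bd in \<open>auto simp: h_def C_def split: split_indicator intro!: AE_I2 power_mono\<close>)
  qed simp
  have le: "norm2 M (h n) \<le> norm2 N H" for n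
  proof -
    have "complex_of_real ((norm2 M (h n))\<^sup>2) = (LINT x|M. ?g x * cnj (h n x))"
    proof -
      have "complex_of_real ((cmod (h n x))\<^sup>2) = ?g x * cnj (h n x)" for x
        unfolding complex_norm_square by (simp add: h_def split: split_indicator)
      then show ?thesis unfolding norm2_sq by (simp only: integral_complex_of_real[symmetric])
    qed
    also have "\<dots> = (LINT y|N. H y * cnj (transform M e (h n) y))"
      by (rule inverse_transform_inner[OF H(1) L12_integrable[OF h]])
    finally have "(norm2 M (h n))\<^sup>2 = cmod (LINT y|N. H y * cnj (transform M e (h n) y))"
      by (metis norm_of_real abs_power2)
    also have "\<dots> \<le> norm2 N H * norm2 N (\<lambda>y. cnj (transform M e (h n) y))"
      by (intro norm2_inner_bound H sqi_cnj sqi_transform h)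
    also have "norm2 N (\<lambda>y. cnj (transform M e (h n) y)) = norm2 M (h n)"
      using norm2_transform[OF h] by (simp add: norm2_def)
    finally have "norm2 M (h n) * norm2 M (h n) \<le> norm2 N H * norm2 M (h n)"
      by (simp add: power2_eq_square)
    then show ?thesis
      by (cases "norm2 M (h n) = 0") (auto simp: mult_le_cancel_right less_le)
  qed
  have "(\<integral>\<^sup>+x. ennreal ((cmod (?g x))\<^sup>2) \<partial>M) = (\<integral>\<^sup>+x. liminf (\<lambda>n. ennreal ((cmod (h n x))\<^sup>2)) \<partial>M)"
  proof (rule nn_integral_cong)
    fix x assume "x \<in> space M"
    then obtain k where k: "x \<in> A k" using A(2) by auto
    have "h n x = ?g x" if "n \<ge> k" for n
      using k incseqD[OF A(4) that] by (auto simp: h_def)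
    then have "(\<lambda>n. ennreal ((cmod (h n x))\<^sup>2)) \<longlonglongrightarrow> ennreal ((cmod (?g x))\<^sup>2)"
      by (intro tendsto_eventually eventually_sequentiallyI[of k]) simp
    then show "ennreal ((cmod (?g x))\<^sup>2) = liminf (\<lambda>n. ennreal ((cmod (h n x))\<^sup>2))"
      by (intro lim_imp_Liminf[symmetric]) auto
  qed
  also have "\<dots> \<le> liminf (\<lambda>n. \<integral>\<^sup>+x. ennreal ((cmod (h n x))\<^sup>2) \<partial>M)"
    by (rule nn_integral_liminf) measurable
  also have "\<dots> \<le> ennreal ((norm2 N H)\<^sup>2)"
    using le by (intro Liminf_le) (auto simp: nn_norm2[OF L12_sqi[OF h]] intro!: ennreal_leI power_mono)
  finally have le2: "(\<integral>\<^sup>+x. ennreal ((cmod (?g x))\<^sup>2) \<partial>M) \<le> ennreal ((norm2 N H)\<^sup>2)" .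
  show *: "sqi M ?g" using le2 by (intro sqi_nnI) (auto intro: le_less_trans)
  from le2 have "(norm2 M ?g)\<^sup>2 \<le> (norm2 N H)\<^sup>2" by (simp add: nn_norm2[OF *])
  then show "norm2 M ?g \<le> norm2 N H" by (rule power2_le_imp_le) simp
qed

end

section \<open>Fourier analysis on the period cell\<close>

definition cellm :: "pt measure" where
  "cellm = circle \<Otimes>\<^sub>M (lborel \<Otimes>\<^sub>M circle)"

type_synonym freq = "int \<times> real \<times> int"

definition freqm :: "freq measure" where
  "freqm = count_space UNIV \<Otimes>\<^sub>M (lborel \<Otimes>\<^sub>M count_space UNIV)"

definition chr :: "pt \<Rightarrow> freq \<Rightarrow> complex" where
  "chr p q = e_circle (fst p) (fst q) * (e_line (fst (snd p)) (fst (snd q)) * e_circle (snd (snd p)) (snd (snd q)))"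

lemma plancherel_cell: "plancherel_kernel cellm freqm chr"
  using plancherel_kernel_pair[OF plancherel_circle plancherel_kernel_pair[OF plancherel_line plancherel_circle]]
  unfolding cellm_def freqm_def chr_def[abs_def] .

interpretation cell: plancherel_kernel cellm freqm chr
  by (rule plancherel_cell)

definition kap :: real where "kap = 1 / sqrt (2 * pi) * (1 / sqrt (2 * pi) * (1 / sqrt (2 * pi)))"

lemma kap_pos: "kap > 0" by (simp add: kap_def)

lemma chr_eq: "chr (x, y, z) (k, \<eta>, l) = kap * cis (- (of_int k * x + \<eta> * y + of_int l * z))"
proof -
  define s where "s = complex_of_real (sqrt (2 * pi))"
  define a b c where "a = cis (- (of_int k * x))" and "b = cis (- (\<eta> * y))" and "c = cis (- (of_int l * z))"
  have "chr (x, y, z) (k, \<eta>, l) = (a / s) * ((b / s) * (c / s))"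
    by (simp add: chr_def e_circle_def e_line_def a_def b_def c_def s_def)
  also have "\<dots> = (1 / s * (1 / s * (1 / s))) * (a * (b * c))" by simp
  also have "1 / s * (1 / s * (1 / s)) = complex_of_real kap"
    by (simp only: kap_def s_def of_real_mult of_real_divide of_real_1)
  also have "a * (b * c) = cis (- (of_int k * x + \<eta> * y + of_int l * z))"
    unfolding a_def b_def c_def cis_mult by (rule arg_cong[where f = cis]) simp
  finally show ?thesis .
qed

lemma sets_cellm [measurable_cong, simp]: "sets cellm = sets borel"
proof -
  have "sets cellm = sets (borel \<Otimes>\<^sub>M (borel \<Otimes>\<^sub>M borel) :: pt measure)"
    unfolding cellm_def by (intro sets_pair_measure_cong) simp_all
  then show ?thesis by (simp only: borel_prod)
qed

lemma space_cellm [simp]: "space cellm = UNIV"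
  using sets_eq_imp_space_eq[OF sets_cellm] by simp

lemma borel_measurable_cellm [simp]: "borel_measurable cellm = borel_measurable borel"
  by (rule measurable_cong_sets) auto

lemma cellm_eq: "cellm = density lborel (indicator cell)"
proof -
  have 1: "(lborel :: real measure) = density lborel (\<lambda>_. 1)" by (simp add: density_1)
  interpret c: sigma_finite_measure "density lborel (indicator {0..2 * pi})"
    using circle.sigma_finite_measure_axioms by (simp add: circle_def)
  have "lborel \<Otimes>\<^sub>M circle = density (lborel \<Otimes>\<^sub>M lborel) (\<lambda>(y, z). 1 * indicator {0..2 * pi} (z::real))"
    using pair_measure_density[of "\<lambda>_. 1" lborel "indicator {0..2 * pi}" lborel, OF _ _ sigma_finite_lborel c.sigma_finite_measure_axioms]
    unfolding circle_def by (simp add: density_1)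
  then have 2: "lborel \<Otimes>\<^sub>M circle = density lborel (\<lambda>(y::real, z). indicator {0..2 * pi} z)"
    by (simp add: lborel_prod)
  interpret d: sigma_finite_measure "(lborel :: real measure) \<Otimes>\<^sub>M circle"
    by (rule sigma_finite_pair_measure) (unfold_locales)
  have d: "sigma_finite_measure (density lborel (\<lambda>(y::real, z). indicator {0..2 * pi} z))"
    using d.sigma_finite_measure_axioms unfolding 2 .
  have m: "(\<lambda>(y::real, z). indicator {0..2 * pi} z :: ennreal) \<in> borel_measurable (lborel :: (real \<times> real) measure)"
    unfolding lborel_prod[symmetric] by measurable
  have "cellm = density (lborel \<Otimes>\<^sub>M lborel) (\<lambda>(x::real, q). indicator {0..2 * pi} x * (case q of (y::real, z) \<Rightarrow> indicator {0..2 * pi} z))"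
    unfolding cellm_def 2 unfolding circle_def
    by (rule pair_measure_density[OF _ m sigma_finite_lborel d]) simp
  also have "\<dots> = density lborel (indicator cell)"
    unfolding lborel_prod by (intro arg_cong2[where f = density] refl) (auto simp: cell_def fun_eq_iff indicator_def)
  finally show ?thesis .
qed

lemma integral_cellm:
  fixes f :: "pt \<Rightarrow> 'b::{banach, second_countable_topology}"
  assumes "f \<in> borel_measurable borel"
  shows "(LINT w:cell|lborel. f w) = (LINT w|cellm. f w)"
proof -
  have m: "cell \<in> sets borel" unfolding cell_def by (intro borel_closed closed_Times) auto
  have "cellm = density lborel (\<lambda>x. ennreal (indicator cell x))"
    unfolding cellm_eq by (intro density_cong) (use m in \<open>auto split: split_indicator\<close>)
  then show ?thesis using integral_density[of f lborel "indicator cell"] assms m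
    by (simp add: set_lebesgue_integral_def)
qed

lemma integrable_cellm:
  fixes f :: "pt \<Rightarrow> 'b::{banach, second_countable_topology}"
  assumes "f \<in> borel_measurable borel"
  shows "set_integrable lborel cell f \<longleftrightarrow> integrable cellm f"
proof -
  have m: "cell \<in> sets borel" unfolding cell_def by (intro borel_closed closed_Times) auto
  have "cellm = density lborel (\<lambda>x. ennreal (indicator cell x))"
    unfolding cellm_eq by (intro density_cong) (use m in \<open>auto split: split_indicator\<close>)
  then show ?thesis using integrable_density[of f lborel "indicator cell"] assms m
    by (simp add: set_integrable_def)
qed

lemma AE_cellm:
  assumes "AE w in lborel. P w"
  shows "AE w in cellm. P w"
proof -
  have m: "(indicator cell :: pt \<Rightarrow> ennreal) \<in> borel_measurable lborel"
    unfolding cell_def by (intro borel_measurable_indicator) (auto intro!: borel_closed closed_Times)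
  show ?thesis unfolding cellm_eq AE_density[OF m] using assms by eventually_elim simp
qed

definition cr :: "(pt \<Rightarrow> real) \<Rightarrow> pt \<Rightarrow> complex" where
  "cr f w = complex_of_real (f w)"

lemma cr_measurable [measurable]: "f \<in> borel_measurable M \<Longrightarrow> cr f \<in> borel_measurable M"
  unfolding cr_def[abs_def] by measurable

lemma cr_measurable_iff: "cr f \<in> borel_measurable M \<longleftrightarrow> f \<in> borel_measurable M"
proof
  assume "cr f \<in> borel_measurable M"
  from measurable_compose[OF this borel_measurable_Re] show "f \<in> borel_measurable M" by (simp add: cr_def)
qed measurable

lemma L2_iff: "L2 f \<longleftrightarrow> periodic_xz f \<and> sqi cellm (cr f)"
  using integrable_cellm[of "\<lambda>w. (f w)\<^sup>2"] by (auto simp: L2_def sqi_def cr_measurable_iff) (auto simp: cr_def)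

lemma L2_sqi: "L2 f \<Longrightarrow> sqi cellm (cr f)" and L2_periodic: "L2 f \<Longrightarrow> periodic_xz f"
  by (simp_all add: L2_iff)

lemma L2_borel [measurable_dest]: "L2 f \<Longrightarrow> f \<in> borel_measurable borel"
  by (simp add: L2_def)

lemma L2_norm_eq: "f \<in> borel_measurable borel \<Longrightarrow> L2_norm f = norm2 cellm (cr f)"
  unfolding L2_norm_def norm2_def by (subst integral_cellm) (auto simp: cr_def)

lemma ip_eq: "f \<in> borel_measurable borel \<Longrightarrow> g \<in> borel_measurable borel \<Longrightarrow> ip f g = (LINT w|cellm. f w * g w)"
  unfolding ip_def by (rule integral_cellm) measurable

lemma ip_complex:
  "f \<in> borel_measurable borel \<Longrightarrow> g \<in> borel_measurable borel \<Longrightarrow>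
    complex_of_real (ip f g) = (LINT w|cellm. cr f w * cr g w)"
  by (subst ip_eq) (auto simp: cr_def simp flip: integral_complex_of_real)

subsection \<open>Translations\<close>

text \<open>Exactly one translate of \<open>x\<close> by a multiple of 2\<pi> lies in a half-open
  interval of length 2\<pi>; a floor finds it. This acts as a partition of unity.\<close>

lemma nn_integral_period_indicator:
  "(\<integral>\<^sup>+n. indicator {b..<b + 2 * pi} (x + 2 * pi * of_int n) \<partial>count_space (UNIV :: int set)) = 1"
proof -
  define m where "m = - \<lfloor>(x - b) / (2 * pi)\<rfloor>"
  have iff: "x + 2 * pi * of_int n \<in> {b..<b + 2 * pi} \<longleftrightarrow> n = m" for n
  proof -
    have "x + 2 * pi * of_int n \<in> {b..<b + 2 * pi} \<longleftrightarrow> of_int (- n) \<le> (x - b) / (2 * pi) \<and> (x - b) / (2 * pi) < of_int (- n) + 1"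
      using pi_gt_zero by (simp add: field_simps)
    also have "\<dots> \<longleftrightarrow> \<lfloor>(x - b) / (2 * pi)\<rfloor> = - n" by (simp only: floor_eq_iff)
    finally show ?thesis unfolding m_def by auto
  qed
  have "(\<integral>\<^sup>+n. indicator {b..<b + 2 * pi} (x + 2 * pi * of_int n) \<partial>count_space (UNIV :: int set)) =
     (\<integral>\<^sup>+n. indicator {m} n \<partial>count_space UNIV)"
    by (rule nn_integral_cong) (use iff in \<open>auto simp: indicator_def\<close>)
  then show ?thesis by simp
qed

lemma periodic_int:
  fixes h :: "real \<Rightarrow> 'b"
  assumes "\<And>x. h (x + 2 * pi) = h x"
  shows "h (x + 2 * pi * of_int n) = h x"
proof -
  have nat: "h (x + 2 * pi * of_nat m) = h x" for x m
  proof (induction m)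
    case (Suc m)
    have "h (x + 2 * pi * of_nat (Suc m)) = h (x + 2 * pi * of_nat m + 2 * pi)" by (simp add: algebra_simps)
    then show ?case using Suc assms by simp
  qed simp
  show ?thesis
  proof (cases n)
    case (nonneg m)
    then show ?thesis using nat[of x m] by simp
  next
    case (neg m)
    then have "h (x + 2 * pi * of_int n) = h (x + 2 * pi * of_int n + 2 * pi * of_nat (Suc m))"
      using nat[of "x + 2 * pi * of_int n" "Suc m"] by simp
    also have "x + 2 * pi * of_int n + 2 * pi * of_nat (Suc m) = x" unfolding neg by (simp add: algebra_simps)
    finally show ?thesis .
  qed
qed

text \<open>Insert the partition of unity for [0, 2\<pi>), shift each summand, and add up the
  partition for [a, a + 2\<pi>) instead. No case distinction on \<open>a\<close> arises, and
  nonnegativity justifies every interchange.\<close>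

lemma nn_integral_period:
  fixes h :: "real \<Rightarrow> ennreal"
  assumes [measurable]: "h \<in> borel_measurable borel" and per: "\<And>x. h (x + 2 * pi) = h x"
  shows "(\<integral>\<^sup>+x. h x * indicator {a..<a + 2 * pi} x \<partial>lborel) = (\<integral>\<^sup>+x. h x * indicator {0..<2 * pi} x \<partial>lborel)"
proof -
  have "(\<integral>\<^sup>+x. h x * indicator {a..<a + 2 * pi} x \<partial>lborel) =
    (\<integral>\<^sup>+x. h x * indicator {a..<a + 2 * pi} x * (\<integral>\<^sup>+n. indicator {0..<0 + 2 * pi} (x + 2 * pi * of_int n) \<partial>count_space (UNIV :: int set)) \<partial>lborel)"
    unfolding nn_integral_period_indicator by simp
  also have "\<dots> = (\<integral>\<^sup>+x. (\<integral>\<^sup>+n. h x * indicator {a..<a + 2 * pi} x * indicator {0..<2 * pi} (x + 2 * pi * of_int n) \<partial>count_space (UNIV :: int set)) \<partial>lborel)"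
    by (subst nn_integral_cmult) auto
  also have "\<dots> = (\<integral>\<^sup>+n. \<integral>\<^sup>+x. h x * indicator {a..<a + 2 * pi} x * indicator {0..<2 * pi} (x + 2 * pi * of_int n) \<partial>lborel \<partial>count_space (UNIV :: int set))"
    by (rule nn_integral_count_space_nn_integral) auto
  also have "\<dots> = (\<integral>\<^sup>+n. \<integral>\<^sup>+x. h x * indicator {0..<2 * pi} x * indicator {a..<a + 2 * pi} (x + 2 * pi * of_int (- n)) \<partial>lborel \<partial>count_space (UNIV :: int set))"
  proof (rule nn_integral_cong)
    fix n :: int
    have "(\<integral>\<^sup>+x. h x * indicator {a..<a + 2 * pi} x * indicator {0..<2 * pi} (x + 2 * pi * of_int n) \<partial>lborel) =
      (\<integral>\<^sup>+x. h (2 * pi * of_int (- n) + 1 * x) * indicator {a..<a + 2 * pi} (2 * pi * of_int (- n) + 1 * x) * indicator {0..<2 * pi} (2 * pi * of_int (- n) + 1 * x + 2 * pi * of_int n) \<partial>lborel)"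
      by (subst nn_integral_real_affine[where t = "2 * pi * of_int (- n)" and c = 1]) auto
    also have "\<dots> = (\<integral>\<^sup>+x. h x * indicator {0..<2 * pi} x * indicator {a..<a + 2 * pi} (x + 2 * pi * of_int (- n)) \<partial>lborel)"
    proof (intro nn_integral_cong)
      fix x
      have "h (2 * pi * of_int (- n) + 1 * x) = h x"
        using periodic_int[of h, OF per, of x "- n"] by (simp add: add.commute)
      moreover have "2 * pi * of_int (- n) + 1 * x + 2 * pi * of_int n = x"
        "2 * pi * of_int (- n) + 1 * x = x + 2 * pi * of_int (- n)" by (simp_all add: algebra_simps)
      ultimately show "h (2 * pi * of_int (- n) + 1 * x) * indicator {a..<a + 2 * pi} (2 * pi * of_int (- n) + 1 * x) * indicator {0..<2 * pi} (2 * pi * of_int (- n) + 1 * x + 2 * pi * of_int n) =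
         h x * indicator {0..<2 * pi} x * indicator {a..<a + 2 * pi} (x + 2 * pi * of_int (- n))"
        by (simp only: mult_ac)
    qed
    finally show "(\<integral>\<^sup>+x. h x * indicator {a..<a + 2 * pi} x * indicator {0..<2 * pi} (x + 2 * pi * of_int n) \<partial>lborel) = \<dots>" .
  qed
  also have "\<dots> = (\<integral>\<^sup>+x. (\<integral>\<^sup>+n. h x * indicator {0..<2 * pi} x * indicator {a..<a + 2 * pi} (x + 2 * pi * of_int (- n)) \<partial>count_space (UNIV :: int set)) \<partial>lborel)"
    by (rule nn_integral_count_space_nn_integral[symmetric]) auto
  also have "\<dots> = (\<integral>\<^sup>+x. h x * indicator {0..<2 * pi} x * (\<integral>\<^sup>+n. indicator {a..<a + 2 * pi} (x + 2 * pi * of_int (- n)) \<partial>count_space (UNIV :: int set)) \<partial>lborel)"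
    by (subst nn_integral_cmult) auto
  also have "\<dots> = (\<integral>\<^sup>+x. h x * indicator {0..<2 * pi} x \<partial>lborel)"
  proof -
    have "bij_betw uminus (UNIV :: int set) UNIV" by (rule bij_betwI[of _ _ _ uminus]) auto
    from nn_integral_bij_count_space[OF this, of "\<lambda>n. indicator {a..<a + 2 * pi} (x + 2 * pi * of_int n)" for x]
    show ?thesis by (simp add: nn_integral_period_indicator)
  qed
  finally show ?thesis .
qed

lemma nn_integral_circle_shift:
  fixes h :: "real \<Rightarrow> ennreal"
  assumes [measurable]: "h \<in> borel_measurable borel" and per: "\<And>x. h (x + 2 * pi) = h x"
  shows "(\<integral>\<^sup>+x. h (x + a) \<partial>circle) = (\<integral>\<^sup>+x. h x \<partial>circle)"
proof -
  have c: "(\<integral>\<^sup>+x. g x \<partial>circle) = (\<integral>\<^sup>+x. g x * indicator {0..<2 * pi} x \<partial>lborel)"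
    if [measurable]: "g \<in> borel_measurable borel" for g :: "real \<Rightarrow> ennreal"
  proof -
    have "(\<integral>\<^sup>+x. g x \<partial>circle) = (\<integral>\<^sup>+x. indicator {0..2 * pi} x * g x \<partial>lborel)"
      unfolding circle_def by (rule nn_integral_density) auto
    \<comment> \<open>Half-open intervals tile the line without overlap; the additional end point in
      \<open>circle\<close> is a null set.\<close>
    also have "\<dots> = (\<integral>\<^sup>+x. g x * indicator {0..<2 * pi} x \<partial>lborel)"
      by (intro nn_integral_cong_AE AE_I[where N = "{2 * pi}"]) (auto simp: indicator_def split: if_splits)
    finally show ?thesis .
  qed
  have "(\<integral>\<^sup>+x. h (x + a) \<partial>circle) = (\<integral>\<^sup>+x. h (x + a) * indicator {0..<2 * pi} x \<partial>lborel)"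
    by (rule c) measurable
  also have "\<dots> = (\<integral>\<^sup>+x. h (- a + 1 * x + a) * indicator {0..<2 * pi} (- a + 1 * x) \<partial>lborel)"
    by (subst nn_integral_real_affine[where t = "- a" and c = 1]) auto
  also have "\<dots> = (\<integral>\<^sup>+x. h x * indicator {a..<a + 2 * pi} x \<partial>lborel)"
    by (intro nn_integral_cong) (auto simp: indicator_def)
  also have "\<dots> = (\<integral>\<^sup>+x. h x \<partial>circle)"
    using nn_integral_period[OF assms] c[OF assms(1)] by simp
  finally show ?thesis .
qed

text \<open>Invariance is demanded for nonnegative periodic integrands; norms, real integrals and
  complex integrals are derived from it once, for shears and translations alike.\<close>

definition period_invariant :: "(pt \<Rightarrow> pt) \<Rightarrow> bool" where
  "period_invariant T \<longleftrightarrow> T \<in> borel_measurable borel \<and>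
     (\<forall>F :: pt \<Rightarrow> ennreal. F \<in> borel_measurable borel \<longrightarrow>
        (\<forall>x y z. F (x + 2 * pi, y, z) = F (x, y, z) \<and> F (x, y, z + 2 * pi) = F (x, y, z)) \<longrightarrow>
        (\<integral>\<^sup>+w. F (T w) \<partial>cellm) = (\<integral>\<^sup>+w. F w \<partial>cellm))"

interpretation lc: sigma_finite_measure "(lborel :: real measure) \<Otimes>\<^sub>M circle"
  by (rule sigma_finite_pair_measure) unfold_locales

interpretation clc: pair_sigma_finite circle "(lborel :: real measure) \<Otimes>\<^sub>M circle" ..

lemma nn_integral_cellm:
  assumes "F \<in> borel_measurable borel"
  shows "(\<integral>\<^sup>+w. F w \<partial>cellm) = (\<integral>\<^sup>+x. \<integral>\<^sup>+y. \<integral>\<^sup>+z. F (x, y, z) \<partial>circle \<partial>lborel \<partial>circle)"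
    and "(\<integral>\<^sup>+w. F w \<partial>cellm) = (\<integral>\<^sup>+q. \<integral>\<^sup>+x. F (x, q) \<partial>circle \<partial>(lborel \<Otimes>\<^sub>M circle))"
proof -
  have [measurable]: "F \<in> borel_measurable (circle \<Otimes>\<^sub>M (lborel \<Otimes>\<^sub>M circle))"
    using assms cellm_def by (metis borel_measurable_cellm)
  show "(\<integral>\<^sup>+w. F w \<partial>cellm) = (\<integral>\<^sup>+x. \<integral>\<^sup>+y. \<integral>\<^sup>+z. F (x, y, z) \<partial>circle \<partial>lborel \<partial>circle)"
    unfolding cellm_def by (simp add: lc.nn_integral_fst[symmetric] circle.nn_integral_fst[symmetric])
  show "(\<integral>\<^sup>+w. F w \<partial>cellm) = (\<integral>\<^sup>+q. \<integral>\<^sup>+x. F (x, q) \<partial>circle \<partial>(lborel \<Otimes>\<^sub>M circle))"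
    unfolding cellm_def by (simp add: clc.nn_integral_snd)
qed

text \<open>The shift may depend on (y, z) because the circle integral over \<open>x\<close> is
  evaluated innermost; this covers the shear.\<close>

lemma period_invariant_x:
  assumes [measurable]: "a \<in> borel_measurable borel"
  shows "period_invariant (\<lambda>(x, y, z). (x + a (y, z), y, z))"
  unfolding period_invariant_def
proof (intro conjI allI impI)
  show m: "(\<lambda>(x, y, z). (x + a (y, z), y, z)) \<in> borel_measurable borel"
    unfolding case_prod_beta' by (intro borel_measurable_Pair borel_measurable_add measurable_compose[OF _ assms])
      (auto intro!: borel_measurable_continuous_onI continuous_intros)
  fix F :: "pt \<Rightarrow> ennreal" assume [measurable]: "F \<in> borel_measurable borel"
    and F: "\<forall>x y z. F (x + 2 * pi, y, z) = F (x, y, z) \<and> F (x, y, z + 2 * pi) = F (x, y, z)"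
  have "(\<lambda>x. F (x, q)) \<in> borel_measurable borel" for q
    by (rule measurable_compose[of "\<lambda>x. (x, q)" borel borel]) (auto intro!: borel_measurable_continuous_onI continuous_intros)
  then have "(\<integral>\<^sup>+x. F (x + a q, q) \<partial>circle) = (\<integral>\<^sup>+x. F (x, q) \<partial>circle)" for q
  proof (intro nn_integral_circle_shift[of "\<lambda>x. F (x, q)" "a q"])
    show "F (x + 2 * pi, q) = F (x, q)" for x using F by (cases q) simp
  qed
  then show "(\<integral>\<^sup>+w. F (case w of (x, y, z) \<Rightarrow> (x + a (y, z), y, z)) \<partial>cellm) = (\<integral>\<^sup>+w. F w \<partial>cellm)"
    using measurable_compose[OF m, of F borel]
    by (subst (1 2) nn_integral_cellm(2)) (auto simp: case_prod_beta')
qed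

lemma period_invariant_yz: "period_invariant (\<lambda>(x, y, z). (x, y + b, z + c))"
  unfolding period_invariant_def
proof (intro conjI allI impI)
  show m: "(\<lambda>(x, y, z). (x, y + b, z + c)) \<in> borel_measurable (borel :: pt measure)"
    unfolding case_prod_beta' by (auto intro!: borel_measurable_continuous_onI continuous_intros)
  fix F :: "pt \<Rightarrow> ennreal" assume [measurable]: "F \<in> borel_measurable borel"
    and F: "\<forall>x y z. F (x + 2 * pi, y, z) = F (x, y, z) \<and> F (x, y, z + 2 * pi) = F (x, y, z)"
  have z: "(\<lambda>z. F (x, y, z)) \<in> borel_measurable borel" for x y
    by (rule measurable_compose[of "\<lambda>z. (x, y, z)" borel borel]) (auto intro!: borel_measurable_continuous_onI continuous_intros)
  have yz: "(\<lambda>(y, z). F (x, y, z)) \<in> borel_measurable (borel \<Otimes>\<^sub>M borel)" for x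
    unfolding borel_prod case_prod_beta' by (rule measurable_compose[of "\<lambda>q. (x, fst q, snd q)" borel borel]) (auto intro!: borel_measurable_continuous_onI continuous_intros)
  have y: "(\<lambda>y. \<integral>\<^sup>+z. F (x, y, z) \<partial>circle) \<in> borel_measurable borel" for x
    using yz[of x] by measurable
  have "(\<integral>\<^sup>+w. F (case w of (x, y, z) \<Rightarrow> (x, y + b, z + c)) \<partial>cellm) = (\<integral>\<^sup>+x. \<integral>\<^sup>+y. \<integral>\<^sup>+z. F (x, y + b, z + c) \<partial>circle \<partial>lborel \<partial>circle)"
    using measurable_compose[OF m, of F borel] by (subst nn_integral_cellm(1)) auto
  also have "\<dots> = (\<integral>\<^sup>+x. \<integral>\<^sup>+y. \<integral>\<^sup>+z. F (x, b + 1 * y, z) \<partial>circle \<partial>lborel \<partial>circle)"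
  proof -
    have "(\<integral>\<^sup>+z. F (x, y', z + c) \<partial>circle) = (\<integral>\<^sup>+z. F (x, y', z) \<partial>circle)" for x y'
      by (rule nn_integral_circle_shift[OF z]) (use F in simp)
    then show ?thesis by (simp add: add.commute)
  qed
  also have "\<dots> = (\<integral>\<^sup>+x. \<integral>\<^sup>+y. \<integral>\<^sup>+z. F (x, y, z) \<partial>circle \<partial>lborel \<partial>circle)"
  proof -
    have "(\<integral>\<^sup>+y. \<integral>\<^sup>+z. F (x, b + 1 * y, z) \<partial>circle \<partial>lborel) = (\<integral>\<^sup>+y. \<integral>\<^sup>+z. F (x, y, z) \<partial>circle \<partial>lborel)" for x
      using nn_integral_real_affine[OF y, of 1 x b] by simp
    then show ?thesis by (simp only:)
  qed
  also have "\<dots> = (\<integral>\<^sup>+w. F w \<partial>cellm)" by (subst nn_integral_cellm(1)) auto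
  finally show "(\<integral>\<^sup>+w. F (case w of (x, y, z) \<Rightarrow> (x, y + b, z + c)) \<partial>cellm) = (\<integral>\<^sup>+w. F w \<partial>cellm)" .
qed

definition pxz :: "(pt \<Rightarrow> 'b) \<Rightarrow> bool" where
  "pxz f \<longleftrightarrow> (\<forall>x y z. f (x + 2 * pi, y, z) = f (x, y, z) \<and> f (x, y, z + 2 * pi) = f (x, y, z))"

lemma periodic_xz_eq: "periodic_xz f = pxz f"
  by (simp add: periodic_xz_def pxz_def)

lemma pxz_cr [simp]: "pxz (cr f) \<longleftrightarrow> pxz f"
  by (simp add: pxz_def cr_def)

lemma period_invariant_measurable: "period_invariant T \<Longrightarrow> T \<in> borel_measurable borel"
  by (simp add: period_invariant_def)

lemma period_invariant_nn:
  assumes "period_invariant T" "F \<in> borel_measurable borel" "pxz F"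
  shows "(\<integral>\<^sup>+w. F (T w) \<partial>cellm) = (\<integral>\<^sup>+w. F w \<partial>cellm)"
  using assms unfolding period_invariant_def pxz_def by blast

lemma period_invariant_norm2:
  assumes T: "period_invariant T" and f: "f \<in> borel_measurable borel" "pxz f"
  shows "sqi cellm (\<lambda>w. f (T w)) \<longleftrightarrow> sqi cellm f" "norm2 cellm (\<lambda>w. f (T w)) = norm2 cellm f"
proof -
  have m: "(\<lambda>w. f (T w)) \<in> borel_measurable borel"
    using measurable_compose[OF period_invariant_measurable[OF T] f(1)] .
  have e: "(\<integral>\<^sup>+w. ennreal ((cmod (f (T w)))\<^sup>2) \<partial>cellm) = (\<integral>\<^sup>+w. ennreal ((cmod (f w))\<^sup>2) \<partial>cellm)"
    using f by (intro period_invariant_nn[OF T, of "\<lambda>w. ennreal ((cmod (f w))\<^sup>2)"]) (auto simp: pxz_def)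
  show "sqi cellm (\<lambda>w. f (T w)) \<longleftrightarrow> sqi cellm f"
    using f m e by (simp add: sqi_iff_nn)
  show "norm2 cellm (\<lambda>w. f (T w)) = norm2 cellm f"
    unfolding norm2_def using f m e by (subst (1 2) integral_eq_nn_integral) auto
qed

lemma period_invariant_integral_real:
  fixes f :: "pt \<Rightarrow> real"
  assumes T: "period_invariant T" and f: "f \<in> borel_measurable borel" "pxz f"
  shows "integrable cellm (\<lambda>w. f (T w)) \<longleftrightarrow> integrable cellm f"
    "integrable cellm f \<Longrightarrow> (LINT w|cellm. f (T w)) = (LINT w|cellm. f w)"
proof -
  have m: "(\<lambda>w. f (T w)) \<in> borel_measurable borel"
    using measurable_compose[OF period_invariant_measurable[OF T] f(1)] .
  have e: "(\<integral>\<^sup>+w. ennreal (g (f (T w))) \<partial>cellm) = (\<integral>\<^sup>+w. ennreal (g (f w)) \<partial>cellm)"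
    if [measurable]: "g \<in> borel_measurable borel" for g :: "real \<Rightarrow> real"
    using f by (intro period_invariant_nn[OF T, of "\<lambda>w. ennreal (g (f w))"]) (auto simp: pxz_def)
  show i: "integrable cellm (\<lambda>w. f (T w)) \<longleftrightarrow> integrable cellm f"
    using f m e[of abs] by (simp add: integrable_iff_bounded)
  show "(LINT w|cellm. f (T w)) = (LINT w|cellm. f w)" if "integrable cellm f"
    using that i e[of "\<lambda>x. x"] e[of "\<lambda>x. - x"] by (subst (1 2) real_lebesgue_integral_def) auto
qed

lemma period_invariant_integral:
  fixes f :: "pt \<Rightarrow> complex"
  assumes T: "period_invariant T" and f: "integrable cellm f" "pxz f"
  shows "integrable cellm (\<lambda>w. f (T w))" "(LINT w|cellm. f (T w)) = (LINT w|cellm. f w)"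
proof -
  have m: "f \<in> borel_measurable borel" using f(1) by auto
  have m': "(\<lambda>w. f (T w)) \<in> borel_measurable borel"
    using measurable_compose[OF period_invariant_measurable[OF T] m] .
  have p: "pxz (\<lambda>w. Re (f w))" "pxz (\<lambda>w. Im (f w))" "pxz (\<lambda>w. cmod (f w))" using f(2) by (auto simp: pxz_def)
  have "integrable cellm (\<lambda>w. cmod (f (T w)))"
    using period_invariant_integral_real(1)[OF T _ p(3)] f m by simp
  then show i: "integrable cellm (\<lambda>w. f (T w))" using m' by (simp add: integrable_norm_iff)
  show "(LINT w|cellm. f (T w)) = (LINT w|cellm. f w)"
    using period_invariant_integral_real(2)[OF T _ p(1)] period_invariant_integral_real(2)[OF T _ p(2)] f(1) m i
    by (simp add: complex_eq_iff integral_Re[symmetric] integral_Im[symmetric] del: integral_Re integral_Im)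
qed

section \<open>A bump function and localized characters\<close>

lemma has_derivative_zero_of_square_bound:
  fixes f :: "real \<Rightarrow> real"
  assumes "\<And>y. \<bar>f y - f a\<bar> \<le> C * (y - a)\<^sup>2"
  shows "(f has_real_derivative 0) (at a)"
  unfolding has_field_derivative_iff
proof (rule Lim_null_comparison)
  show "\<forall>\<^sub>F y in at a. norm ((f y - f a) / (y - a)) \<le> C * \<bar>y - a\<bar>"
    unfolding eventually_at_filter
  proof (intro always_eventually allI impI)
    fix y assume "y \<noteq> a"
    have "\<bar>f y - f a\<bar> \<le> C * \<bar>y - a\<bar> * \<bar>y - a\<bar>"
      using assms[of y] by (simp add: power2_eq_square mult.assoc)
    then show "norm ((f y - f a) / (y - a)) \<le> C * \<bar>y - a\<bar>"
      using \<open>y \<noteq> a\<close> by (simp add: divide_simps)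
  qed
  have "((\<lambda>y. C * \<bar>y - a\<bar>) \<longlongrightarrow> C * \<bar>a - a\<bar>) (at a)" by (intro tendsto_intros)
  then show "((\<lambda>y. C * \<bar>y - a\<bar>) \<longlongrightarrow> 0) (at a)" by simp
qed

lemma exp_ge_term:
  assumes "0 \<le> (x::real)"
  shows "x ^ m / fact m \<le> exp x"
proof -
  have "(\<Sum>n\<in>{m}. x ^ n /\<^sub>R fact n) \<le> (\<Sum>n. x ^ n /\<^sub>R fact n)"
    by (rule sum_le_suminf[OF sums_summable[OF exp_converges]]) (use assms in auto)
  also have "(\<Sum>n. x ^ n /\<^sub>R fact n) = exp x"
    using exp_converges[of x] by (rule sums_unique[symmetric])
  finally show ?thesis by (simp add: divide_inverse mult.commute)
qed

lemma has_vector_derivative_quotient: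
  fixes f :: "real \<Rightarrow> complex"
  assumes "(f has_vector_derivative D) (at a within S)"
  shows "((\<lambda>s. (f s - f a) / of_real (s - a)) \<longlongrightarrow> D) (at a within S)"
proof -
  have "((\<lambda>s. (Re (f s) - Re (f a)) / (s - a)) \<longlongrightarrow> Re D) (at a within S)"
    "((\<lambda>s. (Im (f s) - Im (f a)) / (s - a)) \<longlongrightarrow> Im D) (at a within S)"
    using assms by (simp_all add: has_vector_derivative_complex_iff has_field_derivative_iff)
  then show ?thesis unfolding tendsto_complex_iff
    by (simp add: Re_divide_of_real Im_divide_of_real del: of_real_diff)
qed

text \<open>A family closed under differentiation, so that smoothness of the bump reduces to a
  single derivative rule.\<close>

definition bump_fun :: "nat \<Rightarrow> real poly \<Rightarrow> real \<Rightarrow> real" where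
  "bump_fun n P y = (if \<bar>y\<bar> < 1 then poly P y * inverse (1 - y\<^sup>2) ^ n * exp (- inverse (1 - y\<^sup>2)) else 0)"

text \<open>Numerator of the derivative over the common denominator (1 - y^2)^(n + 2); the three
  terms come from the polynomial, from the power and from the exponential.\<close>

definition bump_next :: "nat \<Rightarrow> real poly \<Rightarrow> real poly" where
  "bump_next n P = pderiv P * [:1, 0, -1:]\<^sup>2 + [:0, 2 * real n:] * P * [:1, 0, -1:] - [:0, 2:] * P"

text \<open>The exponential beats the pole with two powers of s = 1 - y^2 to spare, since exp (1/s)
  >= (1/s)^(n + 2)/(n + 2)!. A quadratic bound makes the derivative vanish at the edge, and the same
  statement covers all points outside.\<close>

lemma bump_fun_edge_bound:
  obtains C where "\<And>a y. 1 \<le> \<bar>a\<bar> \<Longrightarrow> \<bar>bump_fun n P y\<bar> \<le> C * (y - a)\<^sup>2"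
proof -
  have "compact (poly P ` {-1..1})"
    by (intro compact_continuous_image continuous_intros compact_Icc)
  then obtain B where B: "\<And>y. y \<in> {-1..1} \<Longrightarrow> \<bar>poly P y\<bar> \<le> B"
    unfolding real_norm_def[symmetric] using compact_imp_bounded bounded_iff by (metis imageI)
  have B0: "B \<ge> 0" using B[of 0] by auto
  show ?thesis
  proof (rule that)
    fix a y :: real assume a: "1 \<le> \<bar>a\<bar>"
    show "\<bar>bump_fun n P y\<bar> \<le> B * fact (n + 2) * 4 * (y - a)\<^sup>2"
    proof (cases "\<bar>y\<bar> < 1")
      case True
      define s where "s = 1 - y\<^sup>2"
      have s: "s > 0" using True by (simp add: s_def abs_square_less_1)
      have "s = (1 - \<bar>y\<bar>) * (1 + \<bar>y\<bar>)" by (simp add: s_def algebra_simps power2_eq_square)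
      also have "\<dots> \<le> (1 - \<bar>y\<bar>) * 2" using True by (intro mult_left_mono) auto
      also have "\<dots> \<le> 2 * \<bar>y - a\<bar>" using a abs_triangle_ineq2[of a y] by (simp add: abs_minus_commute)
      finally have s2: "s \<le> 2 * \<bar>y - a\<bar>" .
      have "(1 / s) ^ (n + 2) / fact (n + 2) \<le> exp (1 / s)"
        using s by (intro exp_ge_term) simp
      then have "(1 / s) ^ (n + 2) \<le> fact (n + 2) * exp (1 / s)"
        by (simp only: pos_divide_le_eq fact_gt_zero mult.commute)
      then have "exp (- 1 / s) * (1 / s) ^ (n + 2) \<le> exp (- 1 / s) * (fact (n + 2) * exp (1 / s))"
        by (rule mult_left_mono) simp
      also have "\<dots> = fact (n + 2) * (exp (- 1 / s) * exp (1 / s))" by (simp only: mult_ac)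
      also have "\<dots> = fact (n + 2)" by (simp flip: exp_add)
      finally have "exp (- 1 / s) * (1 / s) ^ (n + 2) \<le> fact (n + 2)" .
      then have "exp (- 1 / s) * (1 / s) ^ (n + 2) * s\<^sup>2 \<le> fact (n + 2) * s\<^sup>2"
        by (rule mult_right_mono) simp
      moreover have "exp (- 1 / s) * (1 / s) ^ (n + 2) * s\<^sup>2 = exp (- 1 / s) / s ^ n"
        using s by (simp add: power_add power_divide field_simps power2_eq_square)
      ultimately have "exp (- 1 / s) / s ^ n \<le> fact (n + 2) * s\<^sup>2" by simp
      moreover have "s\<^sup>2 \<le> 4 * (y - a)\<^sup>2"
        using power_mono[OF s2, of 2] s by (simp add: power_mult_distrib)
      ultimately have e: "exp (- 1 / s) / s ^ n \<le> fact (n + 2) * (4 * (y - a)\<^sup>2)"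
        by (meson fact_ge_zero mult_left_mono order_trans)
      have "\<bar>bump_fun n P y\<bar> = \<bar>poly P y\<bar> * (exp (- 1 / s) / s ^ n)"
        using True s by (simp add: bump_fun_def s_def[symmetric] abs_mult inverse_eq_divide power_divide)
      also have "\<dots> \<le> B * (fact (n + 2) * (4 * (y - a)\<^sup>2))"
        using True e B[of y] B0 s by (intro mult_mono) (auto simp: abs_less_iff)
      finally show ?thesis by (simp only: mult.assoc)
    next
      case False
      then show ?thesis using B0 by (simp add: bump_fun_def)
    qed
  qed
qed

lemma bump_fun_deriv: "(bump_fun n P has_real_derivative bump_fun (n + 2) (bump_next n P) y) (at y)"
proof (cases "\<bar>y\<bar> < 1")
  case True
  define s where "s = 1 - y\<^sup>2"
  have s: "s > 0" using True by (simp add: s_def abs_square_less_1)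
  define u where "u = inverse s"
  have us: "u * s = 1" using s by (simp add: u_def)
  have du: "((\<lambda>y. inverse (1 - y\<^sup>2)) has_real_derivative 2 * y * u\<^sup>2) (at y)"
    using s unfolding u_def s_def by (auto intro!: derivative_eq_intros simp: power2_eq_square)
  have "((\<lambda>y. poly P y * inverse (1 - y\<^sup>2) ^ n * exp (- inverse (1 - y\<^sup>2))) has_real_derivative
      (poly (pderiv P) y * u ^ n + real n * (2 * y * u\<^sup>2 * u ^ (n - Suc 0)) * poly P y) * exp (- u)
      + exp (- u) * (- (2 * y * u\<^sup>2)) * (poly P y * u ^ n)) (at y)"
    unfolding u_def s_def by (intro DERIV_mult DERIV_power DERIV_fun_exp DERIV_minus poly_DERIV du[unfolded u_def s_def])
  also have "(poly (pderiv P) y * u ^ n + real n * (2 * y * u\<^sup>2 * u ^ (n - Suc 0)) * poly P y) * exp (- u)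
      + exp (- u) * (- (2 * y * u\<^sup>2)) * (poly P y * u ^ n) = bump_fun (n + 2) (bump_next n P) y"
  proof -
    have s0: "poly [:1, 0, -1:] y = s" by (simp add: s_def power2_eq_square)
    have P: "poly (bump_next n P) y = poly (pderiv P) y * s\<^sup>2 + 2 * real n * y * poly P y * s - 2 * y * poly P y"
      by (simp only: bump_next_def poly_add poly_mult poly_diff poly_power s0) (simp add: algebra_simps)
    have 1: "real n * (u\<^sup>2 * u ^ (n - Suc 0)) = real n * u ^ Suc n"
      by (cases n) (simp_all add: power2_eq_square)
    have 2: "u ^ (n + 2) * s\<^sup>2 = u ^ n" "u ^ (n + 2) * s = u ^ Suc n"
    proof -
      have "u ^ (n + 2) * s\<^sup>2 = u ^ n * (u * s)\<^sup>2" "u ^ (n + 2) * s = u ^ Suc n * (u * s)"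
        by (simp_all add: power_add power_mult_distrib power2_eq_square)
      then show "u ^ (n + 2) * s\<^sup>2 = u ^ n" "u ^ (n + 2) * s = u ^ Suc n" by (simp_all only: us) simp_all
    qed
    have "bump_fun (n + 2) (bump_next n P) y = (poly (pderiv P) y * (u ^ (n + 2) * s\<^sup>2) + 2 * y * poly P y * (real n * (u ^ (n + 2) * s)) - 2 * y * poly P y * u ^ (n + 2)) * exp (- u)"
      using True unfolding bump_fun_def P s_def[symmetric] u_def[symmetric] by (simp add: algebra_simps)
    also have "\<dots> = (poly (pderiv P) y * u ^ n + 2 * y * poly P y * (real n * (u\<^sup>2 * u ^ (n - Suc 0))) - 2 * y * poly P y * (u\<^sup>2 * u ^ n)) * exp (- u)"
      unfolding 2 1 by (simp add: power_add power2_eq_square)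
    finally show ?thesis by (simp add: algebra_simps)
  qed
  finally have "((\<lambda>y. poly P y * inverse (1 - y\<^sup>2) ^ n * exp (- inverse (1 - y\<^sup>2))) has_real_derivative bump_fun (n + 2) (bump_next n P) y) (at y)" .
  then show ?thesis
  proof (rule DERIV_cong_ev[OF refl _ refl, THEN iffD1, rotated])
    have "\<forall>\<^sub>F x in nhds y. x \<in> {-1<..<1}" using True by (intro eventually_nhds_in_open) auto
    then show "\<forall>\<^sub>F x in nhds y. poly P x * inverse (1 - x\<^sup>2) ^ n * exp (- inverse (1 - x\<^sup>2)) = bump_fun n P x"
      by eventually_elim (auto simp: bump_fun_def)
  qed
next
  case False
  obtain C where C: "\<And>a y. 1 \<le> \<bar>a\<bar> \<Longrightarrow> \<bar>bump_fun n P y\<bar> \<le> C * (y - a)\<^sup>2"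
    by (rule bump_fun_edge_bound) blast
  have "(bump_fun n P has_real_derivative 0) (at y)"
    using False C[of y] by (intro has_derivative_zero_of_square_bound[of _ _ C]) (simp add: bump_fun_def)
  then show ?thesis using False by (simp add: bump_fun_def)
qed

text \<open>The factor \<open>exp 1\<close> normalizes \<open>bump 0\<close> to the value 1 at 0, so
  that the cutoff tends to 1 as it is widened. Each derivative raises the order of the pole by two,
  hence the index \<open>2 * j\<close>.\<close>

primrec bump_poly :: "nat \<Rightarrow> real poly" where
  "bump_poly 0 = [:exp 1:]"
| "bump_poly (Suc j) = bump_next (2 * j) (bump_poly j)"

definition bump :: "nat \<Rightarrow> real \<Rightarrow> real" where
  "bump j = bump_fun (2 * j) (bump_poly j)"

lemma bump_deriv: "(bump j has_real_derivative bump (Suc j) y) (at y)"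
  using bump_fun_deriv[of "2 * j" "bump_poly j" y] by (simp add: bump_def)

lemma bump_outside: "1 \<le> \<bar>y\<bar> \<Longrightarrow> bump j y = 0"
  by (simp add: bump_def bump_fun_def)

lemma bump_0_0: "bump 0 0 = 1"
  by (simp add: bump_def bump_fun_def flip: exp_add)

lemma bump_0_bounds: "0 \<le> bump 0 y" "bump 0 y \<le> 1"
proof -
  show "0 \<le> bump 0 y" by (simp add: bump_def bump_fun_def)
  show "bump 0 y \<le> 1"
  proof (cases "\<bar>y\<bar> < 1")
    case True
    define s where "s = 1 - y\<^sup>2"
    have s: "s > 0" "s \<le> 1" using True by (simp_all add: s_def abs_square_less_1)
    have "exp 1 * exp (- 1 / s) = exp (1 - 1 / s)" by (simp add: exp_diff exp_minus field_simps)
    also have "\<dots> \<le> 1" using s by simp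
    finally show ?thesis using True by (simp add: bump_def bump_fun_def s_def inverse_eq_divide)
  qed (simp add: bump_outside)
qed

lemma continuous_bump: "continuous_on UNIV (bump j)"
  using bump_deriv by (intro DERIV_continuous_on) (auto intro: has_field_derivative_at_within)

lemma bump_bounded: obtains B where "B > 0" "\<And>y. \<bar>bump j y\<bar> \<le> B"
proof -
  have "compact (bump j ` {-1..1})"
    by (intro compact_continuous_image continuous_on_subset[OF continuous_bump]) auto
  then obtain B where B: "\<And>y. y \<in> {-1..1} \<Longrightarrow> \<bar>bump j y\<bar> \<le> B"
    unfolding real_norm_def[symmetric] using compact_imp_bounded bounded_iff by (metis imageI)
  show ?thesis
  proof (rule that[of "max B 1"])
    fix y show "\<bar>bump j y\<bar> \<le> max B 1"
      using B[of y] bump_outside[of y j] by (cases "\<bar>y\<bar> \<le> 1") (auto simp: abs_le_iff)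
  qed simp
qed

definition bump_bound :: "nat \<Rightarrow> real" where
  "bump_bound j = (SOME B. B > 0 \<and> (\<forall>y. \<bar>bump j y\<bar> \<le> B))"

lemma bump_bound: "bump_bound j > 0" "\<bar>bump j y\<bar> \<le> bump_bound j"
proof -
  have "\<exists>B>0. \<forall>y. \<bar>bump j y\<bar> \<le> B" using bump_bounded[of j] by metis
  from someI_ex[OF this] show "bump_bound j > 0" "\<bar>bump j y\<bar> \<le> bump_bound j"
    unfolding bump_bound_def by auto
qed

subsection \<open>Test functions\<close>

lemma C_k_add:
  "C_k n f \<Longrightarrow> C_k n g \<Longrightarrow> C_k n (\<lambda>w. f w + g w)"
proof (induction n arbitrary: f g)
  case 0
  then show ?case by (auto intro: continuous_on_add)
next
  case (Suc n)
  have d: "(\<lambda>s. f (w + s *\<^sub>R unit_vec i)) differentiable at 0" "(\<lambda>s. g (w + s *\<^sub>R unit_vec i)) differentiable at 0" for i w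
    using Suc.prems unfolding C_k.simps by blast+
  have eq: "pd i (\<lambda>w. f w + g w) = (\<lambda>w. pd i f w + pd i g w)" for i
    unfolding pd_def using d by (intro ext deriv_add) (auto simp: field_differentiable_def real_differentiable_def)
  show ?case
    unfolding C_k.simps eq
    by (intro allI conjI differentiable_add d Suc.IH) (use Suc.prems in \<open>unfold C_k.simps, blast+\<close>)
qed

definition tf :: "complex \<Rightarrow> freq \<Rightarrow> real \<Rightarrow> nat \<Rightarrow> pt \<Rightarrow> real" where
  "tf c q R j w = Re (c * chr w q * of_real (bump j (fst (snd w) / R)))"

lemma tf_eq:
  "tf c (k, \<eta>, l) R j (x, y, z) = kap * bump j (y / R) *
     (Re c * cos (of_int k * x + \<eta> * y + of_int l * z) + Im c * sin (of_int k * x + \<eta> * y + of_int l * z))"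
proof -
  define th where "th = of_int k * x + \<eta> * y + of_int l * z"
  have "chr (x, y, z) (k, \<eta>, l) = kap * cis (- th)" by (simp only: chr_eq th_def)
  then show ?thesis unfolding th_def[symmetric] by (simp add: tf_def algebra_simps)
qed

lemma tf_has_derivative:
  assumes "R > 0"
  shows "((\<lambda>s. tf c (k, \<eta>, l) R j (w + s *\<^sub>R unit_vec i)) has_real_derivative
    (if i = 1 then tf (- \<i> * of_int k * c) (k, \<eta>, l) R j w
     else if i = 2 then tf (- \<i> * of_real \<eta> * c) (k, \<eta>, l) R j w + tf (c / of_real R) (k, \<eta>, l) R (Suc j) w
     else tf (- \<i> * of_int l * c) (k, \<eta>, l) R j w)) (at 0)"
proof -
  obtain x y z where w: "w = (x, y, z)" by (cases w)
  have b: "((\<lambda>s. bump j ((y + s) / R)) has_real_derivative bump (Suc j) ((y + 0) / R) * (1 / R)) (at 0)"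
    by (rule DERIV_chain2[OF bump_deriv]) (use assms in \<open>auto intro!: derivative_eq_intros\<close>)
  consider "i = 1" | "i = 2" | "i = 3" using exhaust_3 by blast
  then show ?thesis
  proof cases
    case 1
    then show ?thesis unfolding w tf_eq unit_vec_def
      by (auto simp: tf_eq intro!: derivative_eq_intros; simp add: algebra_simps)
  next
    case 2
    then show ?thesis unfolding w tf_eq unit_vec_def
      by (auto simp: tf_eq intro!: derivative_eq_intros b; simp add: algebra_simps add_divide_distrib)
  next
    case 3
    then show ?thesis unfolding w tf_eq unit_vec_def
      by (auto simp: tf_eq intro!: derivative_eq_intros; simp add: algebra_simps)
  qed
qed

lemma pd_tf:
  assumes "R > 0"
  shows "pd 1 (tf c (k, \<eta>, l) R j) = tf (- \<i> * of_int k * c) (k, \<eta>, l) R j"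
    "pd 2 (tf c (k, \<eta>, l) R j) = (\<lambda>w. tf (- \<i> * of_real \<eta> * c) (k, \<eta>, l) R j w + tf (c / of_real R) (k, \<eta>, l) R (Suc j) w)"
    "pd 3 (tf c (k, \<eta>, l) R j) = tf (- \<i> * of_int l * c) (k, \<eta>, l) R j"
  unfolding pd_def
  by (auto simp: fun_eq_iff intro!: DERIV_imp_deriv tf_has_derivative[OF assms, THEN DERIV_cong])

lemma continuous_tf: "R > 0 \<Longrightarrow> continuous_on UNIV (tf c q R j)"
proof -
  assume "R > 0"
  obtain k \<eta> l where q: "q = (k, \<eta>, l)" by (cases q)
  have "tf c q R j = (\<lambda>w. kap * bump j (fst (snd w) / R) *
     (Re c * cos (of_int k * fst w + \<eta> * fst (snd w) + of_int l * snd (snd w)) + Im c * sin (of_int k * fst w + \<eta> * fst (snd w) + of_int l * snd (snd w))))"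
    unfolding q by (auto simp: fun_eq_iff tf_eq)
  then show ?thesis
    using \<open>R > 0\<close> by (auto intro!: continuous_intros continuous_on_compose2[OF continuous_bump])
qed

lemma C_k_tf:
  assumes "R > 0"
  shows "C_k n (tf c q R j)"
proof (induction n arbitrary: c j)
  case 0
  show ?case using continuous_tf[OF assms] by simp
next
  case (Suc n)
  obtain k \<eta> l where q: "q = (k, \<eta>, l)" by (cases q)
  have "C_k n (pd i (tf c q R j))" for i
  proof -
    consider "i = 1" | "i = 2" | "i = 3" using exhaust_3 by blast
    then show ?thesis
      by cases (use Suc[unfolded q] in \<open>simp_all add: q pd_tf[OF assms] C_k_add\<close>)
  qed
  moreover have "(\<lambda>s. tf c q R j (w + s *\<^sub>R unit_vec i)) differentiable at 0" for w i
    unfolding q real_differentiable_def using tf_has_derivative[OF assms] by blast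
  ultimately show ?case unfolding C_k.simps by blast
qed

lemma chr_periodic: "pxz (\<lambda>w. chr w q)"
proof -
  obtain k \<eta> l where q: "q = (k, \<eta>, l)" by (cases q)
  have p: "cis (- (a + of_int m * (2 * pi))) = cis (- a)" for a m
  proof -
    have "- (a + of_int m * (2 * pi)) = - a + 2 * pi * of_int (- m)" by simp
    then show ?thesis using cis_multiple_2pi[of "of_int (- m)"] by (simp only: cis_mult[symmetric]) simp
  qed
  show ?thesis
    unfolding pxz_def q chr_eq using p[of "of_int k * x + \<eta> * y + of_int l * z" k for x y z]
      p[of "of_int k * x + \<eta> * y + of_int l * z" l for x y z] by (simp add: algebra_simps)
qed

lemma test_fun_tf:
  assumes "R > 0"
  shows "test_fun (tf c q R j)"
  unfolding test_fun_def
proof (intro conjI allI)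
  show "C_k n (tf c q R j)" for n by (rule C_k_tf[OF assms])
  show "periodic_xz (tf c q R j)"
    using chr_periodic[of q] by (auto simp: periodic_xz_def pxz_def tf_def)
  show "\<exists>r. \<forall>x y z. r < \<bar>y\<bar> \<longrightarrow> tf c q R j (x, y, z) = 0"
    using assms by (intro exI[of _ R]) (auto simp: tf_def intro!: bump_outside)
qed

lemma test_fun_pd: "test_fun \<phi> \<Longrightarrow> test_fun (pd i \<phi>)"
  unfolding test_fun_def
proof (intro conjI allI; elim conjE)
  assume C: "\<forall>n. C_k n \<phi>" and per: "periodic_xz \<phi>" and supp: "\<exists>R. \<forall>x y z. R < \<bar>y\<bar> \<longrightarrow> \<phi> (x, y, z) = 0"
  show "C_k n (pd i \<phi>)" for n using C[rule_format, of "Suc n"] by simp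
  obtain a b c where e: "unit_vec i = (a, b, c)" by (cases "unit_vec i")
  show "periodic_xz (pd i \<phi>)"
    using per unfolding periodic_xz_def pd_def e by (simp add: add.assoc add.commute[of "2 * pi"]) (simp add: add.assoc[symmetric])
  obtain R where R: "\<And>x y z. R < \<bar>y\<bar> \<Longrightarrow> \<phi> (x, y, z) = 0" using supp by blast
  show "\<exists>R. \<forall>x y z. R < \<bar>y\<bar> \<longrightarrow> pd i \<phi> (x, y, z) = 0"
  proof (intro exI[of _ R] allI impI)
    fix x y z :: real assume y: "R < \<bar>y\<bar>"
    have "((\<lambda>s. \<bar>y + s * b\<bar>) \<longlongrightarrow> \<bar>y + 0 * b\<bar>) (nhds 0)"
      by (intro tendsto_intros filterlim_ident)
    then have "\<forall>\<^sub>F s in nhds 0. R < \<bar>y + s * b\<bar>"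
      by (rule order_tendstoD) (use y in simp)
    then have "\<forall>\<^sub>F s in nhds 0. \<phi> ((x, y, z) + s *\<^sub>R unit_vec i) = 0"
      by eventually_elim (simp add: e R)
    then have "deriv (\<lambda>s. \<phi> ((x, y, z) + s *\<^sub>R unit_vec i)) 0 = deriv (\<lambda>s. 0) 0"
      by (intro deriv_cong_ev refl)
    then show "pd i \<phi> (x, y, z) = 0" by (simp add: pd_def)
  qed
qed

lemma test_fun_continuous: "test_fun \<phi> \<Longrightarrow> continuous_on UNIV \<phi>"
  unfolding test_fun_def by (metis C_k.simps(1))

lemma test_fun_pd_derivative:
  assumes "test_fun \<phi>"
  shows "((\<lambda>s. \<phi> (w + s *\<^sub>R unit_vec i)) has_real_derivative pd i \<phi> w) (at 0)"
proof -
  have "C_k (Suc 0) \<phi>" using assms by (simp only: test_fun_def)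
  then have "(\<lambda>s. \<phi> (w + s *\<^sub>R unit_vec i)) differentiable (at 0)" unfolding C_k.simps by blast
  then show ?thesis by (simp only: pd_def DERIV_deriv_iff_real_differentiable)
qed

lemma test_fun_borel [measurable_dest]: "test_fun \<phi> \<Longrightarrow> \<phi> \<in> borel_measurable borel"
  by (rule borel_measurable_continuous_onI[OF test_fun_continuous])

lemma periodic_bounded:
  fixes g :: "pt \<Rightarrow> 'b::real_normed_vector"
  assumes c: "continuous_on UNIV g" and p: "pxz g" and s: "\<And>x y z. R < \<bar>y\<bar> \<Longrightarrow> g (x, y, z) = 0"
  obtains B where "B \<ge> 0" "\<And>w. norm (g w) \<le> B"
proof -
  let ?K = "{0..2 * pi} \<times> {-R..R} \<times> {0..2 * pi}"
  have "compact (g ` ?K)"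
    by (intro compact_continuous_image continuous_on_subset[OF c] compact_Times) auto
  then obtain B where B: "\<And>w. w \<in> ?K \<Longrightarrow> norm (g w) \<le> B"
    using compact_imp_bounded bounded_iff by (metis imageI)
  show ?thesis
  proof (rule that[of "max B 0"])
    fix w :: pt
    obtain x y z where w: "w = (x, y, z)" by (cases w)
    define m where "m = (\<lambda>x. - \<lfloor>x / (2 * pi)\<rfloor>)"
    have m: "x + 2 * pi * of_int (m x) \<in> {0..2 * pi}" for x
    proof -
      have "of_int \<lfloor>x / (2 * pi)\<rfloor> \<le> x / (2 * pi)" "x / (2 * pi) < of_int \<lfloor>x / (2 * pi)\<rfloor> + 1" by linarith+
      then have "2 * pi * of_int \<lfloor>x / (2 * pi)\<rfloor> \<le> x" "x < 2 * pi * (of_int \<lfloor>x / (2 * pi)\<rfloor> + 1)"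
        using pi_gt_zero by (simp_all only: pos_le_divide_eq pos_divide_less_eq mult_pos_pos zero_less_numeral mult.commute)
      then show ?thesis by (simp add: m_def algebra_simps)
    qed
    have "g (x + 2 * pi * of_int (m x), y, z + 2 * pi * of_int (m z)) = g (x, y, z)"
      using periodic_int[of "\<lambda>x. g (x, y, z + 2 * pi * of_int (m z))" x "m x"] periodic_int[of "\<lambda>z. g (x, y, z)" z "m z"] p
      by (simp add: pxz_def)
    then have eq: "g w = g (x + 2 * pi * of_int (m x), y, z + 2 * pi * of_int (m z))" by (simp add: w)
    show "norm (g w) \<le> max B 0"
    proof (cases "R < \<bar>y\<bar>")
      case True
      then show ?thesis using s by (simp add: w)
    next
      case False
      then show ?thesis unfolding eq using m by (intro max.coboundedI1 B) (auto simp: abs_le_iff)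
    qed
  qed simp
qed

definition slab :: "real \<Rightarrow> pt set" where
  "slab R = {w. \<bar>fst (snd w)\<bar> \<le> R}"

lemma slab_measurable [measurable]: "slab R \<in> sets borel"
proof -
  have "closed (slab R)" unfolding slab_def by (intro closed_Collect_le continuous_intros)
  then show ?thesis by simp
qed

lemma slab_finite: "emeasure cellm (slab R) < \<infinity>"
proof -
  have "slab R = UNIV \<times> ({-R..R} \<times> UNIV)" by (auto simp: slab_def abs_le_iff)
  moreover have "emeasure cellm (UNIV \<times> ({-R..R} \<times> UNIV)) = emeasure circle UNIV * (emeasure lborel {-R..R} * emeasure circle UNIV)"
    unfolding cellm_def by (subst lc.emeasure_pair_measure_Times; (subst circle.emeasure_pair_measure_Times)?; simp?)
  moreover have "\<dots> < \<infinity>"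
    by (auto simp: emeasure_circle ennreal_mult_less_top emeasure_lborel_Icc_eq)
  ultimately show ?thesis by simp
qed

lemma integrable_slab: "integrable cellm (indicator (slab R) :: pt \<Rightarrow> real)"
  using slab_finite by (intro integrable_real_indicator) auto

lemma L12_slab:
  assumes [measurable]: "g \<in> borel_measurable borel" and "\<And>w. cmod (g w) \<le> B * indicator (slab R) w"
  shows "cell.L12 g"
proof -
  have B: "cmod (g w) \<le> norm (B * indicator (slab R) w)" for w using assms(2)[of w] by simp
  have "integrable cellm g"
    using B by (intro Bochner_Integration.integrable_bound[OF integrable_mult_right[OF integrable_slab, of B R]]) auto
  moreover have "(cmod (g w))\<^sup>2 \<le> B\<^sup>2 * indicator (slab R) w" for w
  proof (cases "w \<in> slab R")
    case True
    then show ?thesis using power_mono[OF assms(2)[of w] norm_ge_zero, of 2] by simp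
  next
    case False
    then show ?thesis using assms(2)[of w] by simp
  qed
  then have "integrable cellm (\<lambda>w. (cmod (g w))\<^sup>2)"
    by (intro Bochner_Integration.integrable_bound[OF integrable_mult_right[OF integrable_slab, of "B\<^sup>2" R]]) (auto simp: abs_mult)
  ultimately show ?thesis by (simp add: cell.L12_def sqi_def)
qed

lemma L12_continuous:
  assumes c: "continuous_on UNIV g" and p: "pxz g" and s: "\<And>x y z. R < \<bar>y\<bar> \<Longrightarrow> g (x, y, z) = 0"
  shows "cell.L12 g"
proof -
  obtain B where B: "\<And>w. cmod (g w) \<le> B" using periodic_bounded[OF c p s] by metis
  show ?thesis
  proof (rule L12_slab)
    show "cmod (g w) \<le> B * indicator (slab R) w" for w
      using B[of w] s[of "fst (snd w)" "fst w" "snd (snd w)"] by (auto simp: slab_def indicator_def)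
  qed (rule borel_measurable_continuous_onI[OF c])
qed

lemma L12_test: "test_fun \<phi> \<Longrightarrow> cell.L12 (cr \<phi>)"
proof -
  assume t: "test_fun \<phi>"
  then obtain R where "\<And>x y z. R < \<bar>y\<bar> \<Longrightarrow> \<phi> (x, y, z) = 0" unfolding test_fun_def by metis
  then show ?thesis
    using test_fun_continuous[OF t] t
    by (intro L12_continuous[of _ R]) (auto simp: cr_def[abs_def] pxz_def test_fun_def periodic_xz_def intro!: continuous_intros)
qed

lemma L2_test: "test_fun \<phi> \<Longrightarrow> L2 \<phi>"
  using L12_test[of \<phi>] by (simp add: L2_iff cell.L12_sqi test_fun_def)

lemma continuous_chr: "continuous_on UNIV (\<lambda>w. chr w q)"
  unfolding chr_def e_circle_def e_line_def by (intro continuous_intros) auto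

text \<open>Every difference quotient has integral zero by translation invariance, and the quotients
  converge boundedly. The slab is widened by 1 because steps of length at most 1 move the support in
  \<open>y\<close>.\<close>

lemma integral_line_derivative_eq_0:
  fixes g h :: "pt \<Rightarrow> complex"
  assumes cg: "continuous_on UNIV g" and ch: "continuous_on UNIV h" and pg: "pxz g" and ph: "pxz h"
    and sg: "\<And>x y z. R < \<bar>y\<bar> \<Longrightarrow> g (x, y, z) = 0" and sh: "\<And>x y z. R < \<bar>y\<bar> \<Longrightarrow> h (x, y, z) = 0"
    and d: "\<And>w. ((\<lambda>s. g (w + s *\<^sub>R unit_vec i)) has_vector_derivative h w) (at 0)"
  shows "(LINT w|cellm. h w) = 0"
proof -
  obtain B where B: "B \<ge> 0" "\<And>w. cmod (h w) \<le> B" using periodic_bounded[OF ch ph sh] by metis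
  have d': "((\<lambda>s. g (w + s *\<^sub>R unit_vec i)) has_vector_derivative h (w + s *\<^sub>R unit_vec i)) (at s)" for w s
  proof -
    have "((\<lambda>r. g ((w + s *\<^sub>R unit_vec i) + r *\<^sub>R unit_vec i)) has_vector_derivative h (w + s *\<^sub>R unit_vec i)) (at (s - s))"
      using d[of "w + s *\<^sub>R unit_vec i"] by simp
    moreover have "((\<lambda>r. r - s) has_vector_derivative 1) (at s)" by (auto intro!: derivative_eq_intros)
    ultimately
    have "(((\<lambda>r. g ((w + s *\<^sub>R unit_vec i) + r *\<^sub>R unit_vec i)) \<circ> (\<lambda>r. r - s)) has_vector_derivative 1 *\<^sub>R h (w + s *\<^sub>R unit_vec i)) (at s)"
      by (intro vector_diff_chain_at)
    then show ?thesis by (simp add: o_def scaleR_left_diff_distrib algebra_simps)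
  qed
  have lip: "cmod (g (w + s *\<^sub>R unit_vec i) - g w) \<le> B * \<bar>s\<bar>" for w s
  proof -
    have "norm (g (w + s *\<^sub>R unit_vec i) - g (w + 0 *\<^sub>R unit_vec i)) \<le> B * norm (s - 0)"
    proof (rule differentiable_bound[of UNIV "\<lambda>s. g (w + s *\<^sub>R unit_vec i)"])
      show "((\<lambda>s. g (w + s *\<^sub>R unit_vec i)) has_derivative (\<lambda>r. r *\<^sub>R h (w + s *\<^sub>R unit_vec i))) (at s within UNIV)" for s
        using d'[of w s] by (simp add: has_vector_derivative_def)
      show "onorm (\<lambda>r. r *\<^sub>R h (w + s *\<^sub>R unit_vec i)) \<le> B" for s
      proof (rule onorm_le)
        show "norm (r *\<^sub>R h (w + s *\<^sub>R unit_vec i)) \<le> B * norm r" for r :: real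
          using mult_right_mono[OF B(2)[of "w + s *\<^sub>R unit_vec i"], of "\<bar>r\<bar>"] by (simp add: mult.commute)
      qed
    qed auto
    then show ?thesis by simp
  qed
  define s where "s n = 1 / real (Suc n)" for n
  have s: "s n > 0" "s n \<le> 1" for n by (simp_all add: s_def)
  obtain a b c where e: "unit_vec i = (a, b, c)" by (cases "unit_vec i")
  have b: "\<bar>b\<bar> \<le> 1" using e by (auto simp: unit_vec_def split: if_splits)
  define D where "D n w = (g (w + s n *\<^sub>R unit_vec i) - g w) / of_real (s n)" for n w
  have inv: "(LINT w|cellm. D n w) = 0" for n
  proof -
    have T1: "period_invariant (\<lambda>(x, y, z). (x, y + s n * b, z + s n * c))"
      by (rule period_invariant_yz)
    have T2: "period_invariant (\<lambda>(x, y, z). (x + s n * a, y, z))"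
      using period_invariant_x[of "\<lambda>_. s n * a"] by simp
    have ig: "integrable cellm g" using L12_continuous[OF cg pg sg] by (rule cell.L12_integrable)
    note 1 = period_invariant_integral[OF T1 ig pg]
    have p1: "pxz (\<lambda>w. g (case w of (x, y, z) \<Rightarrow> (x, y + s n * b, z + s n * c)))"
      using pg by (auto simp: pxz_def algebra_simps) (metis add.assoc add.commute)
    note 2 = period_invariant_integral[OF T2 1(1) p1]
    have "(\<lambda>w. g (case case w of (x, y, z) \<Rightarrow> (x + s n * a, y, z) of (x, y, z) \<Rightarrow> (x, y + s n * b, z + s n * c))) = (\<lambda>w. g (w + s n *\<^sub>R unit_vec i))"
      by (auto simp: fun_eq_iff e)
    with 1 2 have "integrable cellm (\<lambda>w. g (w + s n *\<^sub>R unit_vec i))" "(LINT w|cellm. g (w + s n *\<^sub>R unit_vec i)) = (LINT w|cellm. g w)"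
      by simp_all
    then show ?thesis unfolding D_def using ig by simp
  qed
  have "(\<lambda>n. LINT w|cellm. D n w) \<longlonglongrightarrow> (LINT w|cellm. h w)"
  proof (rule integral_dominated_convergence[where w = "\<lambda>w. B * indicator (slab (\<bar>R\<bar> + 1)) w"])
    show "h \<in> borel_measurable cellm" using borel_measurable_continuous_onI[OF ch] by simp
    have "continuous_on UNIV (D n)" for n
      unfolding D_def using s(1)[of n]
      by (intro continuous_intros continuous_on_compose2[OF cg]) auto
    then show "D n \<in> borel_measurable cellm" for n
      unfolding borel_measurable_cellm by (rule borel_measurable_continuous_onI)
    show "integrable cellm (\<lambda>w. B * indicator (slab (\<bar>R\<bar> + 1)) w)" by (intro integrable_mult_right integrable_slab)
    show "AE w in cellm. cmod (D n w) \<le> B * indicator (slab (\<bar>R\<bar> + 1)) w" for n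
    proof (rule AE_I2)
      fix w :: pt
      obtain x y z where w: "w = (x, y, z)" by (cases w)
      show "cmod (D n w) \<le> B * indicator (slab (\<bar>R\<bar> + 1)) w"
      proof (cases "\<bar>y\<bar> \<le> \<bar>R\<bar> + 1")
        case True
        then show ?thesis using lip[of w "s n"] s(1)[of n]
          by (simp add: D_def w slab_def norm_divide field_simps)
      next
        case False
        have "\<bar>s n * b\<bar> \<le> 1" using s[of n] b by (simp add: abs_mult mult_le_one)
        then have "R < \<bar>y + s n * b\<bar>" "R < \<bar>y\<bar>" using False by linarith+
        then show ?thesis using B(1) by (simp add: D_def w e sg slab_def)
      qed
    qed
    show "AE w in cellm. (\<lambda>n. D n w) \<longlonglongrightarrow> h w"
    proof (rule AE_I2)
      fix w
      have "((\<lambda>r. (g (w + r *\<^sub>R unit_vec i) - g (w + 0 *\<^sub>R unit_vec i)) / of_real (r - 0)) \<longlongrightarrow> h w) (at 0)"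
        using d[of w] by (rule has_vector_derivative_quotient)
      moreover have "filterlim s (at 0) sequentially"
        unfolding filterlim_at using s(1) by (auto simp: s_def[abs_def] less_imp_neq[symmetric]) real_asymp
      ultimately have "(\<lambda>n. (g (w + s n *\<^sub>R unit_vec i) - g (w + 0 *\<^sub>R unit_vec i)) / of_real (s n - 0)) \<longlonglongrightarrow> h w"
        by (rule filterlim_compose)
      then show "(\<lambda>n. D n w) \<longlonglongrightarrow> h w" by (simp add: D_def)
    qed
  qed
  then have "(\<lambda>n. 0) \<longlonglongrightarrow> (LINT w|cellm. h w)" by (simp only: inv)
  from LIMSEQ_unique[OF this tendsto_const] show ?thesis .
qed

section \<open>Weak derivatives and the Fourier transform\<close>

lemma norm2_le3:
  assumes "sqi M b" "sqi M c" "sqi M d" "a \<in> borel_measurable M"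
    and "AE x in M. cmod (a x) \<le> cmod (b x) + cmod (c x) + cmod (d x)"
  shows "sqi M a" "norm2 M a \<le> norm2 M b + norm2 M c + norm2 M d"
proof -
  have abs: "sqi M (\<lambda>x. of_real (cmod (f x)))" "norm2 M (\<lambda>x. of_real (cmod (f x))) = norm2 M f" if "sqi M f" for f
    using that by (auto simp: norm2_def intro!: sqi_dominated[OF that, of _ 1])
  let ?s = "\<lambda>x. complex_of_real (cmod (b x)) + of_real (cmod (c x)) + of_real (cmod (d x))"
  have s: "sqi M ?s" by (intro sqi_add abs assms)
  have le: "AE x in M. cmod (a x) \<le> 1 * cmod (?s x)"
    using assms(5) by eventually_elim (simp flip: of_real_add)
  show "sqi M a" by (rule sqi_dominated[OF s assms(4) le])
  have "norm2 M a \<le> 1 * norm2 M ?s" by (rule norm2_dominated[OF s assms(4) le]) simp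
  also have "norm2 M ?s \<le> norm2 M b + norm2 M c + norm2 M d"
    using norm2_triangle[OF sqi_add[OF abs(1)[OF assms(1)] abs(1)[OF assms(2)]] abs(1)[OF assms(3)]]
      norm2_triangle[OF abs(1)[OF assms(1)] abs(1)[OF assms(2)]]
    by (simp add: abs(2) assms)
  finally show "norm2 M a \<le> norm2 M b + norm2 M c + norm2 M d" by simp
qed

definition loc :: "real \<Rightarrow> nat \<Rightarrow> (pt \<Rightarrow> real) \<Rightarrow> pt \<Rightarrow> complex" where
  "loc R j f w = cr f w * of_real (bump j (fst (snd w) / R))"

text \<open>After the cutoff an L2 function is also integrable, so this transform has a value at
  each single frequency, unlike the L2 transform. An index j > 0 records that derivatives fell on
  the cutoff.\<close>

definition lhat :: "(pt \<Rightarrow> real) \<Rightarrow> real \<Rightarrow> nat \<Rightarrow> freq \<Rightarrow> complex" where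
  "lhat f R j = transform cellm chr (loc R j f)"

lemma bump_borel [measurable]: "bump j \<in> borel_measurable borel"
  by (rule borel_measurable_continuous_onI[OF continuous_bump])

lemma coord_borel [measurable]:
  "(\<lambda>w::pt. fst w) \<in> borel_measurable borel" "(\<lambda>w::pt. fst (snd w)) \<in> borel_measurable borel"
  "(\<lambda>w::pt. snd (snd w)) \<in> borel_measurable borel"
  by (auto intro!: borel_measurable_continuous_onI continuous_intros)

lemma bump_loc_borel [measurable]:
  "(\<lambda>w::pt. complex_of_real (bump j (fst (snd w) / R))) \<in> borel_measurable borel"
  unfolding divide_inverse
  by (intro borel_measurable_continuous_onI continuous_on_of_real continuous_on_compose2[OF continuous_bump] continuous_intros) auto

lemma loc_borel [measurable]: "f \<in> borel_measurable borel \<Longrightarrow> loc R j f \<in> borel_measurable borel"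
  unfolding loc_def[abs_def] by (intro borel_measurable_times cr_measurable bump_loc_borel)

lemma cmod_loc: "cmod (loc R j f w) \<le> bump_bound j * cmod (cr f w)"
  using bump_bound[of j] by (auto simp: loc_def norm_mult mult.commute[of "bump_bound j"] intro!: mult_left_mono)

lemma sqi_loc: "L2 f \<Longrightarrow> sqi cellm (loc R j f)"
  by (rule sqi_dominated[OF L2_sqi, of f _ "bump_bound j"]) (auto simp: cmod_loc dest: L2_borel)

lemma norm2_loc: "L2 f \<Longrightarrow> norm2 cellm (loc R j f) \<le> bump_bound j * norm2 cellm (cr f)"
  using bump_bound(1)[of j] by (intro norm2_dominated L2_sqi) (auto simp: cmod_loc dest: L2_borel)

lemma L12_loc:
  assumes "L2 f" "R > 0"
  shows "cell.L12 (loc R j f)"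
proof -
  have [measurable]: "f \<in> borel_measurable borel" using assms(1) by (rule L2_borel)
  have s: "sqi cellm (indicator (slab R) :: pt \<Rightarrow> complex)"
    using L12_slab[of "indicator (slab R)" 1 R] by (auto simp: cell.L12_def split: split_indicator)
  have "integrable cellm (\<lambda>w. loc R j f w * indicator (slab R) w)"
    by (rule sqi_integrable_mult[OF sqi_loc[OF assms(1)] s])
  moreover have "loc R j f w * indicator (slab R) w = loc R j f w" for w
    using bump_outside[of "fst (snd w) / R" j] assms(2) by (auto simp: loc_def slab_def indicator_def)
  ultimately show ?thesis using sqi_loc[OF assms(1)] by (simp add: cell.L12_def)
qed

lemma
  assumes "L2 f" "R > 0"
  shows sqi_lhat: "sqi freqm (lhat f R j)"
    and norm2_lhat: "norm2 freqm (lhat f R j) \<le> bump_bound j * norm2 cellm (cr f)"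
  unfolding lhat_def
  using cell.sqi_transform[OF L12_loc[OF assms]] cell.norm2_transform[OF L12_loc[OF assms], of j] norm2_loc[OF assms(1), of R j]
  by auto

lemma loc_tendsto:
  assumes "L2 f"
  shows "(\<lambda>n. norm2 cellm (\<lambda>w. loc (real (Suc n)) 0 f w - cr f w)) \<longlonglongrightarrow> 0"
proof (rule norm2_tendsto_0_dominated[OF sqi_cmult[OF L2_sqi[OF assms], of 2]])
  have [measurable]: "f \<in> borel_measurable borel" using assms by (rule L2_borel)
  show "(\<lambda>w. loc (real (Suc n)) 0 f w - cr f w) \<in> borel_measurable cellm" for n
    unfolding borel_measurable_cellm by measurable
  show "AE w in cellm. cmod (loc (real (Suc n)) 0 f w - cr f w) \<le> cmod (2 * cr f w)" for n
  proof (rule AE_I2)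
    fix w
    have "cmod (loc (real (Suc n)) 0 f w) \<le> cmod (cr f w)"
      using bump_0_bounds[of "fst (snd w) / real (Suc n)"] by (auto simp: loc_def norm_mult intro!: mult_left_le)
    then show "cmod (loc (real (Suc n)) 0 f w - cr f w) \<le> cmod (2 * cr f w)"
      using norm_triangle_ineq4[of "loc (real (Suc n)) 0 f w" "cr f w"] by (simp add: norm_mult)
  qed
  show "AE w in cellm. (\<lambda>n. loc (real (Suc n)) 0 f w - cr f w) \<longlonglongrightarrow> 0"
  proof (rule AE_I2)
    fix w :: pt
    have "isCont (bump 0) 0" using DERIV_isCont[OF bump_deriv] .
    moreover have "(\<lambda>n. fst (snd w) / real (Suc n)) \<longlonglongrightarrow> 0" by real_asymp
    ultimately have "(\<lambda>n. bump 0 (fst (snd w) / real (Suc n))) \<longlonglongrightarrow> bump 0 0"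
      by (rule isCont_tendsto_compose)
    then have "(\<lambda>n. loc (real (Suc n)) 0 f w - cr f w) \<longlonglongrightarrow> cr f w * of_real 1 - cr f w"
      unfolding loc_def bump_0_0 by (intro tendsto_intros)
    then show "(\<lambda>n. loc (real (Suc n)) 0 f w - cr f w) \<longlonglongrightarrow> 0" by simp
  qed
qed

lemma lhat_tendsto:
  assumes "L2 f" "cell.L2_transform (cr f) F"
  shows "(\<lambda>n. norm2 freqm (\<lambda>q. lhat f (real (Suc n)) 0 q - F q)) \<longlonglongrightarrow> 0"
  unfolding lhat_def
  by (rule cell.L2_transform_lim[OF assms(2) L12_loc[OF assms(1)] loc_tendsto[OF assms(1)]]) simp

lemma tf_borel [measurable]: "R > 0 \<Longrightarrow> tf c q R j \<in> borel_measurable borel"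
  by (rule borel_measurable_continuous_onI[OF continuous_tf])

lemma L2_integrable_mult: "L2 f \<Longrightarrow> L2 g \<Longrightarrow> integrable cellm (\<lambda>w. f w * g w)"
  using integrable_Re[OF sqi_integrable_mult[OF L2_sqi L2_sqi, of f g]] by (simp add: cr_def)

lemma ip_add_right: "L2 f \<Longrightarrow> L2 g \<Longrightarrow> L2 h \<Longrightarrow> ip f (\<lambda>w. g w + h w) = ip f g + ip f h"
  using L2_integrable_mult[of f g] L2_integrable_mult[of f h]
  by (simp add: ip_eq L2_borel distrib_left)

lemma ip_diff_left: "L2 f \<Longrightarrow> L2 g \<Longrightarrow> L2 h \<Longrightarrow> ip (\<lambda>w. f w - g w) h = ip f h - ip g h"
  using L2_integrable_mult[of f h] L2_integrable_mult[of g h]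
  by (simp add: ip_eq L2_borel left_diff_distrib)

lemma ip_bound:
  assumes "L2 f" "L2 g"
  shows "\<bar>ip f g\<bar> \<le> L2_norm f * L2_norm g"
proof -
  have "\<bar>ip f g\<bar> = cmod (LINT w|cellm. cr f w * cr g w)"
    using ip_complex[of f g] assms by (metis L2_borel norm_of_real)
  also have "\<dots> \<le> norm2 cellm (cr f) * norm2 cellm (cr g)"
    by (intro norm2_inner_bound L2_sqi assms)
  finally show ?thesis using assms by (simp add: L2_norm_eq L2_borel)
qed

text \<open>A localized character is not real, so a weak equation has to be tested with its real and its
  imaginary part, which are \<^term>\<open>tf 1\<close> and \<^term>\<open>tf (- \<i>)\<close>.\<close>

definition cpair :: "(pt \<Rightarrow> real) \<Rightarrow> (complex \<Rightarrow> pt \<Rightarrow> real) \<Rightarrow> complex" where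
  "cpair f \<phi> = of_real (ip f (\<phi> 1)) + \<i> * of_real (ip f (\<phi> (- \<i>)))"

lemma cpair_tf:
  assumes "L2 f" "R > 0"
  shows "cpair f (\<lambda>c. tf (a * c) q R j) = a * lhat f R j q"
proof -
  have [measurable]: "f \<in> borel_measurable borel" "tf c q R j \<in> borel_measurable borel" for c
    using assms by (auto intro: L2_borel)
  have i: "integrable cellm (\<lambda>w. cr f w * cr (tf c q R j) w)" for c
    by (intro sqi_integrable_mult L2_sqi assms L2_test test_fun_tf)
  have "cpair f (\<lambda>c. tf (a * c) q R j) = (LINT w|cellm. cr f w * cr (tf (a * 1) q R j) w) + \<i> * (LINT w|cellm. cr f w * cr (tf (a * (- \<i>)) q R j) w)"
    unfolding cpair_def by (simp add: ip_complex)
  also have "\<dots> = (LINT w|cellm. cr f w * cr (tf (a * 1) q R j) w + \<i> * (cr f w * cr (tf (a * (- \<i>)) q R j) w))"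
    using i by simp
  also have "\<dots> = (LINT w|cellm. a * (loc R j f w * chr w q))"
  proof (rule Bochner_Integration.integral_cong[OF refl])
    fix w
    define X where "X = a * chr w q * of_real (bump j (fst (snd w) / R))"
    \<comment> \<open>The two real test functions recover \<open>X\<close> itself, because Re (-
      \<i> X) is the imaginary part of \<open>X\<close>.\<close>
    have "complex_of_real (Re X) + \<i> * of_real (Re (X * (- \<i>))) = X" by (simp add: complex_eq_iff)
    moreover have "tf (a * 1) q R j w = Re X" "tf (a * (- \<i>)) q R j w = Re (X * (- \<i>))"
      by (simp_all only: tf_def X_def mult_1_right) (simp_all add: mult_ac)
    ultimately have "cr (tf (a * 1) q R j) w + \<i> * cr (tf (a * (- \<i>)) q R j) w = X"
      by (simp only: cr_def)
    then have "cr f w * (cr (tf (a * 1) q R j) w + \<i> * cr (tf (a * (- \<i>)) q R j) w) = a * (loc R j f w * chr w q)"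
      by (simp add: X_def loc_def mult_ac)
    then show "cr f w * cr (tf (a * 1) q R j) w + \<i> * (cr f w * cr (tf (a * (- \<i>)) q R j) w) = a * (loc R j f w * chr w q)"
      by (simp add: distrib_left mult_ac)
  qed
  also have "\<dots> = a * lhat f R j q" by (simp add: lhat_def transform_def)
  finally show ?thesis .
qed

lemma cpair_add:
  assumes "L2 f" "\<And>c. L2 (\<phi> c)" "\<And>c. L2 (\<psi> c)"
  shows "cpair f (\<lambda>c w. \<phi> c w + \<psi> c w) = cpair f \<phi> + cpair f \<psi>"
  using assms by (simp add: cpair_def ip_add_right algebra_simps)

definition fc :: "3 \<Rightarrow> freq \<Rightarrow> real" where
  "fc i q = (if i = 1 then of_int (fst q) else if i = 2 then fst (snd q) else of_int (snd (snd q)))"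

lemma fc_simps [simp]: "fc 1 (k, \<eta>, l) = of_int k" "fc 2 (k, \<eta>, l) = \<eta>" "fc 3 (k, \<eta>, l) = of_int l"
  by (simp_all add: fc_def)

lemma fst_freqm [measurable]: "fst \<in> measurable freqm (count_space UNIV)"
  and snd_snd_freqm [measurable]: "(\<lambda>q. snd (snd q)) \<in> measurable freqm (count_space UNIV)"
  and fst_snd_freqm [measurable]: "(\<lambda>q. fst (snd q)) \<in> borel_measurable freqm"
  unfolding freqm_def by measurable

lemma fc_measurable [measurable]: "fc i \<in> borel_measurable freqm"
  unfolding fc_def[abs_def] by measurable

lemma space_freqm [simp]: "space freqm = UNIV"
  by (simp add: freqm_def space_pair_measure)

lemma cpair_pd_tf:
  assumes "L2 f" "R > 0"
  shows "cpair f (\<lambda>c. pd i (tf (a * c) q R j)) =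
    - \<i> * of_real (fc i q) * a * lhat f R j q + (if i = 2 then a / of_real R * lhat f R (Suc j) q else 0)"
proof -
  obtain k \<eta> l where q: "q = (k, \<eta>, l)" by (cases q)
  have *: "cpair f (\<lambda>c. tf (b * (a * c)) q R j') = b * a * lhat f R j' q" for b j'
    using cpair_tf[OF assms, of "b * a" q j'] by (simp add: mult.assoc)
  have t: "L2 (tf c q R j')" for c q j' by (intro L2_test test_fun_tf assms)
  consider "i = 1" | "i = 2" | "i = 3" using exhaust_3 by blast
  then show ?thesis
  proof cases
    case 1
    then show ?thesis using *[of "- \<i> * of_int k" j] by (simp add: q pd_tf[OF assms(2)])
  next
    case 2
    have "cpair f (\<lambda>c w. tf (- \<i> * of_real \<eta> * (a * c)) q R j w + tf (a * c / of_real R) q R (Suc j) w) =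
      cpair f (\<lambda>c. tf (- \<i> * of_real \<eta> * (a * c)) q R j) + cpair f (\<lambda>c. tf (a * c / of_real R) q R (Suc j))"
      by (intro cpair_add assms t)
    then show ?thesis using *[of "- \<i> * of_real \<eta>" j] *[of "1 / of_real R" "Suc j"] 2
      by (simp add: q pd_tf[OF assms(2)])
  next
    case 3
    then show ?thesis using *[of "- \<i> * of_int l" j] by (simp add: q pd_tf[OF assms(2)])
  qed
qed

text \<open>Testing with cut-off characters gives the multiplier identity for \<open>lhat\<close> up
  to a term of order 1/R, and the cutoff transforms converge in L2 as R grows.\<close>

lemma weak_pd_transform:
  assumes f: "L2 f" and g: "L2 g" and weak: "\<And>\<phi>. test_fun \<phi> \<Longrightarrow> ip f (pd i \<phi>) = - ip g \<phi>"
    and F: "cell.L2_transform (cr f) F" and G: "cell.L2_transform (cr g) G"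
  shows "AE q in freqm. G q = \<i> * of_real (fc i q) * F q"
proof -
  note sq = cell.L2_transform_sqi[OF F] cell.L2_transform_sqi[OF G]
  have [measurable]: "F \<in> borel_measurable freqm" "G \<in> borel_measurable freqm"
    using sq by (auto dest: sqi_measurable)
  have eq: "lhat g R 0 q = \<i> * of_real (fc i q) * lhat f R 0 q - (if i = 2 then lhat f R 1 q / of_real R else 0)" if "R > 0" for R q
  proof -
    have "cpair f (\<lambda>c. pd i (tf (1 * c) q R 0)) = - cpair g (\<lambda>c. tf (1 * c) q R 0)"
      by (simp add: cpair_def weak test_fun_tf[OF that])
    then show ?thesis unfolding cpair_pd_tf[OF f that] cpair_tf[OF g that] by (auto split: if_splits simp: algebra_simps minus_equation_iff)
  qed
  \<comment> \<open>The multiplier is unbounded, so its product with \<open>F\<close> is not known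
    to be square integrable. Dividing by 1 + |fc i q| makes all error terms controllable in L2, and
    the claim is that \<open>D\<close> vanishes.\<close>
  define D where "D q = (G q - \<i> * of_real (fc i q) * F q) / of_real (1 + \<bar>fc i q\<bar>)" for q
  have [measurable]: "D \<in> borel_measurable freqm" unfolding D_def[abs_def] by measurable
  have pos: "0 < 1 + \<bar>fc i q\<bar>" for q by linarith
  have ptw: "cmod (D q) \<le> cmod (lhat g R 0 q - G q) + cmod (lhat f R 0 q - F q) + cmod (1 / of_real R * lhat f R 1 q)"
    if "R > 0" for R q
  proof -
    have "G q - \<i> * of_real (fc i q) * F q = - (lhat g R 0 q - G q) + \<i> * of_real (fc i q) * (lhat f R 0 q - F q)
       - (if i = 2 then lhat f R 1 q / of_real R else 0)"
      unfolding eq[OF that] by (simp add: algebra_simps)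
    moreover have "cmod (- A + B - C) \<le> cmod A + cmod B + cmod C" for A B C :: complex
      using norm_triangle_ineq4[of "- A + B" C] norm_triangle_ineq[of "- A" B] by simp
    ultimately have "cmod (G q - \<i> * of_real (fc i q) * F q) \<le> cmod (lhat g R 0 q - G q) + cmod (\<i> * of_real (fc i q) * (lhat f R 0 q - F q))
      + cmod (if i = 2 then lhat f R 1 q / of_real R else 0)" by metis
    also have "\<dots> \<le> cmod (lhat g R 0 q - G q) + \<bar>fc i q\<bar> * cmod (lhat f R 0 q - F q) + cmod (1 / of_real R * lhat f R 1 q)"
      by (intro add_mono) (auto simp: norm_mult)
    also have "\<dots> \<le> (1 + \<bar>fc i q\<bar>) * (cmod (lhat g R 0 q - G q) + cmod (lhat f R 0 q - F q) + cmod (1 / of_real R * lhat f R 1 q))"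
      by (simp add: algebra_simps add_increasing)
    finally show ?thesis
      using pos[of q] unfolding D_def by (simp add: norm_divide divide_le_eq mult.commute del: of_real_add of_real_1)
  qed
  have D: "sqi freqm D"
    by (rule norm2_le3(1)[OF sqi_diff[OF sqi_lhat[OF g, of 1 0] sq(4)] sqi_diff[OF sqi_lhat[OF f, of 1 0] sq(2)] sqi_cmult[OF sqi_lhat[OF f, of 1 1], of 1]])
      (use ptw[of 1] in auto)
  have "norm2 freqm D \<le> norm2 freqm (\<lambda>q. lhat g (real (Suc n)) 0 q - G q) + norm2 freqm (\<lambda>q. lhat f (real (Suc n)) 0 q - F q) + 1 / real (Suc n) * (bump_bound 1 * norm2 cellm (cr f))" for n
  proof -
    let ?R = "real (Suc n)"
    have "norm2 freqm D \<le> norm2 freqm (\<lambda>q. lhat g ?R 0 q - G q) + norm2 freqm (\<lambda>q. lhat f ?R 0 q - F q) + norm2 freqm (\<lambda>q. 1 / of_real ?R * lhat f ?R 1 q)"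
      by (rule norm2_le3(2)[OF sqi_diff[OF sqi_lhat[OF g] sq(4)] sqi_diff[OF sqi_lhat[OF f] sq(2)] sqi_cmult[OF sqi_lhat[OF f]]])
        (use ptw[of ?R] in auto)
    also have "norm2 freqm (\<lambda>q. 1 / of_real ?R * lhat f ?R 1 q) \<le> 1 / ?R * (bump_bound 1 * norm2 cellm (cr f))"
    proof -
      have c: "cmod (1 / complex_of_real ?R) = 1 / ?R" by (simp only: norm_divide norm_one norm_of_real abs_of_nat)
      show ?thesis unfolding norm2_cmult c by (rule mult_left_mono[OF norm2_lhat[OF f]]) simp_all
    qed
    finally show ?thesis by simp
  qed
  moreover have "(\<lambda>n. norm2 freqm (\<lambda>q. lhat g (real (Suc n)) 0 q - G q) + norm2 freqm (\<lambda>q. lhat f (real (Suc n)) 0 q - F q) + 1 / real (Suc n) * (bump_bound 1 * norm2 cellm (cr f))) \<longlonglongrightarrow> 0 + 0 + 0 * (bump_bound 1 * norm2 cellm (cr f))"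
    by (intro tendsto_intros lhat_tendsto f g F G) real_asymp
  ultimately have "norm2 freqm D \<le> 0 + 0 + 0 * (bump_bound 1 * norm2 cellm (cr f))"
    by (intro LIMSEQ_le_const) auto
  then have "norm2 freqm D = 0" by (simp add: antisym)
  from norm2_eq_0_AE[OF D this] show ?thesis
  proof eventually_elim
    case (elim q)
    have "1 + \<bar>fc i q\<bar> \<noteq> 0" using pos[of q] by linarith
    then show ?case using elim by (simp add: D_def del: of_real_add of_real_1)
  qed
qed

lemma L2_transform_exists': "L2 f \<Longrightarrow> \<exists>F. cell.L2_transform (cr f) F"
  using cell.L2_transform_exists[OF L2_sqi] by metis

text \<open>Localized characters already separate L2 functions: equal cutoff transforms at every
  scale have the same limit, and the L2 transform is injective.\<close>

lemma weak_unique: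
  assumes f: "L2 f" and g: "L2 g" and eq: "\<And>\<phi>. test_fun \<phi> \<Longrightarrow> ip f \<phi> = ip g \<phi>"
  shows "AE w in cellm. f w = g w"
proof -
  obtain F G where F: "cell.L2_transform (cr f) F" and G: "cell.L2_transform (cr g) G"
    using L2_transform_exists' f g by metis
  have "lhat f R 0 q = lhat g R 0 q" if "R > 0" for R q
    using cpair_tf[OF f that, of 1 q 0] cpair_tf[OF g that, of 1 q 0]
    by (simp add: cpair_def eq test_fun_tf[OF that])
  then have "AE q in freqm. F q = G q"
    using lhat_tendsto[OF f F] lhat_tendsto[OF g G]
    by (intro norm2_limit_unique[of _ F G "\<lambda>n. lhat g (real (Suc n)) 0"] cell.L2_transform_sqi(2)[OF F] cell.L2_transform_sqi(2)[OF G] sqi_lhat g) auto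
  from cell.L2_transform_inj[OF F G this] show ?thesis by (simp add: cr_def)
qed

lemma has_weak_pd_L2: "has_weak_pd \<alpha> f g \<Longrightarrow> L2 g"
  by (simp add: has_weak_pd_def)

lemma weak_unique_norm:
  assumes "has_weak_pd \<alpha> f g" "has_weak_pd \<alpha> f h"
  shows "L2_norm g = L2_norm h"
proof -
  have gh: "L2 g" "L2 h" using assms by (auto simp: has_weak_pd_def)
  have "AE w in cellm. g w = h w"
  proof (rule weak_unique[OF gh])
    fix \<phi> assume "test_fun \<phi>"
    then have "(- 1) ^ ord_mi \<alpha> * ip g \<phi> = (- 1) ^ ord_mi \<alpha> * ip h \<phi>"
      using assms by (simp add: has_weak_pd_def)
    then show "ip g \<phi> = ip h \<phi>" by simp
  qed
  then show ?thesis using gh by (auto simp: L2_norm_eq L2_borel cr_def intro!: norm2_cong_AE)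
qed

fun mi :: "3 \<Rightarrow> nat \<Rightarrow> multi_index" where
  "mi i j = (if i = 1 then (j, 0, 0) else if i = 2 then (0, j, 0) else (0, 0, j))"

lemma ord_mi_mi: "ord_mi (mi i j) = j" by simp

lemma pd_mi_mi: "pd_mi (mi i j) \<phi> = (pd i ^^ j) \<phi>"
proof -
  consider "i = 1" | "i = 2" | "i = 3" using exhaust_3 by blast
  then show ?thesis by cases auto
qed

text \<open>Pure derivatives are enough to control the full Sobolev weight, by
  \<open>brk_le\<close>. The induction tests the derivative of order \<open>j\<close> with
  \<open>pd i \<phi>\<close>, which is why all lower pure derivatives are assumed to exist.\<close>

lemma weak_power_transform:
  assumes f: "L2 f" and F: "cell.L2_transform (cr f) F"
    and ex: "\<And>m. m \<le> j \<Longrightarrow> \<exists>g. has_weak_pd (mi i m) f g"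
    and g: "has_weak_pd (mi i j) f g" and G: "cell.L2_transform (cr g) G"
  shows "AE q in freqm. G q = (\<i> * of_real (fc i q)) ^ j * F q"
  using ex g G
proof (induction j arbitrary: g G)
  case 0
  have "AE w in cellm. f w = g w"
    using 0(2) by (intro weak_unique f) (auto simp: has_weak_pd_def pd_mi_mi split: if_splits)
  then have "AE w in cellm. cr f w = cr g w" by (simp add: cr_def)
  from cell.L2_transform_unique[OF F 0(3) this] show ?case by eventually_elim simp
next
  case (Suc j)
  obtain h where h: "has_weak_pd (mi i j) f h" using Suc.prems(1)[of j] by auto
  then have h2: "L2 h" by (simp add: has_weak_pd_def)
  obtain H where H: "cell.L2_transform (cr h) H" using L2_transform_exists'[OF h2] by blast
  have g2: "L2 g" using Suc.prems(2) by (simp add: has_weak_pd_def)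
  have 1: "AE q in freqm. H q = (\<i> * of_real (fc i q)) ^ j * F q"
    by (rule Suc.IH[OF _ h H]) (use Suc.prems(1) in simp)
  have 2: "AE q in freqm. G q = \<i> * of_real (fc i q) * H q"
  proof (rule weak_pd_transform[OF h2 g2 _ H Suc.prems(3)])
    fix \<phi> assume \<phi>: "test_fun \<phi>"
    have "ip f ((pd i ^^ j) (pd i \<phi>)) = (- 1) ^ j * ip h (pd i \<phi>)"
      using h test_fun_pd[OF \<phi>] by (simp only: has_weak_pd_def pd_mi_mi ord_mi_mi)
    moreover have "ip f ((pd i ^^ Suc j) \<phi>) = (- 1) ^ Suc j * ip g \<phi>"
      using Suc.prems(2) \<phi> by (simp only: has_weak_pd_def pd_mi_mi ord_mi_mi)
    ultimately have "(- 1) ^ j * ip h (pd i \<phi>) = (- 1) ^ j * (- ip g \<phi>)" by (simp add: funpow_swap1)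
    then show "ip h (pd i \<phi>) = - ip g \<phi>" by (simp only: mult_cancel_left) simp
  qed
  from 1 2 show ?case by eventually_elim simp
qed

definition brk :: "freq \<Rightarrow> real" where
  "brk q = sqrt (1 + (fc 1 q)\<^sup>2 + (fc 2 q)\<^sup>2 + (fc 3 q)\<^sup>2)"

lemma brk_measurable [measurable]: "brk \<in> borel_measurable freqm"
  unfolding brk_def[abs_def] by measurable

lemma brk_ge_1: "1 \<le> brk q"
  by (simp add: brk_def add_increasing2)

lemma fc_le_brk: "\<bar>fc i q\<bar> \<le> brk q"
proof -
  have "(fc i q)\<^sup>2 \<le> 1 + (fc 1 q)\<^sup>2 + (fc 2 q)\<^sup>2 + (fc 3 q)\<^sup>2"
    using exhaust_3[of i] by (auto simp: add_increasing add_increasing2)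
  then show ?thesis unfolding brk_def by (intro real_le_rsqrt) simp
qed

text \<open>Compare with the largest of 1 and the |fc i q|: four squares under the root account for
  the factor 2.\<close>

lemma brk_le: "brk q ^ m \<le> 2 ^ m * (1 + \<bar>fc 1 q\<bar> ^ m + \<bar>fc 2 q\<bar> ^ m + \<bar>fc 3 q\<bar> ^ m)"
proof -
  define M where "M = Max {1, \<bar>fc 1 q\<bar>, \<bar>fc 2 q\<bar>, \<bar>fc 3 q\<bar>}"
  have M: "1 \<le> M" "\<bar>fc i q\<bar> \<le> M" for i
  proof -
    show "1 \<le> M" unfolding M_def by (rule Max_ge) auto
    show "\<bar>fc i q\<bar> \<le> M" unfolding M_def by (rule Max_ge) (use exhaust_3[of i] in auto)
  qed
  have "(fc i q)\<^sup>2 \<le> M\<^sup>2" for i using M(2)[of i] by (metis abs_ge_zero power2_abs power_mono)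
  moreover have "1 \<le> M\<^sup>2" using M(1) by simp
  ultimately have "1 + (fc 1 q)\<^sup>2 + (fc 2 q)\<^sup>2 + (fc 3 q)\<^sup>2 \<le> M\<^sup>2 + M\<^sup>2 + M\<^sup>2 + M\<^sup>2"
    by (intro add_mono) auto
  then have "brk q \<le> 2 * M" unfolding brk_def using M(1)
    by (intro real_le_lsqrt) (auto simp: power_mult_distrib)
  then have "brk q ^ m \<le> (2 * M) ^ m" using brk_ge_1[of q] by (intro power_mono) auto
  also have "\<dots> = 2 ^ m * M ^ m" by (rule power_mult_distrib)
  also have "M ^ m \<le> 1 + \<bar>fc 1 q\<bar> ^ m + \<bar>fc 2 q\<bar> ^ m + \<bar>fc 3 q\<bar> ^ m"
  proof -
    have "M \<in> {1, \<bar>fc 1 q\<bar>, \<bar>fc 2 q\<bar>, \<bar>fc 3 q\<bar>}" unfolding M_def by (rule Max_in) auto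
    then show ?thesis by (auto simp: add_increasing add_increasing2)
  qed
  finally show ?thesis by simp
qed

lemma finite_ord_mi: "finite {\<alpha>. ord_mi \<alpha> \<le> m}"
proof (rule finite_subset)
  show "{\<alpha>. ord_mi \<alpha> \<le> m} \<subseteq> {..m} \<times> {..m} \<times> {..m}" by auto
qed simp

lemma L2_norm_weak_le_sobolev_norm:
  assumes "has_weak_pd \<alpha> f g" "ord_mi \<alpha> \<le> m"
  shows "L2_norm g \<le> sobolev_norm m f"
proof -
  have "\<exists>g. has_weak_pd \<alpha> f g" using assms(1) by blast
  from someI_ex[OF this] have "has_weak_pd \<alpha> f (SOME g. has_weak_pd \<alpha> f g)" .
  then have "L2_norm g = L2_norm (SOME g. has_weak_pd \<alpha> f g)" by (rule weak_unique_norm[OF assms(1)])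
  also have "\<dots> \<le> sobolev_norm m f"
    unfolding sobolev_norm_def
    using assms(2) finite_ord_mi[of m]
    by (intro real_le_rsqrt member_le_sum[of \<alpha> _ "\<lambda>\<alpha>. (L2_norm (SOME g. has_weak_pd \<alpha> f g))\<^sup>2"]) auto
  finally show ?thesis .
qed

text \<open>The weight is dominated by 1 and the three pure powers; the factor 4 counts these four
  terms, and 2^m comes from \<open>brk_le\<close>.\<close>

theorem sobolev_transform:
  assumes f: "sobolev m f" and F: "cell.L2_transform (cr f) F"
  shows "sqi freqm (\<lambda>q. of_real (brk q ^ m) * F q)"
    and "norm2 freqm (\<lambda>q. of_real (brk q ^ m) * F q) \<le> 2 ^ m * 4 * sobolev_norm m f"
proof -
  have L: "L2 f" using f by (simp add: sobolev_def)
  have ex: "\<exists>g. has_weak_pd (mi i j) f g" if "j \<le> m" for i j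
    using f that unfolding sobolev_def by (metis ord_mi_mi)
  obtain g where g: "has_weak_pd (mi i m) f (g i)" for i using ex[OF order_refl] by metis
  have gL: "L2 (g i)" for i using g[of i] by (simp add: has_weak_pd_def)
  obtain G where G: "cell.L2_transform (cr (g i)) (G i)" for i
    using L2_transform_exists'[OF gL] by metis
  have GF: "AE q in freqm. G i q = (\<i> * of_real (fc i q)) ^ m * F q" for i
    by (rule weak_power_transform[OF L F ex g G])
  have bound: "norm2 freqm (G i) \<le> sobolev_norm m f" for i
    using cell.L2_transform_norm[OF G] L2_norm_weak_le_sobolev_norm[OF g, where m = m] gL
    by (simp add: L2_norm_eq L2_borel ord_mi_mi del: mi.simps)
  have "has_weak_pd (mi 1 0) f f" using L by (simp add: has_weak_pd_def)
  then have bound0: "norm2 freqm F \<le> sobolev_norm m f"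
    using cell.L2_transform_norm[OF F] L2_norm_weak_le_sobolev_norm[of "mi 1 0" f f m] L
    by (simp add: L2_norm_eq L2_borel)
  have sq: "sqi freqm F" "sqi freqm (G i)" for i
    using cell.L2_transform_sqi(2)[OF F] cell.L2_transform_sqi(2)[OF G] by auto
  have [measurable]: "F \<in> borel_measurable freqm" "G i \<in> borel_measurable freqm" for i
    using sq by (auto dest: sqi_measurable)
  let ?A = "\<lambda>q. of_real (cmod (F q)) + of_real (cmod (G 1 q)) :: complex"
  have absq: "sqi freqm (\<lambda>q. of_real (cmod (H q)) :: complex)" "norm2 freqm (\<lambda>q. of_real (cmod (H q)) :: complex) = norm2 freqm H" if "sqi freqm H" for H
    using that by (auto simp: norm2_def intro!: sqi_dominated[OF that, of _ 1])
  have A: "sqi freqm ?A" "norm2 freqm ?A \<le> norm2 freqm F + norm2 freqm (G 1)"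
    using norm2_triangle[OF absq(1)[OF sq(1)] absq(1)[OF sq(2)[of 1]]] by (auto intro!: sqi_add absq sq simp: absq sq)
  have ae: "AE q in freqm. cmod (of_real (brk q ^ m) * F q) \<le> cmod (of_real (2 ^ m) * ?A q) + cmod (of_real (2 ^ m) * G 2 q) + cmod (of_real (2 ^ m) * G 3 q)"
    using GF[of 1] GF[of 2] GF[of 3]
  proof eventually_elim
    case (elim q)
    have 1: "cmod (?A q) = cmod (F q) + cmod (G 1 q)" by (simp flip: of_real_add)
    have 2: "cmod (G i q) = \<bar>fc i q\<bar> ^ m * cmod (F q)" if "i \<in> {1, 2, 3}" for i
      using that elim by (auto simp: norm_mult norm_power)
    have "cmod (of_real (2 ^ m) * ?A q) + cmod (of_real (2 ^ m) * G 2 q) + cmod (of_real (2 ^ m) * G 3 q) =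
       2 ^ m * (1 + \<bar>fc 1 q\<bar> ^ m + \<bar>fc 2 q\<bar> ^ m + \<bar>fc 3 q\<bar> ^ m) * cmod (F q)"
    proof -
      have "cmod (of_real (2 ^ m) * X) = 2 ^ m * cmod X" for X :: complex by (simp add: norm_mult norm_power)
      moreover have "2 ^ m * (x + a * x) + 2 ^ m * (b * x) + 2 ^ m * (c * x) = 2 ^ m * (1 + a + b + c) * x" for a b c x :: real
        by (simp add: algebra_simps)
      ultimately show ?thesis using 1 2[of 1] 2[of 2] 2[of 3] by simp
    qed
    moreover have "cmod (of_real (brk q ^ m) * F q) = brk q ^ m * cmod (F q)"
      using brk_ge_1[of q] by (simp add: norm_mult norm_power)
    ultimately show ?case using brk_le[of q m] by (simp add: mult_right_mono)
  qed
  note N = norm2_le3[OF sqi_cmult[OF A(1)] sqi_cmult[OF sq(2)] sqi_cmult[OF sq(2)] _ ae]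
  show "sqi freqm (\<lambda>q. of_real (brk q ^ m) * F q)" by (rule N(1)) measurable
  have "norm2 freqm (\<lambda>q. of_real (brk q ^ m) * F q) \<le> 2 ^ m * norm2 freqm ?A + 2 ^ m * norm2 freqm (G 2) + 2 ^ m * norm2 freqm (G 3)"
    using N(2) unfolding norm2_cmult by (simp add: norm_power)
  also have "\<dots> = 2 ^ m * (norm2 freqm ?A + norm2 freqm (G 2) + norm2 freqm (G 3))" by (simp add: distrib_left)
  also have "\<dots> \<le> 2 ^ m * (4 * sobolev_norm m f)"
    using A(2) bound[of 1] bound[of 2] bound[of 3] bound0 by (intro mult_left_mono) auto
  finally show "norm2 freqm (\<lambda>q. of_real (brk q ^ m) * F q) \<le> 2 ^ m * 4 * sobolev_norm m f" by simp
qed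


subsection \<open>Sobolev regularity from decay of the transform\<close>

lemma chr_line_derivative:
  "((\<lambda>s. chr (w + s *\<^sub>R unit_vec i) q) has_vector_derivative (- \<i> * of_real (fc i q) * chr w q)) (at 0)"
proof -
  obtain k \<eta> l where q: "q = (k, \<eta>, l)" by (cases q)
  obtain x y z where w: "w = (x, y, z)" by (cases w)
  have e: "chr (w + s *\<^sub>R unit_vec i) q = chr w q * cis (- (fc i q * s))" for s
  proof -
    have m: "kap * cis a * cis b = kap * cis (a + b)" for a b by (simp add: cis_mult)
    consider "i = 1" | "i = 2" | "i = 3" using exhaust_3 by blast
    then show ?thesis
    proof cases
      case 1
      have "- (of_int k * (x + s) + \<eta> * y + of_int l * z) = - (of_int k * x + \<eta> * y + of_int l * z) + - (of_int k * s)"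
        by (simp add: algebra_simps)
      then have "chr (x + s, y, z) q = chr (x, y, z) q * cis (- (of_int k * s))" by (simp only: q chr_eq m)
      then show ?thesis using 1 by (simp add: w q unit_vec_def)
    next
      case 2
      have "- (of_int k * x + \<eta> * (y + s) + of_int l * z) = - (of_int k * x + \<eta> * y + of_int l * z) + - (\<eta> * s)"
        by (simp add: algebra_simps)
      then have "chr (x, y + s, z) q = chr (x, y, z) q * cis (- (\<eta> * s))" by (simp only: q chr_eq m)
      then show ?thesis using 2 by (simp add: w q unit_vec_def)
    next
      case 3
      have "- (of_int k * x + \<eta> * y + of_int l * (z + s)) = - (of_int k * x + \<eta> * y + of_int l * z) + - (of_int l * s)"
        by (simp add: algebra_simps)
      then have "chr (x, y, z + s) q = chr (x, y, z) q * cis (- (of_int l * s))" by (simp only: q chr_eq m)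
      then show ?thesis using 3 by (simp add: w q unit_vec_def)
    qed
  qed
  have c: "((\<lambda>s. cis (- (r * s))) has_vector_derivative (- \<i> * of_real r)) (at 0)" for r
    unfolding has_vector_derivative_complex_iff by (auto intro!: derivative_eq_intros)
  have "((\<lambda>s. chr w q * cis (- (fc i q * s))) has_vector_derivative chr w q * (- \<i> * of_real (fc i q))) (at 0)"
    by (rule has_vector_derivative_mult_right[OF c])
  then show ?thesis by (simp add: e mult_ac)
qed

lemma continuous_cr: "continuous_on UNIV \<phi> \<Longrightarrow> continuous_on UNIV (cr \<phi>)"
  unfolding cr_def[abs_def] by (intro continuous_intros)

text \<open>The line derivative of \<open>\<phi>\<close> times the character integrates to zero; the
  product rule then moves the derivative onto the character.\<close>

lemma transform_pd:
  assumes \<phi>: "test_fun \<phi>"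
  shows "transform cellm chr (cr (pd i \<phi>)) q = \<i> * of_real (fc i q) * transform cellm chr (cr \<phi>) q"
proof -
  have \<psi>: "test_fun (pd i \<phi>)" by (rule test_fun_pd[OF \<phi>])
  obtain R1 R2 where R: "\<And>x y z. R1 < \<bar>y\<bar> \<Longrightarrow> \<phi> (x, y, z) = 0" "\<And>x y z. R2 < \<bar>y\<bar> \<Longrightarrow> pd i \<phi> (x, y, z) = 0"
    using \<phi> \<psi> unfolding test_fun_def by metis
  let ?g = "\<lambda>w. cr \<phi> w * chr w q"
  let ?h = "\<lambda>w. cr (pd i \<phi>) w * chr w q + (- \<i> * of_real (fc i q)) * (cr \<phi> w * chr w q)"
  have per: "pxz \<phi>" "pxz (pd i \<phi>)" "pxz (\<lambda>w. chr w q)"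
    using \<phi> \<psi> chr_periodic by (auto simp: test_fun_def periodic_xz_eq)
  have "(LINT w|cellm. ?h w) = 0"
  proof (rule integral_line_derivative_eq_0[of ?g ?h "max R1 R2" i])
    show "continuous_on UNIV ?g" "continuous_on UNIV ?h"
      by (intro continuous_intros continuous_cr test_fun_continuous \<phi> \<psi> continuous_chr)+
    show "pxz ?g" "pxz ?h" using per by (auto simp: pxz_def cr_def)
    show "max R1 R2 < \<bar>y\<bar> \<Longrightarrow> ?g (x, y, z) = 0" "max R1 R2 < \<bar>y\<bar> \<Longrightarrow> ?h (x, y, z) = 0" for x y z
      using R by (auto simp: cr_def)
    fix w
    have "((\<lambda>s. cr \<phi> (w + s *\<^sub>R unit_vec i)) has_vector_derivative cr (pd i \<phi>) w) (at 0)"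
      using test_fun_pd_derivative[OF \<phi>, of w i] unfolding has_vector_derivative_complex_iff cr_def by simp
    from has_vector_derivative_mult[OF this chr_line_derivative[of w i q]]
    show "((\<lambda>s. ?g (w + s *\<^sub>R unit_vec i)) has_vector_derivative ?h w) (at 0)"
      by (simp add: algebra_simps)
  qed
  moreover have "integrable cellm (\<lambda>w. cr \<phi> w * chr w q)" "integrable cellm (\<lambda>w. cr (pd i \<phi>) w * chr w q)"
    using cell.integrable_transform[OF cell.L12_integrable[OF L12_test[OF \<phi>]]] cell.integrable_transform[OF cell.L12_integrable[OF L12_test[OF \<psi>]]]
    by auto
  ultimately show ?thesis unfolding transform_def
    by (subst (asm) Bochner_Integration.integral_add) (simp_all add: add_eq_0_iff)
qed

text \<open>Fourier multiplier of the derivative of order \<alpha>, for the convention in which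
  \<open>chr\<close> carries the minus sign.\<close>

definition sym :: "multi_index \<Rightarrow> freq \<Rightarrow> complex" where
  "sym \<alpha> q = (\<i> * of_real (fc 1 q)) ^ fst \<alpha> * ((\<i> * of_real (fc 2 q)) ^ fst (snd \<alpha>) * (\<i> * of_real (fc 3 q)) ^ snd (snd \<alpha>))"

lemma sym_measurable [measurable]: "sym \<alpha> \<in> borel_measurable freqm"
  unfolding sym_def[abs_def] by measurable

lemma transform_pd_power:
  assumes "test_fun \<phi>"
  shows "test_fun ((pd i ^^ j) \<phi>) \<and> transform cellm chr (cr ((pd i ^^ j) \<phi>)) q = (\<i> * of_real (fc i q)) ^ j * transform cellm chr (cr \<phi>) q"
  by (induction j) (auto simp: assms test_fun_pd transform_pd)

lemma transform_pd_mi: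
  assumes "test_fun \<phi>"
  shows "test_fun (pd_mi \<alpha> \<phi>)" "transform cellm chr (cr (pd_mi \<alpha> \<phi>)) q = sym \<alpha> q * transform cellm chr (cr \<phi>) q"
proof -
  obtain a b c where \<alpha>: "\<alpha> = (a, b, c)" by (cases \<alpha>)
  show "test_fun (pd_mi \<alpha> \<phi>)" "transform cellm chr (cr (pd_mi \<alpha> \<phi>)) q = sym \<alpha> q * transform cellm chr (cr \<phi>) q"
    unfolding \<alpha> by (auto simp: assms transform_pd_power sym_def)
qed

lemma cnj_sym: "cnj (sym \<alpha> q) = (- 1) ^ ord_mi \<alpha> * sym \<alpha> q"
proof -
  obtain a b c where \<alpha>: "\<alpha> = (a, b, c)" by (cases \<alpha>)
  have "(- (\<i> * r)) ^ n = (- 1) ^ n * (\<i> * r) ^ n" for r n by (rule power_minus)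
  then show ?thesis by (simp add: \<alpha> sym_def power_add)
qed

lemma sym_le_brk: "ord_mi \<alpha> \<le> m \<Longrightarrow> cmod (sym \<alpha> q) \<le> brk q ^ m"
proof -
  assume m: "ord_mi \<alpha> \<le> m"
  obtain a b c where \<alpha>: "\<alpha> = (a, b, c)" by (cases \<alpha>)
  have p: "\<bar>fc i q\<bar> ^ n \<le> brk q ^ n" for i n by (intro power_mono fc_le_brk) simp
  have "cmod (sym \<alpha> q) = \<bar>fc 1 q\<bar> ^ a * (\<bar>fc 2 q\<bar> ^ b * \<bar>fc 3 q\<bar> ^ c)"
    by (simp add: \<alpha> sym_def norm_mult norm_power)
  also have "\<dots> \<le> brk q ^ a * (brk q ^ b * brk q ^ c)"
    using brk_ge_1[of q] by (intro mult_mono p) auto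
  also have "\<dots> = brk q ^ ord_mi \<alpha>" by (simp add: \<alpha> power_add)
  also have "\<dots> \<le> brk q ^ m" by (intro power_increasing m brk_ge_1)
  finally show ?thesis .
qed

text \<open>The candidate is the real part of the inverse transform of the multiplier times
  \<open>F\<close>. Pairings of \<open>f\<close> with test functions are real, so the real part
  loses nothing and spares a proof that the inverse transform is real-valued.\<close>

lemma weak_pd_from_transform:
  assumes f: "L2 f" and F: "cell.L2_transform (cr f) F"
    and G: "integrable freqm (\<lambda>q. sym \<alpha> q * F q)" "sqi freqm (\<lambda>q. sym \<alpha> q * F q)"
  obtains g where "has_weak_pd \<alpha> f g" "L2_norm g \<le> norm2 freqm (\<lambda>q. sym \<alpha> q * F q)"
proof -
  define I where "I = cell.inverse_transform (\<lambda>q. sym \<alpha> q * F q)"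
  define g where "g w = Re (I w)" for w
  have I: "sqi cellm I" "norm2 cellm I \<le> norm2 freqm (\<lambda>q. sym \<alpha> q * F q)"
    unfolding I_def using cell.sqi_inverse_transform[OF G] cell.norm2_inverse_transform[OF G] by auto
  have [measurable]: "I \<in> borel_measurable borel" using sqi_measurable[OF I(1)] by simp
  have gm: "cr g \<in> borel_measurable cellm" unfolding cr_def[abs_def] g_def[abs_def] by simp
  have le: "AE w in cellm. cmod (cr g w) \<le> 1 * cmod (I w)" by (simp add: cr_def g_def abs_Re_le_cmod)
  have "pxz I" using chr_periodic unfolding I_def cell.inverse_transform_def pxz_def by simp
  then have "pxz g" by (simp add: pxz_def g_def)
  then have gL: "L2 g" using sqi_dominated[OF I(1) gm le] by (simp add: L2_iff periodic_xz_eq)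
  have "L2_norm g \<le> 1 * norm2 cellm I"
    using norm2_dominated[OF I(1) gm le] gL by (simp add: L2_norm_eq L2_borel)
  with I(2) have n: "L2_norm g \<le> norm2 freqm (\<lambda>q. sym \<alpha> q * F q)" by simp
  have "ip f (pd_mi \<alpha> \<phi>) = (- 1) ^ ord_mi \<alpha> * ip g \<phi>" if \<phi>: "test_fun \<phi>" for \<phi>
  proof -
    note p = transform_pd_mi[OF \<phi>, of \<alpha>]
    have "complex_of_real (ip f (pd_mi \<alpha> \<phi>)) = (LINT w|cellm. cr f w * cnj (cr (pd_mi \<alpha> \<phi>) w))"
      using ip_complex[of f "pd_mi \<alpha> \<phi>"] f p(1) by (simp add: L2_borel test_fun_borel) (simp add: cr_def)
    also have "\<dots> = (LINT q|freqm. F q * cnj (transform cellm chr (cr (pd_mi \<alpha> \<phi>)) q))"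
      by (rule cell.L2_transform_parseval[OF F cell.L2_transform_L12[OF L12_test[OF p(1)]]])
    also have "\<dots> = (LINT q|freqm. (- 1) ^ ord_mi \<alpha> * (sym \<alpha> q * F q * cnj (transform cellm chr (cr \<phi>) q)))"
      by (simp add: p(2) cnj_sym mult_ac)
    also have "\<dots> = (- 1) ^ ord_mi \<alpha> * (LINT w|cellm. I w * cnj (cr \<phi> w))"
      unfolding I_def using cell.inverse_transform_inner[OF G(1) cell.L12_integrable[OF L12_test[OF \<phi>]]]
      by (simp only: integral_mult_right_zero)
    finally have eq: "complex_of_real (ip f (pd_mi \<alpha> \<phi>)) = (- 1) ^ ord_mi \<alpha> * (LINT w|cellm. I w * cnj (cr \<phi> w))" .
    have "Re (LINT w|cellm. I w * cnj (cr \<phi> w)) = (LINT w|cellm. Re (I w * cnj (cr \<phi> w)))"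
      by (intro integral_Re[symmetric] sqi_integrable_mult sqi_cnj I cell.L12_sqi L12_test \<phi>)
    also have "\<dots> = ip g \<phi>"
      using gL \<phi> by (simp add: ip_eq L2_borel test_fun_borel g_def cr_def)
    finally have "Re (LINT w|cellm. I w * cnj (cr \<phi> w)) = ip g \<phi>" .
    moreover have "Re ((- 1) ^ n * X) = (- 1) ^ n * Re X" for n X
      by (cases "even n") auto
    ultimately show ?thesis using arg_cong[OF eq, of Re] by simp
  qed
  then have "has_weak_pd \<alpha> f g" using gL by (simp add: has_weak_pd_def)
  then show ?thesis using n by (rule that)
qed

definition mi_count :: "nat \<Rightarrow> real" where
  "mi_count m = sqrt (real (card {\<alpha>. ord_mi \<alpha> \<le> m}))"

text \<open>Integrability is required besides square integrability because the weak derivatives are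
  produced by an explicit inversion integral. The choice inside \<open>sobolev_norm\<close> is
  harmless by \<open>weak_unique_norm\<close>.\<close>

theorem sobolev_from_transform:
  assumes f: "L2 f" and F: "cell.L2_transform (cr f) F"
    and i: "integrable freqm (\<lambda>q. of_real (brk q ^ m) * F q)" and s: "sqi freqm (\<lambda>q. of_real (brk q ^ m) * F q)"
  shows "sobolev m f" "sobolev_norm m f \<le> mi_count m * norm2 freqm (\<lambda>q. of_real (brk q ^ m) * F q)"
proof -
  have [measurable]: "F \<in> borel_measurable freqm" using cell.L2_transform_sqi(2)[OF F] by (rule sqi_measurable)
  have b: "cmod (sym \<alpha> q * F q) \<le> cmod (of_real (brk q ^ m) * F q)" if "ord_mi \<alpha> \<le> m" for \<alpha> q
    using sym_le_brk[OF that, of q] brk_ge_1[of q] by (simp add: norm_mult norm_power mult_right_mono)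
  have ex: "\<exists>g. has_weak_pd \<alpha> f g \<and> L2_norm g \<le> norm2 freqm (\<lambda>q. of_real (brk q ^ m) * F q)" if "ord_mi \<alpha> \<le> m" for \<alpha>
  proof -
    have 1: "integrable freqm (\<lambda>q. sym \<alpha> q * F q)"
      by (rule Bochner_Integration.integrable_bound[OF i]) (use b[OF that] in auto)
    have 2: "sqi freqm (\<lambda>q. sym \<alpha> q * F q)"
      by (rule sqi_dominated[OF s, of _ 1]) (use b[OF that] in auto)
    have 3: "norm2 freqm (\<lambda>q. sym \<alpha> q * F q) \<le> 1 * norm2 freqm (\<lambda>q. of_real (brk q ^ m) * F q)"
      by (rule norm2_dominated[OF s]) (use b[OF that] in auto)
    obtain g where g: "has_weak_pd \<alpha> f g" "L2_norm g \<le> norm2 freqm (\<lambda>q. sym \<alpha> q * F q)"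
      using weak_pd_from_transform[OF f F 1 2] by blast
    show ?thesis by (rule exI[of _ g]) (use g 3 in auto)
  qed
  then show "sobolev m f" using f unfolding sobolev_def by blast
  have "(L2_norm (SOME g. has_weak_pd \<alpha> f g))\<^sup>2 \<le> (norm2 freqm (\<lambda>q. of_real (brk q ^ m) * F q))\<^sup>2" if \<alpha>: "ord_mi \<alpha> \<le> m" for \<alpha>
  proof -
    obtain g where g: "has_weak_pd \<alpha> f g" "L2_norm g \<le> norm2 freqm (\<lambda>q. of_real (brk q ^ m) * F q)"
      using ex[OF \<alpha>] by blast
    have "\<exists>g. has_weak_pd \<alpha> f g" using g(1) by blast
    from someI_ex[OF this] have h: "has_weak_pd \<alpha> f (SOME g. has_weak_pd \<alpha> f g)" .
    from has_weak_pd_L2[OF h] have "0 \<le> L2_norm (SOME g. has_weak_pd \<alpha> f g)" by (simp add: L2_norm_eq L2_borel)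
    then show ?thesis using weak_unique_norm[OF h g(1)] g(2) by (intro power_mono) auto
  qed
  then have "(\<Sum>\<alpha> | ord_mi \<alpha> \<le> m. (L2_norm (SOME g. has_weak_pd \<alpha> f g))\<^sup>2) \<le>
      real (card {\<alpha>. ord_mi \<alpha> \<le> m}) * (norm2 freqm (\<lambda>q. of_real (brk q ^ m) * F q))\<^sup>2"
    by (intro sum_bounded_above) auto
  then have "sobolev_norm m f \<le> sqrt (real (card {\<alpha>. ord_mi \<alpha> \<le> m}) * (norm2 freqm (\<lambda>q. of_real (brk q ^ m) * F q))\<^sup>2)"
    unfolding sobolev_norm_def by (rule real_sqrt_le_mono)
  then show "sobolev_norm m f \<le> mi_count m * norm2 freqm (\<lambda>q. of_real (brk q ^ m) * F q)"
    by (simp add: real_sqrt_mult mi_count_def)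
qed

section \<open>Almost everywhere limits\<close>

text \<open>If the integrals are summable, the series converges almost everywhere, so its terms
  vanish there. The whole sequence converges; no subsequence is taken.\<close>

lemma AE_tendsto_0_of_summable:
  fixes u :: "nat \<Rightarrow> 'a \<Rightarrow> real"
  assumes [measurable]: "\<And>n. u n \<in> borel_measurable M" and nonneg: "\<And>n x. 0 \<le> u n x"
    and fin: "(\<Sum>n. \<integral>\<^sup>+x. ennreal (u n x) \<partial>M) < \<infinity>"
  shows "AE x in M. (\<lambda>n. u n x) \<longlonglongrightarrow> 0"
proof -
  have "(\<integral>\<^sup>+x. (\<Sum>n. ennreal (u n x)) \<partial>M) < \<infinity>"
    using fin by (subst nn_integral_suminf) auto
  then have "AE x in M. (\<Sum>n. ennreal (u n x)) \<noteq> \<infinity>"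
    by (intro nn_integral_noteq_infinite) auto
  then show ?thesis
  proof eventually_elim
    case (elim x)
    have "summable (\<lambda>n. u n x)" using elim nonneg by (intro summable_suminf_not_top) auto
    then show ?case by (rule summable_LIMSEQ_zero)
  qed
qed

lemma suminf_ennreal_less_top:
  assumes "\<And>n. a n \<le> ennreal (b n)" "\<And>n. 0 \<le> b n" "summable b"
  shows "(\<Sum>n. a n) < (\<infinity> :: ennreal)"
proof -
  have "(\<Sum>n. a n) \<le> (\<Sum>n. ennreal (b n))" by (intro suminf_le assms(1)) auto
  also have "\<dots> = ennreal (\<Sum>n. b n)" by (rule suminf_ennreal2[OF assms(2,3)])
  finally show ?thesis by (auto intro: le_less_trans)
qed

section \<open>Characteristics of the shear flow in frequency space\<close>

definition qs :: "real \<Rightarrow> freq \<Rightarrow> freq" where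
  "qs t q = (fst q, fst (snd q) - of_int (fst q) * t, snd (snd q))"

lemma qs_eq [simp]: "qs t (k, \<eta>, l) = (k, \<eta> - of_int k * t, l)" by (simp add: qs_def)

lemma qs_0 [simp]: "qs 0 q = q" by (simp add: qs_def)

lemma qs_measurable [measurable]: "qs t \<in> measurable freqm freqm"
proof -
  have "qs t \<in> measurable freqm (count_space UNIV \<Otimes>\<^sub>M (lborel \<Otimes>\<^sub>M count_space UNIV))"
    unfolding qs_def[abs_def] by measurable
  then show ?thesis by (simp only: freqm_def[symmetric])
qed

lemma sigma_finite_int: "sigma_finite_measure (count_space (UNIV :: int set))"
  by (rule sigma_finite_measure_count_space_countable) simp

interpretation lz: sigma_finite_measure "(lborel :: real measure) \<Otimes>\<^sub>M count_space (UNIV :: int set)"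
  by (rule sigma_finite_pair_measure[OF sigma_finite_lborel sigma_finite_int])

interpretation zz: sigma_finite_measure "count_space (UNIV :: int set)"
  by (rule sigma_finite_int)

lemma nn_integral_freqm:
  assumes "F \<in> borel_measurable freqm"
  shows "(\<integral>\<^sup>+q. F q \<partial>freqm) = (\<integral>\<^sup>+k. \<integral>\<^sup>+\<eta>. \<integral>\<^sup>+l. F (k, \<eta>, l) \<partial>count_space UNIV \<partial>lborel \<partial>count_space UNIV)"
proof -
  have [measurable]: "F \<in> borel_measurable (count_space UNIV \<Otimes>\<^sub>M (lborel \<Otimes>\<^sub>M count_space UNIV))"
    using assms by (simp add: freqm_def)
  show ?thesis unfolding freqm_def by (simp add: lz.nn_integral_fst[symmetric] zz.nn_integral_fst[symmetric])
qed

text \<open>For fixed \<open>k\<close> the map is a translation in \<eta>, so it preserves the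
  frequency measure.\<close>

lemma nn_integral_qs:
  assumes F: "F \<in> borel_measurable freqm"
  shows "(\<integral>\<^sup>+q. F (qs t q) \<partial>freqm) = (\<integral>\<^sup>+q. F q \<partial>freqm)"
proof -
  have [measurable]: "F \<in> borel_measurable (count_space UNIV \<Otimes>\<^sub>M (lborel \<Otimes>\<^sub>M count_space UNIV))"
    using assms by (simp add: freqm_def)
  have "(\<integral>\<^sup>+q. F (qs t q) \<partial>freqm) = (\<integral>\<^sup>+k. \<integral>\<^sup>+\<eta>. \<integral>\<^sup>+l. F (k, \<eta> - of_int k * t, l) \<partial>count_space UNIV \<partial>lborel \<partial>count_space UNIV)"
    using measurable_compose[OF qs_measurable F] by (subst nn_integral_freqm) auto
  also have "\<dots> = (\<integral>\<^sup>+k. \<integral>\<^sup>+\<eta>. \<integral>\<^sup>+l. F (k, \<eta>, l) \<partial>count_space UNIV \<partial>lborel \<partial>count_space UNIV)"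
  proof (rule nn_integral_cong)
    fix k :: int
    have m: "(\<lambda>\<eta>. \<integral>\<^sup>+l. F (k, \<eta>, l) \<partial>count_space UNIV) \<in> borel_measurable borel"
      by measurable
    show "(\<integral>\<^sup>+\<eta>. \<integral>\<^sup>+l. F (k, \<eta> - of_int k * t, l) \<partial>count_space UNIV \<partial>lborel) = (\<integral>\<^sup>+\<eta>. \<integral>\<^sup>+l. F (k, \<eta>, l) \<partial>count_space UNIV \<partial>lborel)"
      using nn_integral_real_affine[OF m, of 1 "- (of_int k * t)"] by simp
  qed
  also have "\<dots> = (\<integral>\<^sup>+q. F q \<partial>freqm)" by (rule nn_integral_freqm[OF F, symmetric])
  finally show ?thesis .
qed

lemma norm2_qs:
  assumes "sqi freqm F"
  shows "sqi freqm (\<lambda>q. F (qs t q))" "norm2 freqm (\<lambda>q. F (qs t q)) = norm2 freqm F"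
proof -
  have F: "F \<in> borel_measurable freqm" using assms by (rule sqi_measurable)
  have m: "(\<lambda>q. F (qs t q)) \<in> borel_measurable freqm" by (rule measurable_compose[OF qs_measurable F])
  have e: "(\<integral>\<^sup>+q. ennreal ((cmod (F (qs t q)))\<^sup>2) \<partial>freqm) = (\<integral>\<^sup>+q. ennreal ((cmod (F q))\<^sup>2) \<partial>freqm)"
    using nn_integral_qs[of "\<lambda>q. ennreal ((cmod (F q))\<^sup>2)" t] F by simp
  show s: "sqi freqm (\<lambda>q. F (qs t q))" using assms m e by (simp add: sqi_iff_nn)
  show "norm2 freqm (\<lambda>q. F (qs t q)) = norm2 freqm F"
    using e by (simp add: nn_norm2[OF s] nn_norm2[OF assms] power2_eq_iff_nonneg)
qed

section \<open>Time dependence of localized transforms\<close>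

lemma L2_cont_L2: "L2_continuous V \<Longrightarrow> t \<ge> 0 \<Longrightarrow> L2 (V t)"
  by (simp add: L2_continuous_def)

lemma cr_diff: "cr (\<lambda>w. f w - g w) = (\<lambda>w. cr f w - cr g w)" by (simp add: cr_def fun_eq_iff)

lemma L2_diff:
  assumes "L2 f" "L2 g"
  shows "L2 (\<lambda>w. f w - g w)"
  unfolding L2_iff cr_diff
proof
  show "periodic_xz (\<lambda>w. f w - g w)" using L2_periodic[OF assms(1)] L2_periodic[OF assms(2)] by (simp add: periodic_xz_def)
qed (intro sqi_diff L2_sqi assms)

lemma L2_norm_nonneg: "L2 f \<Longrightarrow> 0 \<le> L2_norm f"
  by (simp add: L2_norm_eq L2_borel)

lemma L2_norm_continuous:
  assumes "L2_continuous V" "t \<ge> 0"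
  shows "((\<lambda>s. L2_norm (V s)) \<longlongrightarrow> L2_norm (V t)) (at t within {0..})"
proof (rule LIM_zero_cancel, rule Lim_null_comparison)
  show "((\<lambda>s. L2_norm (\<lambda>w. V s w - V t w)) \<longlongrightarrow> 0) (at t within {0..})"
    using assms by (simp add: L2_continuous_def)
  show "\<forall>\<^sub>F s in at t within {0..}. norm (L2_norm (V s) - L2_norm (V t)) \<le> L2_norm (\<lambda>w. V s w - V t w)"
    unfolding eventually_at_filter
  proof (intro always_eventually allI impI)
    fix s :: real assume "s \<in> {0..}"
    then have L: "L2 (V s)" "L2 (V t)" using assms L2_cont_L2 by auto
    show "norm (L2_norm (V s) - L2_norm (V t)) \<le> L2_norm (\<lambda>w. V s w - V t w)"
      using norm2_diff_abs[OF L2_sqi[OF L(1)] L2_sqi[OF L(2)]] L L2_diff[OF L]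
      by (simp add: L2_norm_eq L2_borel cr_diff)
  qed
qed

lemma L2_norm_bounded:
  assumes "L2_continuous V"
  obtains B where "B \<ge> 0" "\<And>s. s \<in> {0..t} \<Longrightarrow> norm2 cellm (cr (V s)) \<le> B"
proof -
  have "continuous_on {0..t} (\<lambda>s. L2_norm (V s))"
    unfolding continuous_on_def
    by (intro ballI tendsto_within_subset[OF L2_norm_continuous[OF assms]]) auto
  then have "compact ((\<lambda>s. L2_norm (V s)) ` {0..t})" by (intro compact_continuous_image) auto
  then obtain B where B: "\<And>s. s \<in> {0..t} \<Longrightarrow> \<bar>L2_norm (V s)\<bar> \<le> B"
    unfolding real_norm_def[symmetric] using compact_imp_bounded bounded_iff by (metis imageI)
  show ?thesis
  proof (rule that[of "max B 0"])
    fix s assume s: "s \<in> {0..t}"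
    then have "L2 (V s)" using L2_cont_L2[OF assms] by simp
    then show "norm2 cellm (cr (V s)) \<le> max B 0"
      using B[OF s] by (simp add: L2_norm_eq L2_borel)
  qed simp
qed

lemma cmod_chr: "cmod (chr w q) = kap"
proof -
  obtain k \<eta> l where q: "q = (k, \<eta>, l)" by (cases q)
  obtain x y z where w: "w = (x, y, z)" by (cases w)
  show ?thesis using kap_pos by (simp add: q w chr_eq norm_mult)
qed

text \<open>Moving the frequency along a characteristic multiplies the character by a phase in
  \<open>y\<close>; the time derivative of this phase is what cancels the transport term.\<close>

lemma chr_qs: "chr w (qs s q) = chr w q * cis (of_int (fst q) * s * fst (snd w))"
proof -
  obtain k \<eta> l where q: "q = (k, \<eta>, l)" by (cases q)
  obtain x y z where w: "w = (x, y, z)" by (cases w)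
  have "- (of_int k * x + (\<eta> - of_int k * s) * y + of_int l * z) = - (of_int k * x + \<eta> * y + of_int l * z) + of_int k * s * y"
    by (simp add: algebra_simps)
  then have "chr w (qs s q) = kap * cis (- (of_int k * x + \<eta> * y + of_int l * z) + of_int k * s * y)"
    by (simp only: q w qs_eq chr_eq)
  then show ?thesis by (simp only: q w chr_eq cis_mult[symmetric] fst_conv snd_conv mult.assoc)
qed

lemma cmod_cis_1: "cmod (cis a - 1) \<le> \<bar>a\<bar>"
  using iexp_approx1[of a 0] by (simp add: cis_conv_exp)

lemma cmod_cis_2: "cmod (cis a - 1 - \<i> * a) \<le> a\<^sup>2"
proof -
  have "cmod (cis a - 1 - \<i> * a) \<le> \<bar>a\<bar>\<^sup>2 / 2"
    using iexp_approx1[of a 1] by (simp add: cis_conv_exp diff_diff_eq numeral_2_eq_2)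
  also have "\<dots> \<le> a\<^sup>2" by simp
  finally show ?thesis .
qed

text \<open>Cauchy-Schwarz against the character on the slab. The constant depends on
  \<open>R\<close>, which is good enough for continuity in time at a fixed scale.\<close>

lemma norm2_cell_le_transform:
  "L2 f \<Longrightarrow> R > 0 \<Longrightarrow> cmod (lhat f R j q) \<le> bump_bound j * norm2 cellm (cr f) * (kap * norm2 cellm (indicator (slab R)))"
proof -
  assume f: "L2 f" and R: "R > 0"
  have s: "sqi cellm (indicator (slab R) :: pt \<Rightarrow> complex)"
    using L12_slab[of "indicator (slab R)" 1 R] by (auto simp: cell.L12_def split: split_indicator)
  have chr_m: "(\<lambda>w. chr w q) \<in> borel_measurable borel" by (rule borel_measurable_continuous_onI[OF continuous_chr])
  have s2: "sqi cellm (\<lambda>w. indicator (slab R) w * chr w q)"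
    by (rule sqi_dominated[OF s, of _ kap]) (use chr_m in \<open>auto simp: norm_mult cmod_chr mult.commute\<close>)
  have n2: "norm2 cellm (\<lambda>w. indicator (slab R) w * chr w q) \<le> kap * norm2 cellm (indicator (slab R))"
    by (rule norm2_dominated[OF s]) (use chr_m kap_pos in \<open>auto simp: norm_mult cmod_chr mult.commute\<close>)
  have "loc R j f w * chr w q = loc R j f w * (indicator (slab R) w * chr w q)" for w
    using bump_outside[of "fst (snd w) / R" j] R by (auto simp: loc_def slab_def indicator_def)
  then have "cmod (lhat f R j q) = cmod (LINT w|cellm. loc R j f w * (indicator (slab R) w * chr w q))"
    by (simp only: lhat_def transform_def)
  also have "\<dots> \<le> norm2 cellm (loc R j f) * norm2 cellm (\<lambda>w. indicator (slab R) w * chr w q)"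
    by (intro norm2_inner_bound sqi_loc f s2)
  also have "\<dots> \<le> (bump_bound j * norm2 cellm (cr f)) * (kap * norm2 cellm (indicator (slab R)))"
    by (intro mult_mono norm2_loc f n2) (auto simp: bump_bound less_imp_le)
  finally show ?thesis .
qed

lemma lhat_diff:
  assumes "L2 f" "L2 g" "R > 0"
  shows "lhat (\<lambda>w. f w - g w) R j q = lhat f R j q - lhat g R j q"
proof -
  have "loc R j (\<lambda>w. f w - g w) = (\<lambda>w. loc R j f w - loc R j g w)"
    by (simp add: fun_eq_iff loc_def cr_def left_diff_distrib)
  then show ?thesis unfolding lhat_def
    using cell.transform_diff[OF cell.L12_integrable[OF L12_loc[OF assms(1,3)]] cell.L12_integrable[OF L12_loc[OF assms(2,3)]]]
    by simp
qed

lemma lhat_qs_lipschitz: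
  assumes f: "L2 f" and R: "R > 0"
  shows "cmod (lhat f R j (qs s q) - lhat f R j (qs t q)) \<le> \<bar>of_int (fst q)\<bar> * \<bar>s - t\<bar> * R * kap * (LINT w|cellm. cmod (loc R j f w))"
proof -
  note I = cell.L12_integrable[OF L12_loc[OF f R]]
  have "lhat f R j (qs s q) - lhat f R j (qs t q) = (LINT w|cellm. loc R j f w * chr w (qs s q) - loc R j f w * chr w (qs t q))"
    unfolding lhat_def transform_def
    by (rule Bochner_Integration.integral_diff[symmetric]) (auto intro: cell.integrable_transform I)
  also have "cmod \<dots> \<le> (LINT w|cellm. \<bar>of_int (fst q)\<bar> * \<bar>s - t\<bar> * R * kap * cmod (loc R j f w))"
  proof (rule order_trans[OF integral_norm_bound integral_mono])
    show "integrable cellm (\<lambda>w. cmod (loc R j f w * chr w (qs s q) - loc R j f w * chr w (qs t q)))"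
      by (intro integrable_norm Bochner_Integration.integrable_diff cell.integrable_transform I) auto
    show "integrable cellm (\<lambda>w. \<bar>of_int (fst q)\<bar> * \<bar>s - t\<bar> * R * kap * cmod (loc R j f w))"
      by (intro integrable_mult_right integrable_norm I)
    fix w
    show "cmod (loc R j f w * chr w (qs s q) - loc R j f w * chr w (qs t q)) \<le> \<bar>of_int (fst q)\<bar> * \<bar>s - t\<bar> * R * kap * cmod (loc R j f w)"
    proof (cases "\<bar>fst (snd w)\<bar> < R")
      case False
      then have "loc R j f w = 0" using bump_outside[of "fst (snd w) / R" j] R by (simp add: loc_def)
      then show ?thesis by simp
    next
      case True
      have "of_int (fst q) * s * y = of_int (fst q) * t * y + of_int (fst q) * (s - t) * y" for y :: real
        by (simp add: algebra_simps)
      then have "cis (of_int (fst q) * s * fst (snd w)) = cis (of_int (fst q) * t * fst (snd w)) * cis (of_int (fst q) * (s - t) * fst (snd w))"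
        by (simp only: cis_mult)
      then have "chr w (qs s q) - chr w (qs t q) = chr w (qs t q) * (cis (of_int (fst q) * (s - t) * fst (snd w)) - 1)"
        by (simp add: chr_qs right_diff_distrib)
      then have "cmod (chr w (qs s q) - chr w (qs t q)) = kap * cmod (cis (of_int (fst q) * (s - t) * fst (snd w)) - 1)"
        by (simp only: norm_mult cmod_chr)
      also have "\<dots> \<le> kap * (\<bar>of_int (fst q)\<bar> * \<bar>s - t\<bar> * R)"
      proof (intro mult_left_mono)
        have "cmod (cis (of_int (fst q) * (s - t) * fst (snd w)) - 1) \<le> \<bar>of_int (fst q)\<bar> * \<bar>s - t\<bar> * \<bar>fst (snd w)\<bar>"
          using cmod_cis_1[of "of_int (fst q) * (s - t) * fst (snd w)"] by (simp add: abs_mult)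
        also have "\<dots> \<le> \<bar>of_int (fst q)\<bar> * \<bar>s - t\<bar> * R" using True by (intro mult_left_mono) auto
        finally show "cmod (cis (of_int (fst q) * (s - t) * fst (snd w)) - 1) \<le> \<bar>of_int (fst q)\<bar> * \<bar>s - t\<bar> * R" .
      qed (use kap_pos in simp)
      finally have "cmod (loc R j f w) * cmod (chr w (qs s q) - chr w (qs t q)) \<le> cmod (loc R j f w) * (kap * (\<bar>of_int (fst q)\<bar> * \<bar>s - t\<bar> * R))"
        by (rule mult_left_mono) simp
      then show ?thesis unfolding right_diff_distrib[symmetric] norm_mult by (simp only: mult_ac)
    qed
  qed
  finally show ?thesis by simp
qed

text \<open>The change splits into that of the function, controlled by
  \<open>norm2_cell_le_transform\<close>, and that of the frequency, which is Lipschitz because |y|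
  <= R on the support of the cutoff.\<close>

lemma lhat_qs_continuous:
  assumes V: "L2_continuous V" and R: "R > 0" and t: "t \<ge> 0"
  shows "((\<lambda>s. lhat (V s) R j (qs s q)) \<longlongrightarrow> lhat (V t) R j (qs t q)) (at t within {0..})"
proof (rule LIM_zero_cancel, rule Lim_null_comparison)
  define C where "C = bump_bound j * (kap * norm2 cellm (indicator (slab R)))"
  define D where "D = \<bar>of_int (fst q)\<bar> * R * kap * (LINT w|cellm. cmod (loc R j (V t) w))"
  have Vt: "L2 (V t)" using L2_cont_L2[OF V t] .
  show "\<forall>\<^sub>F s in at t within {0..}. cmod (lhat (V s) R j (qs s q) - lhat (V t) R j (qs t q)) \<le> C * L2_norm (\<lambda>w. V s w - V t w) + D * \<bar>s - t\<bar>"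
    unfolding eventually_at_filter
  proof (intro always_eventually allI impI)
    fix s :: real assume "s \<in> {0..}"
    then have Vs: "L2 (V s)" using L2_cont_L2[OF V] by simp
    have "lhat (V s) R j (qs s q) - lhat (V t) R j (qs t q) = lhat (\<lambda>w. V s w - V t w) R j (qs s q) + (lhat (V t) R j (qs s q) - lhat (V t) R j (qs t q))"
      by (simp add: lhat_diff[OF Vs Vt R])
    also have "cmod \<dots> \<le> cmod (lhat (\<lambda>w. V s w - V t w) R j (qs s q)) + cmod (lhat (V t) R j (qs s q) - lhat (V t) R j (qs t q))"
      by (rule norm_triangle_ineq)
    also have "\<dots> \<le> C * L2_norm (\<lambda>w. V s w - V t w) + D * \<bar>s - t\<bar>"
      using norm2_cell_le_transform[OF L2_diff[OF Vs Vt] R, of j "qs s q"] lhat_qs_lipschitz[OF Vt R, of j s q t] L2_diff[OF Vs Vt]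
      by (intro add_mono) (auto simp: C_def D_def L2_norm_eq L2_borel mult_ac)
    finally show "cmod (lhat (V s) R j (qs s q) - lhat (V t) R j (qs t q)) \<le> C * L2_norm (\<lambda>w. V s w - V t w) + D * \<bar>s - t\<bar>" .
  qed
  have "((\<lambda>s. C * L2_norm (\<lambda>w. V s w - V t w) + D * \<bar>s - t\<bar>) \<longlongrightarrow> C * 0 + D * \<bar>t - t\<bar>) (at t within {0..})"
    using V t by (intro tendsto_intros) (auto simp: L2_continuous_def)
  then show "((\<lambda>s. C * L2_norm (\<lambda>w. V s w - V t w) + D * \<bar>s - t\<bar>) \<longlongrightarrow> 0) (at t within {0..})" by simp
qed

lemma lhat_qs_continuous_on:
  assumes "L2_continuous V" "R > 0" "S \<subseteq> {0..}"
  shows "continuous_on S (\<lambda>s. lhat (V s) R j (qs s q))"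
  unfolding continuous_on_def
proof
  fix t assume "t \<in> S"
  then have "t \<ge> 0" using assms(3) by auto
  then show "((\<lambda>s. lhat (V s) R j (qs s q)) \<longlongrightarrow> lhat (V t) R j (qs t q)) (at t within S)"
    by (intro tendsto_within_subset[OF lhat_qs_continuous assms(3)] assms)
qed

lemma lhat_measurable: "L2 f \<Longrightarrow> R > 0 \<Longrightarrow> lhat f R j \<in> borel_measurable freqm"
  by (rule sqi_measurable[OF sqi_lhat])

text \<open>Continuity in time and measurability in frequency give joint measurability, through
  approximation by step functions in time. \<open>max 0 s\<close> extends the family to negative
  times, where nothing is assumed about \<open>V\<close>.\<close>

lemma lhat_joint_measurable:
  assumes V: "L2_continuous V" and R: "R > 0"
  shows "(\<lambda>(s, q). lhat (V (max 0 s)) R j (qs (max 0 s) q)) \<in> borel_measurable (lborel \<Otimes>\<^sub>M freqm)"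
proof (rule borel_measurable_LIMSEQ_metric)
  define g where "g n s = of_int \<lfloor>real (Suc n) * max 0 s\<rfloor> / real (Suc n)" for n :: nat and s :: real
  have g: "g n s \<ge> 0" for n s by (simp add: g_def)
  fix n
  let ?h = "\<lambda>i::int. \<lambda>q. lhat (V (max 0 (of_int i / real (Suc n)))) R j (qs (max 0 (of_int i / real (Suc n))) q)"
  have hm: "?h i \<in> borel_measurable freqm" for i
    by (rule measurable_compose[OF qs_measurable lhat_measurable]) (auto intro: L2_cont_L2[OF V] R)
  have "(\<lambda>p. ?h \<lfloor>real (Suc n) * max 0 (fst p)\<rfloor> (snd p)) \<in> borel_measurable (lborel \<Otimes>\<^sub>M freqm)"
  proof (rule measurable_compose_countable[of "\<lambda>i p. ?h i (snd p)"])
    show "(\<lambda>p. ?h i (snd p)) \<in> borel_measurable (lborel \<Otimes>\<^sub>M freqm)" for i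
      by (rule measurable_compose[OF measurable_snd hm])
    show "(\<lambda>p. \<lfloor>real (Suc n) * max 0 (fst p)\<rfloor>) \<in> measurable (lborel \<Otimes>\<^sub>M freqm) (count_space UNIV)"
      by measurable
  qed
  moreover have "max 0 (of_int \<lfloor>real (Suc n) * max 0 s\<rfloor> / real (Suc n)) = g n s" for s
    using g[of n s] unfolding g_def by (rule max_absorb2)
  ultimately show "(\<lambda>(s, q). lhat (V (g n s)) R j (qs (g n s) q)) \<in> borel_measurable (lborel \<Otimes>\<^sub>M freqm)"
    by (simp only: case_prod_beta')
next
  define g where "g n s = of_int \<lfloor>real (Suc n) * max 0 s\<rfloor> / real (Suc n)" for n :: nat and s :: real
  fix p :: "real \<times> freq"
  obtain s q where p: "p = (s, q)" by (cases p)
  have g: "g n s \<ge> 0" for n by (simp add: g_def)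
  have "(\<lambda>n. g n s) \<longlonglongrightarrow> max 0 s"
  proof (rule LIM_zero_cancel, rule Lim_null_comparison[OF always_eventually[OF allI]])
    fix n
    define N where "N = real (Suc n)"
    have N: "N > 0" by (simp add: N_def)
    have 1: "\<bar>of_int \<lfloor>N * max 0 s\<rfloor> - N * max 0 s\<bar> \<le> 1" by linarith
    have "g n s - max 0 s = (of_int \<lfloor>N * max 0 s\<rfloor> - N * max 0 s) / N"
      using N unfolding g_def N_def[symmetric] by (simp add: diff_divide_distrib)
    then have "norm (g n s - max 0 s) = \<bar>of_int \<lfloor>N * max 0 s\<rfloor> - N * max 0 s\<bar> / N" using N by simp
    also have "\<dots> \<le> 1 / N" using 1 N by (intro divide_right_mono) auto
    finally show "norm (g n s - max 0 s) \<le> 1 / real (Suc n)" by (simp only: N_def)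
  next
    show "(\<lambda>n. 1 / real (Suc n)) \<longlonglongrightarrow> 0" by real_asymp
  qed
  then have "((\<lambda>n. lhat (V (g n s)) R j (qs (g n s) q)) \<longlongrightarrow> lhat (V (max 0 s)) R j (qs (max 0 s) q)) sequentially"
    using continuous_on_tendsto_compose[OF lhat_qs_continuous_on[OF V R order_refl, of j q], of "\<lambda>n. g n s" "max 0 s"] g by simp
  then show "(\<lambda>n. (case p of (s, q) \<Rightarrow> lhat (V (g n s)) R j (qs (g n s) q))) \<longlonglongrightarrow> (case p of (s, q) \<Rightarrow> lhat (V (max 0 s)) R j (qs (max 0 s) q))"
    by (simp add: p)
qed

text \<open>In the evolution of a localized transform every error term carries a factor \<open>1 / R\<close>; its size is
  measured by this time integral.\<close>

definition Jt :: "(real \<Rightarrow> pt \<Rightarrow> real) \<Rightarrow> real \<Rightarrow> nat \<Rightarrow> real \<Rightarrow> freq \<Rightarrow> real" where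
  "Jt V R j t q = integral {0..t} (\<lambda>s. cmod (lhat (V s) R j (qs s q)))"

lemma Jt_nonneg: "0 \<le> Jt V R j t q"
  unfolding Jt_def
  by (cases "(\<lambda>s. cmod (lhat (V s) R j (qs s q))) integrable_on {0..t}")
    (auto intro!: Henstock_Kurzweil_Integration.integral_nonneg simp: not_integrable_integral)

text \<open>Cauchy-Schwarz in time and Plancherel at each time bound the L2 norm of
  \<open>Jt\<close> independently of \<open>R\<close>. Divided by R = n + 1 and squared, the bound
  is summable in \<open>n\<close>, so the errors vanish almost everywhere along all
  integers.\<close>

lemma Jt_AE_tendsto:
  assumes V: "L2_continuous V" and t: "t \<ge> 0"
  shows "AE q in freqm. (\<lambda>n. 1 / real (Suc n) * Jt V (real (Suc n)) j t q) \<longlonglongrightarrow> 0"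
proof -
  obtain B where B: "B \<ge> 0" "\<And>s. s \<in> {0..t} \<Longrightarrow> norm2 cellm (cr (V s)) \<le> B"
    using L2_norm_bounded[OF V] by metis
  interpret P: pair_sigma_finite lborel freqm
    by (intro pair_sigma_finite.intro sigma_finite_lborel cell.N.sigma_finite_measure_axioms)
  define h where "h R s q = ennreal (cmod (lhat (V (max 0 s)) R j (qs (max 0 s) q))) * indicator {0..t} s" for R s q
  have hm [measurable]: "(\<lambda>p. h R (fst p) (snd p)) \<in> borel_measurable (lborel \<Otimes>\<^sub>M freqm)" if "R > 0" for R
    using lhat_joint_measurable[OF V that, of j] unfolding h_def by (simp add: case_prod_beta') measurable
  have hm2: "(\<lambda>s. h R s q) \<in> borel_measurable lborel" if "R > 0" for R q
    using measurable_Pair1[OF hm[OF that], of q] by simp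
  have hm3 [measurable]: "(\<lambda>p. h R (snd p) (fst p)) \<in> borel_measurable (freqm \<Otimes>\<^sub>M lborel)" if "R > 0" for R
    using measurable_pair_swap[OF hm[OF that]] by (simp add: case_prod_beta')
  have Jh: "ennreal (Jt V R j t q) = (\<integral>\<^sup>+s. h R s q \<partial>lborel)" if R: "R > 0" for R q
  proof -
    have c: "continuous_on {0..t} (\<lambda>s. cmod (lhat (V s) R j (qs s q)))"
      by (intro continuous_on_norm lhat_qs_continuous_on V R) auto
    have si: "set_integrable lborel {0..t} (\<lambda>s. cmod (lhat (V s) R j (qs s q)))"
      by (rule borel_integrable_atLeastAtMost'[OF c])
    have "Jt V R j t q = (LINT s:{0..t}|lborel. cmod (lhat (V s) R j (qs s q)))"
      unfolding Jt_def using set_borel_integral_eq_integral(2)[OF si] by simp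
    also have "ennreal \<dots> = (\<integral>\<^sup>+s. ennreal (indicator {0..t} s *\<^sub>R cmod (lhat (V s) R j (qs s q))) \<partial>lborel)"
      unfolding set_lebesgue_integral_def using si unfolding set_integrable_def
      by (intro nn_integral_eq_integral[symmetric]) auto
    also have "\<dots> = (\<integral>\<^sup>+s. h R s q \<partial>lborel)"
      unfolding h_def by (rule nn_integral_cong) (auto simp: indicator_def)
    finally show ?thesis .
  qed
  have Jm: "Jt V R j t \<in> borel_measurable freqm" if R: "R > 0" for R
  proof -
    have "(\<lambda>q. \<integral>\<^sup>+s. h R s q \<partial>lborel) \<in> borel_measurable freqm"
      using hm3[OF R] by (intro lborel.borel_measurable_nn_integral) (simp add: case_prod_beta')
    then have "(\<lambda>q. enn2real (ennreal (Jt V R j t q))) \<in> borel_measurable freqm"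
      unfolding Jh[OF R] by measurable
    then show ?thesis by (simp add: Jt_nonneg)
  qed
  have est: "(\<integral>\<^sup>+q. ennreal ((Jt V R j t q)\<^sup>2) \<partial>freqm) \<le> ennreal (t * (t * (bump_bound j * B)\<^sup>2))" if R: "R > 0" for R
  proof -
    have sq: "ennreal ((Jt V R j t q)\<^sup>2) \<le> ennreal t * (\<integral>\<^sup>+s. (h R s q)\<^sup>2 \<partial>lborel)" for q
    proof -
      have "ennreal ((Jt V R j t q)\<^sup>2) = (\<integral>\<^sup>+s. indicator {0..t} s * h R s q \<partial>lborel)\<^sup>2"
      proof -
        have "(\<integral>\<^sup>+s. indicator {0..t} s * h R s q \<partial>lborel) = (\<integral>\<^sup>+s. h R s q \<partial>lborel)"
          by (rule nn_integral_cong) (auto simp: h_def indicator_def)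
        then show ?thesis using Jh[OF R, of q] Jt_nonneg[of V R j t q] by (simp flip: ennreal_power)
      qed
      also have "\<dots> \<le> (\<integral>\<^sup>+s. (indicator {0..t} s)\<^sup>2 \<partial>lborel) * (\<integral>\<^sup>+s. (h R s q)\<^sup>2 \<partial>lborel)"
        by (rule Cauchy_Schwarz_nn_integral) (use hm2[OF R] in auto)
      also have "(\<integral>\<^sup>+s. (indicator {0..t} s)\<^sup>2 \<partial>lborel) = (\<integral>\<^sup>+s. indicator {0..t} s \<partial>lborel)"
        by (rule nn_integral_cong) (auto simp: indicator_def)
      also have "\<dots> = ennreal t" using t by simp
      finally show ?thesis .
    qed
    \<comment> \<open>At a fixed time \<open>qs\<close> preserves the measure, so Plancherel
      applies, with the bound \<open>B\<close> that continuity provides on the compact time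
      interval.\<close>
    have in_q: "(\<integral>\<^sup>+q. (h R s q)\<^sup>2 \<partial>freqm) \<le> ennreal ((bump_bound j * B)\<^sup>2) * indicator {0..t} s" for s
    proof (cases "s \<in> {0..t}")
      case True
      then have L: "L2 (V s)" and m: "max 0 s = s" using L2_cont_L2[OF V] by auto
      have "(\<integral>\<^sup>+q. (h R s q)\<^sup>2 \<partial>freqm) = (\<integral>\<^sup>+q. ennreal ((cmod (lhat (V s) R j (qs s q)))\<^sup>2) \<partial>freqm)"
        using True m by (intro nn_integral_cong) (simp add: h_def ennreal_power)
      also have "\<dots> = ennreal ((norm2 freqm (lhat (V s) R j))\<^sup>2)"
        using nn_norm2[OF norm2_qs(1)[OF sqi_lhat[OF L R]]] norm2_qs(2)[OF sqi_lhat[OF L R]] by simp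
      also have "norm2 freqm (lhat (V s) R j) \<le> bump_bound j * B"
        by (rule order_trans[OF norm2_lhat[OF L R] mult_left_mono[OF B(2)[OF True]]]) (simp add: bump_bound less_imp_le)
      then have "ennreal ((norm2 freqm (lhat (V s) R j))\<^sup>2) \<le> ennreal ((bump_bound j * B)\<^sup>2)"
        by (intro ennreal_leI power_mono) auto
      finally show ?thesis using True by simp
    qed (simp add: h_def)
    have "(\<integral>\<^sup>+q. ennreal ((Jt V R j t q)\<^sup>2) \<partial>freqm) \<le> (\<integral>\<^sup>+q. ennreal t * (\<integral>\<^sup>+s. (h R s q)\<^sup>2 \<partial>lborel) \<partial>freqm)"
      by (intro nn_integral_mono sq)
    also have "\<dots> = ennreal t * (\<integral>\<^sup>+q. (\<integral>\<^sup>+s. (h R s q)\<^sup>2 \<partial>lborel) \<partial>freqm)"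
      using hm3[OF R] by (intro nn_integral_cmult lborel.borel_measurable_nn_integral) (simp add: case_prod_beta')
    also have "\<dots> \<le> ennreal t * (ennreal ((bump_bound j * B)\<^sup>2) * ennreal t)"
    proof (rule mult_left_mono)
      have "(\<integral>\<^sup>+q. (\<integral>\<^sup>+s. (h R s q)\<^sup>2 \<partial>lborel) \<partial>freqm) = (\<integral>\<^sup>+s. (\<integral>\<^sup>+q. (h R s q)\<^sup>2 \<partial>freqm) \<partial>lborel)"
        using hm[OF R] by (intro P.Fubini') (simp add: case_prod_beta')
      also have "\<dots> \<le> (\<integral>\<^sup>+s. ennreal ((bump_bound j * B)\<^sup>2) * indicator {0..t} s \<partial>lborel)"
        by (intro nn_integral_mono in_q)
      also have "\<dots> = ennreal ((bump_bound j * B)\<^sup>2) * ennreal t"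
        using t by (subst nn_integral_cmult_indicator) auto
      finally show "(\<integral>\<^sup>+q. (\<integral>\<^sup>+s. (h R s q)\<^sup>2 \<partial>lborel) \<partial>freqm) \<le> ennreal ((bump_bound j * B)\<^sup>2) * ennreal t" .
    qed simp
    also have "\<dots> = ennreal (t * (t * (bump_bound j * B)\<^sup>2))"
      using t by (simp add: ennreal_mult' mult.commute)
    finally show ?thesis .
  qed
  have JmS [measurable]: "Jt V (real (Suc n)) j t \<in> borel_measurable freqm" for n
    by (rule Jm) simp
  have "AE q in freqm. (\<lambda>n. (1 / real (Suc n) * Jt V (real (Suc n)) j t q)\<^sup>2) \<longlonglongrightarrow> 0"
  proof (rule AE_tendsto_0_of_summable)
    show "(\<lambda>q. (1 / real (Suc n) * Jt V (real (Suc n)) j t q)\<^sup>2) \<in> borel_measurable freqm" for n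
      by measurable
    show "(\<Sum>n. \<integral>\<^sup>+q. ennreal ((1 / real (Suc n) * Jt V (real (Suc n)) j t q)\<^sup>2) \<partial>freqm) < \<infinity>"
    proof (rule suminf_ennreal_less_top)
      show "summable (\<lambda>n. 1 / (real (Suc n))\<^sup>2 * (t * (t * (bump_bound j * B)\<^sup>2)))"
        using inverse_power_summable[of 2, where 'a = real]
        by (intro summable_mult2) (subst summable_Suc_iff, simp add: divide_inverse)
      fix n
      have "(\<integral>\<^sup>+q. ennreal ((1 / real (Suc n) * Jt V (real (Suc n)) j t q)\<^sup>2) \<partial>freqm) =
        (\<integral>\<^sup>+q. ennreal (1 / (real (Suc n))\<^sup>2) * ennreal ((Jt V (real (Suc n)) j t q)\<^sup>2) \<partial>freqm)"
        by (intro nn_integral_cong) (simp add: ennreal_mult'[symmetric] power_divide del: of_nat_Suc)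
      also have "\<dots> = ennreal (1 / (real (Suc n))\<^sup>2) * (\<integral>\<^sup>+q. ennreal ((Jt V (real (Suc n)) j t q)\<^sup>2) \<partial>freqm)"
        by (intro nn_integral_cmult) measurable
      also have "\<dots> \<le> ennreal (1 / (real (Suc n))\<^sup>2) * ennreal (t * (t * (bump_bound j * B)\<^sup>2))"
        by (intro mult_left_mono est) auto
      also have "\<dots> = ennreal (1 / (real (Suc n))\<^sup>2 * (t * (t * (bump_bound j * B)\<^sup>2)))"
        by (rule ennreal_mult'[symmetric]) simp
      finally show "(\<integral>\<^sup>+q. ennreal ((1 / real (Suc n) * Jt V (real (Suc n)) j t q)\<^sup>2) \<partial>freqm) \<le> ennreal (1 / (real (Suc n))\<^sup>2 * (t * (t * (bump_bound j * B)\<^sup>2)))" .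
      show "0 \<le> 1 / (real (Suc n))\<^sup>2 * (t * (t * (bump_bound j * B)\<^sup>2))" using t by simp
    qed
  qed simp
  then show ?thesis
  proof eventually_elim
    case (elim q)
    have "(\<lambda>n. sqrt ((1 / real (Suc n) * Jt V (real (Suc n)) j t q)\<^sup>2)) \<longlonglongrightarrow> sqrt 0"
      by (rule tendsto_real_sqrt[OF elim])
    then show ?case by (simp add: Jt_nonneg real_sqrt_abs abs_mult del: of_nat_Suc)
  qed
qed

section \<open>The linearized equations in frequency space\<close>

definition sqf :: "freq \<Rightarrow> real" where
  "sqf q = (fc 1 q)\<^sup>2 + (fc 2 q)\<^sup>2 + (fc 3 q)\<^sup>2"

lemma pd_add:
  assumes "test_fun \<phi>" "test_fun \<psi>"
  shows "pd i (\<lambda>w. \<phi> w + \<psi> w) = (\<lambda>w. pd i \<phi> w + pd i \<psi> w)"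
proof
  fix w
  show "pd i (\<lambda>w. \<phi> w + \<psi> w) w = pd i \<phi> w + pd i \<psi> w"
    unfolding pd_def[of i "\<lambda>w. \<phi> w + \<psi> w"]
    by (rule DERIV_imp_deriv[OF DERIV_add[OF test_fun_pd_derivative[OF assms(1)] test_fun_pd_derivative[OF assms(2)]]])
qed

text \<open>The cutoff depends on \<open>y\<close> only, so the second derivatives in
  \<open>x\<close> and \<open>z\<close> act as exact multipliers; the Leibniz rule in
  \<open>y\<close> adds a cross term of order 1/R and a term of order 1/R^2.\<close>

lemma cpair_laplace_tf:
  assumes f: "L2 f" and R: "R > 0"
  shows "cpair f (\<lambda>c. laplace (tf c q R 0)) =
    - of_real (sqf q) * lhat f R 0 q - 2 * \<i> * of_real (fc 2 q) / of_real R * lhat f R 1 q + 1 / (of_real R)\<^sup>2 * lhat f R 2 q"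
proof -
  obtain k \<eta> l where q: "q = (k, \<eta>, l)" by (cases q)
  have ii: "\<i> * K * (\<i> * K) = - (K * K)" for K by (auto simp: complex_eq_iff algebra_simps)
  have t: "test_fun (tf c q R j)" for c j by (rule test_fun_tf[OF R])
  note T = L2_test[OF test_fun_pd[OF t]] L2_test[OF test_fun_pd[OF test_fun_pd[OF t]]]
  have lap: "laplace \<phi> = (\<lambda>w. (pd 1 (pd 1 \<phi>) w + pd 2 (pd 2 \<phi>) w) + pd 3 (pd 3 \<phi>) w)" for \<phi>
    by (simp add: fun_eq_iff laplace_def sum_3)
  have sum2: "L2 (\<lambda>w. pd 1 (pd 1 (tf c q R 0)) w + pd 2 (pd 2 (tf c q R 0)) w)" for c
  proof -
    have "sqi cellm (\<lambda>w. cr (pd 1 (pd 1 (tf c q R 0))) w + cr (pd 2 (pd 2 (tf c q R 0))) w)"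
      by (intro sqi_add L2_sqi T)
    moreover have "periodic_xz (\<lambda>w. pd 1 (pd 1 (tf c q R 0)) w + pd 2 (pd 2 (tf c q R 0)) w)"
      using L2_periodic[OF T(2)[of 1 1 c 0]] L2_periodic[OF T(2)[of 2 2 c 0]] by (simp add: periodic_xz_def)
    ultimately show ?thesis by (simp add: L2_iff cr_def[abs_def])
  qed
  have "cpair f (\<lambda>c. laplace (tf c q R 0)) = cpair f (\<lambda>c. pd 1 (pd 1 (tf c q R 0))) + cpair f (\<lambda>c. pd 2 (pd 2 (tf c q R 0))) + cpair f (\<lambda>c. pd 3 (pd 3 (tf c q R 0)))"
    unfolding lap by (simp only: cpair_add[OF f sum2 T(2)] cpair_add[OF f T(2) T(2)])
  moreover have "cpair f (\<lambda>c. pd 1 (pd 1 (tf c q R 0))) = - of_real ((fc 1 q)\<^sup>2) * lhat f R 0 q"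
    using cpair_pd_tf[OF f R, of 1 "- \<i> * of_int k" q 0] by (simp add: q pd_tf[OF R] power2_eq_square ii)
  moreover have "cpair f (\<lambda>c. pd 3 (pd 3 (tf c q R 0))) = - of_real ((fc 3 q)\<^sup>2) * lhat f R 0 q"
    using cpair_pd_tf[OF f R, of 3 "- \<i> * of_int l" q 0] by (simp add: q pd_tf[OF R] power2_eq_square ii)
  moreover have "cpair f (\<lambda>c. pd 2 (pd 2 (tf c q R 0))) = - of_real ((fc 2 q)\<^sup>2) * lhat f R 0 q
      - 2 * \<i> * of_real (fc 2 q) / of_real R * lhat f R 1 q + 1 / (of_real R)\<^sup>2 * lhat f R 2 q"
  proof -
    have "pd 2 (pd 2 (tf c q R 0)) = (\<lambda>w. pd 2 (tf (- \<i> * of_real \<eta> * c) q R 0) w + pd 2 (tf (1 / of_real R * c) q R 1) w)" for c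
      using pd_add[OF t t, of 2 "- \<i> * of_real \<eta> * c" 0 "c / of_real R" 1] by (simp add: q pd_tf[OF R])
    then have "cpair f (\<lambda>c. pd 2 (pd 2 (tf c q R 0))) = cpair f (\<lambda>c. pd 2 (tf (- \<i> * of_real \<eta> * c) q R 0)) + cpair f (\<lambda>c. pd 2 (tf (1 / of_real R * c) q R 1))"
      by (simp only: cpair_add[OF f T(1) T(1)])
    then show ?thesis unfolding cpair_pd_tf[OF f R]
      by (simp add: q power2_eq_square numeral_2_eq_2 algebra_simps)
  qed
  ultimately show ?thesis by (simp add: sqf_def algebra_simps)
qed

lemma ip_cmult_test: "L2 f \<Longrightarrow> L2 g \<Longrightarrow> ip f (\<lambda>w. g w * c) = ip f g * c"
  by (simp add: ip_eq L2_borel mult.assoc[symmetric])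

lemma L2_slab:
  assumes "g \<in> borel_measurable borel" "periodic_xz g" "B \<ge> 0" and le: "\<And>w. \<bar>g w\<bar> \<le> B * indicator (slab R) w"
  shows "L2 g" "L2_norm g \<le> B * norm2 cellm (indicator (slab R))"
proof -
  have s: "sqi cellm (indicator (slab R) :: pt \<Rightarrow> complex)"
    using L12_slab[of "indicator (slab R)" 1 R] by (auto simp: cell.L12_def split: split_indicator)
  have m: "cr g \<in> borel_measurable cellm" using cr_measurable[OF assms(1)] by simp
  have b: "AE w in cellm. cmod (cr g w) \<le> B * cmod (indicator (slab R) w :: complex)"
  proof (rule AE_I2)
    fix w show "cmod (cr g w) \<le> B * cmod (indicator (slab R) w :: complex)"
      using le[of w] by (cases "w \<in> slab R") (simp_all add: cr_def)
  qed
  show "L2 g" using sqi_dominated[OF s m b] assms(2) by (simp add: L2_iff)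
  show "L2_norm g \<le> B * norm2 cellm (indicator (slab R))"
    using norm2_dominated[OF s m b assms(3)] assms(1) by (simp add: L2_norm_eq)
qed

locale lin_NS =
  fixes \<nu> :: real and u_in :: "pt \<Rightarrow> real ^ 3" and u :: "real \<Rightarrow> pt \<Rightarrow> real ^ 3" and p :: "real \<Rightarrow> pt \<Rightarrow> real"
  assumes nu: "\<nu> > 0" and sol: "lin_NS_solution \<nu> u_in u p"
begin

definition U :: "3 \<Rightarrow> real \<Rightarrow> pt \<Rightarrow> real" where
  "U i t = (\<lambda>w. u t w $ i)"

lemma U_cont: "L2_continuous (U i)" and p_cont: "L2_continuous p"
  using sol by (auto simp: lin_NS_solution_def U_def[abs_def])

lemma U_L2: "t \<ge> 0 \<Longrightarrow> L2 (U i t)" and p_L2: "t \<ge> 0 \<Longrightarrow> L2 (p t)"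
  using L2_cont_L2 U_cont p_cont by auto

lemma pressure: "t \<ge> 0 \<Longrightarrow> test_fun \<phi> \<Longrightarrow> ip (p t) (laplace \<phi>) = 2 * ip (U 2 t) (pd 1 \<phi>)"
  using sol by (simp add: lin_NS_solution_def U_def)

lemma evolution:
  assumes "t \<ge> 0" "test_fun \<phi>"
  shows "((\<lambda>s. ip (U i s) \<phi>) has_real_derivative
           ip (U i t) (\<lambda>(x, y, z). y * pd 1 \<phi> (x, y, z)) - (if i = 1 then ip (U 2 t) \<phi> else 0)
           + ip (p t) (pd i \<phi>) + \<nu> * ip (U i t) (laplace \<phi>)) (at t within {0..})"
  using sol assms unfolding lin_NS_solution_def U_def by blast

text \<open>The test function moves with the characteristic, and its time derivative is minus
  \<open>y\<close> times its derivative in \<open>x\<close>. In the product rule this cancels the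
  transport term of the weak equation, so the unbounded factor \<open>y\<close> disappears; the
  cutoff itself does not move.\<close>

lemma evolution_moving:
  assumes t: "t \<ge> 0" and R: "R > 0"
  shows "((\<lambda>s. ip (U i s) (tf c (qs s q) R 0)) has_real_derivative
     - (if i = 1 then ip (U 2 t) (tf c (qs t q) R 0) else 0)
     + ip (p t) (pd i (tf c (qs t q) R 0)) + \<nu> * ip (U i t) (laplace (tf c (qs t q) R 0))) (at t within {0..})"
proof -
  obtain k \<eta> l where q: "q = (k, \<eta>, l)" by (cases q)
  define \<phi> where "\<phi> s = tf c (qs s q) R 0" for s
  have \<phi>: "test_fun (\<phi> s)" for s unfolding \<phi>_def by (rule test_fun_tf[OF R])
  define \<psi> where "\<psi> = (\<lambda>(x, y, z). y * pd 1 (\<phi> t) (x, y, z))"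
  define X where "X = - (if i = 1 then ip (U 2 t) (\<phi> t) else 0) + ip (p t) (pd i (\<phi> t)) + \<nu> * ip (U i t) (laplace (\<phi> t))"
  define b where "b w = bump 0 (fst (snd w) / R)" for w :: pt
  have b: "\<bar>b w\<bar> \<le> bump_bound 0 * indicator (slab R) w" for w
  proof (cases "w \<in> slab R")
    case True then show ?thesis using bump_bound(2)[of 0] by (simp add: b_def)
  next
    case False
    then show ?thesis using R bump_outside[of "fst (snd w) / R" 0] by (simp add: b_def slab_def)
  qed
  have slab_y: "\<bar>b w\<bar> * \<bar>fst (snd w)\<bar> ^ m \<le> bump_bound 0 * R ^ m * indicator (slab R) w" for w m
  proof (cases "w \<in> slab R")
    case True
    then have "\<bar>b w\<bar> * \<bar>fst (snd w)\<bar> ^ m \<le> bump_bound 0 * R ^ m"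
      using bump_bound[of 0] R by (intro mult_mono power_mono) (auto simp: b_def slab_def less_imp_le)
    then show ?thesis using True by simp
  next
    case False
    then show ?thesis using b[of w] by simp
  qed
  have \<psi>_eq: "\<psi> w = Re (- \<i> * of_int k * of_real (fst (snd w)) * c * chr w (qs t q) * of_real (b w))" for w
  proof -
    obtain x y z where w: "w = (x, y, z)" by (cases w)
    have "\<psi> w = y * tf (- \<i> * of_int k * c) (qs t q) R 0 w"
      by (simp add: \<psi>_def w \<phi>_def q pd_tf[OF R])
    also have "\<dots> = Re (of_real y * (- \<i> * of_int k * c * chr w (qs t q) * of_real (b w)))"
      unfolding tf_def b_def by simp
    finally show ?thesis by (simp add: w mult_ac)
  qed
  have per_\<phi>: "periodic_xz (\<phi> s)" for s using \<phi>[of s] by (simp add: test_fun_def)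
  have \<psi>_per: "periodic_xz \<psi>" using test_fun_pd[OF \<phi>[of t], of 1] unfolding \<psi>_def test_fun_def periodic_xz_def by simp
  have \<psi>_cont: "continuous_on UNIV \<psi>"
    unfolding \<psi>_def case_prod_beta' by (intro continuous_intros continuous_on_compose2[OF test_fun_continuous[OF test_fun_pd[OF \<phi>]]]) auto
  have \<psi>_bound: "\<bar>\<psi> w\<bar> \<le> \<bar>of_int k\<bar> * cmod c * kap * (bump_bound 0 * R) * indicator (slab R) w" for w
  proof -
    have "\<bar>\<psi> w\<bar> \<le> cmod (- \<i> * of_int k * of_real (fst (snd w)) * c * chr w (qs t q) * of_real (b w))"
      unfolding \<psi>_eq by (rule abs_Re_le_cmod)
    also have "\<dots> = \<bar>of_int k\<bar> * cmod c * kap * (\<bar>b w\<bar> * \<bar>fst (snd w)\<bar> ^ 1)"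
      by (simp add: norm_mult cmod_chr)
    also have "\<dots> \<le> \<bar>of_int k\<bar> * cmod c * kap * (bump_bound 0 * R ^ 1 * indicator (slab R) w)"
      using slab_y[of w 1] kap_pos by (intro mult_left_mono) auto
    finally show ?thesis by simp
  qed
  have \<psi>L: "L2 \<psi>"
    by (rule L2_slab(1)[OF borel_measurable_continuous_onI[OF \<psi>_cont] \<psi>_per _ \<psi>_bound])
      (use kap_pos R bump_bound(1)[of 0] in \<open>simp add: less_imp_le\<close>)
  \<comment> \<open>The difference quotient of the moving test function minus its expected
    derivative, which is \<open>- \<psi>\<close>. The second-order bound for \<open>cis\<close> on
    the slab |y| <= R makes it of order |s - t|, uniformly in space.\<close>
  define E where "E s w = (\<phi> s w - \<phi> t w) * inverse (s - t) + \<psi> w" for s w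
  define K where "K = cmod c * kap * (of_int k)\<^sup>2 * (bump_bound 0 * R\<^sup>2)"
  have K0: "K \<ge> 0" unfolding K_def using kap_pos bump_bound(1)[of 0] by (simp add: less_imp_le)
  have E_bound: "\<bar>E s w\<bar> \<le> (K * \<bar>s - t\<bar>) * indicator (slab R) w" if "s \<noteq> t" for s w
  proof -
    define a where "a = of_int k * (s - t) * fst (snd w)"
    define Y where "Y = c * chr w (qs t q) * of_real (b w)"
    have "of_int (fst q) * s * fst (snd w) = of_int (fst q) * t * fst (snd w) + a"
      by (simp add: a_def q algebra_simps)
    then have "chr w (qs s q) = chr w (qs t q) * cis a"
      by (simp only: chr_qs cis_mult[symmetric] mult.assoc)
    then have "\<phi> s w = Re (Y * cis a)" unfolding \<phi>_def tf_def Y_def b_def by (simp add: mult_ac)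
    moreover have "\<phi> t w = Re Y" unfolding \<phi>_def tf_def Y_def b_def ..
    moreover have "\<psi> w * (s - t) = Re (Y * (- (\<i> * of_real a)))"
    proof -
      have "\<psi> w * (s - t) = Re ((- \<i> * of_int k * of_real (fst (snd w)) * c * chr w (qs t q) * of_real (b w)) * of_real (s - t))"
        unfolding \<psi>_eq by simp
      also have "(- \<i> * of_int k * of_real (fst (snd w)) * c * chr w (qs t q) * of_real (b w)) * of_real (s - t) = Y * (- (\<i> * of_real a))"
        by (simp add: Y_def a_def mult_ac)
      finally show ?thesis .
    qed
    moreover have "E s w * (s - t) = \<phi> s w - \<phi> t w + \<psi> w * (s - t)"
      using that by (simp add: E_def distrib_right mult.assoc)
    ultimately have "E s w * (s - t) = Re (Y * cis a) - Re Y + Re (Y * (- (\<i> * of_real a)))" by (simp only:)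
    also have "\<dots> = Re (Y * (cis a - 1 - \<i> * a))" by (simp only: minus_complex.sel(1)[symmetric] plus_complex.sel(1)[symmetric]) (simp add: algebra_simps)
    finally have "E s w * (s - t) = Re (Y * (cis a - 1 - \<i> * a))" .
    then have "\<bar>E s w\<bar> * \<bar>s - t\<bar> \<le> cmod Y * cmod (cis a - 1 - \<i> * a)"
      using abs_Re_le_cmod[of "Y * (cis a - 1 - \<i> * a)"] by (simp only: abs_mult[symmetric] norm_mult)
    also have "\<dots> \<le> (cmod c * kap * \<bar>b w\<bar>) * a\<^sup>2"
      by (rule mult_mono) (auto simp: Y_def norm_mult cmod_chr less_imp_le[OF kap_pos] cmod_cis_2 intro!: mult_nonneg_nonneg)
    also have "\<dots> = cmod c * kap * (of_int k)\<^sup>2 * (\<bar>b w\<bar> * \<bar>fst (snd w)\<bar> ^ 2) * (\<bar>s - t\<bar> * \<bar>s - t\<bar>)"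
      by (simp add: a_def power_mult_distrib power2_eq_square)
    also have "\<dots> \<le> cmod c * kap * (of_int k)\<^sup>2 * (bump_bound 0 * R ^ 2 * indicator (slab R) w) * (\<bar>s - t\<bar> * \<bar>s - t\<bar>)"
      using slab_y[of w 2] kap_pos by (intro mult_right_mono mult_left_mono) auto
    also have "\<dots> = (K * \<bar>s - t\<bar>) * indicator (slab R) w * \<bar>s - t\<bar>" by (simp add: K_def)
    finally show ?thesis using that by (simp add: mult_ac)
  qed
  have E_L2: "L2 (E s)" "L2_norm (E s) \<le> K * \<bar>s - t\<bar> * norm2 cellm (indicator (slab R))" if "s \<noteq> t" for s
  proof -
    have m: "E s \<in> borel_measurable borel" unfolding E_def[abs_def]
      by (intro borel_measurable_continuous_onI continuous_intros test_fun_continuous \<phi> \<psi>_cont)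
    have pr: "periodic_xz (E s)" using per_\<phi> \<psi>_per unfolding E_def periodic_xz_def by simp
    show "L2 (E s)" "L2_norm (E s) \<le> K * \<bar>s - t\<bar> * norm2 cellm (indicator (slab R))"
      by (rule L2_slab[OF m pr mult_nonneg_nonneg[OF K0 abs_ge_zero] E_bound[OF that]])+
  qed
  \<comment> \<open>Product rule for difference quotients: the first quotient is the weak equation
    with the test function frozen at time \<open>t\<close>, the rest is the variation of the test
    function paired with \<open>U i s\<close>.\<close>
  have "((\<lambda>s. (ip (U i s) (\<phi> t) - ip (U i t) (\<phi> t)) / (s - t) + (ip (U i s) (E s) - ip (U i s) \<psi>)) \<longlongrightarrow>
      (ip (U i t) \<psi> + X) + (0 - ip (U i t) \<psi>)) (at t within {0..})"
  proof (intro tendsto_intros)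
    show "((\<lambda>s. (ip (U i s) (\<phi> t) - ip (U i t) (\<phi> t)) / (s - t)) \<longlongrightarrow> ip (U i t) \<psi> + X) (at t within {0..})"
      using evolution[OF t \<phi>[of t], of i] unfolding has_field_derivative_iff \<psi>_def X_def by (simp add: algebra_simps)
    show "((\<lambda>s. ip (U i s) (E s)) \<longlongrightarrow> 0) (at t within {0..})"
    proof (rule Lim_null_comparison)
      show "\<forall>\<^sub>F s in at t within {0..}. norm (ip (U i s) (E s)) \<le> L2_norm (U i s) * (K * \<bar>s - t\<bar> * norm2 cellm (indicator (slab R)))"
        unfolding eventually_at_filter
      proof (intro always_eventually allI impI)
        fix s assume s: "s \<noteq> t" "s \<in> {0..}"
        then have L: "L2 (U i s)" using U_L2 by simp
        have "\<bar>ip (U i s) (E s)\<bar> \<le> L2_norm (U i s) * L2_norm (E s)" by (rule ip_bound[OF L E_L2(1)[OF s(1)]])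
        also have "\<dots> \<le> L2_norm (U i s) * (K * \<bar>s - t\<bar> * norm2 cellm (indicator (slab R)))"
          by (rule mult_left_mono[OF E_L2(2)[OF s(1)] L2_norm_nonneg[OF L]])
        finally show "norm (ip (U i s) (E s)) \<le> L2_norm (U i s) * (K * \<bar>s - t\<bar> * norm2 cellm (indicator (slab R)))" by simp
      qed
      have "((\<lambda>s. L2_norm (U i s) * (K * \<bar>s - t\<bar> * norm2 cellm (indicator (slab R)))) \<longlongrightarrow> L2_norm (U i t) * (K * \<bar>t - t\<bar> * norm2 cellm (indicator (slab R)))) (at t within {0..})"
        by (intro tendsto_intros L2_norm_continuous U_cont t)
      then show "((\<lambda>s. L2_norm (U i s) * (K * \<bar>s - t\<bar> * norm2 cellm (indicator (slab R)))) \<longlongrightarrow> 0) (at t within {0..})" by simp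
    qed
    show "((\<lambda>s. ip (U i s) \<psi>) \<longlongrightarrow> ip (U i t) \<psi>) (at t within {0..})"
    proof (rule LIM_zero_cancel, rule Lim_null_comparison)
      show "\<forall>\<^sub>F s in at t within {0..}. norm (ip (U i s) \<psi> - ip (U i t) \<psi>) \<le> L2_norm (\<lambda>w. U i s w - U i t w) * L2_norm \<psi>"
        unfolding eventually_at_filter
      proof (intro always_eventually allI impI)
        fix s :: real assume "s \<in> {0..}"
        then have L: "L2 (U i s)" "L2 (U i t)" using U_L2 t by auto
        show "norm (ip (U i s) \<psi> - ip (U i t) \<psi>) \<le> L2_norm (\<lambda>w. U i s w - U i t w) * L2_norm \<psi>"
          using ip_bound[OF L2_diff[OF L] \<psi>L] by (simp add: ip_diff_left[OF L \<psi>L])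
      qed
      have "((\<lambda>s. L2_norm (\<lambda>w. U i s w - U i t w)) \<longlongrightarrow> 0) (at t within {0..})"
        using U_cont[of i] t by (simp add: L2_continuous_def)
      then show "((\<lambda>s. L2_norm (\<lambda>w. U i s w - U i t w) * L2_norm \<psi>) \<longlongrightarrow> 0) (at t within {0..})"
        by (rule tendsto_mult_left_zero)
    qed
  qed
  then have "((\<lambda>s. (ip (U i s) (\<phi> t) - ip (U i t) (\<phi> t)) / (s - t) + (ip (U i s) (E s) - ip (U i s) \<psi>)) \<longlongrightarrow> X) (at t within {0..})"
    by simp
  then have "((\<lambda>s. (ip (U i s) (\<phi> s) - ip (U i t) (\<phi> t)) / (s - t)) \<longlongrightarrow> X) (at t within {0..})"
  proof (rule Lim_transform_eventually)
    show "\<forall>\<^sub>F s in at t within {0..}. (ip (U i s) (\<phi> t) - ip (U i t) (\<phi> t)) / (s - t) + (ip (U i s) (E s) - ip (U i s) \<psi>) =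
       (ip (U i s) (\<phi> s) - ip (U i t) (\<phi> t)) / (s - t)"
      unfolding eventually_at_filter
    proof (intro always_eventually allI impI)
      fix s assume s: "s \<noteq> t" "s \<in> {0..}"
      then have L: "L2 (U i s)" using U_L2 by simp
      note LT = L2_test[OF \<phi>[of s]] L2_test[OF \<phi>[of t]]
      have "ip (U i s) (E s) = ip (U i s) (\<lambda>w. (\<phi> s w - \<phi> t w) * inverse (s - t)) + ip (U i s) \<psi>"
      proof -
        have eq: "(\<lambda>w. (\<phi> s w - \<phi> t w) * inverse (s - t)) = (\<lambda>w. E s w - \<psi> w)" by (simp add: E_def)
        have "L2 (\<lambda>w. (\<phi> s w - \<phi> t w) * inverse (s - t))" unfolding eq by (rule L2_diff[OF E_L2(1)[OF s(1)] \<psi>L])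
        from ip_add_right[OF L this \<psi>L] show ?thesis by (simp add: E_def[abs_def])
      qed
      also have "ip (U i s) (\<lambda>w. (\<phi> s w - \<phi> t w) * inverse (s - t)) = ip (U i s) (\<lambda>w. \<phi> s w - \<phi> t w) * inverse (s - t)"
        by (rule ip_cmult_test[OF L L2_diff[OF LT]])
      also have "ip (U i s) (\<lambda>w. \<phi> s w - \<phi> t w) = ip (U i s) (\<phi> s) - ip (U i s) (\<phi> t)"
        using ip_add_right[OF L L2_diff[OF LT] LT(2)] by simp
      finally show "(ip (U i s) (\<phi> t) - ip (U i t) (\<phi> t)) / (s - t) + (ip (U i s) (E s) - ip (U i s) \<psi>) =
         (ip (U i s) (\<phi> s) - ip (U i t) (\<phi> t)) / (s - t)"
        by (simp add: divide_inverse algebra_simps)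
    qed
  qed
  then show ?thesis unfolding has_field_derivative_iff X_def \<phi>_def .
qed

section \<open>Ordinary differential equations for the cutoff modes\<close>

definition W :: "3 \<Rightarrow> real \<Rightarrow> freq \<Rightarrow> real \<Rightarrow> complex" where
  "W i R q s = lhat (U i s) R 0 (qs s q)"

text \<open>Coefficient of u^2 in the equation for u^i at frequency \<xi>: -1 for i = 1 from the
  forcing, and 2 k \<xi>_i/|\<xi>|^2 from minus the gradient of p = -2 \<Delta>^-1 \<partial>_x
  u^2.\<close>

definition acoef :: "3 \<Rightarrow> freq \<Rightarrow> real" where
  "acoef i q = (if i = 1 then - 1 else 0) + 2 * fc 1 q * fc i q / sqf q"

text \<open>All terms in which a derivative falls on the cutoff: two from the viscosity, one from
  the pressure gradient in \<open>y\<close>, and two inherited from solving the localized pressure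
  equation.\<close>

definition err :: "3 \<Rightarrow> real \<Rightarrow> freq \<Rightarrow> real \<Rightarrow> complex" where
  "err i R q t = (let r = qs t q; e = 2 * \<i> * of_real (fc 2 r) / of_real R; d = 1 / (of_real R)\<^sup>2 in
     of_real \<nu> * (- e * lhat (U i t) R 1 r + d * lhat (U i t) R 2 r)
     + (if i = 2 then 1 / of_real R * lhat (p t) R 1 r else 0)
     - \<i> * of_real (fc i r) * ((- e * lhat (p t) R 1 r + d * lhat (p t) R 2 r) / of_real (sqf r)))"

text \<open>The cutoff form of the elliptic equation is solved for the transform of \<open>p\<close>
  by dividing by |\<xi>|^2, which is where positivity of \<open>sqf\<close> enters. The rest is
  collecting terms.\<close>

lemma W_derivative:
  assumes t: "t \<ge> 0" and R: "R > 0" and pos: "sqf (qs t q) > 0"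
  shows "(W i R q has_vector_derivative
    (- of_real (\<nu> * sqf (qs t q)) * W i R q t + of_real (acoef i (qs t q)) * W 2 R q t + err i R q t)) (at t within {0..})"
proof -
  let ?r = "qs t q"
  define e where "e = 2 * \<i> * of_real (fc 2 ?r) / complex_of_real R"
  define d where "d = 1 / (complex_of_real R)\<^sup>2"
  define P where "P j = lhat (p t) R j ?r" for j
  note Up = U_L2[OF t, of i] and pp = p_L2[OF t]
  have W_cpair: "lhat (U i s) R 0 (qs s q) = of_real (ip (U i s) (tf 1 (qs s q) R 0)) + \<i> * of_real (ip (U i s) (tf (- \<i>) (qs s q) R 0))"
    if "s \<ge> 0" for s i
    using cpair_tf[OF U_L2[OF that] R, of i 1 "qs s q" 0] by (simp add: cpair_def)
  define X where "X c = - (if i = 1 then ip (U 2 t) (tf c ?r R 0) else 0)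
     + ip (p t) (pd i (tf c ?r R 0)) + \<nu> * ip (U i t) (laplace (tf c ?r R 0))" for c
  have der: "((\<lambda>s. of_real (ip (U i s) (tf 1 (qs s q) R 0)) + \<i> * of_real (ip (U i s) (tf (- \<i>) (qs s q) R 0))) has_vector_derivative
      (of_real (X 1) + \<i> * of_real (X (- \<i>)))) (at t within {0..})"
    unfolding has_vector_derivative_complex_iff using evolution_moving[OF t R, of i _ q] by (simp add: X_def)
  have der2: "(W i R q has_vector_derivative (of_real (X 1) + \<i> * of_real (X (- \<i>)))) (at t within {0..})"
    by (rule has_vector_derivative_transform[OF _ _ der]) (use t W_cpair in \<open>auto simp: W_def\<close>)
  have "of_real (X 1) + \<i> * of_real (X (- \<i>)) = - (if i = 1 then W 2 R q t else 0)
      + cpair (p t) (\<lambda>c. pd i (tf (1 * c) ?r R 0)) + of_real \<nu> * cpair (U i t) (\<lambda>c. laplace (tf c ?r R 0))"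
    using W_cpair[OF t, of 2] by (simp add: X_def cpair_def W_def algebra_simps)
  also have "cpair (p t) (\<lambda>c. pd i (tf (1 * c) ?r R 0)) = - \<i> * of_real (fc i ?r) * P 0 + (if i = 2 then 1 / of_real R * P 1 else 0)"
    unfolding cpair_pd_tf[OF pp R] P_def by simp
  also have "cpair (U i t) (\<lambda>c. laplace (tf c ?r R 0)) = - of_real (sqf ?r) * W i R q t - e * lhat (U i t) R 1 ?r + d * lhat (U i t) R 2 ?r"
    unfolding cpair_laplace_tf[OF Up R] e_def d_def W_def ..
  also have "P 0 = (2 * \<i> * of_real (fc 1 ?r) * W 2 R q t - e * P 1 + d * P 2) / of_real (sqf ?r)"
  proof -
    have "cpair (p t) (\<lambda>c. laplace (tf c ?r R 0)) = 2 * cpair (U 2 t) (\<lambda>c. pd 1 (tf (1 * c) ?r R 0))"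
      by (simp add: cpair_def pressure[OF t] test_fun_tf[OF R])
    then have "- of_real (sqf ?r) * P 0 - e * P 1 + d * P 2 = 2 * (- \<i> * of_real (fc 1 ?r) * W 2 R q t)"
      unfolding cpair_laplace_tf[OF pp R] cpair_pd_tf[OF U_L2[OF t] R] by (simp add: P_def e_def d_def W_def)
    then have "of_real (sqf ?r) * P 0 = 2 * \<i> * of_real (fc 1 ?r) * W 2 R q t - e * P 1 + d * P 2"
      by (simp add: algebra_simps add_eq_0_iff)
    then show ?thesis using pos by (simp add: field_simps)
  qed
  finally have X_eq: "of_real (X 1) + \<i> * of_real (X (- \<i>)) = - (if i = 1 then W 2 R q t else 0)
      + (- \<i> * of_real (fc i ?r) * ((2 * \<i> * of_real (fc 1 ?r) * W 2 R q t - e * P 1 + d * P 2) / of_real (sqf ?r)) + (if i = 2 then 1 / of_real R * P 1 else 0))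
      + of_real \<nu> * (- of_real (sqf ?r) * W i R q t - e * lhat (U i t) R 1 ?r + d * lhat (U i t) R 2 ?r)" .
  have err_eq: "err i R q t = of_real \<nu> * (- e * lhat (U i t) R 1 ?r + d * lhat (U i t) R 2 ?r)
     + (if i = 2 then 1 / of_real R * P 1 else 0)
     - \<i> * of_real (fc i ?r) * ((- e * P 1 + d * P 2) / of_real (sqf ?r))"
    unfolding err_def Let_def e_def d_def P_def ..
  have alg: "- (if i = 1 then w2 else 0) + (- \<i> * x * ((2 * \<i> * k * w2 - e * P1 + d * P2) / S) + D) + n * (- S * w - e * L1 + d * L2) =
      - (n * S) * w + ((if i = 1 then - 1 else 0) + 2 * k * x / S) * w2 + (n * (- e * L1 + d * L2) + D - \<i> * x * ((- e * P1 + d * P2) / S))"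
    for w2 x k P1 P2 S D n w L1 L2 :: complex
    by (simp add: add_divide_distrib diff_divide_distrib algebra_simps)
  have ac: "complex_of_real (acoef i ?r) = (if i = 1 then - 1 else 0) + 2 * of_real (fc 1 ?r) * of_real (fc i ?r) / of_real (sqf ?r)"
    by (simp add: acoef_def)
  have "of_real (X 1) + \<i> * of_real (X (- \<i>)) =
     - of_real (\<nu> * sqf ?r) * W i R q t + of_real (acoef i ?r) * W 2 R q t + err i R q t"
    unfolding X_eq err_eq ac of_real_mult by (rule alg)
  with der2 show ?thesis by simp
qed

definition Esum :: "3 \<Rightarrow> real \<Rightarrow> freq \<Rightarrow> real \<Rightarrow> real" where
  "Esum i R q t = cmod (lhat (U i t) R 1 (qs t q)) + cmod (lhat (U i t) R 2 (qs t q)) + cmod (lhat (p t) R 1 (qs t q)) + cmod (lhat (p t) R 2 (qs t q))"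

definition Jsum :: "3 \<Rightarrow> real \<Rightarrow> freq \<Rightarrow> real \<Rightarrow> real" where
  "Jsum i R q t = Jt (U i) R 1 t q + Jt (U i) R 2 t q + Jt p R 1 t q + Jt p R 2 t q"

lemma Jsum_derivative:
  assumes "R > 0" "s \<in> {0..t}"
  shows "(Jsum i R q has_real_derivative Esum i R q s) (at s within {0..t})"
proof -
  have d: "((\<lambda>s. Jt V R j s q) has_real_derivative cmod (lhat (V s) R j (qs s q))) (at s within {0..t})" if "L2_continuous V" for V j
    unfolding Jt_def
    by (rule integral_has_real_derivative[OF _ assms(2)]) (intro continuous_on_norm lhat_qs_continuous_on that assms(1); auto)
  then show ?thesis unfolding Jsum_def[abs_def] Esum_def by (intro DERIV_add d U_cont p_cont)
qed

lemma Jsum_0: "Jsum i R q 0 = 0"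
  by (simp add: Jsum_def Jt_def)

lemma Jsum_nonneg: "0 \<le> Jsum i R q t"
  by (simp add: Jsum_def Jt_nonneg)

lemma Jsum_mono: "R > 0 \<Longrightarrow> 0 \<le> s \<Longrightarrow> s \<le> t \<Longrightarrow> Jsum i R q s \<le> Jsum i R q t"
proof (rule DERIV_nonneg_imp_increasing_open[of s t "Jsum i R q"])
  assume a: "R > 0" "0 \<le> s" "s \<le> t"
  have d: "(Jsum i R q has_real_derivative Esum i R q x) (at x within {0..t})" if "x \<in> {s..t}" for x
    using that a by (intro Jsum_derivative) auto
  show "\<exists>y. DERIV (Jsum i R q) x :> y \<and> 0 \<le> y" if "s < x" "x < t" for x
    using d[of x] that a at_within_Icc_at[of 0 x t] by (intro exI[of _ "Esum i R q x"]) (auto simp: Esum_def)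
  show "continuous_on {s..t} (Jsum i R q)"
    by (rule continuous_on_subset[of "{0..t}"], rule DERIV_continuous_on[OF Jsum_derivative]) (use a in auto)
qed auto

text \<open>Depends on the frequency but not on \<open>R\<close>, so for a fixed mode it is bounded
  on compact time intervals uniformly over all scales.\<close>

definition errc :: "3 \<Rightarrow> freq \<Rightarrow> real" where
  "errc i r = \<nu> * (2 * \<bar>fc 2 r\<bar> + 1) + 1 + \<bar>fc i r\<bar> * (2 * \<bar>fc 2 r\<bar> + 1) / sqf r"

lemma err_bound:
  assumes R: "R \<ge> 1" and pos: "sqf (qs t q) > 0"
  shows "cmod (err i R q t) \<le> errc i (qs t q) * (Esum i R q t / R)"
proof -
  let ?r = "qs t q"
  define e where "e = 2 * \<i> * of_real (fc 2 ?r) / complex_of_real R"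
  define d where "d = 1 / (complex_of_real R)\<^sup>2"
  have e: "cmod e = 2 * \<bar>fc 2 ?r\<bar> / R" using R by (simp add: e_def norm_divide norm_mult)
  \<comment> \<open>R >= 1 absorbs the terms of order 1/R^2 into those of order 1/R.\<close>
  have d: "cmod d \<le> 1 / R"
  proof -
    have "cmod d = 1 / R\<^sup>2" unfolding d_def norm_divide norm_power by simp
    also have "\<dots> \<le> 1 / R" using R self_le_power[of R 2] by (intro divide_left_mono) auto
    finally show ?thesis .
  qed
  define M where "M = 2 * \<bar>fc 2 ?r\<bar> + 1"
  have M: "M \<ge> 0" by (simp add: M_def)
  have two: "cmod (- e * a + d * b) \<le> M / R * (cmod a + cmod b)" for a b
  proof -
    have "cmod (- e * a + d * b) \<le> cmod e * cmod a + cmod d * cmod b"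
      using norm_triangle_ineq[of "- e * a" "d * b"] by (simp add: norm_mult)
    also have "\<dots> \<le> M / R * cmod a + M / R * cmod b"
      using R d order_trans[OF d, of "M / R"] unfolding e by (intro add_mono mult_right_mono) (auto simp: M_def divide_right_mono)
    finally show ?thesis by (simp add: distrib_left)
  qed
  define S where "S = Esum i R q t"
  have S: "cmod (lhat (U i t) R 1 ?r) + cmod (lhat (U i t) R 2 ?r) \<le> S"
    "cmod (lhat (p t) R 1 ?r) + cmod (lhat (p t) R 2 ?r) \<le> S" "cmod (lhat (p t) R 1 ?r) \<le> S"
    by (simp_all add: S_def Esum_def add_increasing add_increasing2)
  have 1: "cmod (of_real \<nu> * (- e * lhat (U i t) R 1 ?r + d * lhat (U i t) R 2 ?r)) \<le> \<nu> * (M / R * S)"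
  proof -
    have "cmod (- e * lhat (U i t) R 1 ?r + d * lhat (U i t) R 2 ?r) \<le> M / R * S"
      using two[of "lhat (U i t) R 1 ?r" "lhat (U i t) R 2 ?r"] mult_left_mono[OF S(1), of "M / R"] M R by simp
    from mult_left_mono[OF this, of \<nu>] show ?thesis using nu by (simp only: norm_mult norm_of_real abs_of_pos less_imp_le)
  qed
  have 2: "cmod (if i = 2 then 1 / of_real R * lhat (p t) R 1 ?r else 0) \<le> 1 / R * S"
    using S R by (auto simp: norm_mult norm_divide divide_right_mono intro!: order_trans[OF norm_ge_zero S(3)] divide_nonneg_nonneg)
  have 3: "cmod (\<i> * of_real (fc i ?r) * ((- e * lhat (p t) R 1 ?r + d * lhat (p t) R 2 ?r) / of_real (sqf ?r))) \<le> \<bar>fc i ?r\<bar> * ((M / R * S) / sqf ?r)"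
  proof -
    have "cmod (- e * lhat (p t) R 1 ?r + d * lhat (p t) R 2 ?r) \<le> M / R * S"
      using two[of "lhat (p t) R 1 ?r" "lhat (p t) R 2 ?r"] mult_left_mono[OF S(2), of "M / R"] M R by simp
    from divide_right_mono[OF this, of "sqf ?r"] pos
    have "cmod (- e * lhat (p t) R 1 ?r + d * lhat (p t) R 2 ?r) / sqf ?r \<le> M / R * S / sqf ?r" by simp
    from mult_left_mono[OF this, of "\<bar>fc i ?r\<bar>"]
    show ?thesis using pos by (simp only: norm_mult norm_divide norm_of_real abs_of_pos norm_ii mult_1 abs_ge_zero)
  qed
  have tri: "cmod (a + b - c) \<le> cmod a + cmod b + cmod c" for a b c :: complex
    using norm_triangle_ineq4[of "a + b" c] norm_triangle_ineq[of a b] by simp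
  have "cmod (err i R q t) \<le> \<nu> * (M / R * S) + 1 / R * S + \<bar>fc i ?r\<bar> * ((M / R * S) / sqf ?r)"
    unfolding err_def Let_def e_def[symmetric] d_def[symmetric]
    by (rule order_trans[OF tri]) (intro add_mono 1 2 3)
  also have "\<dots> = errc i ?r * (S / R)" unfolding errc_def M_def[symmetric]
    by (simp only: distrib_right) (simp add: mult_ac)
  finally show ?thesis by (simp add: S_def)
qed

end

subsection \<open>Integration along characteristics\<close>

text \<open>The antiderivative in \<open>t\<close> of |\<xi>_t|^2 that vanishes at 0, so exp (-
  \<nu> Aint) is the viscous damping of a mode.\<close>

definition Aint :: "real \<Rightarrow> freq \<Rightarrow> real" where
  "Aint t q = ((fc 1 q)\<^sup>2 + (fc 3 q)\<^sup>2) * t + ((fc 2 q)\<^sup>2 * t - fc 2 q * fc 1 q * t\<^sup>2 + (fc 1 q)\<^sup>2 * t ^ 3 / 3)"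

lemma fc_qs: "fc i (qs t q) = (if i = 2 then fc 2 q - fc 1 q * t else fc i q)"
  by (cases q) (auto simp: fc_def)

lemma sqf_qs: "sqf (qs t q) = (fc 1 q)\<^sup>2 + (fc 2 q - fc 1 q * t)\<^sup>2 + (fc 3 q)\<^sup>2"
  by (simp add: sqf_def fc_qs)

lemma Aint_derivative: "((\<lambda>t. Aint t q) has_real_derivative sqf (qs t q)) (at t within S)"
  unfolding Aint_def sqf_qs
  by (auto intro!: derivative_eq_intros simp: power2_eq_square algebra_simps)

lemma sqf_qs_derivative: "((\<lambda>t. sqf (qs t q)) has_real_derivative - 2 * fc 1 q * fc 2 (qs t q)) (at t within S)"
  unfolding sqf_qs fc_qs by (auto intro!: derivative_eq_intros simp: algebra_simps)

text \<open>For k = 0 the frequency is at rest and \<eta> keeps it away from 0; for k \<noteq> 0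
  already k^2 does. The excluded set \<eta> = 0 is null and contains the zero mode.\<close>

lemma sqf_qs_pos:
  assumes "fc 2 q \<noteq> 0"
  shows "sqf (qs t q) > 0"
proof (cases "fc 1 q = 0")
  case True
  then show ?thesis using assms by (simp add: sqf_qs add_nonneg_pos add_pos_nonneg)
next
  case False
  then show ?thesis by (simp add: sqf_qs add_pos_nonneg)
qed

lemma AE_fc2: "AE q in freqm. fc 2 q \<noteq> 0"
proof (rule AE_I[where N = "{q. fc 2 q = 0}"])
  have m: "{q. fc 2 q = 0} \<in> sets freqm"
    using measurable_sets[OF fc_measurable, of "{0}" 2] by (simp add: vimage_def)
  then show "{q. fc 2 q = 0} \<in> sets freqm" .
  have "emeasure freqm {q. fc 2 q = 0} = (\<integral>\<^sup>+q. indicator {q. fc 2 q = 0} q \<partial>freqm)" using m by simp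
  also have "\<dots> = (\<integral>\<^sup>+k. \<integral>\<^sup>+\<eta>. \<integral>\<^sup>+l. indicator {q. fc 2 q = 0} (k, \<eta>, l) \<partial>count_space (UNIV :: int set) \<partial>lborel \<partial>count_space (UNIV :: int set))"
    using m by (intro nn_integral_freqm) auto
  also have "\<dots> = (\<integral>\<^sup>+k. \<integral>\<^sup>+\<eta>. 0 \<partial>(lborel :: real measure) \<partial>count_space (UNIV :: int set))"
  proof (rule nn_integral_cong, rule nn_integral_cong_AE)
    fix k :: int
    have "AE \<eta> in lborel. \<eta> \<noteq> (0::real)" by (rule AE_lborel_singleton)
    then show "AE \<eta> in lborel. (\<integral>\<^sup>+l. indicator {q. fc 2 q = 0} (k, \<eta>, l) \<partial>count_space (UNIV :: int set)) = 0"
      by eventually_elim simp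
  qed
  finally show "emeasure freqm {q. fc 2 q = 0} = 0" by simp
qed auto

lemma continuous_bound:
  fixes f :: "real \<Rightarrow> real"
  assumes "continuous_on {0..t} f"
  shows "\<exists>B\<ge>0. \<forall>s\<in>{0..t}. \<bar>f s\<bar> \<le> B"
proof -
  have "compact (f ` {0..t})" using assms by (intro compact_continuous_image) auto
  then obtain B where B: "\<And>s. s \<in> {0..t} \<Longrightarrow> \<bar>f s\<bar> \<le> B"
    unfolding real_norm_def[symmetric] using compact_imp_bounded bounded_iff by (metis imageI)
  show ?thesis by (rule exI[of _ "max B 0"]) (use B in \<open>auto intro!: max.coboundedI1\<close>)
qed

text \<open>Mean value inequality with a majorant. It converts a pointwise bound of the errors by
  \<open>Esum\<close> into an integrated one by \<open>Jsum\<close>.\<close>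

lemma vector_derivative_bound:
  fixes f :: "real \<Rightarrow> complex"
  assumes "0 \<le> t"
    and f: "\<And>s. s \<in> {0..t} \<Longrightarrow> (f has_vector_derivative f' s) (at s within {0..t})"
    and g: "\<And>s. s \<in> {0..t} \<Longrightarrow> (g has_real_derivative g' s) (at s within {0..t})"
    and le: "\<And>s. s \<in> {0..t} \<Longrightarrow> cmod (f' s) \<le> g' s"
  shows "cmod (f t - f 0) \<le> g t - g 0"
proof (cases "t = 0")
  case False
  then have t: "0 < t" using assms(1) by simp
  show ?thesis
  proof (rule differentiable_bound_general[OF t, of f g f' g'])
    show "continuous_on {0..t} f"
      unfolding continuous_on_eq_continuous_within using f has_vector_derivative_continuous by blast
    show "continuous_on {0..t} g" using g by (rule DERIV_continuous_on)
    fix s assume s: "0 < s" "s < t"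
    show "(f has_vector_derivative f' s) (at s)" using f[of s] s at_within_Icc_at[of 0 s t] by simp
    show "(g has_vector_derivative g' s) (at s)" using g[of s] s at_within_Icc_at[of 0 s t]
      by (simp add: has_real_derivative_iff_has_vector_derivative)
    show "cmod (f' s) \<le> g' s" using le s by simp
  qed
qed simp

context lin_NS
begin

text \<open>Duhamel integral. As exp (\<nu> Aint) |\<xi>_s|^2 u^2 is conserved, the forcing in the
  equation for exp (\<nu> Aint) u^i is that constant times \<open>acoef\<close> over
  \<open>sqf\<close>.\<close>

definition mcoef :: "3 \<Rightarrow> real \<Rightarrow> freq \<Rightarrow> real" where
  "mcoef i t q = integral {0..t} (\<lambda>s. acoef i (qs s q) / sqf (qs s q))"

lemma continuous_sqf_qs: "continuous_on S (\<lambda>s. sqf (qs s q))"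
  unfolding sqf_qs by (intro continuous_intros)

lemma continuous_fc_qs: "continuous_on S (\<lambda>s. fc i (qs s q))"
  unfolding fc_qs by (cases "i = 2") (auto intro!: continuous_intros)

lemma continuous_acoef_qs: "fc 2 q \<noteq> 0 \<Longrightarrow> continuous_on S (\<lambda>s. acoef i (qs s q))"
  unfolding acoef_def using sqf_qs_pos[of q]
  by (intro continuous_intros continuous_sqf_qs continuous_fc_qs) (auto simp: less_imp_neq[symmetric])

lemma continuous_errc_qs: "fc 2 q \<noteq> 0 \<Longrightarrow> continuous_on S (\<lambda>s. errc i (qs s q))"
  unfolding errc_def using sqf_qs_pos[of q]
  by (intro continuous_intros continuous_sqf_qs continuous_fc_qs) (auto simp: less_imp_neq[symmetric])

lemma continuous_Aint: "continuous_on S (\<lambda>s. Aint s q)"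
  unfolding Aint_def by (intro continuous_intros) auto

lemma Esum_nonneg: "0 \<le> Esum i R q t" by (simp add: Esum_def)

lemma W_derivative':
  assumes "s \<in> {0..t}" "R > 0" "fc 2 q \<noteq> 0"
  shows "(W i R q has_vector_derivative
    (- of_real (\<nu> * sqf (qs s q)) * W i R q s + of_real (acoef i (qs s q)) * W 2 R q s + err i R q s)) (at s within {0..t})"
  using assms by (intro has_vector_derivative_within_subset[OF W_derivative] sqf_qs_pos) auto

lemma exp_Aint_derivative:
  "((\<lambda>s. complex_of_real (exp (\<nu> * Aint s q))) has_vector_derivative of_real (exp (\<nu> * Aint s q) * (\<nu> * sqf (qs s q)))) (at s within S)"
proof -
  have "((\<lambda>s. exp (\<nu> * Aint s q)) has_real_derivative exp (\<nu> * Aint s q) * (\<nu> * sqf (qs s q))) (at s within S)"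
    by (auto intro!: derivative_eq_intros Aint_derivative)
  then show ?thesis unfolding has_vector_derivative_complex_iff by simp
qed

text \<open>Since |\<xi>|^2 acoef 2 = 2 k \<xi>_2 is minus the time derivative of |\<xi>_t|^2, the
  pressure term cancels when u^2 is multiplied by |\<xi>_t|^2; up to sign the conserved unknown is
  \<Delta>u^2 with the damping undone. Only cutoff errors remain, and \<open>B\<close> depends on
  the mode but not on \<open>R\<close>.\<close>

lemma W2_estimate:
  assumes t: "t \<ge> 0" and q: "fc 2 q \<noteq> 0"
  obtains B where "B \<ge> 0" "\<And>R s. R \<ge> 1 \<Longrightarrow> s \<in> {0..t} \<Longrightarrow>
     cmod (of_real (exp (\<nu> * Aint s q) * sqf (qs s q)) * W 2 R q s - of_real (sqf q) * W 2 R q 0) \<le> B / R * Jsum 2 R q s"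
proof -
  have pos: "sqf (qs s q) > 0" for s using sqf_qs_pos[OF q] .
  have "continuous_on {0..t} (\<lambda>s. exp (\<nu> * Aint s q) * sqf (qs s q) * errc 2 (qs s q))"
    by (intro continuous_intros continuous_Aint continuous_sqf_qs continuous_errc_qs q)
  from continuous_bound[OF this] obtain B where B: "B \<ge> 0" "\<And>s. s \<in> {0..t} \<Longrightarrow> \<bar>exp (\<nu> * Aint s q) * sqf (qs s q) * errc 2 (qs s q)\<bar> \<le> B"
    by blast
  show ?thesis
  proof (rule that[OF B(1)])
    fix R s :: real assume R: "R \<ge> 1" and s: "s \<in> {0..t}"
    define Y where "Y r = complex_of_real (exp (\<nu> * Aint r q)) * (of_real (sqf (qs r q)) * W 2 R q r)" for r
    have dsq: "((\<lambda>r. complex_of_real (sqf (qs r q))) has_vector_derivative of_real (- 2 * fc 1 q * fc 2 (qs r q))) (at r within {0..s})" for r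
      using sqf_qs_derivative[of q r] unfolding has_vector_derivative_complex_iff by simp
    have dY: "(Y has_vector_derivative (of_real (exp (\<nu> * Aint r q)) * (of_real (sqf (qs r q)) * err 2 R q r))) (at r within {0..s})"
      if r: "r \<in> {0..s}" for r
    proof -
      have a: "complex_of_real (sqf (qs r q)) * of_real (acoef 2 (qs r q)) = of_real (2 * fc 1 q * fc 2 (qs r q))"
        using pos[of r] unfolding of_real_mult[symmetric] acoef_def by (simp add: fc_qs[of 1])
      have "(Y has_vector_derivative (of_real (exp (\<nu> * Aint r q)) *
          (of_real (sqf (qs r q)) * (- of_real (\<nu> * sqf (qs r q)) * W 2 R q r + of_real (acoef 2 (qs r q)) * W 2 R q r + err 2 R q r)
            + of_real (- 2 * fc 1 q * fc 2 (qs r q)) * W 2 R q r)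
          + of_real (exp (\<nu> * Aint r q) * (\<nu> * sqf (qs r q))) * (of_real (sqf (qs r q)) * W 2 R q r))) (at r within {0..s})"
        unfolding Y_def[abs_def]
        by (intro has_vector_derivative_mult exp_Aint_derivative dsq W_derivative' r q) (use R in simp)
      also have "of_real (exp (\<nu> * Aint r q)) *
          (of_real (sqf (qs r q)) * (- of_real (\<nu> * sqf (qs r q)) * W 2 R q r + of_real (acoef 2 (qs r q)) * W 2 R q r + err 2 R q r)
            + of_real (- 2 * fc 1 q * fc 2 (qs r q)) * W 2 R q r)
          + of_real (exp (\<nu> * Aint r q) * (\<nu> * sqf (qs r q))) * (of_real (sqf (qs r q)) * W 2 R q r)
        = of_real (exp (\<nu> * Aint r q)) * (of_real (sqf (qs r q)) * err 2 R q r)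
          + of_real (exp (\<nu> * Aint r q)) * W 2 R q r * (complex_of_real (sqf (qs r q)) * of_real (acoef 2 (qs r q)) - of_real (2 * fc 1 q * fc 2 (qs r q)))"
        by (simp add: algebra_simps)
      also have "\<dots> = of_real (exp (\<nu> * Aint r q)) * (of_real (sqf (qs r q)) * err 2 R q r)"
        unfolding a by simp
      finally show ?thesis .
    qed
    have "cmod (Y s - Y 0) \<le> B / R * Jsum 2 R q s - B / R * Jsum 2 R q 0"
    proof (rule vector_derivative_bound[OF _ dY])
      show "0 \<le> s" using s by simp
      show "((\<lambda>s. B / R * Jsum 2 R q s) has_real_derivative B / R * Esum 2 R q r) (at r within {0..s})" if "r \<in> {0..s}" for r
        by (intro DERIV_cmult Jsum_derivative that) (use R in simp)
      fix r assume r: "r \<in> {0..s}"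
      then have rt: "r \<in> {0..t}" using s by auto
      have "cmod (of_real (exp (\<nu> * Aint r q)) * (of_real (sqf (qs r q)) * err 2 R q r)) = exp (\<nu> * Aint r q) * sqf (qs r q) * cmod (err 2 R q r)"
        using pos[of r] by (simp add: norm_mult)
      also have "\<dots> \<le> exp (\<nu> * Aint r q) * sqf (qs r q) * (errc 2 (qs r q) * (Esum 2 R q r / R))"
        using err_bound[OF R pos] pos[of r] by (intro mult_left_mono) auto
      also have "\<dots> = (exp (\<nu> * Aint r q) * sqf (qs r q) * errc 2 (qs r q)) * (Esum 2 R q r / R)" by (simp only: mult.assoc)
      also have "\<dots> \<le> B * (Esum 2 R q r / R)"
        using B(2)[OF rt] R Esum_nonneg[of 2 R q r] by (intro mult_right_mono) (auto simp: abs_le_iff)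
      finally show "cmod (of_real (exp (\<nu> * Aint r q)) * (of_real (sqf (qs r q)) * err 2 R q r)) \<le> B / R * Esum 2 R q r" by simp
    qed auto
    then show "cmod (of_real (exp (\<nu> * Aint s q) * sqf (qs s q)) * W 2 R q s - of_real (sqf q) * W 2 R q 0) \<le> B / R * Jsum 2 R q s"
      by (simp add: Y_def Jsum_0 Aint_def mult.assoc)
  qed
qed

text \<open>Two errors add up: that of the conserved quantity for u^2, bounded up to time
  \<open>t\<close> by monotonicity of \<open>Jsum\<close>, and that of the equation for u^i
  itself.\<close>

lemma W_estimate:
  assumes t: "t \<ge> 0" and q: "fc 2 q \<noteq> 0"
  obtains B where "\<And>R. R \<ge> 1 \<Longrightarrow>
     cmod (of_real (exp (\<nu> * Aint t q)) * W i R q t - W i R q 0 - of_real (sqf q) * W 2 R q 0 * of_real (mcoef i t q))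
       \<le> B * (1 / R * Jsum 2 R q t + 1 / R * Jsum i R q t)"
proof -
  have pos: "sqf (qs s q) > 0" for s using sqf_qs_pos[OF q] .
  obtain B where B: "B \<ge> 0" "\<And>R s. R \<ge> 1 \<Longrightarrow> s \<in> {0..t} \<Longrightarrow>
     cmod (of_real (exp (\<nu> * Aint s q) * sqf (qs s q)) * W 2 R q s - of_real (sqf q) * W 2 R q 0) \<le> B / R * Jsum 2 R q s"
    using W2_estimate[OF t q] by metis
  have cq: "continuous_on {0..t} (\<lambda>s. acoef i (qs s q) / sqf (qs s q))"
    using pos by (intro continuous_intros continuous_acoef_qs continuous_sqf_qs q) (auto simp: less_imp_neq[symmetric])
  from continuous_bound[OF this] obtain D where D: "D \<ge> 0" "\<And>s. s \<in> {0..t} \<Longrightarrow> \<bar>acoef i (qs s q) / sqf (qs s q)\<bar> \<le> D"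
    by blast
  have "continuous_on {0..t} (\<lambda>s. exp (\<nu> * Aint s q) * errc i (qs s q))"
    by (intro continuous_intros continuous_Aint continuous_errc_qs q)
  from continuous_bound[OF this] obtain G where G: "G \<ge> 0" "\<And>s. s \<in> {0..t} \<Longrightarrow> \<bar>exp (\<nu> * Aint s q) * errc i (qs s q)\<bar> \<le> G"
    by blast
  show ?thesis
  proof (rule that[of "D * B * t + G"])
    fix R :: real assume R: "R \<ge> 1"
    define Z where "Z s = of_real (exp (\<nu> * Aint s q)) * W i R q s - of_real (sqf q) * W 2 R q 0 * of_real (mcoef i s q)" for s
    define X where "X s = of_real (exp (\<nu> * Aint s q) * sqf (qs s q)) * W 2 R q s - of_real (sqf q) * W 2 R q 0" for s
    have dm: "((\<lambda>s. complex_of_real (mcoef i s q)) has_vector_derivative of_real (acoef i (qs s q) / sqf (qs s q))) (at s within {0..t})"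
      if "s \<in> {0..t}" for s
      using integral_has_real_derivative[OF cq that] unfolding has_vector_derivative_complex_iff mcoef_def by simp
    have dZ: "(Z has_vector_derivative (of_real (acoef i (qs s q) / sqf (qs s q)) * X s + of_real (exp (\<nu> * Aint s q)) * err i R q s)) (at s within {0..t})"
      if s: "s \<in> {0..t}" for s
    proof -
      have a: "of_real (acoef i (qs s q) / sqf (qs s q)) * (of_real (exp (\<nu> * Aint s q) * sqf (qs s q)) * W 2 R q s) = of_real (exp (\<nu> * Aint s q)) * (of_real (acoef i (qs s q)) * W 2 R q s)"
        using pos[of s] by (simp add: field_simps)
      have "(Z has_vector_derivative (of_real (exp (\<nu> * Aint s q)) *
          (- of_real (\<nu> * sqf (qs s q)) * W i R q s + of_real (acoef i (qs s q)) * W 2 R q s + err i R q s)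
          + of_real (exp (\<nu> * Aint s q) * (\<nu> * sqf (qs s q))) * W i R q s)
          - of_real (sqf q) * W 2 R q 0 * of_real (acoef i (qs s q) / sqf (qs s q))) (at s within {0..t})"
        unfolding Z_def[abs_def]
        by (intro has_vector_derivative_diff has_vector_derivative_mult has_vector_derivative_mult_right exp_Aint_derivative W_derivative' s q dm) (use R in simp)
      also have "of_real (exp (\<nu> * Aint s q)) *
          (- of_real (\<nu> * sqf (qs s q)) * W i R q s + of_real (acoef i (qs s q)) * W 2 R q s + err i R q s)
          + of_real (exp (\<nu> * Aint s q) * (\<nu> * sqf (qs s q))) * W i R q s
          - of_real (sqf q) * W 2 R q 0 * of_real (acoef i (qs s q) / sqf (qs s q))
        = of_real (acoef i (qs s q) / sqf (qs s q)) * X s + of_real (exp (\<nu> * Aint s q)) * err i R q s"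
        unfolding X_def right_diff_distrib a by (simp add: algebra_simps)
      finally show ?thesis .
    qed
    have "cmod (Z t - Z 0) \<le> (D * (B / R * Jsum 2 R q t) * t + G / R * Jsum i R q t) - (D * (B / R * Jsum 2 R q t) * 0 + G / R * Jsum i R q 0)"
    proof (rule vector_derivative_bound[OF t dZ])
      show "((\<lambda>s. D * (B / R * Jsum 2 R q t) * s + G / R * Jsum i R q s) has_real_derivative D * (B / R * Jsum 2 R q t) + G / R * Esum i R q s) (at s within {0..t})"
        if "s \<in> {0..t}" for s
        by (rule DERIV_add[OF _ DERIV_cmult[OF Jsum_derivative[OF _ that]]]) (use R in \<open>auto intro!: derivative_eq_intros\<close>)
      fix s assume s: "s \<in> {0..t}"
      have "cmod (of_real (acoef i (qs s q) / sqf (qs s q)) * X s) \<le> D * (B / R * Jsum 2 R q t)"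
      proof -
        have "cmod (X s) \<le> B / R * Jsum 2 R q s" unfolding X_def by (rule B(2)[OF R s])
        also have "\<dots> \<le> B / R * Jsum 2 R q t" using R s B(1) by (intro mult_left_mono Jsum_mono) auto
        finally show ?thesis using D(2)[OF s] D(1) unfolding norm_mult norm_of_real by (intro mult_mono) auto
      qed
      moreover have "cmod (of_real (exp (\<nu> * Aint s q)) * err i R q s) \<le> G / R * Esum i R q s"
      proof -
        have "cmod (of_real (exp (\<nu> * Aint s q)) * err i R q s) \<le> exp (\<nu> * Aint s q) * (errc i (qs s q) * (Esum i R q s / R))"
          using err_bound[OF R pos] unfolding norm_mult norm_of_real
            by (simp only: abs_exp_cancel mult_left_mono exp_ge_zero)
        also have "\<dots> = (exp (\<nu> * Aint s q) * errc i (qs s q)) * (Esum i R q s / R)" by (simp only: mult.assoc)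
        also have "\<dots> \<le> G * (Esum i R q s / R)"
          using G(2)[OF s] R Esum_nonneg[of i R q s] by (intro mult_right_mono) (auto simp: abs_le_iff)
        finally show ?thesis by simp
      qed
      ultimately show "cmod (of_real (acoef i (qs s q) / sqf (qs s q)) * X s + of_real (exp (\<nu> * Aint s q)) * err i R q s) \<le> D * (B / R * Jsum 2 R q t) + G / R * Esum i R q s"
        by (intro order_trans[OF norm_triangle_ineq] add_mono)
    qed
    moreover have "Z t - Z 0 = of_real (exp (\<nu> * Aint t q)) * W i R q t - W i R q 0 - of_real (sqf q) * W 2 R q 0 * of_real (mcoef i t q)"
      by (simp add: Z_def Aint_def mcoef_def)
    moreover have "D * (B / R * Jsum 2 R q t) * t + G / R * Jsum i R q t \<le> (D * B * t + G) * (1 / R * Jsum 2 R q t + 1 / R * Jsum i R q t)"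
    proof -
      have "0 \<le> D * B * t" "0 \<le> G" "0 \<le> 1 / R * Jsum 2 R q t" "0 \<le> 1 / R * Jsum i R q t"
        using D B G t R Jsum_nonneg by auto
      then have "0 \<le> (D * B * t) * (1 / R * Jsum i R q t)" "0 \<le> G * (1 / R * Jsum 2 R q t)" by (simp_all only: mult_nonneg_nonneg)
      moreover have "P * x + G * y \<le> (P + G) * (x + y)" if "0 \<le> P * y" "0 \<le> G * x" for P x y
        using that by (simp add: algebra_simps)
      ultimately have "(D * B * t) * (1 / R * Jsum 2 R q t) + G * (1 / R * Jsum i R q t) \<le> (D * B * t + G) * (1 / R * Jsum 2 R q t + 1 / R * Jsum i R q t)"
        by blast
      then show ?thesis by (simp add: mult_ac)
    qed
    ultimately show "cmod (of_real (exp (\<nu> * Aint t q)) * W i R q t - W i R q 0 - of_real (sqf q) * W 2 R q 0 * of_real (mcoef i t q))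
       \<le> (D * B * t + G) * (1 / R * Jsum 2 R q t + 1 / R * Jsum i R q t)"
      by (simp add: Jsum_0)
  qed
qed

lemma Jsum_AE:
  assumes "t \<ge> 0"
  shows "AE q in freqm. (\<lambda>n. 1 / real (Suc n) * Jsum i (real (Suc n)) q t) \<longlonglongrightarrow> 0"
  using Jt_AE_tendsto[OF U_cont assms, of i 1] Jt_AE_tendsto[OF U_cont assms, of i 2]
    Jt_AE_tendsto[OF p_cont assms, of 1] Jt_AE_tendsto[OF p_cont assms, of 2]
proof eventually_elim
  case (elim q)
  have "(\<lambda>n. 1 / real (Suc n) * Jt (U i) (real (Suc n)) 1 t q + 1 / real (Suc n) * Jt (U i) (real (Suc n)) 2 t q + 1 / real (Suc n) * Jt p (real (Suc n)) 1 t q + 1 / real (Suc n) * Jt p (real (Suc n)) 2 t q) \<longlonglongrightarrow> 0 + 0 + 0 + 0"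
    by (intro tendsto_add elim)
  then show ?case by (simp add: Jsum_def distrib_left del: of_nat_Suc)
qed

lemma W_tendsto_L2:
  assumes t: "t \<ge> 0" and F: "cell.L2_transform (cr (U i t)) F"
  shows "(\<lambda>n. norm2 freqm (\<lambda>q. W i (real (Suc n)) q t - F (qs t q))) \<longlonglongrightarrow> 0"
    and "sqi freqm (\<lambda>q. W i (real (Suc n)) q t - F (qs t q))"
proof -
  have s: "sqi freqm (\<lambda>q. lhat (U i t) (real (Suc n)) 0 q - F q)" for n
    by (intro sqi_diff sqi_lhat U_L2 t cell.L2_transform_sqi(2)[OF F]) simp
  show "sqi freqm (\<lambda>q. W i (real (Suc n)) q t - F (qs t q))"
    using norm2_qs(1)[OF s, of n t] by (simp only: W_def)
  show "(\<lambda>n. norm2 freqm (\<lambda>q. W i (real (Suc n)) q t - F (qs t q))) \<longlonglongrightarrow> 0"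
    using lhat_tendsto[OF U_L2[OF t] F] unfolding norm2_qs(2)[OF s, of _ t, symmetric] by (simp only: W_def)
qed

text \<open>Two components at two times must converge along one common subsequence. The sum of
  squares reduces this to L1 convergence of a single sequence.\<close>

lemma norm2_AE_subseq4:
  assumes s: "\<And>j n. j \<in> {0..<4::nat} \<Longrightarrow> sqi M (D j n)" and l: "\<And>j. j \<in> {0..<4::nat} \<Longrightarrow> (\<lambda>n. norm2 M (D j n)) \<longlonglongrightarrow> 0"
  obtains r :: "nat \<Rightarrow> nat" where "strict_mono r" "AE x in M. \<forall>j\<in>{0..<4}. (\<lambda>n. D j (r n) x) \<longlonglongrightarrow> 0"
proof -
  define u where "u n x = (\<Sum>j\<in>{0..<4::nat}. (cmod (D j n x))\<^sup>2)" for n x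
  have ui: "integrable M (u n)" for n unfolding u_def by (intro Bochner_Integration.integrable_sum sqi_integrable s)
  have "(LINT x|M. norm (u n x)) = (\<Sum>j\<in>{0..<4::nat}. (norm2 M (D j n))\<^sup>2)" for n
  proof -
    have "(LINT x|M. norm (u n x)) = (LINT x|M. u n x)" by (simp add: u_def sum_nonneg)
    also have "\<dots> = (\<Sum>j\<in>{0..<4::nat}. (norm2 M (D j n))\<^sup>2)"
      unfolding u_def norm2_sq by (intro Bochner_Integration.integral_sum sqi_integrable s)
    finally show ?thesis .
  qed
  moreover have "(\<lambda>n. \<Sum>j\<in>{0..<4::nat}. (norm2 M (D j n))\<^sup>2) \<longlonglongrightarrow> (\<Sum>j\<in>{0..<4::nat}. 0\<^sup>2)"
    by (intro tendsto_sum tendsto_power l)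
  ultimately have "(\<lambda>n. LINT x|M. norm (u n x)) \<longlonglongrightarrow> 0" by simp
  from tendsto_L1_AE_subseq[OF ui this] obtain r where r: "strict_mono r" "AE x in M. (\<lambda>n. u (r n) x) \<longlonglongrightarrow> 0" by blast
  have "AE x in M. \<forall>j\<in>{0..<4}. (\<lambda>n. D j (r n) x) \<longlonglongrightarrow> 0"
    using r(2)
  proof (eventually_elim, intro ballI)
    fix x j assume u: "(\<lambda>n. u (r n) x) \<longlonglongrightarrow> 0" and j: "j \<in> {0..<4::nat}"
    have "(\<lambda>n. sqrt (u (r n) x)) \<longlonglongrightarrow> sqrt 0" by (rule tendsto_real_sqrt[OF u])
    moreover have "cmod (D j (r n) x) \<le> sqrt (u (r n) x)" for n
      unfolding u_def using j by (intro real_le_rsqrt member_le_sum) auto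
    ultimately show "(\<lambda>n. D j (r n) x) \<longlonglongrightarrow> 0"
      by - (rule Lim_null_comparison[where g = "\<lambda>n. sqrt (u (r n) x)", OF always_eventually[OF allI]], simp_all)
  qed
  with r(1) show ?thesis by (rule that)
qed

text \<open>Cutoff modes converge in L2, hence almost everywhere along a subsequence of integer
  scales, while the errors vanish along all integers. So both estimates pass to the limit for almost
  every mode.\<close>

theorem transform_evolution:
  assumes t: "t \<ge> 0"
    and F: "\<And>i. cell.L2_transform (cr (U i t)) (F i)" and G: "\<And>i. cell.L2_transform (cr (U i 0)) (G i)"
  shows "AE q in freqm. of_real (exp (\<nu> * Aint t q) * sqf (qs t q)) * F 2 (qs t q) = of_real (sqf q) * G 2 q"
    and "AE q in freqm. of_real (exp (\<nu> * Aint t q)) * F i (qs t q) = G i q + of_real (sqf q) * G 2 q * of_real (mcoef i t q)"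
proof -
  define D where "D j n q = (if j = 0 then W 2 (real (Suc n)) q t - F 2 (qs t q) else if j = 1 then W 2 (real (Suc n)) q 0 - G 2 (qs 0 q)
    else if j = 2 then W i (real (Suc n)) q t - F i (qs t q) else W i (real (Suc n)) q 0 - G i (qs 0 q))" for j n :: nat and q
  have D: "sqi freqm (D j n)" "(\<lambda>n. norm2 freqm (D j n)) \<longlonglongrightarrow> 0" for j n
    unfolding D_def[abs_def] using W_tendsto_L2[OF t F] W_tendsto_L2[OF order_refl G]
    by (cases "j = 0"; cases "j = 1"; cases "j = 2"; simp del: of_nat_Suc)+
  obtain r where r: "strict_mono r" "AE q in freqm. \<forall>j\<in>{0..<4}. (\<lambda>n. D j (r n) q) \<longlonglongrightarrow> 0"
    using norm2_AE_subseq4[of freqm D, OF D] by blast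
  have both: "AE q in freqm. of_real (exp (\<nu> * Aint t q) * sqf (qs t q)) * F 2 (qs t q) = of_real (sqf q) * G 2 q \<and>
     of_real (exp (\<nu> * Aint t q)) * F i (qs t q) = G i q + of_real (sqf q) * G 2 q * of_real (mcoef i t q)"
    using r(2) AE_fc2 Jsum_AE[OF t, of i] Jsum_AE[OF t, of 2]
  proof eventually_elim
    case (elim q)
    define R where "R n = real (Suc (r n))" for n
    have R: "R n \<ge> 1" for n by (simp add: R_def)
    have "(\<lambda>n. D 0 (r n) q) \<longlonglongrightarrow> 0" "(\<lambda>n. D 1 (r n) q) \<longlonglongrightarrow> 0" "(\<lambda>n. D 2 (r n) q) \<longlonglongrightarrow> 0" "(\<lambda>n. D 3 (r n) q) \<longlonglongrightarrow> 0"
      using elim(1) by auto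
    then have l: "(\<lambda>n. W 2 (R n) q t) \<longlonglongrightarrow> F 2 (qs t q)" "(\<lambda>n. W 2 (R n) q 0) \<longlonglongrightarrow> G 2 q"
      "(\<lambda>n. W i (R n) q t) \<longlonglongrightarrow> F i (qs t q)" "(\<lambda>n. W i (R n) q 0) \<longlonglongrightarrow> G i q"
      by (simp_all add: D_def R_def LIM_zero_iff)
    have J: "(\<lambda>n. 1 / R n * Jsum 2 (R n) q t) \<longlonglongrightarrow> 0" "(\<lambda>n. 1 / R n * Jsum i (R n) q t) \<longlonglongrightarrow> 0"
      using LIMSEQ_subseq_LIMSEQ[OF elim(4) r(1)] LIMSEQ_subseq_LIMSEQ[OF elim(3) r(1)] by (simp_all add: R_def o_def)
    obtain B where B: "\<And>R s. R \<ge> 1 \<Longrightarrow> s \<in> {0..t} \<Longrightarrow>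
        cmod (of_real (exp (\<nu> * Aint s q) * sqf (qs s q)) * W 2 R q s - of_real (sqf q) * W 2 R q 0) \<le> B / R * Jsum 2 R q s"
      using W2_estimate[OF t elim(2)] by metis
    have "(\<lambda>n. of_real (exp (\<nu> * Aint t q) * sqf (qs t q)) * W 2 (R n) q t - of_real (sqf q) * W 2 (R n) q 0) \<longlonglongrightarrow> 0"
    proof (rule Lim_null_comparison[OF always_eventually[OF allI]])
      show "cmod (of_real (exp (\<nu> * Aint t q) * sqf (qs t q)) * W 2 (R n) q t - of_real (sqf q) * W 2 (R n) q 0) \<le> B * (1 / R n * Jsum 2 (R n) q t)" for n
        using B[OF R, of t n] t by simp
      show "(\<lambda>n. B * (1 / R n * Jsum 2 (R n) q t)) \<longlonglongrightarrow> 0" by (rule tendsto_mult_right_zero[OF J(1)])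
    qed
    moreover have "(\<lambda>n. of_real (exp (\<nu> * Aint t q) * sqf (qs t q)) * W 2 (R n) q t - of_real (sqf q) * W 2 (R n) q 0) \<longlonglongrightarrow>
       of_real (exp (\<nu> * Aint t q) * sqf (qs t q)) * F 2 (qs t q) - of_real (sqf q) * G 2 q"
      by (intro tendsto_intros l)
    ultimately have 1: "of_real (exp (\<nu> * Aint t q) * sqf (qs t q)) * F 2 (qs t q) = of_real (sqf q) * G 2 q"
      using LIMSEQ_unique by fastforce
    obtain C where C: "\<And>R. R \<ge> 1 \<Longrightarrow>
      cmod (of_real (exp (\<nu> * Aint t q)) * W i R q t - W i R q 0 - of_real (sqf q) * W 2 R q 0 * of_real (mcoef i t q))
       \<le> C * (1 / R * Jsum 2 R q t + 1 / R * Jsum i R q t)"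
      using W_estimate[OF t elim(2), of i] by metis
    have "(\<lambda>n. of_real (exp (\<nu> * Aint t q)) * W i (R n) q t - W i (R n) q 0 - of_real (sqf q) * W 2 (R n) q 0 * of_real (mcoef i t q)) \<longlonglongrightarrow> 0"
      by (rule Lim_null_comparison[OF always_eventually[OF allI, OF C[OF R]]]) (intro tendsto_mult_right_zero tendsto_add_zero J)
    moreover have "(\<lambda>n. of_real (exp (\<nu> * Aint t q)) * W i (R n) q t - W i (R n) q 0 - of_real (sqf q) * W 2 (R n) q 0 * of_real (mcoef i t q)) \<longlonglongrightarrow>
       of_real (exp (\<nu> * Aint t q)) * F i (qs t q) - G i q - of_real (sqf q) * G 2 q * of_real (mcoef i t q)"
      by (intro tendsto_intros l)
    ultimately have "of_real (exp (\<nu> * Aint t q)) * F i (qs t q) - G i q - of_real (sqf q) * G 2 q * of_real (mcoef i t q) = 0"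
      using LIMSEQ_unique by blast
    with 1 show ?case by (simp add: diff_diff_eq)
  qed
  from both show "AE q in freqm. of_real (exp (\<nu> * Aint t q) * sqf (qs t q)) * F 2 (qs t q) = of_real (sqf q) * G 2 q"
    by eventually_elim simp
  from both show "AE q in freqm. of_real (exp (\<nu> * Aint t q)) * F i (qs t q) = G i q + of_real (sqf q) * G 2 q * of_real (mcoef i t q)"
    by eventually_elim simp
qed

end

section \<open>Averages, shears and the heat semigroup\<close>

text \<open>Cauchy-Schwarz with the constant 1. If \<open>f\<close> is not square integrable the
  right-hand side is infinite, which is where positive total measure enters.\<close>

lemma ennreal_integral_sq_le:
  fixes f :: "'a \<Rightarrow> real"
  assumes "finite_measure M" "measure M (space M) > 0" and [measurable]: "f \<in> borel_measurable M"
  shows "ennreal ((LINT x|M. f x)\<^sup>2) \<le> ennreal (measure M (space M)) * (\<integral>\<^sup>+x. ennreal ((f x)\<^sup>2) \<partial>M)"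
proof -
  interpret finite_measure M by fact
  let ?f = "\<lambda>x. complex_of_real (f x)"
  show ?thesis
  proof (cases "sqi M ?f")
    case True
    have 1: "sqi M (\<lambda>x. 1)" by (simp add: sqi_def)
    have "\<bar>LINT x|M. f x\<bar> \<le> norm2 M ?f * sqrt (measure M (space M))"
      using norm2_inner_bound[OF True 1] by (simp add: norm2_def[of _ "\<lambda>x. 1"])
    from power_mono[OF this abs_ge_zero, of 2]
    have "(LINT x|M. f x)\<^sup>2 \<le> measure M (space M) * (norm2 M ?f)\<^sup>2" by (simp add: power_mult_distrib mult.commute)
    then have "ennreal ((LINT x|M. f x)\<^sup>2) \<le> ennreal (measure M (space M)) * ennreal ((norm2 M ?f)\<^sup>2)"
      by (simp add: ennreal_mult[symmetric] ennreal_leI)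
    then show ?thesis using nn_norm2[OF True] by simp
  next
    case False
    then have "(\<integral>\<^sup>+x. ennreal ((f x)\<^sup>2) \<partial>M) = \<infinity>" by (auto simp: sqi_iff_nn not_less top_unique)
    then show ?thesis using assms(2) by (simp add: ennreal_mult_top)
  qed
qed

lemma emeasure_circle_UNIV: "emeasure circle UNIV = ennreal (2 * pi)"
  by (simp add: emeasure_circle)

lemma measure_circle_UNIV: "measure circle UNIV = 2 * pi"
  by (simp add: measure_def emeasure_circle_UNIV)

lemma borel_section: "f \<in> borel_measurable (borel :: pt measure) \<Longrightarrow> (\<lambda>x. f (x, r)) \<in> borel_measurable borel"
  by (rule measurable_compose[of _ _ borel]) (auto intro!: borel_measurable_continuous_onI continuous_intros)

lemma x_avg_eq:
  assumes "f \<in> borel_measurable borel"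
  shows "x_avg f r = 1 / (2 * pi) * (LINT x|circle. f (x, r))"
  using borel_section[OF assms, of r] by (cases r) (simp add: x_avg_def set_lebesgue_integral_def integral_circle)

lemma x_avg_measurable [measurable]:
  assumes f: "f \<in> borel_measurable borel"
  shows "x_avg f \<in> borel_measurable borel"
proof -
  have "(\<lambda>p. (snd p, fst p)) \<in> measurable ((borel :: (real \<times> real) measure) \<Otimes>\<^sub>M circle) (borel \<Otimes>\<^sub>M borel)" by measurable
  moreover have "f \<in> borel_measurable (borel \<Otimes>\<^sub>M borel)" using f by (simp add: borel_prod)
  ultimately have "(\<lambda>(r, x). f (x, r)) \<in> borel_measurable ((borel :: (real \<times> real) measure) \<Otimes>\<^sub>M circle)"
    unfolding split_beta by (rule measurable_compose)
  then have "(\<lambda>r. LINT x|circle. f (x, r)) \<in> borel_measurable borel" by (rule circle.borel_measurable_lebesgue_integral)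
  then show ?thesis unfolding x_avg_eq[OF f, abs_def] by simp
qed

lemma borel_lift [measurable]:
  fixes a :: "real \<times> real \<Rightarrow> 'b::topological_space"
  assumes "a \<in> borel_measurable borel"
  shows "(\<lambda>w::pt. a (snd w)) \<in> borel_measurable borel"
  using assms by (rule measurable_compose[rotated]) (intro borel_measurable_continuous_onI continuous_intros)

lemma L2_x_avg:
  assumes f: "L2 f"
  shows "L2 (\<lambda>w. x_avg f (snd w))"
proof -
  have fm [measurable]: "f \<in> borel_measurable borel" using f by (rule L2_borel)
  have m [measurable]: "(\<lambda>w::pt. x_avg f (snd w)) \<in> borel_measurable borel" using fm by measurable
  have m2: "(\<lambda>w. ennreal ((cmod (cr (\<lambda>w. x_avg f (snd w)) w))\<^sup>2)) \<in> borel_measurable borel" by measurable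
  have le: "ennreal (2 * pi) * ennreal ((x_avg f r)\<^sup>2) \<le> (\<integral>\<^sup>+x. ennreal ((f (x, r))\<^sup>2) \<partial>circle)" for r
  proof -
    have "ennreal ((LINT x|circle. f (x, r))\<^sup>2) \<le> ennreal (2 * pi) * (\<integral>\<^sup>+x. ennreal ((f (x, r))\<^sup>2) \<partial>circle)"
      using ennreal_integral_sq_le[OF finite_measure_circle, of "\<lambda>x. f (x, r)"] borel_section[OF fm, of r] by (simp add: measure_circle_UNIV)
    from mult_left_mono[OF this, of "ennreal (1 / (2 * pi))"]
    have "ennreal (1 / (2 * pi)) * ennreal ((LINT x|circle. f (x, r))\<^sup>2) \<le> ennreal (1 / (2 * pi)) * ennreal (2 * pi) * (\<integral>\<^sup>+x. ennreal ((f (x, r))\<^sup>2) \<partial>circle)"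
      by (simp add: mult.assoc)
    also have "ennreal (1 / (2 * pi)) * ennreal (2 * pi) = 1"
      by (simp add: ennreal_mult[symmetric])
    finally have "ennreal (1 / (2 * pi) * (LINT x|circle. f (x, r))\<^sup>2) \<le> (\<integral>\<^sup>+x. ennreal ((f (x, r))\<^sup>2) \<partial>circle)"
      by (simp add: ennreal_mult[symmetric])
    moreover have "1 / (2 * pi) * (LINT x|circle. f (x, r))\<^sup>2 = 2 * pi * (x_avg f r)\<^sup>2"
      unfolding x_avg_eq[OF fm] by (simp add: power2_eq_square field_simps)
    ultimately show ?thesis by (simp add: ennreal_mult)
  qed
  have "(\<integral>\<^sup>+w. ennreal ((cmod (cr (\<lambda>w. x_avg f (snd w)) w))\<^sup>2) \<partial>cellm) = (\<integral>\<^sup>+r. ennreal (2 * pi) * ennreal ((x_avg f r)\<^sup>2) \<partial>(lborel \<Otimes>\<^sub>M circle))"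
    unfolding nn_integral_cellm(2)[OF m2] by (simp add: cr_def emeasure_circle_UNIV mult.commute)
  also have "\<dots> \<le> (\<integral>\<^sup>+r. \<integral>\<^sup>+x. ennreal ((f (x, r))\<^sup>2) \<partial>circle \<partial>(lborel \<Otimes>\<^sub>M circle))"
    by (rule nn_integral_mono) (rule le)
  also have "\<dots> = (\<integral>\<^sup>+w. ennreal ((cmod (cr f w))\<^sup>2) \<partial>cellm)"
    by (subst nn_integral_cellm(2)) (use fm in \<open>auto simp: cr_def\<close>)
  also have "\<dots> < \<infinity>" using L2_sqi[OF f] by (simp add: sqi_iff_nn)
  finally have "sqi cellm (cr (\<lambda>w. x_avg f (snd w)))" by (intro sqi_nnI) simp_all
  moreover have "periodic_xz (\<lambda>w. x_avg f (snd w))"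
    using L2_periodic[OF f] by (simp add: periodic_xz_def x_avg_def)
  ultimately show ?thesis by (simp add: L2_iff)
qed

lemma integral_cellm_iterated:
  assumes "integrable cellm (G :: pt \<Rightarrow> complex)"
  shows "(LINT w|cellm. G w) = (LINT r|(lborel \<Otimes>\<^sub>M circle). LINT x|circle. G (x, r))"
  using clc.integral_snd[of "\<lambda>x r. G (x, r)"] assms by (simp add: cellm_def)

text \<open>The cutoff does not involve \<open>x\<close>, so it commutes with averaging in
  \<open>x\<close>, and averaging projects onto the modes with k = 0.\<close>

lemma lhat_x_avg:
  assumes f: "L2 f" and R: "R > 0"
  shows "lhat (\<lambda>w. x_avg f (snd w)) R 0 q = of_bool (fst q = 0) * lhat f R 0 q"
proof -
  have fm: "f \<in> borel_measurable borel" using f by (rule L2_borel)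
  define \<psi> where "\<psi> r = e_line (fst r) (fst (snd q)) * e_circle (snd r) (snd (snd q)) * of_real (bump 0 (fst r / R))" for r
  have split: "lhat g R 0 q = (LINT r|(lborel \<Otimes>\<^sub>M circle). \<psi> r * (LINT x|circle. of_real (g (x, r)) * e_circle x (fst q)))" if "L2 g" for g
  proof -
    have "integrable cellm (\<lambda>w. loc R 0 g w * chr w q)"
      by (rule cell.integrable_transform[OF cell.L12_integrable[OF L12_loc[OF that R]]]) simp
    from integral_cellm_iterated[OF this]
    have "lhat g R 0 q = (LINT r|(lborel \<Otimes>\<^sub>M circle). LINT x|circle. loc R 0 g (x, r) * chr (x, r) q)"
      by (simp add: lhat_def transform_def)
    also have "\<dots> = (LINT r|(lborel \<Otimes>\<^sub>M circle). LINT x|circle. \<psi> r * (of_real (g (x, r)) * e_circle x (fst q)))"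
      by (intro Bochner_Integration.integral_cong refl) (simp add: loc_def cr_def chr_def \<psi>_def mult_ac)
    finally show ?thesis by simp
  qed
  have e0: "(LINT x|circle. e_circle x k) = of_bool (k = 0) * (2 * pi / sqrt (2 * pi))" for k
    unfolding e_circle_def using integral_cis_circle[of "- k"] by simp
  have "(LINT x|circle. complex_of_real (x_avg f (snd (x, r))) * e_circle x (fst q))
      = of_bool (fst q = 0) * (LINT x|circle. of_real (f (x, r)) * e_circle x (fst q))" for r
  proof (cases "fst q = 0")
    case True
    have "(LINT x|circle. complex_of_real (f (x, r)) * e_circle x 0) = of_real (LINT x|circle. f (x, r)) / sqrt (2 * pi)"
      by (simp add: e_circle_def)
    moreover have "(LINT x|circle. complex_of_real (x_avg f r) * e_circle x 0) = of_real (x_avg f r) * (2 * pi / sqrt (2 * pi))"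
      by (simp add: e0)
    ultimately show ?thesis using True by (simp add: x_avg_eq[OF fm])
  qed (simp add: e0)
  then show ?thesis unfolding split[OF L2_x_avg[OF f]] split[OF f]
    by (cases "fst q = 0") (simp_all, simp add: e0)
qed

lemma L2_transformI_lhat:
  assumes f: "L2 f" and F: "sqi freqm F"
    and lim: "(\<lambda>n. norm2 freqm (\<lambda>q. lhat f (real (Suc n)) 0 q - F q)) \<longlonglongrightarrow> 0"
  shows "cell.L2_transform (cr f) F"
  by (rule cell.L2_transformI[where h = "\<lambda>n. loc (real (Suc n)) 0 f", OF L2_sqi[OF f] F L12_loc[OF f] loc_tendsto[OF f]])
    (use lim in \<open>simp_all add: lhat_def del: of_nat_Suc\<close>)

lemma of_bool_fst_measurable [measurable]: "(\<lambda>q. of_bool (fst q = 0) :: complex) \<in> borel_measurable freqm"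
  by measurable

lemma x_avg_transform:
  assumes f: "L2 f" and F: "cell.L2_transform (cr f) F"
  shows "cell.L2_transform (cr (\<lambda>w. x_avg f (snd w))) (\<lambda>q. of_bool (fst q = 0) * F q)"
proof (rule L2_transformI_lhat[OF L2_x_avg[OF f]])
  have Fs: "sqi freqm F" using F by (rule cell.L2_transform_sqi)
  show "sqi freqm (\<lambda>q. of_bool (fst q = 0) * F q)"
    using Fs by (rule sqi_dominated[where C = 1]) (use Fs in auto)
  show "(\<lambda>n. norm2 freqm (\<lambda>q. lhat (\<lambda>w. x_avg f (snd w)) (real (Suc n)) 0 q - of_bool (fst q = 0) * F q)) \<longlonglongrightarrow> 0"
  proof (rule Lim_null_comparison[OF always_eventually[OF allI] lhat_tendsto[OF f F]])
    fix n
    have s: "sqi freqm (\<lambda>q. lhat f (real (Suc n)) 0 q - F q)" by (intro sqi_diff sqi_lhat f Fs) simp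
    have eq: "lhat (\<lambda>w. x_avg f (snd w)) (real (Suc n)) 0 q - of_bool (fst q = 0) * F q = of_bool (fst q = 0) * (lhat f (real (Suc n)) 0 q - F q)" for q
      by (simp add: lhat_x_avg[OF f] algebra_simps del: of_nat_Suc)
    have "norm2 freqm (\<lambda>q. of_bool (fst q = 0) * (lhat f (real (Suc n)) 0 q - F q)) \<le> 1 * norm2 freqm (\<lambda>q. lhat f (real (Suc n)) 0 q - F q)"
      using s by (rule norm2_dominated) (use sqi_measurable[OF s] in auto)
    then show "norm (norm2 freqm (\<lambda>q. lhat (\<lambda>w. x_avg f (snd w)) (real (Suc n)) 0 q - of_bool (fst q = 0) * F q)) \<le> norm2 freqm (\<lambda>q. lhat f (real (Suc n)) 0 q - F q)"
      unfolding eq by simp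
  qed
qed

lemma x_fluct_eq: "x_fluct f = (\<lambda>w. f w - x_avg f (snd w))"
  by (simp add: x_fluct_def fun_eq_iff)

lemma L2_x_fluct: "L2 f \<Longrightarrow> L2 (x_fluct f)"
  unfolding x_fluct_eq by (intro L2_diff L2_x_avg)

lemma x_fluct_transform:
  assumes f: "L2 f" and F: "cell.L2_transform (cr f) F"
  shows "cell.L2_transform (cr (x_fluct f)) (\<lambda>q. of_bool (fst q \<noteq> 0) * F q)"
proof -
  have "(\<lambda>q. F q - of_bool (fst q = 0) * F q) = (\<lambda>q. of_bool (fst q \<noteq> 0) * F q)" by auto
  then show ?thesis
    using cell.L2_transform_diff[OF F x_avg_transform[OF f F]] by (simp add: x_fluct_eq cr_diff)
qed

lemma shear_eq: "shear t f = (\<lambda>w. f ((\<lambda>(x, y, z). (x + t * y, y, z)) w))"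
  by (simp add: shear_def fun_eq_iff)

lemma period_invariant_shear: "period_invariant (\<lambda>(x, y, z). (x + t * y, y, z))"
proof -
  have "(\<lambda>r::real \<times> real. t * fst r) \<in> borel_measurable borel" by (intro borel_measurable_continuous_onI continuous_intros)
  from period_invariant_x[OF this] show ?thesis by simp
qed

lemma L2_shear:
  assumes f: "L2 f"
  shows "L2 (shear t f)"
proof -
  have fm: "cr f \<in> borel_measurable borel" using L2_borel[OF f] by measurable
  have "sqi cellm (cr (shear t f))"
    using period_invariant_norm2(1)[OF period_invariant_shear[of t] fm] L2_sqi[OF f] L2_periodic[OF f]
    by (simp add: shear_eq cr_def[abs_def] periodic_xz_eq pxz_def)
  moreover have "periodic_xz (shear t f)"
  proof -
    have "f (x + 2 * pi + t * y, y, z) = f (x + t * y, y, z)" for x y z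
      using L2_periodic[OF f] unfolding periodic_xz_def by (metis add.commute add.left_commute)
    then show ?thesis using L2_periodic[OF f] by (simp add: periodic_xz_def shear_def)
  qed
  ultimately show ?thesis by (simp add: L2_iff)
qed

text \<open>The shear leaves \<open>y\<close>, hence the cutoff, unchanged; undoing it in the
  character of frequency \<open>q\<close> produces the one of frequency
  \<open>qs t q\<close>.\<close>

lemma lhat_shear:
  assumes f: "L2 f" and R: "R > 0"
  shows "lhat (shear t f) R 0 q = lhat f R 0 (qs t q)"
proof -
  let ?T = "\<lambda>(x, y, z). (x + t * y, y, z)"
  define G where "G w = loc R 0 f w * chr w (qs t q)" for w
  have i: "integrable cellm G"
    unfolding G_def by (rule cell.integrable_transform[OF cell.L12_integrable[OF L12_loc[OF f R]]]) simp
  have p: "pxz G" using L2_periodic[OF f] chr_periodic[of "qs t q"] by (simp add: G_def pxz_def loc_def cr_def periodic_xz_def)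
  have eq: "loc R 0 (shear t f) w * chr w q = G (?T w)" for w
    by (cases w; cases q) (simp add: G_def loc_def cr_def shear_def chr_eq algebra_simps)
  show ?thesis unfolding lhat_def transform_def eq period_invariant_integral(2)[OF period_invariant_shear i p]
    by (simp only: G_def[abs_def])
qed

lemma shear_transform:
  assumes f: "L2 f" and F: "cell.L2_transform (cr f) F"
  shows "cell.L2_transform (cr (shear t f)) (\<lambda>q. F (qs t q))"
proof (rule L2_transformI_lhat[OF L2_shear[OF f]])
  have Fs: "sqi freqm F" using F by (rule cell.L2_transform_sqi)
  then show "sqi freqm (\<lambda>q. F (qs t q))" by (rule norm2_qs)
  have "norm2 freqm (\<lambda>q. lhat (shear t f) (real (Suc n)) 0 q - F (qs t q)) = norm2 freqm (\<lambda>q. lhat f (real (Suc n)) 0 q - F q)" for n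
  proof -
    have "sqi freqm (\<lambda>q. lhat f (real (Suc n)) 0 q - F q)" by (intro sqi_diff sqi_lhat f Fs) simp
    from norm2_qs(2)[OF this, of t] show ?thesis by (simp add: lhat_shear[OF f] del: of_nat_Suc)
  qed
  then show "(\<lambda>n. norm2 freqm (\<lambda>q. lhat (shear t f) (real (Suc n)) 0 q - F (qs t q))) \<longlonglongrightarrow> 0"
    using lhat_tendsto[OF f F] by simp
qed

section \<open>Gaussian convolution in (y, z) as a Fourier multiplier\<close>

definition gauss :: "real \<Rightarrow> (real \<times> real) measure" where
  "gauss s = density lborel (\<lambda>v. ennreal (1 / (4 * pi * s) * exp (- ((fst v)\<^sup>2 + (snd v)\<^sup>2) / (4 * s))))"

lemma sets_gauss [measurable_cong, simp]: "sets (gauss s) = sets borel"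
  and space_gauss [simp]: "space (gauss s) = UNIV"
  by (simp_all add: gauss_def)

lemma borel_measurable_gauss [simp]: "borel_measurable (gauss s) = borel_measurable borel"
  by (rule measurable_cong_sets) simp_all

lemma plane_coord_borel [measurable]:
  "(fst :: real \<times> real \<Rightarrow> real) \<in> borel_measurable borel" "(snd :: real \<times> real \<Rightarrow> real) \<in> borel_measurable borel"
  by (intro borel_measurable_continuous_onI continuous_intros)+

lemma gauss_density_measurable [measurable]:
  "(\<lambda>v::real \<times> real. exp (- ((fst v)\<^sup>2 + (snd v)\<^sup>2) / (4 * s))) \<in> borel_measurable borel"
  by measurable

text \<open>Standard deviation \<open>sqrt (2 * s)\<close> in \<open>gaussian_fourier\<close>: the
  heat kernel at time \<open>s\<close> has variance 2s in each variable.\<close>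

lemma gaussian_line:
  assumes s: "s > 0"
  shows "integrable lborel (\<lambda>y::real. exp (- y\<^sup>2 / (4 * s)))"
    and "(LINT y|lborel. of_real (exp (- y\<^sup>2 / (4 * s))) * cis (a * y)) = complex_of_real (sqrt (4 * pi * s) * exp (- (s * a\<^sup>2)))"
proof -
  have "sqrt (2 * s) > 0" "(sqrt (2 * s))\<^sup>2 = 2 * s" using s by simp_all
  note g = integrable_gaussian[OF this(1)] gaussian_fourier[OF this(1), of a]
  have "sqrt (2 * pi) * sqrt (2 * s) = sqrt (4 * pi * s)" by (simp add: real_sqrt_mult[symmetric])
  then show "integrable lborel (\<lambda>y::real. exp (- y\<^sup>2 / (4 * s)))"
    "(LINT y|lborel. of_real (exp (- y\<^sup>2 / (4 * s))) * cis (a * y)) = complex_of_real (sqrt (4 * pi * s) * exp (- (s * a\<^sup>2)))"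
    using g s by (simp_all add: power_mult_distrib)
qed

lemma gauss_density_split: "exp (- ((fst v)\<^sup>2 + (snd v)\<^sup>2) / (4 * s)) = exp (- (fst v)\<^sup>2 / (4 * s)) * exp (- (snd v)\<^sup>2 / (4 * s :: real))"
  by (simp add: exp_add[symmetric] add_divide_distrib diff_divide_distrib)

lemma integrable_gauss_density:
  assumes s: "s > 0"
  shows "integrable lborel (\<lambda>v::real \<times> real. exp (- ((fst v)\<^sup>2 + (snd v)\<^sup>2) / (4 * s)))"
  using lborel_pair.integrable_pair_mult[OF gaussian_line(1)[OF s] gaussian_line(1)[OF s]]
  by (simp only: gauss_density_split lborel_prod)

lemma finite_gauss:
  assumes s: "s > 0"
  shows "finite_measure (gauss s)"
proof (rule finite_measureI)
  have m: "(\<lambda>v::real \<times> real. ennreal (1 / (4 * pi * s) * exp (- ((fst v)\<^sup>2 + (snd v)\<^sup>2) / (4 * s)))) \<in> borel_measurable lborel"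
    by measurable
  have "emeasure (gauss s) (space (gauss s)) = (\<integral>\<^sup>+v. ennreal (1 / (4 * pi * s) * exp (- ((fst v)\<^sup>2 + (snd v)\<^sup>2) / (4 * s))) \<partial>lborel)"
    unfolding space_gauss unfolding gauss_def by (subst emeasure_density[OF m]) simp_all
  also have "\<dots> \<noteq> \<infinity>"
  proof -
    have "integrable lborel (\<lambda>v::real \<times> real. 1 / (4 * pi * s) * exp (- ((fst v)\<^sup>2 + (snd v)\<^sup>2) / (4 * s)))"
      by (intro integrable_mult_right integrable_gauss_density s)
    then show ?thesis using s by (subst nn_integral_eq_integral) auto
  qed
  finally show "emeasure (gauss s) (space (gauss s)) \<noteq> \<infinity>" .
qed

lemma gauss_fourier:
  assumes s: "s > 0"
  shows "(LINT v|gauss s. cis (a * fst v + b * snd v)) = complex_of_real (exp (- (s * (a\<^sup>2 + b\<^sup>2))))"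
proof -
  let ?P = "\<lambda>a y. complex_of_real (exp (- y\<^sup>2 / (4 * s))) * cis (a * y)"
  have i: "integrable lborel (?P a)" for a
  proof (rule Bochner_Integration.integrable_bound[OF gaussian_line(1)[OF s]])
    have [measurable]: "(\<lambda>y. cis (a * y)) \<in> borel_measurable lborel" by (simp, intro borel_measurable_continuous_onI continuous_intros)
    show "?P a \<in> borel_measurable lborel" by measurable
  qed (simp add: norm_mult)
  have cm: "(\<lambda>v::real \<times> real. cis (a * fst v + b * snd v)) \<in> borel_measurable borel"
    by (intro borel_measurable_continuous_onI continuous_intros)
  have "(LINT v|gauss s. cis (a * fst v + b * snd v)) =
      (LINT v|lborel. (1 / (4 * pi * s) * exp (- ((fst v)\<^sup>2 + (snd v)\<^sup>2) / (4 * s))) *\<^sub>R cis (a * fst v + b * snd v))"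
    unfolding gauss_def using s cm by (subst integral_density) auto
  also have "\<dots> = of_real (1 / (4 * pi * s)) * (LINT v|(lborel \<Otimes>\<^sub>M lborel). ?P a (fst v) * ?P b (snd v))"
    unfolding gauss_density_split integral_mult_right_zero[symmetric] lborel_prod
    by (intro Bochner_Integration.integral_cong refl) (simp add: scaleR_conv_of_real cis_mult[symmetric] mult_ac)
  also have "(LINT v|(lborel \<Otimes>\<^sub>M lborel). ?P a (fst v) * ?P b (snd v)) = (LINT x|lborel. LINT y|lborel. ?P a x * ?P b y)"
    using lborel_pair.integral_fst[of "\<lambda>x y. ?P a x * ?P b y"] lborel_pair.integrable_pair_mult[OF i[of a] i[of b]] by (simp add: split_beta')
  also have "\<dots> = complex_of_real (sqrt (4 * pi * s) * exp (- (s * a\<^sup>2))) * complex_of_real (sqrt (4 * pi * s) * exp (- (s * b\<^sup>2)))"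
    by (simp only: integral_mult_right_zero integral_mult_left_zero gaussian_line(2)[OF s])
  also have "\<dots> = of_real (4 * pi * s * exp (- (s * (a\<^sup>2 + b\<^sup>2))))"
  proof -
    have "sqrt c * x * (sqrt c * y) = (sqrt c * sqrt c) * (x * y)" for c x y :: real by (simp only: mult_ac)
    moreover have "exp (- (s * a\<^sup>2)) * exp (- (s * b\<^sup>2)) = exp (- (s * (a\<^sup>2 + b\<^sup>2)))" by (simp add: distrib_left exp_add[symmetric])
    ultimately show ?thesis unfolding of_real_mult[symmetric] of_real_eq_iff using s by (simp only: real_sqrt_mult_self) simp
  qed
  finally show ?thesis using s by simp
qed

text \<open>The convolution acts on functions of all three variables, so that the transform on the
  cell also serves the averages, which are lifted to functions constant in \<open>x\<close>.\<close>

definition gconv :: "real \<Rightarrow> (pt \<Rightarrow> real) \<Rightarrow> pt \<Rightarrow> real" where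
  "gconv s b w = (LINT v|gauss s. b (w + (0, v)))"

lemma heat_eq_gconv:
  assumes s: "s > 0" and b: "b \<in> borel_measurable borel"
  shows "heat s b r = gconv s (\<lambda>w. b (snd w)) (x, r)"
proof -
  obtain y z where r: "r = (y, z)" by (cases r)
  let ?k = "\<lambda>v. 1 / (4 * pi * s) * exp (- ((fst v)\<^sup>2 + (snd v)\<^sup>2) / (4 * s))"
  have k: "?k \<in> borel_measurable lborel" by measurable
  have kb: "(\<lambda>v. ?k (v - r) * b v) \<in> borel_measurable borel" using b by measurable
  have bt: "(\<lambda>v. b (snd ((x, r) + (0, v)))) \<in> borel_measurable lborel" by (rule measurable_compose[OF _ b]) (simp, measurable)
  have "gconv s (\<lambda>w. b (snd w)) (x, r) = (LINT v|lborel. ?k v *\<^sub>R b (r + v))"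
    unfolding gconv_def gauss_def using s by (subst integral_density[OF bt k]) auto
  also have "\<dots> = (LINT v|lborel. ?k ((r + v) - r) * b (r + v))" by simp
  also have "\<dots> = (LINT v|distr lborel borel ((+) r). ?k (v - r) * b v)"
    by (rule integral_distr[OF _ kb, symmetric]) simp
  also have "\<dots> = heat s b r"
    using s by (simp add: lborel_distr_plus heat_def r split_beta' power2_commute[of y] power2_commute[of z])
  finally show ?thesis ..
qed

lemma translate_eq: "w + (0, v) = (\<lambda>(x, y, z). (x, y + fst v, z + snd v)) (w :: pt)"
  by (cases w; cases v) simp

lemma period_invariant_translate: "period_invariant (\<lambda>w. w + (0, v))"
  unfolding translate_eq by (rule period_invariant_yz)

lemma pxz_translate: "pxz f \<Longrightarrow> pxz (\<lambda>w. f (w + (0, v)))"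
  unfolding pxz_def by (cases v) (simp add: add.assoc add.commute[of "2 * pi"], simp add: add.assoc[symmetric])

lemma L2_translate:
  assumes b: "L2 b"
  shows "L2 (\<lambda>w. b (w + (0, v)))" "norm2 cellm (cr (\<lambda>w. b (w + (0, v)))) = norm2 cellm (cr b)"
proof -
  have m: "cr b \<in> borel_measurable borel" using L2_borel[OF b] by measurable
  have p: "pxz b" using L2_periodic[OF b] by (simp add: periodic_xz_eq)
  note P = period_invariant_norm2[OF period_invariant_translate[of v] m]
  show "L2 (\<lambda>w. b (w + (0, v)))" "norm2 cellm (cr (\<lambda>w. b (w + (0, v)))) = norm2 cellm (cr b)"
    using P p pxz_translate[OF p, of v] L2_sqi[OF b] by (simp_all add: L2_iff periodic_xz_eq cr_def[abs_def] pxz_def)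
qed

lemma translate_pair_measurable:
  assumes b: "b \<in> borel_measurable (borel :: pt measure)"
  shows "(\<lambda>p. b (fst p + (0, snd p))) \<in> borel_measurable (cellm \<Otimes>\<^sub>M gauss s)"
proof -
  have "(\<lambda>p. fst p + (0, snd p)) \<in> measurable (cellm \<Otimes>\<^sub>M gauss s) (borel :: pt measure)"
    by (intro borel_measurable_add borel_measurable_Pair) measurable
  from measurable_compose[OF this b] show ?thesis .
qed

context
  fixes s :: real
  assumes s: "s > 0"
begin

interpretation G: finite_measure "gauss s" by (rule finite_gauss[OF s])
interpretation CG: pair_sigma_finite cellm "gauss s" ..

lemma gconv_nn:
  assumes b: "L2 b"
  shows "(\<integral>\<^sup>+p. ennreal ((b (fst p + (0, snd p)))\<^sup>2) \<partial>(cellm \<Otimes>\<^sub>M gauss s)) < \<infinity>"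
proof -
  have [measurable]: "(\<lambda>p. b (fst p + (0, snd p))) \<in> borel_measurable (cellm \<Otimes>\<^sub>M gauss s)"
    by (rule translate_pair_measurable[OF L2_borel[OF b]])
  have "(\<integral>\<^sup>+p. ennreal ((b (fst p + (0, snd p)))\<^sup>2) \<partial>(cellm \<Otimes>\<^sub>M gauss s)) = (\<integral>\<^sup>+v. \<integral>\<^sup>+w. ennreal ((b (w + (0, v)))\<^sup>2) \<partial>cellm \<partial>gauss s)"
    by (subst CG.nn_integral_snd[symmetric]) simp_all
  also have "\<dots> = (\<integral>\<^sup>+v. ennreal ((norm2 cellm (cr b))\<^sup>2) \<partial>gauss s)"
    using nn_norm2[OF L2_sqi[OF L2_translate(1)[OF b]]] by (simp add: L2_translate(2)[OF b] cr_def)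
  also have "\<dots> < \<infinity>" by (auto simp: G.emeasure_eq_measure ennreal_mult_less_top)
  finally show ?thesis .
qed

lemma measure_gauss: "measure (gauss s) UNIV = 1"
  using gauss_fourier[OF s, of 0 0] by (simp add: scaleR_conv_of_real)

lemma L2_gconv:
  assumes b: "L2 b"
  shows "L2 (gconv s b)"
proof -
  have [measurable]: "(\<lambda>p. b (fst p + (0, snd p))) \<in> borel_measurable (cellm \<Otimes>\<^sub>M gauss s)"
    by (rule translate_pair_measurable[OF L2_borel[OF b]])
  have bv: "(\<lambda>v. b (w + (0, v))) \<in> borel_measurable (gauss s)" for w
    unfolding borel_measurable_gauss by (rule measurable_compose[OF _ L2_borel[OF b]]) (intro borel_measurable_continuous_onI continuous_intros)
  have m: "gconv s b \<in> borel_measurable cellm"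
    unfolding gconv_def by (rule G.borel_measurable_lebesgue_integral) simp
  then have mc: "cr (gconv s b) \<in> borel_measurable cellm" by (simp add: cr_measurable)
  have "(\<integral>\<^sup>+w. ennreal ((cmod (cr (gconv s b) w))\<^sup>2) \<partial>cellm) \<le> (\<integral>\<^sup>+w. \<integral>\<^sup>+v. ennreal ((b (w + (0, v)))\<^sup>2) \<partial>gauss s \<partial>cellm)"
  proof (rule nn_integral_mono)
    fix w show "ennreal ((cmod (cr (gconv s b) w))\<^sup>2) \<le> (\<integral>\<^sup>+v. ennreal ((b (w + (0, v)))\<^sup>2) \<partial>gauss s)"
      using ennreal_integral_sq_le[OF finite_gauss[OF s] _ bv[of w]] by (simp add: measure_gauss cr_def gconv_def)
  qed
  also have "\<dots> = (\<integral>\<^sup>+p. ennreal ((b (fst p + (0, snd p)))\<^sup>2) \<partial>(cellm \<Otimes>\<^sub>M gauss s))"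
    by (subst G.nn_integral_fst[symmetric]) simp_all
  also have "\<dots> < \<infinity>" by (rule gconv_nn[OF b])
  finally have "sqi cellm (cr (gconv s b))" using mc by (intro sqi_nnI)
  moreover have "periodic_xz (gconv s b)"
    using pxz_translate[of b] L2_periodic[OF b] by (simp add: periodic_xz_eq pxz_def gconv_def)
  ultimately show ?thesis by (simp add: L2_iff)
qed

lemma transform_translate:
  assumes "test_fun \<phi>"
  shows "cell.L12 (cr (\<lambda>w. \<phi> (w + (0, - v))))"
    and "transform cellm chr (cr (\<lambda>w. \<phi> (w + (0, - v)))) q = cis (- (fc 2 q * fst v + fc 3 q * snd v)) * transform cellm chr (cr \<phi>) q"
proof -
  have p: "pxz \<phi>" using assms by (simp add: test_fun_def periodic_xz_eq)
  have c: "continuous_on UNIV (\<lambda>w. \<phi> (w + (0, - v)))"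
    by (rule continuous_on_compose2[OF test_fun_continuous[OF assms]]) (auto intro!: continuous_intros)
  obtain R where R: "\<And>x y z. R < \<bar>y\<bar> \<Longrightarrow> \<phi> (x, y, z) = 0" using assms unfolding test_fun_def by blast
  show L: "cell.L12 (cr (\<lambda>w. \<phi> (w + (0, - v))))"
  proof (rule L12_continuous[where R = "R + \<bar>fst v\<bar>"])
    show "continuous_on UNIV (cr (\<lambda>w. \<phi> (w + (0, - v))))" by (rule continuous_cr[OF c])
    show "pxz (cr (\<lambda>w. \<phi> (w + (0, - v))))" using pxz_translate[OF p, of "- v"] by simp
    show "cr (\<lambda>w. \<phi> (w + (0, - v))) (x, y, z) = 0" if "R + \<bar>fst v\<bar> < \<bar>y\<bar>" for x y z
      using R[of "y - fst v" x "z - snd v"] that by (cases v) (simp add: cr_def)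
  qed
  define f where "f w = cr (\<lambda>w. \<phi> (w + (0, - v))) w * chr w q" for w
  have i: "integrable cellm f" unfolding f_def by (rule cell.integrable_transform[OF cell.L12_integrable[OF L]]) simp
  have pf: "pxz f" using pxz_translate[OF p, of "- v"] chr_periodic[of q] by (simp add: f_def pxz_def cr_def)
  have eq: "f (w + (0, v)) = cis (- (fc 2 q * fst v + fc 3 q * snd v)) * (cr \<phi> w * chr w q)" for w
    by (cases w; cases q; cases v) (simp add: f_def cr_def chr_eq cis_mult algebra_simps)
  have "transform cellm chr (cr (\<lambda>w. \<phi> (w + (0, - v)))) q = (LINT w|cellm. f w)" by (simp add: transform_def f_def)
  also have "\<dots> = (LINT w|cellm. f (w + (0, v)))" using period_invariant_integral(2)[OF period_invariant_translate i pf] by simp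
  finally show "transform cellm chr (cr (\<lambda>w. \<phi> (w + (0, - v)))) q = cis (- (fc 2 q * fst v + fc 3 q * snd v)) * transform cellm chr (cr \<phi>) q"
    by (simp add: eq transform_def)
qed

text \<open>The translation is moved to the test function, whose transform is an absolutely
  convergent integral and acquires a phase. Parseval carries the phase over to
  \<open>B\<close>.\<close>

lemma ip_translate:
  assumes b: "L2 b" and B: "cell.L2_transform (cr b) B" and \<phi>: "test_fun \<phi>"
  shows "complex_of_real (LINT w|cellm. b (w + (0, v)) * \<phi> w) = (LINT q|freqm. cis (fc 2 q * fst v + fc 3 q * snd v) * (B q * cnj (transform cellm chr (cr \<phi>) q)))"
proof -
  define f where "f w = cr b w * cr (\<lambda>w. \<phi> (w + (0, - v))) w" for w
  have L: "cell.L12 (cr (\<lambda>w. \<phi> (w + (0, - v))))" by (rule transform_translate(1)[OF \<phi>])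
  have i: "integrable cellm f" unfolding f_def by (rule sqi_integrable_mult[OF L2_sqi[OF b] cell.L12_sqi[OF L]])
  have p: "pxz b" "pxz \<phi>" using L2_periodic[OF b] \<phi> by (simp_all add: test_fun_def periodic_xz_eq)
  have pf: "pxz f" using p(1) pxz_translate[OF p(2), of "- v"] by (simp add: f_def pxz_def cr_def)
  have "complex_of_real (LINT w|cellm. b (w + (0, v)) * \<phi> w) = (LINT w|cellm. f (w + (0, v)))"
    unfolding integral_complex_of_real[symmetric] by (simp add: f_def cr_def add.assoc zero_prod_def[symmetric])
  also have "\<dots> = (LINT w|cellm. f w)" by (rule period_invariant_integral(2)[OF period_invariant_translate i pf])
  also have "\<dots> = (LINT w|cellm. cr b w * cnj (cr (\<lambda>w. \<phi> (w + (0, - v))) w))" by (simp add: f_def cr_def)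
  also have "\<dots> = (LINT q|freqm. B q * cnj (transform cellm chr (cr (\<lambda>w. \<phi> (w + (0, - v)))) q))"
    by (rule cell.L2_transform_parseval[OF B cell.L2_transform_L12[OF L]])
  finally show ?thesis by (simp add: transform_translate(2)[OF \<phi>] cis_cnj ac_simps)
qed

text \<open>Averaging the phase of a translation over the Gaussian measure gives the heat
  multiplier. Both interchanges of integrals are absolutely convergent: in space by square
  integrability on the product, in frequency because the phase is bounded and \<open>gauss s\<close>
  is finite.\<close>

lemma ip_gconv:
  assumes b: "L2 b" and B: "cell.L2_transform (cr b) B" and \<phi>: "test_fun \<phi>"
  shows "complex_of_real (ip (gconv s b) \<phi>) =
    (LINT q|freqm. of_real (exp (- (s * ((fc 2 q)\<^sup>2 + (fc 3 q)\<^sup>2)))) * (B q * cnj (transform cellm chr (cr \<phi>) q)))"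
proof -
  interpret FG: pair_sigma_finite freqm "gauss s"
    by (rule pair_sigma_finite.intro[OF cell.N.sigma_finite_measure_axioms G.sigma_finite_measure_axioms])
  have bm [measurable]: "(\<lambda>p. b (fst p + (0, snd p))) \<in> borel_measurable (cellm \<Otimes>\<^sub>M gauss s)"
    by (rule translate_pair_measurable[OF L2_borel[OF b]])
  have \<phi>m [measurable]: "\<phi> \<in> borel_measurable cellm" using test_fun_borel[OF \<phi>] by simp
  define \<Phi> where "\<Phi> = transform cellm chr (cr \<phi>)"
  have i1: "integrable (cellm \<Otimes>\<^sub>M gauss s) (\<lambda>(w, v). b (w + (0, v)) * \<phi> w)"
  proof (rule Bochner_Integration.integrable_bound)
    have "integrable (cellm \<Otimes>\<^sub>M gauss s) (\<lambda>p. (b (fst p + (0, snd p)))\<^sup>2)"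
      using gconv_nn[OF b] bm by (intro integrableI_nonneg) (simp_all add: split_beta')
    moreover have "integrable (cellm \<Otimes>\<^sub>M gauss s) (\<lambda>p. (\<phi> (fst p))\<^sup>2 * 1)"
      using sqi_integrable[OF L2_sqi[OF L2_test[OF \<phi>]]] G.integrable_const[of "1::real"]
      by (intro CG.integrable_pair_mult) (simp_all add: cr_def)
    ultimately show "integrable (cellm \<Otimes>\<^sub>M gauss s) (\<lambda>p. (b (fst p + (0, snd p)))\<^sup>2 + (\<phi> (fst p))\<^sup>2 * 1)" by (rule Bochner_Integration.integrable_add)
    show "(\<lambda>(w, v). b (w + (0, v)) * \<phi> w) \<in> borel_measurable (cellm \<Otimes>\<^sub>M gauss s)" by measurable
    have "\<bar>c * d\<bar> \<le> \<bar>c\<^sup>2 + d\<^sup>2\<bar>" for c d :: real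
    proof -
      have "2 * \<bar>c * d\<bar> \<le> c\<^sup>2 + d\<^sup>2" using sum_squares_bound[of "\<bar>c\<bar>" "\<bar>d\<bar>"] by (simp add: abs_mult)
      then show ?thesis using abs_ge_zero[of "c * d"] by linarith
    qed
    then show "AE p in cellm \<Otimes>\<^sub>M gauss s. norm (case p of (w, v) \<Rightarrow> b (w + (0, v)) * \<phi> w) \<le> norm ((b (fst p + (0, snd p)))\<^sup>2 + (\<phi> (fst p))\<^sup>2 * 1)"
      by (simp add: split_beta')
  qed
  have BP: "integrable freqm (\<lambda>q. B q * cnj (\<Phi> q))"
    unfolding \<Phi>_def by (intro sqi_integrable_mult sqi_cnj cell.L2_transform_sqi(2)[OF B] cell.sqi_transform L12_test \<phi>)
  have [measurable]: "B \<in> borel_measurable freqm" "\<Phi> \<in> borel_measurable freqm"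
    unfolding \<Phi>_def using cell.L2_transform_sqi(2)[OF B] cell.sqi_transform[OF L12_test[OF \<phi>]] by (simp_all add: sqi_measurable)
  have cm: "(\<lambda>p. cis (fc 2 (fst p) * fst (snd p) + fc 3 (fst p) * snd (snd p))) \<in> borel_measurable (freqm \<Otimes>\<^sub>M gauss s)"
  proof -
    have c: "cis \<in> borel_measurable borel" by (intro borel_measurable_continuous_onI continuous_intros)
    have "(\<lambda>v::real \<times> real. fst v) \<in> borel_measurable borel" "(\<lambda>v::real \<times> real. snd v) \<in> borel_measurable borel"
      by (intro borel_measurable_continuous_onI continuous_intros)+
    then have [measurable]: "(\<lambda>v. fst v) \<in> borel_measurable (gauss s)" "(\<lambda>v. snd v) \<in> borel_measurable (gauss s)" by simp_all
    show ?thesis by (rule measurable_compose[OF _ c]) measurable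
  qed
  have i2: "integrable (freqm \<Otimes>\<^sub>M gauss s) (\<lambda>(q, v). cis (fc 2 q * fst v + fc 3 q * snd v) * (B q * cnj (\<Phi> q)))"
  proof (rule Bochner_Integration.integrable_bound)
    show "integrable (freqm \<Otimes>\<^sub>M gauss s) (\<lambda>p. (B (fst p) * cnj (\<Phi> (fst p))) * 1)"
      using BP G.integrable_const[of "1::complex"] by (rule FG.integrable_pair_mult)
    show "(\<lambda>(q, v). cis (fc 2 q * fst v + fc 3 q * snd v) * (B q * cnj (\<Phi> q))) \<in> borel_measurable (freqm \<Otimes>\<^sub>M gauss s)"
      unfolding split_beta' by (intro borel_measurable_times cm) measurable
  qed (simp add: split_beta' norm_mult)
  have "ip (gconv s b) \<phi> = (LINT w|cellm. gconv s b w * \<phi> w)"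
    by (rule ip_eq[OF L2_borel[OF L2_gconv[OF b]] test_fun_borel[OF \<phi>]])
  also have "\<dots> = (LINT w|cellm. LINT v|gauss s. b (w + (0, v)) * \<phi> w)" by (simp add: gconv_def)
  also have "\<dots> = (LINT v|gauss s. LINT w|cellm. b (w + (0, v)) * \<phi> w)" by (rule CG.Fubini_integral[OF i1, symmetric])
  also have "complex_of_real \<dots> = (LINT v|gauss s. complex_of_real (LINT w|cellm. b (w + (0, v)) * \<phi> w))"
    by (rule integral_complex_of_real[symmetric])
  also have "\<dots> = (LINT v|gauss s. LINT q|freqm. cis (fc 2 q * fst v + fc 3 q * snd v) * (B q * cnj (\<Phi> q)))"
    by (simp only: ip_translate[OF b B \<phi>] \<Phi>_def)
  also have "\<dots> = (LINT q|freqm. LINT v|gauss s. cis (fc 2 q * fst v + fc 3 q * snd v) * (B q * cnj (\<Phi> q)))" by (rule FG.Fubini_integral[OF i2])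
  also have "\<dots> = (LINT q|freqm. of_real (exp (- (s * ((fc 2 q)\<^sup>2 + (fc 3 q)\<^sup>2)))) * (B q * cnj (\<Phi> q)))"
    by (simp only: integral_mult_left_zero gauss_fourier[OF s])
  finally show ?thesis by (simp add: \<Phi>_def)
qed

end

lemma gconv_from_transform:
  assumes s: "s > 0" and a: "L2 a" and b: "L2 b" and A: "cell.L2_transform (cr a) A" and B: "cell.L2_transform (cr b) B"
    and AB: "AE q in freqm. A q = of_real (exp (- (s * ((fc 2 q)\<^sup>2 + (fc 3 q)\<^sup>2)))) * B q"
  shows "AE w in cellm. a w = gconv s b w"
proof (rule weak_unique[OF a L2_gconv[OF s b]])
  fix \<phi> assume \<phi>: "test_fun \<phi>"
  let ?\<Phi> = "transform cellm chr (cr \<phi>)"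
  have Am: "A \<in> borel_measurable freqm" "B \<in> borel_measurable freqm"
    using cell.L2_transform_sqi(2)[OF A] cell.L2_transform_sqi(2)[OF B] by (simp_all add: sqi_measurable)
  have \<Phi>m: "?\<Phi> \<in> borel_measurable freqm" using cell.sqi_transform[OF L12_test[OF \<phi>]] by (rule sqi_measurable)
  have "complex_of_real (ip a \<phi>) = (LINT w|cellm. cr a w * cnj (cr \<phi> w))"
    unfolding ip_complex[OF L2_borel[OF a] test_fun_borel[OF \<phi>]] by (simp add: cr_def)
  also have "\<dots> = (LINT q|freqm. A q * cnj (?\<Phi> q))"
    by (rule cell.L2_transform_parseval[OF A cell.L2_transform_L12[OF L12_test[OF \<phi>]]])
  also have "\<dots> = (LINT q|freqm. of_real (exp (- (s * ((fc 2 q)\<^sup>2 + (fc 3 q)\<^sup>2)))) * (B q * cnj (?\<Phi> q)))"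
    using AB Am \<Phi>m by (intro integral_cong_AE) (auto elim!: eventually_mono)
  also have "\<dots> = of_real (ip (gconv s b) \<phi>)" by (rule ip_gconv[OF s b B \<phi>, symmetric])
  finally show "ip a \<phi> = ip (gconv s b) \<phi>" by simp
qed

text \<open>Countably many translates of the exceptional set in one period cover the exceptional set
  on the line.\<close>

lemma AE_periodic_line:
  assumes P: "Measurable.pred borel P" and per: "\<And>z. P (z + 2 * pi) = P z" and ae: "AE z in circle. P z"
  shows "AE z in lborel. P (z::real)"
proof -
  have "AE z in lborel. z \<in> {0..2 * pi} \<longrightarrow> P z" using ae unfolding circle_def by (subst (asm) AE_density) auto
  then have "AE z in lborel. 2 * pi * of_int n + 1 * z \<in> {0..2 * pi} \<longrightarrow> P (2 * pi * of_int n + 1 * z)" for n :: int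
    by (intro AE_borel_affine) (use P in measurable)
  then have "AE z in lborel. \<forall>n::int. 2 * pi * of_int n + z \<in> {0..2 * pi} \<longrightarrow> P (2 * pi * of_int n + z)"
    by (subst AE_all_countable) simp
  then show ?thesis
  proof eventually_elim
    case (elim z)
    define n where "n = - \<lfloor>z / (2 * pi)\<rfloor>"
    have "2 * pi * of_int n + z \<in> {0..2 * pi}"
      using floor_divide_lower[of "2 * pi" z] floor_divide_upper[of "2 * pi" z] by (simp add: n_def algebra_simps)
    then show ?case using elim periodic_int[of P z n] per by (simp add: add.commute)
  qed
qed

text \<open>Returns from null sets of the cell measure to Lebesgue null sets of the plane, where the
  formulas for the averages are claimed. The variable \<open>x\<close> is discarded because the
  circle has positive measure.\<close>

lemma AE_periodic_plane:
  assumes P: "Measurable.pred borel P" and per: "\<And>y z. P (y, z + 2 * pi) = P (y, z)"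
    and ae: "AE w in cellm. P (snd w)"
  shows "AE r in lborel. P (r :: real \<times> real)"
proof -
  interpret lc1: pair_sigma_finite "lborel :: real measure" circle ..
  have "AE x in circle. AE r in lborel \<Otimes>\<^sub>M circle. P r"
    using clc.AE_pair[OF ae[unfolded cellm_def]] by simp
  then have "AE r in lborel \<Otimes>\<^sub>M circle. P r"
    using emeasure_eq_0_AE[of "\<lambda>_. True" circle] emeasure_circle_UNIV by (cases "AE r in lborel \<Otimes>\<^sub>M circle. P r") auto
  from lc1.AE_pair[OF this] have "AE y in lborel. AE z in circle. P (y, z)" .
  then have "AE y in lborel. AE z in lborel. P (y, z)"
  proof eventually_elim
    case (elim y)
    have "Measurable.pred borel (\<lambda>z. P (y, z))"
      by (rule measurable_compose[OF _ P]) (intro borel_measurable_continuous_onI continuous_intros)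
    then show ?case by (rule AE_periodic_line[OF _ per elim])
  qed
  moreover have "{r \<in> space (lborel \<Otimes>\<^sub>M lborel). P r} \<in> sets (lborel \<Otimes>\<^sub>M lborel)"
    unfolding lborel_prod using P by (simp add: pred_def)
  ultimately have "AE r in lborel \<Otimes>\<^sub>M lborel. P r" by (intro lborel_pair.AE_pair_measure)
  then show ?thesis by (simp only: lborel_prod)
qed

theorem heat_from_transform:
  fixes a b :: "real \<times> real \<Rightarrow> real"
  assumes s: "s \<ge> 0" and m: "a \<in> borel_measurable borel" "b \<in> borel_measurable borel"
    and a: "L2 (\<lambda>w. a (snd w))" and b: "L2 (\<lambda>w. b (snd w))"
    and A: "cell.L2_transform (cr (\<lambda>w. a (snd w))) A" and B: "cell.L2_transform (cr (\<lambda>w. b (snd w))) B"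
    and AB: "AE q in freqm. A q = of_real (exp (- (s * ((fc 2 q)\<^sup>2 + (fc 3 q)\<^sup>2)))) * B q"
  shows "AE r in lborel. a r = heat s b r"
proof -
  \<comment> \<open>\<open>heat\<close> is the identity at s = 0 by definition and a Gaussian
    integral otherwise; the Gaussian density degenerates at s = 0, which occurs for t = 0.\<close>
  define h where "h = (if s = 0 then \<lambda>w. b (snd w) else gconv s (\<lambda>w. b (snd w)))"
  have h: "heat s b r = h (0, r)" "h w = h (0, snd w)" for r w
    using heat_eq_gconv[OF _ m(2), of s r] heat_eq_gconv[OF _ m(2), of s "snd w"] s
    by (auto simp: h_def heat_def gconv_def split_beta)
  have hL: "L2 h" using b L2_gconv[OF _ b] s by (cases "s = 0") (auto simp: h_def)
  have "AE w in cellm. a (snd w) = h w"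
  proof (cases "s = 0")
    case True
    have "AE w in cellm. cr (\<lambda>w. a (snd w)) w = cr (\<lambda>w. b (snd w)) w"
      by (rule cell.L2_transform_inj[OF A B]) (use AB True in simp)
    then show ?thesis using True by (simp add: cr_def h_def)
  next
    case False
    then show ?thesis using gconv_from_transform[OF _ a b A B AB] s by (simp add: h_def)
  qed
  moreover have hm: "(\<lambda>r. h (0, r)) \<in> borel_measurable borel"
    by (rule measurable_compose[OF _ L2_borel[OF hL]]) (intro borel_measurable_continuous_onI continuous_intros)
  ultimately show ?thesis unfolding h(1)
    by (intro AE_periodic_plane) (use m L2_periodic[OF a] L2_periodic[OF hL] h(2) in \<open>auto simp: periodic_xz_def\<close>)
qed

section \<open>Estimates\<close>

lemma integrable_inverse_square_line: "integrable lborel (\<lambda>x::real. 1 / (1 + x\<^sup>2))"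
  using integrable_inverse_1_plus_square by (simp add: set_integrable_def einterval_eq inverse_eq_divide)

lemma integrable_inverse_square_int: "integrable (count_space UNIV) (\<lambda>k::int. 1 / (1 + (real_of_int k)\<^sup>2))"
proof -
  let ?f = "\<lambda>k::int. 1 / (1 + (real_of_int k)\<^sup>2)"
  have "summable (\<lambda>n. norm (1 / (1 + (real n)\<^sup>2)))"
  proof (rule summable_comparison_test'[where N = 1, OF inverse_power_summable[of 2]])
    show "norm (norm (1 / (1 + (real n)\<^sup>2))) \<le> inverse ((real n)\<^sup>2)" if "1 \<le> n" for n
      using that by (simp add: inverse_eq_divide) (intro divide_left_mono mult_pos_pos; simp add: add_pos_nonneg)
  qed simp
  then have n: "Infinite_Set_Sum.abs_summable_on (\<lambda>n::nat. 1 / (1 + (real n)\<^sup>2)) UNIV" by (simp only: abs_summable_on_nat_iff')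
  have "Infinite_Set_Sum.abs_summable_on ?f (range int)" "Infinite_Set_Sum.abs_summable_on ?f (range (\<lambda>n. - int n))"
    by (intro abs_summable_on_reindex, use n in simp)+
  then have "Infinite_Set_Sum.abs_summable_on ?f (range int \<union> range (\<lambda>n. - int n))" by (rule abs_summable_on_union)
  moreover have "range int \<union> range (\<lambda>n. - int n) = UNIV"
  proof (intro equalityI subsetI)
    fix k :: int show "k \<in> range int \<union> range (\<lambda>n. - int n)" by (cases k rule: int_cases2) auto
  qed simp
  ultimately show ?thesis by (simp add: Infinite_Set_Sum.abs_summable_on_def)
qed

lemma brk_sq: "(brk q)\<^sup>2 = 1 + sqf q"
  by (simp add: brk_def sqf_def)

lemma sqf_nonneg: "0 \<le> sqf q"
  by (simp add: sqf_def)

text \<open>The square of \<open>brk\<close> dominates each of 1 + k^2, 1 + \<eta>^2 and 1 + l^2, so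
  its sixth power dominates their product. The exponent 8 is twice the 4 of
  \<open>integrable_brk_weight\<close>.\<close>

lemma integrable_brk: "integrable freqm (\<lambda>q. 1 / brk q ^ 8)"
proof (rule Bochner_Integration.integrable_bound)
  interpret a: pair_sigma_finite "lborel :: real measure" "count_space (UNIV :: int set)" ..
  interpret b: pair_sigma_finite "count_space (UNIV :: int set)" "(lborel :: real measure) \<Otimes>\<^sub>M count_space (UNIV :: int set)" ..
  show "integrable freqm (\<lambda>q. 1 / (1 + (real_of_int (fst q))\<^sup>2) * (1 / (1 + (fst (snd q))\<^sup>2) * (1 / (1 + (real_of_int (snd (snd q)))\<^sup>2))))"
    unfolding freqm_def
    by (intro b.integrable_pair_mult a.integrable_pair_mult integrable_inverse_square_int integrable_inverse_square_line)
  show "AE q in freqm. norm (1 / brk q ^ 8) \<le> norm (1 / (1 + (real_of_int (fst q))\<^sup>2) * (1 / (1 + (fst (snd q))\<^sup>2) * (1 / (1 + (real_of_int (snd (snd q)))\<^sup>2))))"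
  proof (rule AE_I2)
    fix q :: freq
    obtain k \<eta> l where q: "q = (k, \<eta>, l)" by (cases q)
    let ?A = "1 + (real_of_int k)\<^sup>2" and ?B = "1 + \<eta>\<^sup>2" and ?C = "1 + (real_of_int l)\<^sup>2"
    have b: "(brk q)\<^sup>2 = 1 + (real_of_int k)\<^sup>2 + \<eta>\<^sup>2 + (real_of_int l)\<^sup>2" by (simp add: brk_def q)
    have "?A * (?B * ?C) \<le> (brk q)\<^sup>2 * ((brk q)\<^sup>2 * (brk q)\<^sup>2)"
      unfolding b by (intro mult_mono) auto
    also have "\<dots> = brk q ^ 6" by (simp add: power2_eq_square eval_nat_numeral)
    also have "\<dots> \<le> brk q ^ 8" by (intro power_increasing brk_ge_1) simp
    finally have "?A * (?B * ?C) \<le> brk q ^ 8" .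
    moreover have "0 < ?A * (?B * ?C)" by (intro mult_pos_pos) (auto intro: add_pos_nonneg)
    ultimately have "1 / brk q ^ 8 \<le> 1 / (?A * (?B * ?C))" by (intro frac_le) auto
    then show "norm (1 / brk q ^ 8) \<le> norm (1 / (1 + (real_of_int (fst q))\<^sup>2) * (1 / (1 + (fst (snd q))\<^sup>2) * (1 / (1 + (real_of_int (snd (snd q)))\<^sup>2))))"
      using brk_ge_1[of q] by (simp add: q abs_mult)
  qed
qed measurable

text \<open>Cauchy-Schwarz after writing brk^3 = brk^-4 brk^7: this spends exactly the four orders
  by which H^7 exceeds H^3.\<close>

lemma integrable_brk_weight:
  assumes G: "sqi freqm (\<lambda>q. of_real (brk q ^ 7) * G q)"
  shows "integrable freqm (\<lambda>q. brk q ^ 3 * cmod (G q))"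
proof -
  have pos: "brk q > 0" for q using brk_ge_1[of q] by linarith
  have "sqi freqm (\<lambda>q. of_real (1 / brk q ^ 4))"
  proof -
    have "(cmod (of_real (1 / brk q ^ 4)))\<^sup>2 = 1 / brk q ^ 8" for q
      using pos[of q] by (simp add: norm_divide norm_power power_divide power_mult[symmetric])
    then show ?thesis using integrable_brk by (simp add: sqi_def)
  qed
  from integrable_norm[OF sqi_integrable_mult[OF this G]]
  have "integrable freqm (\<lambda>q. cmod (of_real (1 / brk q ^ 4) * (of_real (brk q ^ 7) * G q)))" .
  moreover have "cmod (of_real (1 / brk q ^ 4) * (of_real (brk q ^ 7) * G q)) = brk q ^ 3 * cmod (G q)" for q
  proof -
    have p: "brk q ^ 7 / brk q ^ 4 = brk q ^ 3" using power_diff[of "brk q" 4 7] pos[of q] by simp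
    have "cmod (of_real (1 / brk q ^ 4) * (of_real (brk q ^ 7) * G q)) = brk q ^ 7 / brk q ^ 4 * cmod (G q)"
      using pos[of q] by (simp add: norm_mult norm_divide norm_power)
    then show ?thesis by (simp only: p)
  qed
  ultimately show ?thesis by simp
qed

lemma fst_qs [simp]: "fst (qs t q) = fst q"
  by (simp add: qs_def)

lemma fc1_ge_1:
  assumes "fst q \<noteq> 0"
  shows "1 \<le> (fc 1 q)\<^sup>2"
proof -
  have "1 \<le> (fst q)\<^sup>2" using assms by (simp add: int_one_le_iff_zero_less)
  then have "real_of_int 1 \<le> real_of_int ((fst q)\<^sup>2)" by (simp only: of_int_le_iff)
  then show ?thesis by (simp add: fc_def)
qed

lemma sqf_ge_1: "fst q \<noteq> 0 \<Longrightarrow> 1 \<le> sqf q"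
  using fc1_ge_1[of q] by (simp add: sqf_def add_increasing2)

text \<open>No frequency weight is lost, but the factor grows in \<open>t\<close>; it serves where
  only integrability at a fixed time matters.\<close>

lemma sqf_crude: "sqf q \<le> 2 * (1 + t\<^sup>2) * sqf (qs t q)"
proof -
  \<comment> \<open>The difference of the two sides is (e - 2kt)^2.\<close>
  have "e\<^sup>2 \<le> 2 * (e - k * t)\<^sup>2 + 2 * (k\<^sup>2 * t\<^sup>2)" for e k :: real
    using zero_le_power2[of "e - 2 * (k * t)"] by (simp add: power2_eq_square algebra_simps)
  moreover have "a + E + c \<le> 2 * (1 + T) * (a + d + c)" if "E \<le> 2 * d + 2 * (a * T)" "0 \<le> a" "0 \<le> c" "0 \<le> d" "0 \<le> T" for a c d E T :: real
  proof -
    have "2 * (1 + T) * (a + d + c) = 2 * a + 2 * d + 2 * c + 2 * (a * T) + 2 * (T * d) + 2 * (T * c)" by (simp add: algebra_simps)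
    then show ?thesis using that mult_nonneg_nonneg[of T d] mult_nonneg_nonneg[of T c] by linarith
  qed
  ultimately show ?thesis unfolding sqf_qs sqf_def[of q] by simp
qed

text \<open>Inviscid damping: for \<open>k \<noteq> 0\<close>, \<open>|kt| \<le> |\<eta>| + |\<eta> - kt|\<close> trades powers of \<open>\<langle>t\<rangle>\<close> for regularity.\<close>

lemma sqf_ratio:
  assumes "fst q \<noteq> 0"
  shows "(1 + t\<^sup>2) * sqf q \<le> 3 * brk q ^ 4 * sqf (qs t q)"
proof -
  define X Y where "X = sqf q" and "Y = sqf (qs t q)"
  have XY: "1 \<le> X" "1 \<le> Y" using sqf_ge_1[of q] sqf_ge_1[of "qs t q"] assms by (simp_all add: X_def Y_def)
  have "t\<^sup>2 \<le> (fc 1 q)\<^sup>2 * t\<^sup>2" using mult_right_mono[OF fc1_ge_1[OF assms], of "t\<^sup>2"] by simp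
  \<comment> \<open>The difference of the two sides is (2 \<eta> - kt)^2.\<close>
  also have "\<dots> \<le> 2 * (fc 2 q)\<^sup>2 + 2 * (fc 2 q - fc 1 q * t)\<^sup>2"
    using zero_le_power2[of "2 * fc 2 q - fc 1 q * t"] by (simp add: power2_eq_square algebra_simps)
  also have "\<dots> \<le> 2 * X + 2 * Y" unfolding X_def Y_def sqf_qs unfolding sqf_def by simp
  finally have "1 + t\<^sup>2 \<le> 1 + 2 * X + 2 * Y" by simp
  \<comment> \<open>\<open>X\<close> and \<open>Y\<close> are at least 1 because \<open>k\<close> is
    a nonzero integer, so the sum 1 + 2X + 2Y is absorbed into a product.\<close>
  moreover have "0 \<le> (X - 1) * (Y - 1)" "0 \<le> X * Y" using XY by simp_all
  ultimately have "1 + t\<^sup>2 \<le> 3 * (1 + X) * Y" using XY by (simp add: algebra_simps)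
  then have "(1 + t\<^sup>2) * X \<le> 3 * (1 + X) * Y * X" using XY by (intro mult_right_mono) auto
  also have "\<dots> \<le> 3 * (1 + X) * Y * (1 + X)" using XY by (intro mult_left_mono) auto
  also have "\<dots> = 3 * brk q ^ 4 * Y"
  proof -
    have "brk q ^ 4 = (1 + X)\<^sup>2" by (simp add: brk_sq[symmetric] power_mult[symmetric] X_def)
    then show ?thesis by (simp add: power2_eq_square)
  qed
  finally show ?thesis by (simp add: X_def Y_def)
qed

text \<open>Enhanced dissipation with \<open>c = 1/12\<close>: this is the minimum over \<open>\<eta>\<close> of the integrated dissipation.\<close>

lemma Aint_ge:
  assumes "fst q \<noteq> 0" "0 \<le> t"
  shows "t ^ 3 / 12 \<le> Aint t q"
proof -
  \<comment> \<open>Completing the square in \<eta>: the minimum is at \<eta> = kt/2, half way along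
    the path, and leaves k^2 t^3 (1/3 - 1/4) = k^2 t^3/12.\<close>
  have "Aint t q = ((fc 1 q)\<^sup>2 + (fc 3 q)\<^sup>2) * t + t * (fc 2 q - fc 1 q * t / 2)\<^sup>2 + (fc 1 q)\<^sup>2 * (t ^ 3 / 12)"
    by (simp add: Aint_def power2_eq_square power3_eq_cube field_simps)
  moreover have "1 * (t ^ 3 / 12) \<le> (fc 1 q)\<^sup>2 * (t ^ 3 / 12)"
    using assms by (intro mult_right_mono fc1_ge_1) auto
  moreover have "0 \<le> ((fc 1 q)\<^sup>2 + (fc 3 q)\<^sup>2) * t" "0 \<le> t * (fc 2 q - fc 1 q * t / 2)\<^sup>2" using assms by simp_all
  ultimately show ?thesis by linarith
qed

lemma abs_fc_mult_le: "\<bar>fc 1 q * fc i q\<bar> \<le> sqf q"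
proof -
  have "(fc 1 q)\<^sup>2 \<le> sqf q" "(fc i q)\<^sup>2 \<le> sqf q" by (auto simp: sqf_def fc_def)
  then show ?thesis using sum_squares_bound[of "\<bar>fc 1 q\<bar>" "\<bar>fc i q\<bar>"] by (simp add: abs_mult)
qed

text \<open>The initial condition holds only almost everywhere, so the transform of the data has to
  be carried over to the solution at time 0.\<close>

lemma cell_transform_cong:
  assumes F: "cell.L2_transform f F" and g: "sqi cellm g" and eq: "AE w in cellm. f w = g w"
  shows "cell.L2_transform g F"
proof -
  have "norm2 cellm (\<lambda>x. h x - f x) = norm2 cellm (\<lambda>x. h x - g x)" if "cell.L12 h" for h
    using sqi_measurable[OF cell.L12_sqi[OF that]] sqi_measurable[OF g] sqi_measurable[OF cell.L2_transform_sqi(1)[OF F]] eq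
    by (intro norm2_cong_AE) auto
  then show ?thesis using F g unfolding cell.L2_transform_def by simp
qed

context lin_NS
begin

text \<open>1 from the forcing and 2 from the pressure, the latter because |k \<xi>_i| <= |\<xi>|^2.
  At \<xi> = 0 the quotient is 0 by the convention for division.\<close>

lemma acoef_bound: "\<bar>acoef i q\<bar> \<le> 3"
proof -
  define r where "r = fc 1 q * fc i q / sqf q"
  have "\<bar>r\<bar> \<le> 1" unfolding r_def
    using abs_fc_mult_le[of q i] sqf_nonneg[of q] by (cases "sqf q = 0") (simp_all add: abs_divide divide_le_eq_1 less_le)
  moreover have "acoef i q = (if i = 1 then - 1 else 0) + 2 * r" by (simp add: acoef_def r_def)
  ultimately show ?thesis by (simp add: abs_le_iff)
qed

text \<open>By \<open>sqf_ratio\<close> the integrand, multiplied by \<open>sqf q\<close>, is at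
  most 9 brk^4/(1 + s^2); its integral stays below 18 brk^4 since arctan is below 2, so the forcing
  by u^2 causes no growth in time. With \<open>sqf_crude\<close> the weight is spared and growth in
  \<open>t\<close> accepted.\<close>

lemma mcoef_bound:
  assumes q: "fst q \<noteq> 0" "fc 2 q \<noteq> 0" and t: "0 \<le> t"
  shows "sqf q * \<bar>mcoef i t q\<bar> \<le> 18 * brk q ^ 4" "sqf q * \<bar>mcoef i t q\<bar> \<le> 6 * (1 + t\<^sup>2) * t"
proof -
  define f where "f s = sqf q * (acoef i (qs s q) / sqf (qs s q))" for s
  have pos: "sqf (qs s q) > 0" for s using sqf_qs_pos[OF q(2)] .
  have "continuous_on {0..t} f"
    unfolding f_def using pos by (intro continuous_intros continuous_acoef_qs continuous_sqf_qs q) (auto simp: less_imp_neq[symmetric])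
  then have fi: "f integrable_on {0..t}" by (rule integrable_continuous_real)
  have eq: "sqf q * \<bar>mcoef i t q\<bar> = norm (integral {0..t} f)"
  proof -
    have "integral {0..t} f = sqf q * mcoef i t q"
      unfolding f_def mcoef_def by (rule Henstock_Kurzweil_Integration.integral_mult_right)
    then show ?thesis using sqf_nonneg[of q] by (simp add: abs_mult)
  qed
  have fb: "norm (f s) \<le> 3 * c" if "sqf q / sqf (qs s q) \<le> c" for s c
  proof -
    have "norm (f s) = \<bar>acoef i (qs s q)\<bar> * (sqf q / sqf (qs s q))"
      using sqf_nonneg[of q] pos[of s] by (simp add: f_def abs_mult)
    also have "\<dots> \<le> 3 * c" using acoef_bound that sqf_nonneg[of q] pos[of s] by (intro mult_mono) auto
    finally show ?thesis .
  qed
  have "((\<lambda>s. 9 * brk q ^ 4 * (1 / (1 + s\<^sup>2))) has_integral (9 * brk q ^ 4 * arctan t - 9 * brk q ^ 4 * arctan 0)) {0..t}"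
    using t by (intro fundamental_theorem_of_calculus)
      (auto intro!: derivative_eq_intros simp: has_real_derivative_iff_has_vector_derivative[symmetric] inverse_eq_divide)
  moreover have "norm (f s) \<le> 9 * brk q ^ 4 * (1 / (1 + s\<^sup>2))" for s
  proof -
    have "sqf q / sqf (qs s q) \<le> 3 * brk q ^ 4 * (1 / (1 + s\<^sup>2))"
      using sqf_ratio[OF q(1), of s] pos[of s] by (simp add: divide_simps add_pos_nonneg) (simp add: mult_ac)
    from fb[OF this] show ?thesis by simp
  qed
  ultimately have "norm (integral {0..t} f) \<le> 9 * brk q ^ 4 * arctan t"
    using integral_norm_bound_integral[OF fi, of "\<lambda>s. 9 * brk q ^ 4 * (1 / (1 + s\<^sup>2))"] by (simp add: has_integral_iff)
  also have "\<dots> \<le> 9 * brk q ^ 4 * 2"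
    using arctan_ubound[of t] pi_less_4 brk_ge_1[of q] by (intro mult_left_mono) auto
  finally show "sqf q * \<bar>mcoef i t q\<bar> \<le> 18 * brk q ^ 4" by (simp add: eq)
  have "norm (f s) \<le> 6 * (1 + t\<^sup>2)" if s: "s \<in> {0..t}" for s
  proof -
    have "sqf q / sqf (qs s q) \<le> 2 * (1 + s\<^sup>2)" using sqf_crude[of q s] pos[of s] by (simp add: divide_le_eq)
    also have "\<dots> \<le> 2 * (1 + t\<^sup>2)" using s by (simp add: power_mono)
    finally show ?thesis using fb by fastforce
  qed
  then have "norm (integral {0..t} f) \<le> integral {0..t} (\<lambda>s. 6 * (1 + t\<^sup>2))"
    by (intro integral_norm_bound_integral fi) auto
  then show "sqf q * \<bar>mcoef i t q\<bar> \<le> 6 * (1 + t\<^sup>2) * t" using t by (simp add: eq mult.commute)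
qed

end

text \<open>Fixes a time together with representatives of the transforms of the solution at that
  time and of the data, as these are determined only up to null sets.\<close>

locale lin_NS_regular = lin_NS +
  fixes t :: real and F G :: "3 \<Rightarrow> freq \<Rightarrow> complex"
  assumes t: "t \<ge> 0" and reg: "sobolev_vec 7 u_in"
    and F: "\<And>i. cell.L2_transform (cr (U i t)) (F i)"
    and G: "\<And>i. cell.L2_transform (cr (\<lambda>w. u_in w $ i)) (G i)"
begin

lemma u_in_sobolev: "sobolev 7 (\<lambda>w. u_in w $ i)" and u_in_L2: "L2 (\<lambda>w. u_in w $ i)"
  using reg by (simp_all add: sobolev_vec_def sobolev_def)

lemma initial_transform: "cell.L2_transform (cr (U i 0)) (G i)"
proof (rule cell_transform_cong[OF G L2_sqi[OF U_L2]])
  have "AE w in lborel. u 0 w = u_in w" using sol by (simp add: lin_NS_solution_def)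
  from AE_cellm[OF this] show "AE w in cellm. cr (\<lambda>w. u_in w $ i) w = cr (U i 0) w"
    by eventually_elim (simp add: cr_def U_def)
qed simp

lemmas E2 = transform_evolution(1)[OF t F initial_transform]
lemmas Ei = transform_evolution(2)[OF t F initial_transform]

text \<open>The factor 512 is 2^7 times 4, from \<open>sobolev_transform\<close>.\<close>

lemma G_weight: "sqi freqm (\<lambda>q. of_real (brk q ^ 7) * G i q)"
  "norm2 freqm (\<lambda>q. of_real (brk q ^ 7) * G i q) \<le> 512 * sobolev_norm 7 (\<lambda>w. u_in w $ i)"
  using sobolev_transform[OF u_in_sobolev G] by simp_all

lemma F_measurable [measurable]: "F i \<in> borel_measurable freqm" and G_measurable [measurable]: "G i \<in> borel_measurable freqm"
  using cell.L2_transform_sqi(2)[OF F] cell.L2_transform_sqi(2)[OF G] by (simp_all add: sqi_measurable)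

text \<open>Transform of the sheared fluctuation: the shear evaluates at \<open>qs t q\<close>, and
  removing the average discards k = 0.\<close>

definition X :: "3 \<Rightarrow> freq \<Rightarrow> complex" where
  "X i q = of_bool (fst q \<noteq> 0) * F i (qs t q)"

definition decay :: real where
  "decay = exp (- (1 / 12) * \<nu> * t ^ 3)"

lemma X_measurable [measurable]: "X i \<in> borel_measurable freqm"
  unfolding X_def by measurable

lemma X_transform: "cell.L2_transform (cr (shear t (x_fluct (U i t)))) (X i)"
  using shear_transform[OF L2_x_fluct[OF U_L2[OF t]] x_fluct_transform[OF U_L2[OF t] F], of t i] by (simp add: X_def[abs_def])

lemma decay_bounds: "0 < decay" "decay \<le> 1"
  using nu t by (simp_all add: decay_def)

lemma exp_Aint_ge:
  assumes "fst q \<noteq> 0"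
  shows "1 \<le> decay * exp (\<nu> * Aint t q)"
proof -
  have "\<nu> * (t ^ 3 / 12) \<le> \<nu> * Aint t q" using Aint_ge[OF assms t] nu by (intro mult_left_mono) auto
  then have "exp 0 \<le> exp (- (1 / 12) * \<nu> * t ^ 3 + \<nu> * Aint t q)" unfolding exp_le_cancel_iff by simp
  then show ?thesis by (simp only: exp_add decay_def exp_zero)
qed

lemma X_le_exp:
  assumes "fst q \<noteq> 0"
  shows "cmod (X i q) \<le> decay * (exp (\<nu> * Aint t q) * cmod (F i (qs t q)))"
  using mult_right_mono[OF exp_Aint_ge[OF assms], of "cmod (F i (qs t q))"] assms by (simp add: X_def mult.assoc)

text \<open>The first bound carries the decay and feeds the norms, at the price of brk^4. The second
  has no weight and feeds the integrability that Fourier inversion asks for, since brk^7 times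
  \<open>G 2\<close> is known to be square integrable only.\<close>

lemma X2_bound: "AE q in freqm. cmod (X 2 q) \<le> 3 * decay / (1 + t\<^sup>2) * brk q ^ 4 * cmod (G 2 q) \<and> cmod (X 2 q) \<le> 2 * (1 + t\<^sup>2) * cmod (G 2 q)"
  using E2
proof eventually_elim
  case (elim q)
  show ?case
  proof (cases "fst q = 0")
    case True
    have "0 \<le> 3 * decay / (1 + t\<^sup>2) * brk q ^ 4 * cmod (G 2 q)"
      using brk_ge_1[of q] decay_bounds by (intro mult_nonneg_nonneg divide_nonneg_nonneg) auto
    then show ?thesis using True by (simp add: X_def)
  next
    case False
    define y g where "y = sqf (qs t q)" and "g = cmod (G 2 q)"
    have y: "1 \<le> y" using sqf_ge_1[of "qs t q"] False by (simp add: y_def)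
    have g: "0 \<le> g" by (simp add: g_def)
    have "exp (\<nu> * Aint t q) * y * cmod (F 2 (qs t q)) = sqf q * g"
      using arg_cong[OF elim, of cmod] y sqf_nonneg[of q] by (simp only: norm_mult norm_of_real y_def g_def) simp
    then have e: "exp (\<nu> * Aint t q) * cmod (F 2 (qs t q)) = sqf q / y * g" using y by (simp add: field_simps)
    have le: "cmod (X 2 q) \<le> decay * (sqf q / y * g)" using X_le_exp[OF False, of 2] unfolding e .
    have r: "sqf q / y \<le> 3 * brk q ^ 4 / (1 + t\<^sup>2)" "sqf q / y \<le> 2 * (1 + t\<^sup>2)"
      using sqf_ratio[OF False, of t] sqf_crude[of q t] y
      by (simp_all add: y_def[symmetric] divide_simps add_pos_nonneg) (simp add: mult_ac)
    have "decay * (sqf q / y * g) \<le> decay * (3 * brk q ^ 4 / (1 + t\<^sup>2) * g)"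
      using r(1) g decay_bounds by (intro mult_left_mono mult_right_mono) auto
    moreover have "decay * (sqf q / y * g) \<le> 1 * (2 * (1 + t\<^sup>2) * g)"
      using r(2) g decay_bounds y sqf_nonneg[of q] by (intro mult_mono mult_right_mono) auto
    ultimately show ?thesis using le by (simp add: g_def mult_ac)
  qed
qed

text \<open>Same double purpose as in \<open>X2_bound\<close>, with the data of u^2 entering through
  \<open>mcoef\<close>. The constants 18 and 6 are those of \<open>mcoef_bound\<close>.\<close>

lemma X_bound: "AE q in freqm. cmod (X i q) \<le> decay * (cmod (G i q) + 18 * brk q ^ 4 * cmod (G 2 q))
    \<and> cmod (X i q) \<le> cmod (G i q) + 6 * (1 + t\<^sup>2) * t * cmod (G 2 q)"
  using Ei[of i] AE_fc2
proof eventually_elim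
  case (elim q)
  show ?case
  proof (cases "fst q = 0")
    case True
    then show ?thesis using brk_ge_1[of q] decay_bounds t by (auto simp: X_def intro!: mult_nonneg_nonneg add_nonneg_nonneg)
  next
    case False
    define g m where "g = cmod (G 2 q)" and "m = sqf q * \<bar>mcoef i t q\<bar>"
    have g: "0 \<le> g" by (simp add: g_def)
    have "exp (\<nu> * Aint t q) * cmod (F i (qs t q)) = cmod (G i q + of_real (sqf q) * G 2 q * of_real (mcoef i t q))"
      using arg_cong[OF elim(1), of cmod] by (simp only: norm_mult norm_of_real abs_exp_cancel)
    also have "\<dots> \<le> cmod (G i q) + cmod (of_real (sqf q) * G 2 q * of_real (mcoef i t q))" by (rule norm_triangle_ineq)
    also have "\<dots> = cmod (G i q) + m * g" using sqf_nonneg[of q] by (simp add: norm_mult g_def m_def)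
    finally have "decay * (exp (\<nu> * Aint t q) * cmod (F i (qs t q))) \<le> decay * (cmod (G i q) + m * g)"
      using decay_bounds by (intro mult_left_mono) auto
    with X_le_exp[OF False, of i] have le: "cmod (X i q) \<le> decay * (cmod (G i q) + m * g)" by linarith
    have m: "m \<le> 18 * brk q ^ 4" "m \<le> 6 * (1 + t\<^sup>2) * t" unfolding m_def using mcoef_bound[OF False elim(2) t] by simp_all
    have m0: "0 \<le> m" using sqf_nonneg[of q] by (simp add: m_def)
    have "decay * (cmod (G i q) + m * g) \<le> decay * (cmod (G i q) + 18 * brk q ^ 4 * g)"
      using m(1) g decay_bounds by (intro mult_left_mono add_left_mono mult_right_mono) auto
    moreover have "decay * (cmod (G i q) + m * g) \<le> 1 * (cmod (G i q) + 6 * (1 + t\<^sup>2) * t * g)"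
      using m(2) m0 g decay_bounds by (intro mult_mono add_left_mono mult_right_mono) auto
    ultimately show ?thesis using le by (simp add: g_def)
  qed
qed

end

lemma sobolev_norm_nonneg: "0 \<le> sobolev_norm m f"
  by (simp add: sobolev_norm_def sum_nonneg)

lemma sobolev_norm_le_vec: "sobolev_norm m (\<lambda>w. v w $ i) \<le> sobolev_vec_norm m v"
  unfolding sobolev_vec_norm_def by (intro real_le_rsqrt member_le_sum) auto

lemma mi_count_nonneg: "0 \<le> mi_count m"
  by (simp add: mi_count_def)

context lin_NS_regular
begin

lemma L2_shear_fluct: "L2 (shear t (x_fluct (U i t)))"
  by (intro L2_shear L2_x_fluct U_L2 t)

text \<open>The constant 1536 is 3 times 512. The exponent m = 3 serves the H^3 norm and m = 0 the
  unsheared L2 norm.\<close>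

lemma brk_X2:
  assumes "m \<le> 3"
  shows "integrable freqm (\<lambda>q. of_real (brk q ^ m) * X 2 q)"
    and "sqi freqm (\<lambda>q. of_real (brk q ^ m) * X 2 q)"
    and "norm2 freqm (\<lambda>q. of_real (brk q ^ m) * X 2 q) \<le> 1536 * decay / (1 + t\<^sup>2) * sobolev_norm 7 (\<lambda>w. u_in w $ 2)"
proof -
  let ?C = "3 * decay / (1 + t\<^sup>2)"
  have C: "0 \<le> ?C" using decay_bounds by (intro divide_nonneg_nonneg) auto
  have b: "0 < brk q" for q using brk_ge_1[of q] by linarith
  have bm: "brk q ^ m \<le> brk q ^ 3" for q using assms brk_ge_1[of q] by (intro power_increasing)
  have m: "(\<lambda>q. of_real (brk q ^ m) * X 2 q) \<in> borel_measurable freqm" by measurable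
  have b7: "brk q ^ 3 * brk q ^ 4 = brk q ^ 7" for q by (simp add: power_add[symmetric])
  have le: "AE q in freqm. cmod (of_real (brk q ^ m) * X 2 q) \<le> ?C * cmod (of_real (brk q ^ 7) * G 2 q)"
    using X2_bound
  proof eventually_elim
    case (elim q)
    have "brk q ^ m * cmod (X 2 q) \<le> brk q ^ 3 * (?C * brk q ^ 4 * cmod (G 2 q))"
      using elim bm[of q] b[of q] by (intro mult_mono) auto
    also have "\<dots> = ?C * (brk q ^ 7 * cmod (G 2 q))" by (simp only: b7[symmetric] mult_ac)
    finally show ?case using b[of q] by (simp add: norm_mult norm_power)
  qed
  show "sqi freqm (\<lambda>q. of_real (brk q ^ m) * X 2 q)" by (rule sqi_dominated[OF G_weight(1) m le])
  have "norm2 freqm (\<lambda>q. of_real (brk q ^ m) * X 2 q) \<le> ?C * norm2 freqm (\<lambda>q. of_real (brk q ^ 7) * G 2 q)"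
    by (rule norm2_dominated[OF G_weight(1) m le C])
  also have "\<dots> \<le> ?C * (512 * sobolev_norm 7 (\<lambda>w. u_in w $ 2))" by (intro mult_left_mono G_weight(2) C)
  finally show "norm2 freqm (\<lambda>q. of_real (brk q ^ m) * X 2 q) \<le> 1536 * decay / (1 + t\<^sup>2) * sobolev_norm 7 (\<lambda>w. u_in w $ 2)" by simp
  show "integrable freqm (\<lambda>q. of_real (brk q ^ m) * X 2 q)"
  proof (rule Bochner_Integration.integrable_bound[OF _ m])
    show "integrable freqm (\<lambda>q. 2 * (1 + t\<^sup>2) * (brk q ^ 3 * cmod (G 2 q)))"
      by (intro integrable_mult_right integrable_brk_weight G_weight)
    show "AE q in freqm. norm (of_real (brk q ^ m) * X 2 q) \<le> norm (2 * (1 + t\<^sup>2) * (brk q ^ 3 * cmod (G 2 q)))"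
      using X2_bound
    proof eventually_elim
      case (elim q)
      have "brk q ^ m * cmod (X 2 q) \<le> brk q ^ 3 * (2 * (1 + t\<^sup>2) * cmod (G 2 q))"
        using elim bm[of q] b[of q] by (intro mult_mono) auto
      also have "\<dots> = 2 * (1 + t\<^sup>2) * (brk q ^ 3 * cmod (G 2 q))" by (simp only: mult_ac)
      also have "\<dots> \<le> \<bar>2 * (1 + t\<^sup>2) * (brk q ^ 3 * cmod (G 2 q))\<bar>" by (rule abs_ge_self)
      finally show ?case using b[of q] by (simp only: norm_mult norm_of_real abs_of_pos zero_less_power real_norm_def)
    qed
  qed
qed

text \<open>The constant 9728 is (1 + 18) times 512: one part for the component itself and 18 for
  the forcing by u^2, both measured by the norm of the whole vector. One order for H^1 and four for
  the forcing stay within 7.\<close>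

lemma brk_X:
  shows "integrable freqm (\<lambda>q. of_real (brk q ^ 1) * X i q)"
    and "sqi freqm (\<lambda>q. of_real (brk q ^ 1) * X i q)"
    and "norm2 freqm (\<lambda>q. of_real (brk q ^ 1) * X i q) \<le> 9728 * decay * sobolev_vec_norm 7 u_in"
proof -
  have b: "0 < brk q" for q using brk_ge_1[of q] by linarith
  have b_le: "brk q \<le> brk q ^ 3" "brk q \<le> brk q ^ 7" "brk q * brk q ^ 4 \<le> brk q ^ 7" for q
    using brk_ge_1[of q] power_increasing[of 1 3 "brk q"] power_increasing[of 1 7 "brk q"] power_increasing[of 5 7 "brk q"]
    by (simp_all add: power_Suc[symmetric] del: power_Suc)
  have m: "(\<lambda>q. of_real (brk q ^ 1) * X i q) \<in> borel_measurable freqm" by measurable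
  note s1 = sqi_cmult[OF G_weight(1)[of i], of "of_real decay"]
  note s2 = sqi_cmult[OF G_weight(1)[of 2], of "of_real (18 * decay)"]
  have le: "AE q in freqm. cmod (of_real (brk q ^ 1) * X i q) \<le> cmod (of_real decay * (of_real (brk q ^ 7) * G i q))
      + cmod (of_real (18 * decay) * (of_real (brk q ^ 7) * G 2 q)) + cmod 0"
    using X_bound[of i]
  proof eventually_elim
    case (elim q)
    have "brk q * cmod (X i q) \<le> brk q * (decay * (cmod (G i q) + 18 * brk q ^ 4 * cmod (G 2 q)))"
      using elim b[of q] by (intro mult_left_mono) auto
    also have "\<dots> = decay * (brk q * cmod (G i q)) + 18 * decay * ((brk q * brk q ^ 4) * cmod (G 2 q))" by (simp add: algebra_simps)
    also have "\<dots> \<le> decay * (brk q ^ 7 * cmod (G i q)) + 18 * decay * (brk q ^ 7 * cmod (G 2 q))"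
      using decay_bounds b_le[of q] by (intro add_mono mult_left_mono mult_right_mono) auto
    finally show ?case using b[of q] decay_bounds by (simp add: norm_mult norm_power)
  qed
  note n = norm2_le3[OF s1 s2 sqi_0 m le]
  show "sqi freqm (\<lambda>q. of_real (brk q ^ 1) * X i q)" by (rule n)
  have "norm2 freqm (\<lambda>q. of_real (brk q ^ 1) * X i q) \<le> decay * norm2 freqm (\<lambda>q. of_real (brk q ^ 7) * G i q) + 18 * decay * norm2 freqm (\<lambda>q. of_real (brk q ^ 7) * G 2 q)"
    using n(2) decay_bounds by (simp add: norm2_cmult)
  also have "\<dots> \<le> decay * (512 * sobolev_vec_norm 7 u_in) + 18 * decay * (512 * sobolev_vec_norm 7 u_in)"
    using decay_bounds order_trans[OF G_weight(2) mult_left_mono[OF sobolev_norm_le_vec]] by (intro add_mono mult_left_mono) auto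
  finally show "norm2 freqm (\<lambda>q. of_real (brk q ^ 1) * X i q) \<le> 9728 * decay * sobolev_vec_norm 7 u_in" by simp
  show "integrable freqm (\<lambda>q. of_real (brk q ^ 1) * X i q)"
  proof (rule Bochner_Integration.integrable_bound[OF _ m])
    show "integrable freqm (\<lambda>q. brk q ^ 3 * cmod (G i q) + 6 * (1 + t\<^sup>2) * t * (brk q ^ 3 * cmod (G 2 q)))"
      by (intro Bochner_Integration.integrable_add integrable_mult_right integrable_brk_weight G_weight)
    show "AE q in freqm. norm (of_real (brk q ^ 1) * X i q) \<le> norm (brk q ^ 3 * cmod (G i q) + 6 * (1 + t\<^sup>2) * t * (brk q ^ 3 * cmod (G 2 q)))"
      using X_bound[of i]
    proof eventually_elim
      case (elim q)
      have "brk q * cmod (X i q) \<le> brk q ^ 3 * (cmod (G i q) + 6 * (1 + t\<^sup>2) * t * cmod (G 2 q))"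
        using elim b_le(1)[of q] b[of q] by (intro mult_mono) auto
      also have "\<dots> = brk q ^ 3 * cmod (G i q) + 6 * (1 + t\<^sup>2) * t * (brk q ^ 3 * cmod (G 2 q))"
        by (simp only: distrib_left mult_ac)
      also have "\<dots> \<le> \<bar>brk q ^ 3 * cmod (G i q) + 6 * (1 + t\<^sup>2) * t * (brk q ^ 3 * cmod (G 2 q))\<bar>" by (rule abs_ge_self)
      finally show ?case using b[of q] by (simp only: norm_mult norm_of_real abs_of_pos power_one_right real_norm_def)
    qed
  qed
qed

lemma fluct_estimate_2:
  "L2 (x_fluct (U 2 t))" "sobolev 3 (shear t (x_fluct (U 2 t)))"
  "L2_norm (x_fluct (U 2 t)) + sobolev_norm 3 (shear t (x_fluct (U 2 t)))
    \<le> (1 + mi_count 3) * (1536 * decay / (1 + t\<^sup>2) * sobolev_norm 7 (\<lambda>w. u_in w $ 2))"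
proof -
  let ?N = "1536 * decay / (1 + t\<^sup>2) * sobolev_norm 7 (\<lambda>w. u_in w $ 2)"
  show L: "L2 (x_fluct (U 2 t))" by (intro L2_x_fluct U_L2 t)
  note s = sobolev_from_transform[OF L2_shear_fluct X_transform brk_X2(1,2)[OF order_refl]]
  show "sobolev 3 (shear t (x_fluct (U 2 t)))" by (rule s)
  have H: "cell.L2_transform (cr (x_fluct (U 2 t))) (\<lambda>q. of_bool (fst q \<noteq> 0) * F 2 q)"
    by (rule x_fluct_transform[OF U_L2[OF t] F])
  have "L2_norm (x_fluct (U 2 t)) = norm2 freqm (\<lambda>q. of_bool (fst q \<noteq> 0) * F 2 q)"
    by (simp add: L2_norm_eq[OF L2_borel[OF L]] cell.L2_transform_norm[OF H])
  \<comment> \<open>The norm is the same before and after the shear because \<open>qs t\<close>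
    preserves the frequency measure.\<close>
  also have "\<dots> = norm2 freqm (\<lambda>q. of_real (brk q ^ 0) * X 2 q)"
    using norm2_qs(2)[OF cell.L2_transform_sqi(2)[OF H], of t] by (simp add: X_def[abs_def])
  also have "\<dots> \<le> ?N" by (rule brk_X2) simp
  finally have "L2_norm (x_fluct (U 2 t)) \<le> ?N" .
  moreover have "sobolev_norm 3 (shear t (x_fluct (U 2 t))) \<le> mi_count 3 * ?N"
    by (rule order_trans[OF s(2) mult_left_mono[OF brk_X2(3)[OF order_refl] mi_count_nonneg]])
  ultimately show "L2_norm (x_fluct (U 2 t)) + sobolev_norm 3 (shear t (x_fluct (U 2 t))) \<le> (1 + mi_count 3) * ?N"
    unfolding distrib_right by simp
qed

lemma fluct_estimate:
  "sobolev 1 (shear t (x_fluct (U i t)))"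
  "sobolev_norm 1 (shear t (x_fluct (U i t))) \<le> mi_count 1 * (9728 * decay * sobolev_vec_norm 7 u_in)"
proof -
  note s = sobolev_from_transform[OF L2_shear_fluct X_transform brk_X(1,2)]
  show "sobolev 1 (shear t (x_fluct (U i t)))" by (rule s)
  show "sobolev_norm 1 (shear t (x_fluct (U i t))) \<le> mi_count 1 * (9728 * decay * sobolev_vec_norm 7 u_in)"
    by (rule order_trans[OF s(2) mult_left_mono[OF brk_X(3) mi_count_nonneg]])
qed

text \<open>For k = 0 the characteristic is at rest and the pressure coefficient contains the factor
  k, so \<open>acoef\<close> reduces to -1 for i = 1 and to 0 otherwise. The Duhamel term integrates
  to -t times the data of u^2, and the damping becomes the heat multiplier.\<close>

lemma mean_transform:
  "AE q in freqm. of_bool (fst q = 0) * F i q = of_real (exp (- (\<nu> * t * ((fc 2 q)\<^sup>2 + (fc 3 q)\<^sup>2)))) *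
     (of_bool (fst q = 0) * G i q - of_real (if i = 1 then t else 0) * (of_bool (fst q = 0) * G 2 q))"
  using Ei[of i] AE_fc2
proof eventually_elim
  case (elim q)
  show ?case
  proof (cases "fst q = 0")
    case True
    let ?c = "if i = 1 then - 1 else 0 :: real"
    have q: "qs s q = q" for s using True by (simp add: qs_def prod_eq_iff)
    have k: "fc 1 q = 0" using True by (simp add: fc_def)
    have pos: "sqf q > 0" using sqf_qs_pos[OF elim(2), of 0] by simp
    have A: "\<nu> * Aint t q = \<nu> * t * ((fc 2 q)\<^sup>2 + (fc 3 q)\<^sup>2)" by (simp add: Aint_def k algebra_simps)
    have "mcoef i t q = t * (?c / sqf q)" using t by (simp add: mcoef_def q acoef_def k)
    then have mc: "of_real (sqf q) * G 2 q * of_real (mcoef i t q) = of_real (t * ?c) * G 2 q" using pos by simp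
    define E where "E = exp (\<nu> * t * ((fc 2 q)\<^sup>2 + (fc 3 q)\<^sup>2))"
    have E: "E > 0" "exp (- (\<nu> * t * ((fc 2 q)\<^sup>2 + (fc 3 q)\<^sup>2))) = 1 / E" by (simp_all add: E_def exp_minus inverse_eq_divide)
    have "of_real E * F i q = G i q - of_real (if i = 1 then t else 0) * G 2 q"
      using elim(1) unfolding q mc A by (auto simp: E_def)
    then have "F i q = of_real (1 / E) * (G i q - of_real (if i = 1 then t else 0) * G 2 q)"
      using E(1) by (simp add: nonzero_eq_divide_eq mult.commute)
    then show ?thesis unfolding E(2) using True by simp
  qed simp
qed

lemma mean_heat:
  "AE r in lborel. x_avg (U i t) r = heat (\<nu> * t) (\<lambda>r. x_avg (\<lambda>w. u_in w $ i) r - (if i = 1 then t else 0) * x_avg (\<lambda>w. u_in w $ 2) r) r"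
proof (rule heat_from_transform[OF _ _ _ _ _ x_avg_transform[OF U_L2[OF t] F] _ mean_transform])
  let ?c = "if i = 1 then t else 0" and ?a = "\<lambda>i w. x_avg (\<lambda>w. u_in w $ i) (snd w)"
  have m: "x_avg (\<lambda>w. u_in w $ i) \<in> borel_measurable borel" for i using L2_borel[OF u_in_L2] by measurable
  show "0 \<le> \<nu> * t" using nu t by simp
  show "x_avg (U i t) \<in> borel_measurable borel" using L2_borel[OF U_L2[OF t]] by measurable
  show "(\<lambda>r. x_avg (\<lambda>w. u_in w $ i) r - ?c * x_avg (\<lambda>w. u_in w $ 2) r) \<in> borel_measurable borel"
    using m by (intro borel_measurable_diff borel_measurable_times) auto
  show "L2 (\<lambda>w. x_avg (U i t) (snd w))" by (intro L2_x_avg U_L2 t)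
  have cr_eq: "cr (\<lambda>w. ?a i w - ?c * ?a 2 w) = (\<lambda>w. cr (?a i) w - of_real ?c * cr (?a 2) w)" by (simp add: cr_def fun_eq_iff)
  show T: "cell.L2_transform (cr (\<lambda>w. ?a i w - ?c * ?a 2 w))
     (\<lambda>q. of_bool (fst q = 0) * G i q - of_real ?c * (of_bool (fst q = 0) * G 2 q))"
    unfolding cr_eq by (intro cell.L2_transform_diff cell.L2_transform_cmult x_avg_transform u_in_L2 G)
  show "L2 (\<lambda>w. ?a i w - ?c * ?a 2 w)"
    using cell.L2_transform_sqi(1)[OF T] L2_periodic[OF L2_x_avg[OF u_in_L2]] by (simp add: L2_iff periodic_xz_def)
qed

end

theorem proposition1p2:
  "\<exists>c::real. 0 < c \<and> c < 1 / 3 \<and> (\<exists>C::real. C > 0 \<and>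
     (\<forall>(\<nu>::real) (u_in :: pt \<Rightarrow> real ^ 3) (u :: real \<Rightarrow> pt \<Rightarrow> real ^ 3) (p :: real \<Rightarrow> pt \<Rightarrow> real).
        \<nu> > 0 \<and> sobolev_vec 7 u_in \<and> div_free u_in \<and> lin_NS_solution \<nu> u_in u p \<longrightarrow>
        (\<forall>t::real. t \<ge> 0 \<longrightarrow>
           (let u1 = (\<lambda>w. u t w $ 1); u2 = (\<lambda>w. u t w $ 2); u3 = (\<lambda>w. u t w $ 3);
                u1_in = (\<lambda>w. u_in w $ 1); u2_in = (\<lambda>w. u_in w $ 2); u3_in = (\<lambda>w. u_in w $ 3)
            in
              L2 (x_fluct u2) \<and> sobolev 3 (shear t (x_fluct u2)) \<and>
              L2_norm (x_fluct u2) + sobolev_norm 3 (shear t (x_fluct u2))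
                \<le> C * jap t powi (- 2) * exp (- c * \<nu> * t ^ 3) * sobolev_norm 7 u2_in \<and>
              sobolev 1 (shear t (x_fluct u1)) \<and>
              sobolev_norm 1 (shear t (x_fluct u1))
                \<le> C * exp (- c * \<nu> * t ^ 3) * sobolev_vec_norm 7 u_in \<and>
              sobolev 1 (shear t (x_fluct u3)) \<and>
              sobolev_norm 1 (shear t (x_fluct u3))
                \<le> C * exp (- c * \<nu> * t ^ 3) * sobolev_vec_norm 7 u_in \<and>
              (AE w in lborel. x_avg u1 w =
                 heat (\<nu> * t) (\<lambda>w'. x_avg u1_in w' - t * x_avg u2_in w') w) \<and>
              (AE w in lborel. x_avg u2 w = heat (\<nu> * t) (x_avg u2_in) w) \<and>
              (AE w in lborel. x_avg u3 w = heat (\<nu> * t) (x_avg u3_in) w)))))"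
  (is "\<exists>c. _ \<and> _ \<and> (\<exists>C. _ \<and> (\<forall>\<nu> u_in u p. _ \<longrightarrow> (\<forall>t. _ \<longrightarrow> ?Q c C \<nu> u_in u p t)))")
\<comment> \<open>The rate is the one obtained in \<open>Aint_ge\<close>.\<close>
proof (rule exI[of _ "1 / 12"], intro conjI)
  \<comment> \<open>Sum of the constants of both kinds of estimate, so that it dominates each; in 1
    + mi_count 3 the summand 1 stands for the plain L2 norm.\<close>
  define C where "C = 1536 * (1 + mi_count 3) + 9728 * mi_count 1"
  have C: "0 < C" "1536 * (1 + mi_count 3) \<le> C" "9728 * mi_count 1 \<le> C"
    using mi_count_nonneg[of 1] mi_count_nonneg[of 3] by (simp_all add: C_def)
  show "\<exists>C>0. \<forall>\<nu> u_in u p. \<nu> > 0 \<and> sobolev_vec 7 u_in \<and> div_free u_in \<and> lin_NS_solution \<nu> u_in u p \<longrightarrow>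
      (\<forall>t\<ge>0. ?Q (1 / 12) C \<nu> u_in u p t)"
  proof (rule exI[of _ C], intro conjI allI impI)
    fix \<nu> :: real and u_in :: "pt \<Rightarrow> real ^ 3" and u :: "real \<Rightarrow> pt \<Rightarrow> real ^ 3" and p :: "real \<Rightarrow> pt \<Rightarrow> real" and t :: real
    assume h: "\<nu> > 0 \<and> sobolev_vec 7 u_in \<and> div_free u_in \<and> lin_NS_solution \<nu> u_in u p" and t: "t \<ge> 0"
    interpret lin_NS \<nu> u_in u p using h by unfold_locales auto
    obtain F where F: "\<And>i. cell.L2_transform (cr (U i t)) (F i)"
      using L2_transform_exists'[OF U_L2[OF t]] by metis
    have "\<exists>G. cell.L2_transform (cr (\<lambda>w. u_in w $ i)) G" for i
      using h by (intro L2_transform_exists') (auto simp: sobolev_vec_def sobolev_def)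
    then obtain G where G: "\<And>i. cell.L2_transform (cr (\<lambda>w. u_in w $ i)) (G i)" by metis
    interpret lin_NS_regular \<nu> u_in u p t F G using h t F G by unfold_locales auto
    have V: "0 \<le> decay * sobolev_vec_norm 7 u_in"
      using decay_bounds order_trans[OF sobolev_norm_nonneg sobolev_norm_le_vec] by (intro mult_nonneg_nonneg) auto
    have jap: "jap t powi (- 2) = 1 / (1 + t\<^sup>2)"
      by (simp add: jap_def power_int_minus inverse_eq_divide)
    have e2: "(1 + mi_count 3) * (1536 * decay / (1 + t\<^sup>2) * sobolev_norm 7 (\<lambda>w. u_in w $ 2))
        \<le> C * jap t powi (- 2) * decay * sobolev_norm 7 (\<lambda>w. u_in w $ 2)"
    proof -
      have "0 \<le> decay / (1 + t\<^sup>2) * sobolev_norm 7 (\<lambda>w. u_in w $ 2)"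
        using decay_bounds sobolev_norm_nonneg by (intro mult_nonneg_nonneg divide_nonneg_nonneg) auto
      moreover have "K * (1536 * d / j * N) = 1536 * K * (d / j * N)" "C * (1 / j) * d * N = C * (d / j * N)" for K d j N :: real by simp_all
      ultimately show ?thesis using mult_right_mono[OF C(2)] by (simp only: jap)
    qed
    have e1: "mi_count 1 * (9728 * decay * sobolev_vec_norm 7 u_in) \<le> C * decay * sobolev_vec_norm 7 u_in"
      using mult_right_mono[OF C(3) V] by (simp add: mult_ac)
    note est2 = order_trans[OF fluct_estimate_2(3) e2] and est = order_trans[OF fluct_estimate(2) e1]
    show "?Q (1 / 12) C \<nu> u_in u p t"
      unfolding Let_def using fluct_estimate_2(1,2) est2 fluct_estimate(1)[of 1] est[of 1] fluct_estimate(1)[of 3] est[of 3]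
        mean_heat[of 1] mean_heat[of 2] mean_heat[of 3]
      unfolding U_def decay_def by simp
  qed (rule C)
qed simp_all

end
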